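(* Let $s\in(\frac12,1)$, $N>2s$, $0<b<\min\{\frac N2,1\}$, $\beta^2=\frac{2s-b}{N}$ and $a^*=\|Q\|_{2}^{2\beta^2}$. Suppose $V$ satisfies $0\le V\in L^\infty_{loc}(\mathbb{R}^N)$, $\lim_{|x|\to\infty}V(x)=\infty$ and $V(0)=0$. For any $0<a<a^*$, let $u_a$ be a nonnegative minimizer of $e(a)=\inf\{E_a(u): u\in\mathcal H,\ \|u\|_2^2=1\}$, and define $$\varepsilon_a:=\Big(\int_{\mathbb{R}^N}|(-\Delta)^{\frac s2}u_a|^2dx\Big)^{-\frac1{2s}},\qquad w_a(x):=\varepsilon_a^{\frac N2}u_a(\varepsilon_a x).$$ Then there exists a subsequence of $\{w_a\}$, still denoted by $\{w_a\}$, such that $$\lim_{a\nearrow a^*}w_a=w_0\quad\text{strongly in }H^s(\mathbb{R}^N),$$ where $w_0$ is an optimizer of the Gagliardo–Nirenberg inequality $$\frac{a^*}{1+\beta^2}\int_{\mathbb{R}^N}|x|^{-b}|u(x)|^{2+2\beta^2}dx\le\|(-\Delta)^{\frac s2}u\|_2^2\,\|u\|_2^{2\beta^2},\qquad u\in H^s(\mathbb{R}^N).$$ In addition, $$\|w_a\|_{L^\infty(\mathbb{R}^N)}\le C\quad\text{and}\quad w_a(x)\to0\ \text{ as }|x|\to\infty\ \text{ uniformly for }a\nearrow a^*,$$ where $C>0$ is independent of $0<a<a^*$.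
   Context: $N$ is a positive integer (the space dimension), $\beta=\sqrt{(2s-b)/N}$, and $\|\cdot\|_2$ is the $L^2(\mathbb{R}^N)$ norm. For $u\in H^s(\mathbb{R}^N)$, $$\int_{\mathbb{R}^N}|(-\Delta)^{\frac s2}u|^2dx=\frac{C(N,s)}{2}\iint_{\mathbb{R}^{2N}}\frac{|u(x)-u(y)|^2}{|x-y|^{N+2s}}\,dx\,dy,\qquad C(N,s)=\Big(\int_{\mathbb{R}^N}\frac{1-\cos\xi_1}{|\xi|^{N+2s}}d\xi\Big)^{-1}.$$ The space is $\mathcal H=\{u\in H^s(\mathbb{R}^N):\int_{\mathbb{R}^N}V(x)|u(x)|^2dx<\infty\}$, and the energy is $$E_a(u)=\int_{\mathbb{R}^N}\big(|(-\Delta)^{\frac s2}u|^2+V(x)|u|^2\big)dx-\frac{a}{1+\beta^2}\int_{\mathbb{R}^N}\frac{|u(x)|^{2+2\beta^2}}{|x|^b}dx.$$ A minimizer for $e(a)$ is a $u\in\mathcal H$ with $\|u\|_2^2=1$ and $E_a(u)=e(a)$. The notation $a\nearrow a^*$ means $a\to a^*$ with $a<a^*$; passing to a subsequence means restricting to a sequence of values $a$ increasing to $a^*$. The function $Q$ and the constant $a^*$: it is a known (recalled) fact that the Gagliardo–Nirenberg inequality displayed in the claim holds with optimal constant $a^*=\|Q\|_2^{2\beta^2}>0$, where $Q>0$ is an optimizer of it that solves $(-\Delta)^sQ+Q-|x|^{-b}|Q|^{2\beta^2}Q=0$ in $\mathbb{R}^N$ and satisfies $$\int_{\mathbb{R}^N}|(-\Delta)^{\frac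 s2}Q|^2dx=\frac1{\beta^2}\int_{\mathbb{R}^N}|Q|^2dx=\frac1{1+\beta^2}\int_{\mathbb{R}^N}|x|^{-b}|Q|^{2+2\beta^2}dx.$$ An optimizer of the inequality is a nonzero element of $H^s(\mathbb{R}^N)$ for which equality holds.
   Formalization: Since V in L^∞_loc is defined only almost everywhere, V(0)=0 is taken to mean that 0 is a Lebesgue point of V with value 0 (implied by continuity at 0); with V(0)=0 only at the single point the claim fails. *)

theory Defs
  imports "HOL-Analysis.Analysis" "HOL-Probability.Essential_Supremum"
begin

text \<open>
  Elements of $L^2$ and $H^s$ are represented by real-valued Lebesgue measurable functions on a
  Euclidean space \<open>'a\<close> of dimension \<open>N = DIM('a)\<close>; functions agreeing almost everywhere are not
  identified, so pointwise assertions about them are made almost everywhere. All integrals are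
  Bochner integrals, hence finiteness is always expressed by \<^const>\<open>integrable\<close>.
\<close>

section \<open>The space \<open>H\<^sup>s\<close>\<close>

definition L2_norm_sq :: "('a::euclidean_space \<Rightarrow> real) \<Rightarrow> real" where
  "L2_norm_sq u = (LINT x|lebesgue. \<bar>u x\<bar>\<^sup>2)"

definition L2_norm :: "('a::euclidean_space \<Rightarrow> real) \<Rightarrow> real" where
  "L2_norm u = sqrt (L2_norm_sq u)"

text \<open>
  The normalizing constant $C(N,s)$. The coordinate $\xi_1$ is taken along an arbitrary basis
  vector, on which the integral does not depend by rotation invariance.
\<close>

definition frac_const :: "'a::euclidean_space itself \<Rightarrow> real \<Rightarrow> real" where
  "frac_const T s = inverse (LINT \<xi>|(lebesgue :: 'a measure).
     (1 - cos (\<xi> \<bullet> (SOME e. e \<in> Basis))) / norm \<xi> powr (real DIM('a) + 2 * s))"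

text \<open>On the diagonal (a null set) the quotients below have the value 0.\<close>

definition gagliardo_form ::
  "real \<Rightarrow> ('a::euclidean_space \<Rightarrow> real) \<Rightarrow> ('a \<Rightarrow> real) \<Rightarrow> 'a \<times> 'a \<Rightarrow> real" where
  "gagliardo_form s u v = (\<lambda>(x, y).
     (u x - u y) * (v x - v y) / norm (x - y) powr (real DIM('a) + 2 * s))"

definition Hs :: "real \<Rightarrow> ('a::euclidean_space \<Rightarrow> real) set" where
  "Hs s = {u. u \<in> borel_measurable lebesgue \<and>
              integrable lebesgue (\<lambda>x. \<bar>u x\<bar>\<^sup>2) \<and>
              integrable (lebesgue \<Otimes>\<^sub>M lebesgue) (gagliardo_form s u u)}"

text \<open>The pairing $\int (-\Delta)^{s/2}u\,(-\Delta)^{s/2}v\,dx$ on $H^s$.\<close>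

definition frac_pairing ::
  "real \<Rightarrow> ('a::euclidean_space \<Rightarrow> real) \<Rightarrow> ('a \<Rightarrow> real) \<Rightarrow> real" where
  "frac_pairing s u v =
     frac_const TYPE('a) s / 2 * (LINT p|(lebesgue \<Otimes>\<^sub>M lebesgue). gagliardo_form s u v p)"

text \<open>$\int |(-\Delta)^{s/2}u|^2\,dx = \|(-\Delta)^{s/2}u\|_2^2$ for $u \in H^s$.\<close>

definition frac_energy :: "real \<Rightarrow> ('a::euclidean_space \<Rightarrow> real) \<Rightarrow> real" where
  "frac_energy s u = frac_const TYPE('a) s / 2 *
     (LINT (x, y)|(lebesgue \<Otimes>\<^sub>M lebesgue). \<bar>u x - u y\<bar>\<^sup>2 / norm (x - y) powr (real DIM('a) + 2 * s))"

definition Hs_norm :: "real \<Rightarrow> ('a::euclidean_space \<Rightarrow> real) \<Rightarrow> real" where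
  "Hs_norm s u = sqrt (L2_norm_sq u + frac_energy s u)"

definition Hs_tendsto ::
  "real \<Rightarrow> (nat \<Rightarrow> 'a::euclidean_space \<Rightarrow> real) \<Rightarrow> ('a \<Rightarrow> real) \<Rightarrow> bool" where
  "Hs_tendsto s f g \<longleftrightarrow> g \<in> Hs s \<and> (\<forall>k. f k \<in> Hs s) \<and>
     (\<lambda>k. Hs_norm s (\<lambda>x. f k x - g x)) \<longlonglongrightarrow> 0"

definition Linf_norm :: "('a::euclidean_space \<Rightarrow> real) \<Rightarrow> ereal" where
  "Linf_norm u = esssup lebesgue (\<lambda>x. ereal \<bar>u x\<bar>)"

section \<open>The Gagliardo--Nirenberg inequality\<close>

definition weighted_int :: "real \<Rightarrow> real \<Rightarrow> ('a::euclidean_space \<Rightarrow> real) \<Rightarrow> real" where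
  "weighted_int b \<beta> u = (LINT x|lebesgue. norm x powr (- b) * \<bar>u x\<bar> powr (2 + 2 * \<beta>\<^sup>2))"

text \<open>
  The inequality with constant \<open>A\<close>. Its left-hand side being finite is part of the claim, and has to
  be said explicitly because the Bochner integral of a non-integrable function is 0.
\<close>

definition GN_inequality :: "'a::euclidean_space itself \<Rightarrow> real \<Rightarrow> real \<Rightarrow> real \<Rightarrow> real \<Rightarrow> bool" where
  "GN_inequality T s b \<beta> A \<longleftrightarrow> (\<forall>u :: 'a \<Rightarrow> real. u \<in> Hs s \<longrightarrow>
     integrable lebesgue (\<lambda>x. norm x powr (- b) * \<bar>u x\<bar> powr (2 + 2 * \<beta>\<^sup>2)) \<and>
     A / (1 + \<beta>\<^sup>2) * weighted_int b \<beta> u \<le> frac_energy s u * L2_norm u powr (2 * \<beta>\<^sup>2))"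

definition GN_optimizer ::
  "real \<Rightarrow> real \<Rightarrow> real \<Rightarrow> real \<Rightarrow> ('a::euclidean_space \<Rightarrow> real) \<Rightarrow> bool" where
  "GN_optimizer s b \<beta> A u \<longleftrightarrow> u \<in> Hs s \<and> \<not> (AE x in lebesgue. u x = 0) \<and>
     A / (1 + \<beta>\<^sup>2) * weighted_int b \<beta> u = frac_energy s u * L2_norm u powr (2 * \<beta>\<^sup>2)"

text \<open>Weak $H^s$ solutions of $(-\Delta)^s Q + Q - |x|^{-b}|Q|^{2\beta^2}Q = 0$.\<close>

definition GN_equation ::
  "real \<Rightarrow> real \<Rightarrow> real \<Rightarrow> ('a::euclidean_space \<Rightarrow> real) \<Rightarrow> bool" where
  "GN_equation s b \<beta> Q \<longleftrightarrow> (\<forall>\<phi> \<in> Hs s.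
     frac_pairing s Q \<phi> + (LINT x|lebesgue. Q x * \<phi> x)
     - (LINT x|lebesgue. norm x powr (- b) * \<bar>Q x\<bar> powr (2 * \<beta>\<^sup>2) * Q x * \<phi> x) = 0)"

text \<open>
  The function $Q$: a positive optimizer of the inequality with constant $\|Q\|_2^{2\beta^2}$, which
  is therefore the optimal constant, together with its equation and its integral identities.
\<close>

definition GN_ground_state ::
  "real \<Rightarrow> real \<Rightarrow> real \<Rightarrow> ('a::euclidean_space \<Rightarrow> real) \<Rightarrow> bool" where
  "GN_ground_state s b \<beta> Q \<longleftrightarrow>
     Q \<in> Hs s \<and> (AE x in lebesgue. 0 < Q x) \<and>
     GN_inequality TYPE('a) s b \<beta> (L2_norm Q powr (2 * \<beta>\<^sup>2)) \<and>
     GN_optimizer s b \<beta> (L2_norm Q powr (2 * \<beta>\<^sup>2)) Q \<and>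
     GN_equation s b \<beta> Q \<and>
     frac_energy s Q = 1 / \<beta>\<^sup>2 * L2_norm_sq Q \<and>
     1 / \<beta>\<^sup>2 * L2_norm_sq Q = 1 / (1 + \<beta>\<^sup>2) * weighted_int b \<beta> Q"

section \<open>The potential and the minimization problem\<close>

definition Linf_loc :: "('a::euclidean_space \<Rightarrow> real) set" where
  "Linf_loc = {V. V \<in> borel_measurable lebesgue \<and>
     (\<forall>K. compact K \<longrightarrow> (\<exists>M. AE x in lebesgue. x \<in> K \<longrightarrow> \<bar>V x\<bar> \<le> M))}"

text \<open>
  An element of $L^\infty_{loc}$ is only defined up to null sets, so the phrase ``$V(x_0) = c$''
  carries information only if \<open>c\<close> is the value determined by the class of \<open>V\<close>. This is expressed by
  requiring that \<open>x\<^sub>0\<close> be a Lebesgue point of \<open>V\<close> (implied by continuity at \<open>x\<^sub>0\<close>) at which the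
  representative has the value \<open>c\<close>.
\<close>

definition lebesgue_point :: "('a::euclidean_space \<Rightarrow> real) \<Rightarrow> 'a \<Rightarrow> bool" where
  "lebesgue_point f x\<^sub>0 \<longleftrightarrow>
     ((\<lambda>r. (LINT x:ball x\<^sub>0 r|lebesgue. \<bar>f x - f x\<^sub>0\<bar>) / measure lebesgue (ball x\<^sub>0 r)) \<longlongrightarrow> 0)
       (at_right 0)"

definition has_value_at :: "('a::euclidean_space \<Rightarrow> real) \<Rightarrow> 'a \<Rightarrow> real \<Rightarrow> bool" where
  "has_value_at f x\<^sub>0 c \<longleftrightarrow> f x\<^sub>0 = c \<and> lebesgue_point f x\<^sub>0"

definition energy_space :: "real \<Rightarrow> ('a::euclidean_space \<Rightarrow> real) \<Rightarrow> ('a \<Rightarrow> real) set" where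
  "energy_space s V = {u \<in> Hs s. integrable lebesgue (\<lambda>x. V x * \<bar>u x\<bar>\<^sup>2)}"

definition energy ::
  "real \<Rightarrow> real \<Rightarrow> real \<Rightarrow> ('a::euclidean_space \<Rightarrow> real) \<Rightarrow> real \<Rightarrow> ('a \<Rightarrow> real) \<Rightarrow> real" where
  "energy s b \<beta> V a u = frac_energy s u + (LINT x|lebesgue. V x * \<bar>u x\<bar>\<^sup>2)
     - a / (1 + \<beta>\<^sup>2) * (LINT x|lebesgue. \<bar>u x\<bar> powr (2 + 2 * \<beta>\<^sup>2) / norm x powr b)"

definition min_energy ::
  "real \<Rightarrow> real \<Rightarrow> real \<Rightarrow> ('a::euclidean_space \<Rightarrow> real) \<Rightarrow> real \<Rightarrow> real" where
  "min_energy s b \<beta> V a = Inf {energy s b \<beta> V a u | u. u \<in> energy_space s V \<and> L2_norm_sq u = 1}"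

definition minimizer ::
  "real \<Rightarrow> real \<Rightarrow> real \<Rightarrow> ('a::euclidean_space \<Rightarrow> real) \<Rightarrow> real \<Rightarrow> ('a \<Rightarrow> real) \<Rightarrow> bool" where
  "minimizer s b \<beta> V a u \<longleftrightarrow>
     u \<in> energy_space s V \<and> L2_norm_sq u = 1 \<and> energy s b \<beta> V a u = min_energy s b \<beta> V a"

end

theory Submission
  imports Defs "HOL-Complex_Analysis.Great_Picard"
begin

text \<open>
  The rescaled functions \<open>w\<^sub>a\<close> have mass and seminorm 1, and they cannot lower
  \<open>E\<^sub>a\<close> by being truncated from above, up to a multiple of the lost mass. Combined with the
  Gagliardo--Nirenberg inequality for \<open>(w\<^sub>a - k)\<^sub>+\<close> and the elementary Faber--Krahn bound
  $\|v\|_2^2 \le C |\{v \ne 0\}|^{2s/N} [v]^2$, De Giorgi's iteration over the levels \<open>k\<close>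
  bounds \<open>w\<^sub>a\<close> uniformly. Given this bound, \<open>|x|\<^sup>-\<^sup>b\<close> makes the nonlinear term compact.
  Since the minimal energy tends to 0 (test with cut-offs of \<open>Q\<close> concentrated at the origin), the
  nonlinear term of \<open>w\<^sub>a\<close> tends to its largest possible value, so that every limit is an
  optimizer and no mass or seminorm is lost. Strong convergence makes the mass outside large balls
  uniformly small, and a second iteration, above a barrier that exceeds \<open>w\<^sub>a\<close> on such a ball,
  gives the uniform decay.
\<close>

section \<open>Lebesgue measure and the kernel\<close>

text \<open>No Euler-Lagrange equation for \<open>u a\<close> is used. Minimality enters only
  through competitors lying between 0 and \<open>u a\<close>. Divided by the square root of its mass
  m, such a competitor is admissible, and the nonlinear term only gains from this because
  m^(-\<beta>^2) is at least 1; hence lost mass is paid at the rate e(a).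

  After rescaling the rate is e(a) \<epsilon>^(2s), and it must be bounded for all a below
  \<open>astar\<close>. The minimal energies have a common bound P, hence so have the potential
  energies; since V grows at infinity, this keeps the seminorm of \<open>u a\<close> above some
  \<kappa>. So P / \<kappa> serves for every a, and whether \<epsilon> tends to 0 never has to be
  decided.

  The other obstacle is the test function. V may grow so fast that Q is not admissible, no rate of
  decay of Q is assumed, and concentrating by the factor \<rho> multiplies the deficit in the
  Gagliardo-Nirenberg inequality by \<rho>^(2s). The cut-off of Q must therefore be optimal up to
  o(\<rho>^(-2s)). This comes from testing the equation of Q with the squared cut-off times Q, not
  from estimates of the tails of Q.\<close>

lemma sigma_finite_lebesgue: "sigma_finite_measure (lebesgue :: 'a::euclidean_space measure)"
proof
  let ?A = "range (\<lambda>n. cball (0::'a) (real n))"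
  have "\<Union> ?A = space lebesgue"
    using real_arch_simple by (fastforce simp: dist_norm)
  moreover have "\<forall>a\<in>?A. emeasure lebesgue a \<noteq> \<infinity>"
    using emeasure_lborel_cball_finite by (auto simp: less_top)
  ultimately show "\<exists>A. countable A \<and> A \<subseteq> sets lebesgue \<and> \<Union> A = space (lebesgue :: 'a measure) \<and>
      (\<forall>a\<in>A. emeasure lebesgue a \<noteq> \<infinity>)"
    by (intro exI[of _ ?A]) auto
qed

interpretation leb: sigma_finite_measure "lebesgue :: 'a::euclidean_space measure"
  by (rule sigma_finite_lebesgue)

interpretation lebp: pair_sigma_finite "lebesgue :: 'a::euclidean_space measure" "lebesgue :: 'b::euclidean_space measure"
  ..

lemma id_leb_borel [measurable]: "(\<lambda>x. x) \<in> lebesgue \<rightarrow>\<^sub>M borel"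
  using id_borel_measurable_lebesgue unfolding id_def .

lemma cball_sets_lebesgue [measurable]: "cball a r \<in> sets (lebesgue :: 'a::euclidean_space measure)"
  and ball_sets_lebesgue [measurable]: "ball a r \<in> sets (lebesgue :: 'a::euclidean_space measure)"
  by auto

lemma fst_leb_borel [measurable]: "fst \<in> (lebesgue \<Otimes>\<^sub>M M) \<rightarrow>\<^sub>M borel"
  using measurable_compose[OF measurable_fst id_leb_borel] by simp

lemma snd_leb_borel [measurable]: "snd \<in> (M \<Otimes>\<^sub>M lebesgue) \<rightarrow>\<^sub>M borel"
  using measurable_compose[OF measurable_snd id_leb_borel] by simp

section \<open>Lebesgue integrals under dilation and reflection\<close>

lemma lebesgue_scale_density:
  assumes "c > 0"
  shows "(lebesgue :: 'a::euclidean_space measure) =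
    density (distr lebesgue lebesgue (\<lambda>x. c *\<^sub>R x)) (\<lambda>_. ennreal (c ^ DIM('a)))"
proof -
  have eq: "(\<Sum>j\<in>Basis. (c * (x \<bullet> j)) *\<^sub>R j) = c *\<^sub>R x" for x :: 'a
    by (simp add: scaleR_scaleR[symmetric] scaleR_sum_right[symmetric] euclidean_representation
        del: scaleR_scaleR)
  show ?thesis
    using lebesgue_affine_euclidean[of "\<lambda>_::'a. c" 0] assms by (simp add: eq)
qed

lemma nn_integral_lebesgue_scale:
  fixes f :: "'a::euclidean_space \<Rightarrow> ennreal"
  assumes [measurable]: "f \<in> borel_measurable lebesgue" and "c > 0"
  shows "(\<integral>\<^sup>+x. f x \<partial>lebesgue) = ennreal (c ^ DIM('a)) * (\<integral>\<^sup>+x. f (c *\<^sub>R x) \<partial>lebesgue)"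
proof -
  have "(\<integral>\<^sup>+x. f x \<partial>lebesgue) =
    (\<integral>\<^sup>+x. f x \<partial>density (distr lebesgue lebesgue (\<lambda>x. c *\<^sub>R x)) (\<lambda>_. ennreal (c ^ DIM('a))))"
    using lebesgue_scale_density[OF assms(2), where 'a='a] by simp
  also have "\<dots> = \<integral>\<^sup>+ x. ennreal (c ^ DIM('a)) * f x \<partial>distr lebesgue lebesgue (\<lambda>x. c *\<^sub>R x)"
    by (subst nn_integral_density) (auto simp del: scaleR_scaleR)
  also have "\<dots> = ennreal (c ^ DIM('a)) * (\<integral>\<^sup>+x. f (c *\<^sub>R x) \<partial>lebesgue)"
    by (subst nn_integral_cmult) (auto simp: nn_integral_distr)
  finally show ?thesis .
qed

lemma borel_measurable_lebesgue_scale [measurable (raw)]: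
  "f \<in> borel_measurable lebesgue \<Longrightarrow> (\<lambda>x. f (c *\<^sub>R x)) \<in> borel_measurable (lebesgue :: 'a::euclidean_space measure)"
  by (rule measurable_compose[OF lebesgue_measurable_scaling])

lemma
  fixes f :: "'a::euclidean_space \<Rightarrow> real"
  assumes [measurable]: "f \<in> borel_measurable lebesgue" and c: "c > 0"
  shows integrable_lebesgue_scale:
      "integrable lebesgue (\<lambda>x. f (c *\<^sub>R x)) \<longleftrightarrow> integrable lebesgue f" (is ?A)
    and integral_lebesgue_scale:
      "(LINT x|lebesgue. f x) = c ^ DIM('a) * (LINT x|lebesgue. f (c *\<^sub>R x))" (is ?B)
proof -
  have 1: "(\<integral>\<^sup>+x. ennreal (norm (f x)) \<partial>lebesgue) = ennreal (c ^ DIM('a)) * (\<integral>\<^sup>+x. ennreal (norm (f (c *\<^sub>R x))) \<partial>lebesgue)"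
    by (rule nn_integral_lebesgue_scale) (use c in auto)
  have "ennreal (c ^ DIM('a)) \<noteq> 0"
    using c by simp
  then show ?A
    unfolding integrable_iff_bounded 1 by (auto simp: ennreal_mult_less_top)
  have "(LINT x|lebesgue. f x) =
    (LINT x|density (distr lebesgue lebesgue (\<lambda>x. c *\<^sub>R x)) (\<lambda>_. ennreal (c ^ DIM('a))). f x)"
    using lebesgue_scale_density[OF c, where 'a='a] by simp
  also have "\<dots> = (LINT x|distr lebesgue lebesgue (\<lambda>x. c *\<^sub>R x). c ^ DIM('a) * f x)"
    by (subst integral_density) (use c in auto)
  also have "\<dots> = c ^ DIM('a) * (LINT x|lebesgue. f (c *\<^sub>R x))"
    by (subst integral_distr) auto
  finally show ?B .
qed

lemma AE_lebesgue_scale: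
  fixes c :: real
  assumes c: "c > 0" and P: "AE x in (lebesgue :: 'a::euclidean_space measure). P x"
  shows "AE x in (lebesgue :: 'a measure). P (c *\<^sub>R x)"
proof -
  from P obtain A where A: "A \<in> null_sets lebesgue" "\<And>x. \<not> P x \<Longrightarrow> x \<in> A"
    by (auto simp: eventually_ae_filter)
  have "AE x in density (distr lebesgue lebesgue (\<lambda>x. c *\<^sub>R x)) (\<lambda>_. ennreal (c ^ DIM('a))). x \<notin> A"
    by (subst lebesgue_scale_density[OF c, symmetric]) (rule AE_not_in[OF A(1)])
  then have "AE x in distr lebesgue lebesgue (\<lambda>x. c *\<^sub>R x). x \<notin> A"
    by (subst (asm) AE_density) (use c in auto)
  then have "AE x in lebesgue. c *\<^sub>R x \<notin> A"
    by (intro AE_distrD[of "\<lambda>x. c *\<^sub>R x" lebesgue lebesgue "\<lambda>x. x \<notin> A"]) auto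
  then show ?thesis
    by eventually_elim (use A in auto)
qed

lemma nn_integral_lebesgue_reflect:
  fixes g :: "'a::euclidean_space \<Rightarrow> ennreal"
  assumes [measurable]: "g \<in> borel_measurable borel"
  shows "(\<integral>\<^sup>+y. g (x - y) \<partial>lebesgue) = (\<integral>\<^sup>+y. g y \<partial>lebesgue)"
proof -
  have "(\<integral>\<^sup>+y. g y \<partial>lborel) =
      (\<integral>\<^sup>+y. g y \<partial>density (distr lborel borel (\<lambda>y. x + (-1) *\<^sub>R y)) (\<lambda>_. ennreal (\<bar>-1\<bar> ^ DIM('a))))"
    using lborel_affine[of "-1" x] by simp
  also have "\<dots> = (\<integral>\<^sup>+y. g (x - y) \<partial>lborel)"
    by (simp add: nn_integral_density nn_integral_distr)
  finally show ?thesis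
    by (simp add: nn_integral_completion)
qed

text \<open>Takes the place of polar coordinates. Off the origin \<open>f\<close> is dominated by
  the series of \<open>c j\<close> times the indicator of the ball of radius \<open>r j\<close>,
  whose j-th integral is the volume of the unit ball times \<open>c j * r j ^ DIM('a)\<close>.
  Enlarging dyadic shells to full balls costs only a constant factor.\<close>

lemma nn_integral_dyadic_finite:
  fixes f :: "'a::euclidean_space \<Rightarrow> ennreal"
  assumes c: "\<And>j. 0 \<le> c j" and r: "\<And>j. 0 \<le> r j"
    and sm: "summable (\<lambda>j. c j * r j ^ DIM('a))"
    and f: "\<And>x. x \<noteq> 0 \<Longrightarrow> f x = 0 \<or> (\<exists>j::nat. f x \<le> ennreal (c j) \<and> norm x \<le> r j)"
  shows "(\<integral>\<^sup>+x. f x \<partial>lebesgue) < \<infinity>"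
proof -
  have "AE x in lebesgue. x \<noteq> (0::'a)"
    using AE_lborel_singleton[of "0::'a"] by (rule AE_completion)
  then have "AE x in lebesgue. f x \<le> (\<Sum>j. ennreal (c j) * indicator (cball 0 (r j)) x)"
  proof eventually_elim
    case (elim x)
    show ?case
    proof (cases "f x = 0")
      case False
      then obtain j where j: "f x \<le> ennreal (c j)" "norm x \<le> r j"
        using f[OF elim] by auto
      have "f x \<le> (\<Sum>i\<in>{j}. ennreal (c i) * indicator (cball 0 (r i)) x)"
        using j by (simp add: indicator_def)
      also have "\<dots> \<le> (\<Sum>j. ennreal (c j) * indicator (cball 0 (r j)) x)"
        by (rule sum_le_suminf) auto
      finally show ?thesis .
    qed simp
  qed
  then have "(\<integral>\<^sup>+x. f x \<partial>lebesgue) \<le>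
      (\<integral>\<^sup>+(x::'a). (\<Sum>j. ennreal (c j) * indicator (cball 0 (r j)) x) \<partial>lebesgue)"
    by (rule nn_integral_mono_AE)
  also have "\<dots> = (\<Sum>j. (\<integral>\<^sup>+x. ennreal (c j) * indicator (cball (0::'a) (r j)) x \<partial>lebesgue))"
    by (rule nn_integral_suminf) auto
  also have "\<dots> = (\<Sum>j. ennreal (unit_ball_vol (real DIM('a)) * (c j * r j ^ DIM('a))))"
  proof (rule suminf_cong)
    fix j
    have "(\<integral>\<^sup>+x. ennreal (c j) * indicator (cball (0::'a) (r j)) x \<partial>lebesgue) =
        ennreal (c j) * emeasure lborel (cball (0::'a) (r j))"
      by (simp add: nn_integral_cmult_indicator)
    also have "\<dots> = ennreal (c j) * ennreal (unit_ball_vol (real DIM('a)) * r j ^ DIM('a))"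
      using r by (subst emeasure_cball) auto
    also have "\<dots> = ennreal (unit_ball_vol (real DIM('a)) * (c j * r j ^ DIM('a)))"
      using c r by (subst ennreal_mult[symmetric]) (auto simp: mult_ac)
    finally show "(\<integral>\<^sup>+x. ennreal (c j) * indicator (cball (0::'a) (r j)) x \<partial>lebesgue) =
      ennreal (unit_ball_vol (real DIM('a)) * (c j * r j ^ DIM('a)))" .
  qed
  also have "\<dots> < \<infinity>"
    using c r by (subst suminf_ennreal2) (auto intro!: summable_mult sm mult_nonneg_nonneg)
  finally show ?thesis .
qed

lemma dyadic_outside:
  fixes t :: real assumes "1 \<le> t" shows "\<exists>j::nat. 2 ^ j \<le> t \<and> t \<le> 2 * 2 ^ j"
proof -
  define j where "j = nat \<lfloor>log 2 t\<rfloor>"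
  have l: "0 \<le> log 2 t" using assms by simp
  then have "real j \<le> log 2 t" "log 2 t \<le> real j + 1"
    unfolding j_def by linarith+
  then have "2 powr real j \<le> t" "t \<le> 2 powr (real j + 1)"
    using assms by (simp_all add: le_log_iff log_le_iff)
  then show ?thesis
    by (auto simp: powr_realpow powr_add intro!: exI[of _ j])
qed

lemma dyadic_inside:
  fixes t :: real assumes "0 < t" "t \<le> 1" shows "\<exists>j::nat. (1/2) ^ j / 2 \<le> t \<and> t \<le> (1/2) ^ j"
proof -
  have "1 \<le> 1 / t" using assms by simp
  from dyadic_outside[OF this] obtain j :: nat where "2 ^ j \<le> 1 / t" "1 / t \<le> 2 * 2 ^ j" by auto
  then show ?thesis
    using assms by (intro exI[of _ j]) (auto simp: field_simps)
qed

text \<open>Vanishes at the origin, because both \<open>0 powr e\<close> and division by 0 are 0.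
  Lower bounds for the kernel therefore need two distinct points, while upper bounds hold on the
  diagonal as well.\<close>

definition kern :: "real \<Rightarrow> 'a::euclidean_space \<Rightarrow> real" where
  "kern s h = 1 / norm h powr (real DIM('a) + 2 * s)"

lemma kern_powr: "kern s (h :: 'a::euclidean_space) = norm h powr (- (real DIM('a) + 2 * s))"
  by (simp only: kern_def powr_minus_divide)

lemma kern_nonneg [simp]: "0 \<le> kern s h"
  by (simp add: kern_def)

lemma kern_measurable [measurable]: "kern s \<in> borel_measurable borel"
  unfolding kern_def by measurable

lemma kern_minus: "kern s (x - y) = kern s (y - x)"
  by (simp add: kern_def norm_minus_commute)

lemma kern_scale:
  "c > 0 \<Longrightarrow> kern s (c *\<^sub>R h :: 'a::euclidean_space) = c powr (- (real DIM('a) + 2 * s)) * kern s h"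
proof -
  assume "c > 0"
  then have "1 / (c * t) powr e = c powr (- e) * (1 / t powr e)" if "t \<ge> 0" for e t :: real
    using that by (simp add: powr_mult powr_minus field_simps)
  then show ?thesis
    using \<open>c > 0\<close> by (simp add: kern_def)
qed

text \<open>The factor \<open>min 1 ((norm h)\<^sup>2)\<close> bounds the squared increment of a
  Lipschitz cut-off with values in [0, 1]. At infinity the shells form a geometric series of ratio
  2^(-2s), near the origin one of ratio 2^(-(2-2s)); this is where both 0 < s and s < 1
  enter.\<close>

lemma kern_unit_finite:
  assumes "0 < s" "s < 1"
  shows "(\<integral>\<^sup>+h. ennreal (min 1 ((norm h)\<^sup>2) * kern s (h::'a::euclidean_space)) \<partial>lebesgue) < \<infinity>"
proof -
  let ?N = "real DIM('a)" and ?n = "DIM('a)"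
  let ?f = "\<lambda>h::'a. ennreal (min 1 ((norm h)\<^sup>2) * kern s h)"
  have 1: "(\<integral>\<^sup>+h. ?f h * indicator {h. 1 \<le> norm h} h \<partial>lebesgue) < \<infinity>"
  proof (rule nn_integral_dyadic_finite[of "\<lambda>j. (2 ^ j) powr (- (?N + 2 * s))" "\<lambda>j. 2 * 2 ^ j"])
    have "(\<lambda>j::nat. (2 ^ j) powr (- (?N + 2 * s)) * (2 * 2 ^ j) ^ ?n) =
        (\<lambda>j. 2 ^ ?n * (2 powr (- (2 * s))) ^ j)"
    proof
      fix j :: nat
      have "((2::real) * 2 ^ j) ^ ?n = 2 ^ ?n * (2 ^ j) powr ?N"
        by (simp add: power_mult_distrib powr_realpow)
      then have "(2 ^ j) powr (- (?N + 2 * s)) * ((2::real) * 2 ^ j) ^ ?n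
          = 2 ^ ?n * ((2 ^ j) powr (- (?N + 2 * s)) * (2 ^ j) powr ?N)"
        by simp
      also have "\<dots> = 2 ^ ?n * (2 ^ j) powr (- (2 * s))"
        by (simp add: powr_add[symmetric])
      also have "((2::real) ^ j) powr (- (2 * s)) = (2 powr (- (2 * s))) ^ j"
        by (simp add: powr_realpow[symmetric] powr_powr mult.commute)
      finally show "(2 ^ j) powr (- (?N + 2 * s)) * ((2::real) * 2 ^ j) ^ ?n = 2 ^ ?n * (2 powr (- (2 * s))) ^ j" .
    qed
    moreover have "summable (\<lambda>j. (2::real) ^ ?n * (2 powr (- (2 * s))) ^ j)"
      using assms powr_less_cancel_iff[of 2 "- (2 * s)" 0]
      by (intro summable_mult summable_geometric) auto
    ultimately show "summable (\<lambda>j::nat. (2 ^ j) powr (- (?N + 2 * s)) * (2 * 2 ^ j) ^ ?n)"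
      by simp
    fix x :: 'a
    show "?f x * indicator {h. 1 \<le> norm h} x = 0 \<or>
      (\<exists>j. ?f x * indicator {h. 1 \<le> norm h} x \<le> ennreal ((2 ^ j) powr (- (?N + 2 * s))) \<and> norm x \<le> 2 * 2 ^ j)"
    proof (cases "1 \<le> norm x")
      case True
      obtain j :: nat where j: "2 ^ j \<le> norm x" "norm x \<le> 2 * 2 ^ j" 
        using dyadic_outside[OF True] by auto
      have "min 1 ((norm x)\<^sup>2) * kern s x \<le> 1 * kern s x"
        by (intro mult_right_mono) auto
      also have "\<dots> = norm x powr (- (?N + 2 * s))"
        by (simp add: kern_powr)
      also have "\<dots> \<le> (2 ^ j) powr (- (?N + 2 * s))"
        using assms j by (intro powr_mono2') auto
      finally show ?thesis
        using True j by (intro disjI2 exI[of _ j]) (auto intro!: ennreal_leI)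
    qed simp
  qed auto
  have 2: "(\<integral>\<^sup>+h. ?f h * indicator {h. norm h \<le> 1} h \<partial>lebesgue) < \<infinity>"
  proof (rule nn_integral_dyadic_finite[of "\<lambda>j. ((1/2)^j)\<^sup>2 * ((1/2) ^ j / 2) powr (- (?N + 2 * s))" "\<lambda>j. (1/2) ^ j"])
    have "(\<lambda>j::nat. ((1/2)^j)\<^sup>2 * ((1/2) ^ j / 2) powr (- (?N + 2 * s)) * ((1/2) ^ j) ^ ?n) =
        (\<lambda>j. (1/2) powr (- (?N + 2 * s)) * ((1/2) powr (2 - 2 * s)) ^ j)"
    proof
      fix j :: nat
      let ?t = "(1/2::real) ^ j"
      have "?t\<^sup>2 * (?t / 2) powr (- (?N + 2 * s)) * ?t ^ ?n
          = (?t powr 2 * (?t powr (- (?N + 2 * s)) * ?t powr ?N)) * (1/2) powr (- (?N + 2 * s))"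
        using powr_mult[of ?t "1/2" "- (?N + 2 * s)"] by (simp add: powr_realpow)
      also have "?t powr 2 * (?t powr (- (?N + 2 * s)) * ?t powr ?N) = ?t powr (2 - 2 * s)"
        by (simp only: powr_add[symmetric]) simp
      also have "?t powr (2 - 2 * s) = ((1/2) powr (2 - 2 * s)) ^ j"
        by (simp add: powr_realpow[symmetric] powr_powr mult.commute)
      finally show "?t\<^sup>2 * (?t / 2) powr (- (?N + 2 * s)) * ?t ^ ?n =
          (1/2) powr (- (?N + 2 * s)) * ((1/2) powr (2 - 2 * s)) ^ j"
        by simp
    qed
    moreover have "summable (\<lambda>j. (1/2::real) powr (- (?N + 2 * s)) * ((1/2) powr (2 - 2 * s)) ^ j)"
    proof (intro summable_mult summable_geometric)
      have "(1/2::real) powr (2 - 2 * s) < 1 powr (2 - 2 * s)"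
        using assms by (intro powr_less_mono2) auto
      then show "norm ((1/2::real) powr (2 - 2 * s)) < 1" by simp
    qed
    ultimately show "summable (\<lambda>j::nat. ((1/2)^j)\<^sup>2 * ((1/2) ^ j / 2) powr (- (?N + 2 * s)) * ((1/2) ^ j) ^ ?n)"
      by simp
    fix x :: 'a
    assume "x \<noteq> 0"
    show "?f x * indicator {h. norm h \<le> 1} x = 0 \<or>
      (\<exists>j. ?f x * indicator {h. norm h \<le> 1} x \<le> ennreal (((1/2)^j)\<^sup>2 * ((1/2) ^ j / 2) powr (- (?N + 2 * s))) \<and> norm x \<le> (1/2) ^ j)"
    proof (cases "norm x \<le> 1")
      case True
      obtain j :: nat where j: "(1/2) ^ j / 2 \<le> norm x" "norm x \<le> (1/2) ^ j" 
        using dyadic_inside[of "norm x"] \<open>x \<noteq> 0\<close> True by auto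
      have "min 1 ((norm x)\<^sup>2) * kern s x \<le> (norm x)\<^sup>2 * kern s x"
        by (intro mult_right_mono) auto
      also have "\<dots> = (norm x)\<^sup>2 * norm x powr (- (?N + 2 * s))"
        by (simp add: kern_powr)
      also have "\<dots> \<le> ((1/2) ^ j)\<^sup>2 * ((1/2) ^ j / 2) powr (- (?N + 2 * s))"
        using assms j by (intro mult_mono powr_mono2' power_mono) auto
      finally show ?thesis
        using True j by (intro disjI2 exI[of _ j]) (auto intro!: ennreal_leI)
    qed simp
  qed auto
  have "(\<integral>\<^sup>+h. ?f h \<partial>lebesgue) \<le> (\<integral>\<^sup>+h. ?f h * indicator {h. 1 \<le> norm h} h + ?f h * indicator {h. norm h \<le> 1} h \<partial>lebesgue)"
    by (intro nn_integral_mono) (auto simp: indicator_def)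
  also have "\<dots> = (\<integral>\<^sup>+h. ?f h * indicator {h. 1 \<le> norm h} h \<partial>lebesgue) + (\<integral>\<^sup>+h. ?f h * indicator {h. norm h \<le> 1} h \<partial>lebesgue)"
    by (rule nn_integral_add) measurable
  also have "\<dots> < \<infinity>"
    using 1 2 by simp
  finally show ?thesis .
qed

text \<open>Translation removes x and the substitution h = \<rho> h' produces the power of \<rho>.
  The summand 1 in the constant only makes it strictly positive without a lower bound for the
  integral.\<close>

lemma kern_cutoff_bound:
  assumes "0 < s" "s < 1"
  obtains C where "C > 0"
    "\<And>\<rho> x. \<rho> > 0 \<Longrightarrow> (\<integral>\<^sup>+y. ennreal (min 1 ((norm (x - y) / \<rho>)\<^sup>2) * kern s (x - y :: 'a::euclidean_space)) \<partial>lebesgue)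
      \<le> ennreal (C * \<rho> powr (- 2 * s))"
proof -
  let ?I = "(\<integral>\<^sup>+h. ennreal (min 1 ((norm h)\<^sup>2) * kern s (h::'a)) \<partial>lebesgue)"
  have fin: "?I < \<infinity>" by (rule kern_unit_finite[OF assms])
  show thesis
  proof (rule that[of "enn2real ?I + 1"])
    show "enn2real ?I + 1 > 0"
      using enn2real_nonneg[of ?I] by linarith
    fix \<rho> :: real and x :: 'a assume \<rho>: "\<rho> > 0"
    have "(\<integral>\<^sup>+y. ennreal (min 1 ((norm (x - y) / \<rho>)\<^sup>2) * kern s (x - y)) \<partial>lebesgue) =
        (\<integral>\<^sup>+y. ennreal (min 1 ((norm y / \<rho>)\<^sup>2) * kern s (y::'a)) \<partial>lebesgue)"
      by (rule nn_integral_lebesgue_reflect) measurable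
    also have "\<dots> = ennreal (\<rho> ^ DIM('a)) * (\<integral>\<^sup>+y. ennreal (min 1 ((norm (\<rho> *\<^sub>R y) / \<rho>)\<^sup>2) * kern s (\<rho> *\<^sub>R y::'a)) \<partial>lebesgue)"
      by (rule nn_integral_lebesgue_scale[OF _ \<rho>]) measurable
    also have "(\<integral>\<^sup>+y. ennreal (min 1 ((norm (\<rho> *\<^sub>R y) / \<rho>)\<^sup>2) * kern s (\<rho> *\<^sub>R y::'a)) \<partial>lebesgue)
        = (\<integral>\<^sup>+y. ennreal (\<rho> powr (- (real DIM('a) + 2 * s))) * ennreal (min 1 ((norm y)\<^sup>2) * kern s (y::'a)) \<partial>lebesgue)"
      using \<rho> by (intro nn_integral_cong) (simp add: kern_scale ennreal_mult'[symmetric] mult_ac)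
    also have "\<dots> = ennreal (\<rho> powr (- (real DIM('a) + 2 * s))) * ?I"
      by (rule nn_integral_cmult) measurable
    also have "ennreal (\<rho> ^ DIM('a)) * \<dots> = ennreal (\<rho> powr (- 2 * s)) * ?I"
      using \<rho> by (simp add: mult.assoc[symmetric] ennreal_mult'[symmetric] powr_realpow[symmetric] powr_add[symmetric])
    also have "\<dots> \<le> ennreal (\<rho> powr (- 2 * s)) * ennreal (enn2real ?I + 1)"
      using fin by (intro mult_left_mono) (auto simp: ennreal_enn2real_if)
    also have "\<dots> = ennreal ((enn2real ?I + 1) * \<rho> powr (- 2 * s))"
      by (subst ennreal_mult'[symmetric]) (auto simp: mult.commute)
    finally show "(\<integral>\<^sup>+y. ennreal (min 1 ((norm (x - y) / \<rho>)\<^sup>2) * kern s (x - y)) \<partial>lebesgue)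
      \<le> ennreal ((enn2real ?I + 1) * \<rho> powr (- 2 * s))" .
  qed
qed

section \<open>Integrals of the singular weight\<close>

lemma weight_unit_ball_finite:
  assumes "0 < g" "g < real DIM('a)"
  shows "(\<integral>\<^sup>+x. ennreal (norm x powr (- g)) * indicator (cball 0 1) (x::'a::euclidean_space) \<partial>lebesgue) < \<infinity>"
proof (rule nn_integral_dyadic_finite[of "\<lambda>j. ((1/2) ^ j / 2) powr (- g)" "\<lambda>j. (1/2) ^ j"])
  let ?N = "real DIM('a)" and ?n = "DIM('a)"
  have "(\<lambda>j::nat. ((1/2) ^ j / 2) powr (- g) * ((1/2) ^ j) ^ ?n) =
      (\<lambda>j. (1/2) powr (- g) * ((1/2) powr (?N - g)) ^ j)"
  proof
    fix j :: nat
    let ?t = "(1/2::real) ^ j"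
    have "(?t / 2) powr (- g) * ?t ^ ?n = (1/2) powr (- g) * (?t powr (- g) * ?t powr ?N)"
      using powr_mult[of ?t "1/2" "- g"] by (simp add: powr_realpow)
    also have "?t powr (- g) * ?t powr ?N = ?t powr (?N - g)"
      by (simp only: powr_add[symmetric]) simp
    also have "?t powr (?N - g) = ((1/2) powr (?N - g)) ^ j"
      by (simp add: powr_realpow[symmetric] powr_powr mult.commute)
    finally show "(?t / 2) powr (- g) * ?t ^ ?n = (1/2) powr (- g) * ((1/2) powr (?N - g)) ^ j" .
  qed
  moreover have "summable (\<lambda>j. (1/2::real) powr (- g) * ((1/2) powr (?N - g)) ^ j)"
  proof (intro summable_mult summable_geometric)
    have "(1/2::real) powr (?N - g) < 1 powr (?N - g)"
      using assms by (intro powr_less_mono2) auto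
    then show "norm ((1/2::real) powr (?N - g)) < 1" by simp
  qed
  ultimately show "summable (\<lambda>j::nat. ((1/2) ^ j / 2) powr (- g) * ((1/2) ^ j) ^ ?n)"
    by simp
  fix x :: 'a
  assume "x \<noteq> 0"
  show "ennreal (norm x powr (- g)) * indicator (cball 0 1) x = 0 \<or>
    (\<exists>j. ennreal (norm x powr (- g)) * indicator (cball 0 1) x \<le> ennreal (((1/2) ^ j / 2) powr (- g)) \<and> norm x \<le> (1/2) ^ j)"
  proof (cases "norm x \<le> 1")
    case True
    obtain j :: nat where j: "(1/2) ^ j / 2 \<le> norm x" "norm x \<le> (1/2) ^ j" 
      using dyadic_inside[of "norm x"] \<open>x \<noteq> 0\<close> True by auto
    have "norm x powr (- g) \<le> ((1/2) ^ j / 2) powr (- g)"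
      using assms j by (intro powr_mono2') auto
    then show ?thesis
      using True j by (intro disjI2 exI[of _ j]) (auto intro!: ennreal_leI)
  qed simp
qed auto

text \<open>Up to a constant, a ball around the origin is the worst set of given measure. Cut A at
  the radius r with r^N = |A|: inside, the ball contributes a multiple of r^(N-g) by scaling;
  outside, the weight is at most r^(-g). Both terms are |A|^(1-g/N) times a constant.\<close>

lemma weight_set_bound:
  assumes g: "0 < g" "g < real DIM('a)"
  obtains C where "C > 0"
    "\<And>A. A \<in> sets lebesgue \<Longrightarrow> emeasure lebesgue A < \<infinity> \<Longrightarrow>
      (\<integral>\<^sup>+x. ennreal (norm x powr (- g)) * indicator A (x::'a::euclidean_space) \<partial>lebesgue)
        \<le> ennreal (C * measure lebesgue A powr (1 - g / real DIM('a)))"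
proof -
  let ?N = "real DIM('a)"
  let ?I = "(\<integral>\<^sup>+x. ennreal (norm x powr (- g)) * indicator (cball 0 1) (x::'a) \<partial>lebesgue)"
  have fin: "?I < \<infinity>" by (rule weight_unit_ball_finite[OF g])
  show thesis
  proof (rule that[of "enn2real ?I + 1"])
    show "enn2real ?I + 1 > 0"
      using enn2real_nonneg[of ?I] by linarith
    fix A :: "'a set" assume A[measurable]: "A \<in> sets lebesgue" and Afin: "emeasure lebesgue A < \<infinity>"
    let ?m = "measure lebesgue A"
    have eA: "emeasure lebesgue A = ennreal ?m"
      using Afin by (intro emeasure_eq_ennreal_measure) auto
    show "(\<integral>\<^sup>+x. ennreal (norm x powr (- g)) * indicator A x \<partial>lebesgue)
        \<le> ennreal ((enn2real ?I + 1) * ?m powr (1 - g / ?N))"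
    proof (cases "?m = 0")
      case True
      then have "A \<in> null_sets lebesgue"
        using eA by auto
      then have "AE x in lebesgue. x \<notin> A" by (rule AE_not_in)
      then have "(\<integral>\<^sup>+x. ennreal (norm x powr (- g)) * indicator A x \<partial>lebesgue) = (\<integral>\<^sup>+(x::'a). 0 \<partial>lebesgue)"
        by (intro nn_integral_cong_AE) (auto simp: indicator_def)
      then show ?thesis by simp
    next
      case False
      then have m: "?m > 0" by (simp add: zero_less_measure_iff)
      define r where "r = ?m powr (1 / ?N)"
      have r: "r > 0" using m by (simp add: r_def)
      have rN: "r powr ?N = ?m" using m by (simp add: r_def powr_powr)
      have rg: "r powr (?N - g) = ?m powr (1 - g / ?N)"
        by (simp add: r_def powr_powr diff_divide_distrib)
      have pw: "ennreal (norm x powr (- g)) * indicator A x \<le>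
          ennreal (norm x powr (- g)) * indicator (cball 0 r) x + ennreal (r powr (- g)) * indicator A x" for x :: 'a
      proof (cases "norm x \<le> r")
        case False
        then have "norm x powr (- g) \<le> r powr (- g)"
          using g r by (intro powr_mono2') auto
        then have "ennreal (norm x powr (- g)) * indicator A x \<le> ennreal (r powr (- g)) * indicator A x"
          by (intro mult_right_mono ennreal_leI) auto
        then show ?thesis by (rule order_trans) simp
      next
        case True
        then have "ennreal (norm x powr (- g)) * indicator A x \<le>
            ennreal (norm x powr (- g)) * indicator (cball 0 r) x"
          by (intro mult_left_mono) (simp_all add: indicator_def)
        then show ?thesis by (rule order_trans) simp
      qed
      have "(\<integral>\<^sup>+x. ennreal (norm x powr (- g)) * indicator A x \<partial>lebesgue) \<le>
          (\<integral>\<^sup>+x. ennreal (norm x powr (- g)) * indicator (cball 0 r) x + ennreal (r powr (- g)) * indicator A x \<partial>lebesgue)"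
        by (rule nn_integral_mono) (rule pw)
      also have "\<dots> = (\<integral>\<^sup>+x. ennreal (norm x powr (- g)) * indicator (cball 0 r) (x::'a) \<partial>lebesgue) +
          (\<integral>\<^sup>+x. ennreal (r powr (- g)) * indicator A x \<partial>lebesgue)"
        by (rule nn_integral_add) measurable
      finally have le: "(\<integral>\<^sup>+x. ennreal (norm x powr (- g)) * indicator A x \<partial>lebesgue) \<le>
          (\<integral>\<^sup>+x. ennreal (norm x powr (- g)) * indicator (cball 0 r) (x::'a) \<partial>lebesgue) +
          (\<integral>\<^sup>+x. ennreal (r powr (- g)) * indicator A x \<partial>lebesgue)" .
      have "(\<integral>\<^sup>+x. ennreal (r powr (- g)) * indicator A x \<partial>lebesgue) = ennreal (r powr (- g) * ?m)"
        by (subst nn_integral_cmult_indicator) (simp_all only: eA A ennreal_mult' powr_ge_zero)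
      also have "r powr (- g) * ?m = ?m powr (1 - g / ?N)"
        unfolding rg[symmetric] using powr_add[of r "- g" ?N] by (simp add: rN)
      finally have e1: "(\<integral>\<^sup>+x. ennreal (r powr (- g)) * indicator A x \<partial>lebesgue) = ennreal (?m powr (1 - g / ?N))" .
      have "(\<integral>\<^sup>+x. ennreal (norm (r *\<^sub>R x) powr (- g)) * indicator (cball 0 r) (r *\<^sub>R x::'a) \<partial>lebesgue) =
          (\<integral>\<^sup>+x. ennreal (r powr (- g)) * (ennreal (norm x powr (- g)) * indicator (cball 0 1) (x::'a)) \<partial>lebesgue)"
        using r by (intro nn_integral_cong) (auto simp: indicator_def powr_mult ennreal_mult')
      also have "\<dots> = ennreal (r powr (- g)) * ?I"
        by (rule nn_integral_cmult) measurable
      finally have e2: "(\<integral>\<^sup>+x. ennreal (norm (r *\<^sub>R x) powr (- g)) * indicator (cball 0 r) (r *\<^sub>R x::'a) \<partial>lebesgue)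
          = ennreal (r powr (- g)) * ?I" .
      have "(\<integral>\<^sup>+x. ennreal (norm x powr (- g)) * indicator (cball 0 r) (x::'a) \<partial>lebesgue)
         = ennreal (r ^ DIM('a)) * (\<integral>\<^sup>+x. ennreal (norm (r *\<^sub>R x) powr (- g)) * indicator (cball 0 r) (r *\<^sub>R x::'a) \<partial>lebesgue)"
        by (rule nn_integral_lebesgue_scale[OF _ r]) measurable
      also have "\<dots> = ennreal (r ^ DIM('a) * r powr (- g)) * ?I"
        unfolding e2 using r by (simp add: mult.assoc[symmetric] ennreal_mult')
      also have "r ^ DIM('a) * r powr (- g) = ?m powr (1 - g / ?N)"
        unfolding rg[symmetric] using r powr_add[of r ?N "- g"] by (simp add: powr_realpow)
      finally have e3: "(\<integral>\<^sup>+x. ennreal (norm x powr (- g)) * indicator (cball 0 r) (x::'a) \<partial>lebesgue)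
         = ennreal (?m powr (1 - g / ?N)) * ?I" .
      have I: "?I = ennreal (enn2real ?I)"
        using fin by (simp add: ennreal_enn2real_if)
      have "ennreal (?m powr (1 - g / ?N)) * ?I + ennreal (?m powr (1 - g / ?N))
          = ennreal ((enn2real ?I + 1) * ?m powr (1 - g / ?N))"
        by (subst I, subst ennreal_mult'[symmetric], simp, subst ennreal_plus[symmetric]) (auto simp: algebra_simps)
      then show ?thesis
        using le unfolding e1 e3 by simp
    qed
  qed
qed

section \<open>The Gagliardo form\<close>

text \<open>The double integral without the factor C(N,s)/2, so that estimates on it do not involve
  the sign of that constant.\<close>

definition gagB :: "real \<Rightarrow> ('a::euclidean_space \<Rightarrow> real) \<Rightarrow> ('a \<Rightarrow> real) \<Rightarrow> real" where
  "gagB s u v = (LINT p|(lebesgue \<Otimes>\<^sub>M lebesgue). gagliardo_form s u v p)"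

abbreviation gag :: "real \<Rightarrow> ('a::euclidean_space \<Rightarrow> real) \<Rightarrow> real" where
  "gag s u \<equiv> gagB s u u"

text \<open>The seminorm with values in [0, \<infinity>], for functions whose membership in
  \<open>Hs s\<close> is still to be proved; its iterated form allows integrating in y
  first.\<close>

definition ngag :: "real \<Rightarrow> ('a::euclidean_space \<Rightarrow> real) \<Rightarrow> ennreal" where
  "ngag s u = (\<integral>\<^sup>+x. \<integral>\<^sup>+y. ennreal ((u x - u y)\<^sup>2 * kern s (x - y)) \<partial>lebesgue \<partial>lebesgue)"

lemma gagliardo_form_kern:
  "gagliardo_form s u v (x, y) = (u x - u y) * (v x - v y) * kern s (x - y)"
  by (simp add: gagliardo_form_def kern_def)

lemma gagliardo_form_kern':
  "gagliardo_form s u v = (\<lambda>p. (u (fst p) - u (snd p)) * (v (fst p) - v (snd p)) * kern s (fst p - snd p))"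
  by (auto simp: gagliardo_form_kern)

lemma gagliardo_form_measurable [measurable]:
  fixes u :: "'a::euclidean_space \<Rightarrow> real"
  assumes [measurable]: "u \<in> borel_measurable lebesgue" "v \<in> borel_measurable lebesgue"
  shows "gagliardo_form s u v \<in> borel_measurable (lebesgue \<Otimes>\<^sub>M lebesgue)"
  unfolding gagliardo_form_kern' by measurable

lemma gagliardo_form_nonneg: "0 \<le> gagliardo_form s u u p"
  by (cases p) (simp add: gagliardo_form_kern)

lemma frac_energy_gag: "frac_energy s (u :: 'a::euclidean_space \<Rightarrow> real) = frac_const TYPE('a) s / 2 * gag s u"
proof -
  have "(\<lambda>(x, y). \<bar>u x - u y\<bar>\<^sup>2 / norm (x - y) powr (real DIM('a) + 2 * s)) = gagliardo_form s u u"
    by (auto simp: gagliardo_form_def power2_eq_square)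
  then show ?thesis
    by (simp add: frac_energy_def gagB_def)
qed

lemma frac_pairing_gag:
  "frac_pairing s (u :: 'a::euclidean_space \<Rightarrow> real) v = frac_const TYPE('a) s / 2 * gagB s u v"
  by (simp add: frac_pairing_def gagB_def)

lemma gag_nonneg [simp]: "0 \<le> gag s u"
  unfolding gagB_def by (intro integral_nonneg_AE) (simp add: gagliardo_form_nonneg)

lemma ngag_pair:
  fixes u :: "'a::euclidean_space \<Rightarrow> real"
  assumes [measurable]: "u \<in> borel_measurable lebesgue"
  shows "ngag s u = (\<integral>\<^sup>+p. ennreal (gagliardo_form s u u p) \<partial>(lebesgue \<Otimes>\<^sub>M lebesgue))"
  unfolding ngag_def
  by (subst leb.nn_integral_fst[symmetric]) (auto simp: gagliardo_form_kern power2_eq_square)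

lemma Hs_iff:
  "u \<in> Hs s \<longleftrightarrow> u \<in> borel_measurable lebesgue \<and> integrable lebesgue (\<lambda>x. (u x)\<^sup>2) \<and> ngag s u < \<infinity>"
proof (cases "u \<in> borel_measurable lebesgue")
  case True
  have "integrable (lebesgue \<Otimes>\<^sub>M lebesgue) (gagliardo_form s u u) \<longleftrightarrow> ngag s u < \<infinity>"
    unfolding ngag_pair[OF True] integrable_iff_bounded
    using True by (simp add: gagliardo_form_nonneg)
  then show ?thesis by (simp add: Hs_def)
qed (simp add: Hs_def)

lemma Hs_measurable: "u \<in> Hs s \<Longrightarrow> u \<in> borel_measurable lebesgue"
  and Hs_L2: "u \<in> Hs s \<Longrightarrow> integrable lebesgue (\<lambda>x. (u x)\<^sup>2)"
  and Hs_gag_integrable: "u \<in> Hs s \<Longrightarrow> integrable (lebesgue \<Otimes>\<^sub>M lebesgue) (gagliardo_form s u u)"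
  by (simp_all add: Hs_def)

lemma ngag_eq: "u \<in> Hs s \<Longrightarrow> ngag s u = ennreal (gag s u)"
  using nn_integral_eq_integral[OF Hs_gag_integrable] 
  by (subst ngag_pair) (simp_all add: Hs_measurable gagB_def gagliardo_form_nonneg)

lemma L2_norm_sq_power: "L2_norm_sq u = (LINT x|lebesgue. (u x)\<^sup>2)"
  by (simp add: L2_norm_sq_def)

lemma L2_norm_sq_nonneg [simp]: "0 \<le> L2_norm_sq u"
  by (simp add: L2_norm_sq_def)

lemma nn_L2_norm_sq: "u \<in> Hs s \<Longrightarrow> (\<integral>\<^sup>+x. ennreal ((u x)\<^sup>2) \<partial>lebesgue) = ennreal (L2_norm_sq u)"
  unfolding L2_norm_sq_power by (rule nn_integral_eq_integral[OF Hs_L2]) auto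

lemma abs_mult_le_sum_squares: "\<bar>a * b\<bar> \<le> a\<^sup>2 + (b::real)\<^sup>2"
proof -
  have "2 * (\<bar>a\<bar> * \<bar>b\<bar>) \<le> a\<^sup>2 + b\<^sup>2" "0 \<le> \<bar>a\<bar> * \<bar>b\<bar>"
    using zero_le_power2[of "\<bar>a\<bar> - \<bar>b\<bar>"] by (simp_all add: power2_diff)
  then show ?thesis by (simp only: abs_mult)
qed

lemma integrable_mult_L2:
  fixes f g :: "'b \<Rightarrow> real"
  assumes [measurable]: "f \<in> borel_measurable M" "g \<in> borel_measurable M"
    and f: "integrable M (\<lambda>x. (f x)\<^sup>2)" and g: "integrable M (\<lambda>x. (g x)\<^sup>2)"
  shows "integrable M (\<lambda>x. f x * g x)"
proof (rule Bochner_Integration.integrable_bound)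
  show "integrable M (\<lambda>x. (f x)\<^sup>2 + (g x)\<^sup>2)" using f g by simp
  show "AE x in M. norm (f x * g x) \<le> norm ((f x)\<^sup>2 + (g x)\<^sup>2)"
    using abs_mult_le_sum_squares by simp
qed measurable

lemma gagB_integrable:
  assumes "u \<in> Hs s" "v \<in> Hs s"
  shows "integrable (lebesgue \<Otimes>\<^sub>M lebesgue) (gagliardo_form s u v)"
proof (rule Bochner_Integration.integrable_bound)
  note [measurable] = assms[THEN Hs_measurable]
  show "integrable (lebesgue \<Otimes>\<^sub>M lebesgue) (\<lambda>p. gagliardo_form s u u p + gagliardo_form s v v p)"
    using assms by (intro Bochner_Integration.integrable_add Hs_gag_integrable)
  have "\<bar>gagliardo_form s u v p\<bar> \<le> gagliardo_form s u u p + gagliardo_form s v v p" for p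
  proof -
    obtain x y where p: "p = (x, y)" by force
    let ?a = "u x - u y" and ?b = "v x - v y"
    have "\<bar>?a * ?b\<bar> * kern s (x - y) \<le> (?a * ?a + ?b * ?b) * kern s (x - y)"
      using abs_mult_le_sum_squares[of ?a ?b] by (intro mult_right_mono) (auto simp: power2_eq_square)
    then show ?thesis
      unfolding p gagliardo_form_kern by (simp only: abs_mult distrib_right abs_of_nonneg[OF kern_nonneg])
  qed
  then show "AE p in (lebesgue \<Otimes>\<^sub>M lebesgue). norm (gagliardo_form s u v p) \<le> norm (gagliardo_form s u u p + gagliardo_form s v v p)"
    by (simp add: gagliardo_form_nonneg)
  show "gagliardo_form s u v \<in> borel_measurable (lebesgue \<Otimes>\<^sub>M lebesgue)" by measurable
qed

section \<open>Linear structure of the space and normal contractions\<close>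

lemma integrable_square_add:
  fixes f g :: "'b \<Rightarrow> real"
  assumes [measurable]: "f \<in> borel_measurable M" "g \<in> borel_measurable M"
    and f: "integrable M (\<lambda>x. (f x)\<^sup>2)" and g: "integrable M (\<lambda>x. (g x)\<^sup>2)"
  shows "integrable M (\<lambda>x. (f x + g x)\<^sup>2)"
  using integrable_mult_L2[OF assms] f g by (simp add: power2_sum mult.assoc)

lemma Hs_add: assumes "u \<in> Hs s" "v \<in> Hs s" shows "(\<lambda>x. u x + v x) \<in> Hs s"
proof -
  note [measurable] = assms[THEN Hs_measurable]
  have eq: "gagliardo_form s (\<lambda>x. u x + v x) (\<lambda>x. u x + v x) =
      (\<lambda>p. gagliardo_form s u u p + (2 * gagliardo_form s u v p + gagliardo_form s v v p))"
    by (auto simp: gagliardo_form_kern algebra_simps)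
  have "integrable (lebesgue \<Otimes>\<^sub>M lebesgue) (gagliardo_form s (\<lambda>x. u x + v x) (\<lambda>x. u x + v x))"
    unfolding eq using assms by (intro Bochner_Integration.integrable_add integrable_mult_right gagB_integrable)
  moreover have "integrable lebesgue (\<lambda>x. (u x + v x)\<^sup>2)"
    using assms by (intro integrable_square_add Hs_measurable Hs_L2) auto
  ultimately show ?thesis
    unfolding Hs_def by simp
qed

lemma Hs_cmult: assumes "u \<in> Hs s" shows "(\<lambda>x. c * u x) \<in> Hs s"
proof -
  note [measurable] = assms[THEN Hs_measurable]
  have eq: "gagliardo_form s (\<lambda>x. c * u x) (\<lambda>x. c * u x) = (\<lambda>p. c\<^sup>2 * gagliardo_form s u u p)"
    by (auto simp: gagliardo_form_kern algebra_simps power2_eq_square)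
  have "integrable (lebesgue \<Otimes>\<^sub>M lebesgue) (gagliardo_form s (\<lambda>x. c * u x) (\<lambda>x. c * u x))"
    unfolding eq using assms by (intro integrable_mult_right gagB_integrable)
  then show ?thesis
    using Hs_L2[OF assms] by (simp add: Hs_def power_mult_distrib)
qed

lemma Hs_diff: "u \<in> Hs s \<Longrightarrow> v \<in> Hs s \<Longrightarrow> (\<lambda>x. u x - v x) \<in> Hs s"
  using Hs_add[of u s "\<lambda>x. -1 * v x"] Hs_cmult[of v s "-1"] by simp

lemma gag_add:
  assumes "u \<in> Hs s" "v \<in> Hs s"
  shows "gag s (\<lambda>x. u x + v x) = gag s u + 2 * gagB s u v + gag s v"
proof -
  have eq: "gagliardo_form s (\<lambda>x. u x + v x) (\<lambda>x. u x + v x) =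
      (\<lambda>p. (gagliardo_form s u u p + 2 * gagliardo_form s u v p) + gagliardo_form s v v p)"
    by (auto simp: gagliardo_form_kern algebra_simps)
  show ?thesis
    using assms unfolding gagB_def eq
    by (simp add: gagB_integrable)
qed

lemma gag_cmult: "gag s (\<lambda>x. c * u x) = c\<^sup>2 * gag s u"
proof -
  have eq: "gagliardo_form s (\<lambda>x. c * u x) (\<lambda>x. c * u x) = (\<lambda>p. c\<^sup>2 * gagliardo_form s u u p)"
    by (auto simp: gagliardo_form_kern algebra_simps power2_eq_square)
  show ?thesis
    by (simp add: gagB_def eq)
qed

lemma L2_norm_sq_cmult: "L2_norm_sq (\<lambda>x. c * u x) = c\<^sup>2 * L2_norm_sq u"
  by (simp add: L2_norm_sq_def abs_mult power_mult_distrib)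

lemma L2_norm_sq_mono_AE:
  assumes "u \<in> Hs s" "v \<in> borel_measurable lebesgue" "AE x in lebesgue. \<bar>v x\<bar> \<le> \<bar>u x\<bar>"
  shows "integrable lebesgue (\<lambda>x. (v x)\<^sup>2)" "L2_norm_sq v \<le> L2_norm_sq u"
proof -
  have le: "AE x in lebesgue. (v x)\<^sup>2 \<le> (u x)\<^sup>2"
    using assms(3) by eventually_elim (simp add: abs_le_square_iff)
  show i: "integrable lebesgue (\<lambda>x. (v x)\<^sup>2)"
    by (rule Bochner_Integration.integrable_bound[OF Hs_L2[OF assms(1)]]) (use assms(2) le in auto)
  show "L2_norm_sq v \<le> L2_norm_sq u"
    unfolding L2_norm_sq_power
    by (rule integral_mono_AE[OF i Hs_L2[OF assms(1)] le])
qed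

lemma Hs_contraction:
  assumes u: "u \<in> Hs s" and v [measurable]: "v \<in> borel_measurable lebesgue"
    and 1: "\<And>x. \<bar>v x\<bar> \<le> \<bar>u x\<bar>" and 2: "\<And>x y. \<bar>v x - v y\<bar> \<le> \<bar>u x - u y\<bar>"
  shows "v \<in> Hs s" and "gag s v \<le> gag s u" and "L2_norm_sq v \<le> L2_norm_sq u"
proof -
  note [measurable] = u[THEN Hs_measurable]
  have le: "gagliardo_form s v v p \<le> gagliardo_form s u u p" for p
  proof -
    obtain x y where p: "p = (x, y)" by force
    have "(v x - v y) * (v x - v y) \<le> (u x - u y) * (u x - u y)"
      using 2[of x y] by (metis abs_le_square_iff power2_eq_square)
    then show ?thesis
      unfolding p gagliardo_form_kern by (intro mult_right_mono) auto
  qed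
  have int: "integrable (lebesgue \<Otimes>\<^sub>M lebesgue) (gagliardo_form s v v)"
    by (rule Bochner_Integration.integrable_bound[OF gagB_integrable[OF u u]])
      (use le in \<open>auto simp: gagliardo_form_nonneg\<close>)
  have "integrable lebesgue (\<lambda>x. (v x)\<^sup>2)"
    using 1 by (intro L2_norm_sq_mono_AE(1)[OF u v]) simp
  with int v show vHs: "v \<in> Hs s"
    unfolding Hs_def by simp
  show "gag s v \<le> gag s u"
    unfolding gagB_def using u vHs by (intro integral_mono gagB_integrable le)
  show "L2_norm_sq v \<le> L2_norm_sq u"
    using 1 by (intro L2_norm_sq_mono_AE(2)[OF u v]) auto
qed

text \<open>The part of the energy of a product in which the difference falls on the cut-off;
  \<open>f\<close> stands for the square of the other factor. Integrating in y first leaves a bound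
  that does not depend on x, so only the integral of \<open>f\<close> remains.\<close>

lemma cutoff_energy_bound:
  assumes "0 < s" "s < 1"
  obtains C where "C > 0"
    "\<And>\<rho> \<phi> (f :: 'a::euclidean_space \<Rightarrow> real). \<rho> > 0 \<Longrightarrow> \<phi> \<in> borel_measurable borel \<Longrightarrow>
      (\<And>x y. \<bar>\<phi> x - \<phi> y\<bar> \<le> min 1 (norm (x - y) / \<rho>)) \<Longrightarrow>
      f \<in> borel_measurable lebesgue \<Longrightarrow> (\<And>x. 0 \<le> f x) \<Longrightarrow>
      (\<integral>\<^sup>+x. \<integral>\<^sup>+y. ennreal (f x * (\<phi> x - \<phi> y)\<^sup>2 * kern s (x - y)) \<partial>lebesgue \<partial>lebesgue)
        \<le> ennreal (C * \<rho> powr (- 2 * s)) * (\<integral>\<^sup>+x. ennreal (f x) \<partial>lebesgue)"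
proof -
  obtain C where C: "C > 0" and b: "\<And>\<rho> x. \<rho> > 0 \<Longrightarrow>
      (\<integral>\<^sup>+y. ennreal (min 1 ((norm (x - y) / \<rho>)\<^sup>2) * kern s (x - y :: 'a::euclidean_space)) \<partial>lebesgue)
      \<le> ennreal (C * \<rho> powr (- 2 * s))"
    using kern_cutoff_bound[OF assms, where 'a='a] by blast
  show thesis
  proof (rule that[OF C])
    fix \<rho> :: real and \<phi> f :: "'a \<Rightarrow> real"
    assume \<rho>: "\<rho> > 0" and [measurable]: "\<phi> \<in> borel_measurable borel" "f \<in> borel_measurable lebesgue"
      and lip: "\<And>x y. \<bar>\<phi> x - \<phi> y\<bar> \<le> min 1 (norm (x - y) / \<rho>)" and f: "\<And>x. 0 \<le> f x"
    have sq: "(\<phi> x - \<phi> y)\<^sup>2 \<le> min 1 ((norm (x - y) / \<rho>)\<^sup>2)" for x y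
    proof -
      have l: "\<bar>\<phi> x - \<phi> y\<bar> \<le> 1" "\<bar>\<phi> x - \<phi> y\<bar> \<le> norm (x - y) / \<rho>"
        using lip[of x y] by auto
      show ?thesis
        using power_mono[OF l(1), of 2] power_mono[OF l(2), of 2] by simp
    qed
    have "(\<integral>\<^sup>+x. \<integral>\<^sup>+y. ennreal (f x * (\<phi> x - \<phi> y)\<^sup>2 * kern s (x - y)) \<partial>lebesgue \<partial>lebesgue)
        \<le> (\<integral>\<^sup>+x. ennreal (f x) * ennreal (C * \<rho> powr (- 2 * s)) \<partial>lebesgue)"
    proof (rule nn_integral_mono)
      fix x :: 'a
      have "(\<integral>\<^sup>+y. ennreal (f x * (\<phi> x - \<phi> y)\<^sup>2 * kern s (x - y)) \<partial>lebesgue)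
          \<le> (\<integral>\<^sup>+y. ennreal (f x) * ennreal (min 1 ((norm (x - y) / \<rho>)\<^sup>2) * kern s (x - y)) \<partial>lebesgue)"
      proof (rule nn_integral_mono)
        fix y :: 'a
        have "f x * ((\<phi> x - \<phi> y)\<^sup>2 * kern s (x - y)) \<le> f x * (min 1 ((norm (x - y) / \<rho>)\<^sup>2) * kern s (x - y))"
          using sq[of x y] f by (intro mult_left_mono mult_right_mono) auto
        then show "ennreal (f x * (\<phi> x - \<phi> y)\<^sup>2 * kern s (x - y)) \<le> ennreal (f x) * ennreal (min 1 ((norm (x - y) / \<rho>)\<^sup>2) * kern s (x - y))"
          using f by (subst ennreal_mult'[symmetric]) (auto intro!: ennreal_leI simp: mult.assoc)
      qed
      also have "\<dots> = ennreal (f x) * (\<integral>\<^sup>+y. ennreal (min 1 ((norm (x - y) / \<rho>)\<^sup>2) * kern s (x - y)) \<partial>lebesgue)"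
        by (rule nn_integral_cmult) measurable
      also have "\<dots> \<le> ennreal (f x) * ennreal (C * \<rho> powr (- 2 * s))"
        by (intro mult_left_mono b \<rho>) auto
      finally show "(\<integral>\<^sup>+y. ennreal (f x * (\<phi> x - \<phi> y)\<^sup>2 * kern s (x - y)) \<partial>lebesgue)
        \<le> ennreal (f x) * ennreal (C * \<rho> powr (- 2 * s))" .
    qed
    also have "\<dots> = (\<integral>\<^sup>+x. ennreal (f x) \<partial>lebesgue) * ennreal (C * \<rho> powr (- 2 * s))"
      by (rule nn_integral_multc) measurable
    finally show "(\<integral>\<^sup>+x. \<integral>\<^sup>+y. ennreal (f x * (\<phi> x - \<phi> y)\<^sup>2 * kern s (x - y)) \<partial>lebesgue \<partial>lebesgue)
        \<le> ennreal (C * \<rho> powr (- 2 * s)) * (\<integral>\<^sup>+x. ennreal (f x) \<partial>lebesgue)"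
      by (simp add: mult.commute)
  qed
qed

lemma nn_integral_double_add:
  assumes "f \<in> borel_measurable M" "g \<in> borel_measurable M"
  shows "(\<integral>\<^sup>+x. 2 * f x + 2 * g x \<partial>M) = 2 * integral\<^sup>N M f + 2 * integral\<^sup>N M g"
  using assms by (simp add: nn_integral_add nn_integral_cmult)

text \<open>Leibniz rule in the form \<phi>(x) u(x) - \<phi>(y) u(y) = \<phi>(y) (u(x) - u(y)) +
  u(x) (\<phi>(x) - \<phi>(y)). The first summand is controlled by the seminorm of u, the second by
  \<open>cutoff_energy_bound\<close> with f = u^2.\<close>

lemma Hs_cutoff:
  fixes u :: "'a::euclidean_space \<Rightarrow> real"
  assumes s: "0 < s" "s < 1" and u: "u \<in> Hs s" and \<rho>: "\<rho> > 0"
    and \<phi> [measurable]: "\<phi> \<in> borel_measurable borel"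
    and lip: "\<And>x y. \<bar>\<phi> x - \<phi> y\<bar> \<le> min 1 (norm (x - y) / \<rho>)"
    and bd: "\<And>x. \<bar>\<phi> x\<bar> \<le> 1"
  shows "(\<lambda>x. \<phi> x * u x) \<in> Hs s"
proof -
  note [measurable] = u[THEN Hs_measurable]
  obtain C where C: "C > 0"
    "\<And>\<rho> \<phi> (f :: 'a::euclidean_space \<Rightarrow> real). \<rho> > 0 \<Longrightarrow> \<phi> \<in> borel_measurable borel \<Longrightarrow>
      (\<And>x y. \<bar>\<phi> x - \<phi> y\<bar> \<le> min 1 (norm (x - y) / \<rho>)) \<Longrightarrow>
      f \<in> borel_measurable lebesgue \<Longrightarrow> (\<And>x. 0 \<le> f x) \<Longrightarrow>
      (\<integral>\<^sup>+x. \<integral>\<^sup>+y. ennreal (f x * (\<phi> x - \<phi> y)\<^sup>2 * kern s (x - y)) \<partial>lebesgue \<partial>lebesgue)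
        \<le> ennreal (C * \<rho> powr (- 2 * s)) * (\<integral>\<^sup>+x. ennreal (f x) \<partial>lebesgue)"
    using cutoff_energy_bound[OF s, where 'a='a] by blast
  let ?A = "\<lambda>x y. ennreal ((u x - u y)\<^sup>2 * kern s (x - y))"
    and ?B = "\<lambda>x y. ennreal ((u x)\<^sup>2 * (\<phi> x - \<phi> y)\<^sup>2 * kern s (x - y))"
  have "ngag s (\<lambda>x. \<phi> x * u x) \<le> (\<integral>\<^sup>+x. \<integral>\<^sup>+y. 2 * ?A x y + 2 * ?B x y \<partial>lebesgue \<partial>lebesgue)"
    unfolding ngag_def
  proof (intro nn_integral_mono)
    fix x y :: 'a
    let ?a = "\<phi> y * (u x - u y)" and ?b = "u x * (\<phi> x - \<phi> y)"
    have "(\<phi> x * u x - \<phi> y * u y)\<^sup>2 = (?a + ?b)\<^sup>2"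
      by (simp add: algebra_simps)
    also have "\<dots> \<le> 2 * ?a\<^sup>2 + 2 * ?b\<^sup>2"
      using zero_le_power2[of "?a - ?b"] by (simp add: power2_sum power2_diff)
    also have "\<dots> \<le> 2 * (u x - u y)\<^sup>2 + 2 * ((u x)\<^sup>2 * (\<phi> x - \<phi> y)\<^sup>2)"
    proof -
      have "(\<phi> y)\<^sup>2 \<le> 1" using bd[of y] by (simp add: abs_square_le_1)
      then have "(\<phi> y)\<^sup>2 * (u x - u y)\<^sup>2 \<le> 1 * (u x - u y)\<^sup>2" by (intro mult_right_mono) auto
      then show ?thesis by (simp add: power_mult_distrib)
    qed
    finally have "(\<phi> x * u x - \<phi> y * u y)\<^sup>2 * kern s (x - y) \<le>
        (2 * (u x - u y)\<^sup>2 + 2 * ((u x)\<^sup>2 * (\<phi> x - \<phi> y)\<^sup>2)) * kern s (x - y)"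
      by (intro mult_right_mono) auto
    also have "\<dots> = 2 * ((u x - u y)\<^sup>2 * kern s (x - y)) + 2 * ((u x)\<^sup>2 * (\<phi> x - \<phi> y)\<^sup>2 * kern s (x - y))"
      by (simp add: algebra_simps)
    finally have "ennreal ((\<phi> x * u x - \<phi> y * u y)\<^sup>2 * kern s (x - y)) \<le>
        ennreal (2 * ((u x - u y)\<^sup>2 * kern s (x - y)) + 2 * ((u x)\<^sup>2 * (\<phi> x - \<phi> y)\<^sup>2 * kern s (x - y)))"
      by (rule ennreal_leI)
    also have "\<dots> = 2 * ?A x y + 2 * ?B x y"
      by (subst ennreal_plus) (auto simp: ennreal_mult')
    finally show "ennreal ((\<phi> x * u x - \<phi> y * u y)\<^sup>2 * kern s (x - y)) \<le> 2 * ?A x y + 2 * ?B x y" .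
  qed
  also have "\<dots> = (\<integral>\<^sup>+x. 2 * (\<integral>\<^sup>+y. ?A x y \<partial>lebesgue) + 2 * (\<integral>\<^sup>+y. ?B x y \<partial>lebesgue) \<partial>lebesgue)"
    by (rule nn_integral_cong, rule nn_integral_double_add) measurable
  also have "\<dots> = 2 * ngag s u + 2 * (\<integral>\<^sup>+x. \<integral>\<^sup>+y. ?B x y \<partial>lebesgue \<partial>lebesgue)"
    unfolding ngag_def by (rule nn_integral_double_add) measurable
  also have "(\<integral>\<^sup>+x. \<integral>\<^sup>+y. ?B x y \<partial>lebesgue \<partial>lebesgue) \<le>
      ennreal (C * \<rho> powr (- 2 * s)) * (\<integral>\<^sup>+x. ennreal ((u x)\<^sup>2) \<partial>lebesgue)"
    by (rule C(2)[OF \<rho> \<phi> lip, of "\<lambda>x. (u x)\<^sup>2"]) simp_all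
  finally have le: "ngag s (\<lambda>x. \<phi> x * u x) \<le> 2 * ngag s u +
      2 * (ennreal (C * \<rho> powr (- 2 * s)) * (\<integral>\<^sup>+x. ennreal ((u x)\<^sup>2) \<partial>lebesgue))"
    by (simp add: mult_left_mono add_left_mono)
  have ng: "ngag s (\<lambda>x. \<phi> x * u x) < \<infinity>"
    by (rule le_less_trans[OF le]) (simp add: nn_L2_norm_sq[OF u] ngag_eq[OF u] ennreal_mult_less_top)
  have m: "(\<lambda>x. \<phi> x * u x) \<in> borel_measurable lebesgue"
    by measurable
  have "\<bar>\<phi> x * u x\<bar> \<le> \<bar>u x\<bar>" for x
    using bd[of x] by (simp add: abs_mult mult_left_le_one_le)
  then have "integrable lebesgue (\<lambda>x. (\<phi> x * u x)\<^sup>2)"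
    by (intro L2_norm_sq_mono_AE(1)[OF u m]) simp
  with m ng show ?thesis
    unfolding Hs_iff by simp
qed

section \<open>Scaling\<close>

text \<open>The dilation that preserves the mass; \<open>w a\<close> is
  \<open>scl (\<epsilon> a) (u a)\<close>.\<close>

definition scl :: "real \<Rightarrow> ('a::euclidean_space \<Rightarrow> real) \<Rightarrow> 'a \<Rightarrow> real" where
  "scl c u = (\<lambda>x. c powr (real DIM('a) / 2) * u (c *\<^sub>R x))"

lemma scl_measurable:
  assumes [measurable]: "u \<in> borel_measurable lebesgue"
  shows "scl c u \<in> borel_measurable lebesgue"
  unfolding scl_def by measurable

lemma scl_inverse:
  fixes u :: "'a::euclidean_space \<Rightarrow> real"
  assumes "c > 0" shows "scl c (scl (1 / c) u) = u"
proof -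
  have "c powr (real DIM('a) / 2) * (1 / c) powr (real DIM('a) / 2) = 1"
    using assms powr_mult[of c "1 / c" "real DIM('a) / 2"] by simp
  then show ?thesis
    using assms unfolding scl_def by (simp add: mult.assoc[symmetric])
qed

lemma powr_half_square: "c > 0 \<Longrightarrow> (c powr (real n / 2))\<^sup>2 = c ^ n"
  by (simp add: power2_eq_square powr_add[symmetric] powr_realpow)

lemma scl_power2: "c > 0 \<Longrightarrow> (scl c u x)\<^sup>2 = c ^ DIM('a) * (u (c *\<^sub>R x :: 'a::euclidean_space))\<^sup>2"
  by (simp add: scl_def power_mult_distrib powr_half_square)

lemma L2_scl:
  fixes u :: "'a::euclidean_space \<Rightarrow> real"
  assumes c: "c > 0" and [measurable]: "u \<in> borel_measurable lebesgue"
  shows "integrable lebesgue (\<lambda>x. (scl c u x)\<^sup>2) \<longleftrightarrow> integrable lebesgue (\<lambda>x. (u x)\<^sup>2)"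
    and "L2_norm_sq (scl c u) = L2_norm_sq u"
  using c integrable_lebesgue_scale[OF _ c, of "\<lambda>x. (u x)\<^sup>2"] integral_lebesgue_scale[OF _ c, of "\<lambda>x. (u x)\<^sup>2"]
  by (simp_all add: scl_power2 L2_norm_sq_power)

lemma ngag_scl:
  fixes u :: "'a::euclidean_space \<Rightarrow> real"
  assumes c: "c > 0" and [measurable]: "u \<in> borel_measurable lebesgue"
  shows "ngag s (scl c u) = ennreal (c powr (2 * s)) * ngag s u"
proof -
  let ?N = "real DIM('a)"
  define F where "F = (\<lambda>x y. ennreal ((u x - u y)\<^sup>2 * kern s (x - y)))"
  have Fm[measurable]: "(\<lambda>p. F (fst p) (snd p)) \<in> borel_measurable (lebesgue \<Otimes>\<^sub>M lebesgue)"
    unfolding F_def by measurable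
  have Fx: "F x \<in> borel_measurable lebesgue" for x
    unfolding F_def by measurable
  have 1: "ennreal ((scl c u x - scl c u y)\<^sup>2 * kern s (x - y)) = ennreal (c powr (2 * ?N + 2 * s)) * F (c *\<^sub>R x) (c *\<^sub>R y)" for x y
  proof -
    have "(scl c u x - scl c u y)\<^sup>2 = c powr ?N * (u (c *\<^sub>R x) - u (c *\<^sub>R y))\<^sup>2"
      using c by (simp add: scl_def right_diff_distrib[symmetric] power_mult_distrib powr_half_square powr_realpow)
    moreover have "kern s (x - y) = c powr (?N + 2 * s) * kern s (c *\<^sub>R x - c *\<^sub>R y)"
      using kern_scale[OF c, of s "x - y"] c powr_add[of c "?N + 2 * s" "- (?N + 2 * s)"]
      by (simp add: scaleR_right_diff_distrib)
    moreover have "c powr (2 * ?N + 2 * s) = c powr ?N * c powr (?N + 2 * s)"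
      by (simp add: powr_add[symmetric])
    ultimately show ?thesis
      by (simp add: F_def ennreal_mult'[symmetric] mult_ac)
  qed
  have "ngag s (scl c u) = (\<integral>\<^sup>+x. \<integral>\<^sup>+y. ennreal (c powr (2 * ?N + 2 * s)) * F (c *\<^sub>R x) (c *\<^sub>R y) \<partial>lebesgue \<partial>lebesgue)"
    by (simp add: ngag_def 1)
  also have "\<dots> = (\<integral>\<^sup>+x. ennreal (c powr (2 * ?N + 2 * s)) * (\<integral>\<^sup>+y. F (c *\<^sub>R x) (c *\<^sub>R y) \<partial>lebesgue) \<partial>lebesgue)"
    by (intro nn_integral_cong nn_integral_cmult borel_measurable_lebesgue_scale Fx)
  also have "\<dots> = (\<integral>\<^sup>+x. ennreal (c powr (?N + 2 * s)) * (\<integral>\<^sup>+y. F (c *\<^sub>R x) y \<partial>lebesgue) \<partial>lebesgue)"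
  proof (intro nn_integral_cong)
    fix x
    have "c powr (2 * ?N + 2 * s) = c powr (?N + 2 * s) * c ^ DIM('a)"
      using c by (simp add: powr_add[symmetric] powr_realpow[symmetric])
    then show "ennreal (c powr (2 * ?N + 2 * s)) * (\<integral>\<^sup>+y. F (c *\<^sub>R x) (c *\<^sub>R y) \<partial>lebesgue) =
        ennreal (c powr (?N + 2 * s)) * (\<integral>\<^sup>+y. F (c *\<^sub>R x) y \<partial>lebesgue)"
      unfolding nn_integral_lebesgue_scale[OF Fx[of "c *\<^sub>R x"] c]
      by (simp only: ennreal_mult' powr_ge_zero mult.assoc)
  qed
  also have "\<dots> = ennreal (c powr (?N + 2 * s)) * (\<integral>\<^sup>+x. (\<integral>\<^sup>+y. F (c *\<^sub>R x) y \<partial>lebesgue) \<partial>lebesgue)"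
    by (rule nn_integral_cmult, rule borel_measurable_lebesgue_scale) measurable
  also have "\<dots> = ennreal (c powr (2 * s)) * (\<integral>\<^sup>+x. (\<integral>\<^sup>+y. F x y \<partial>lebesgue) \<partial>lebesgue)"
  proof -
    have "c powr (?N + 2 * s) = c powr (2 * s) * c ^ DIM('a)"
      using c by (simp add: powr_add[symmetric] powr_realpow[symmetric] add.commute)
    moreover have "(\<lambda>x. \<integral>\<^sup>+y. F x y \<partial>lebesgue) \<in> borel_measurable lebesgue"
      by measurable
    ultimately show ?thesis
      using nn_integral_lebesgue_scale[OF _ c, of "\<lambda>x. \<integral>\<^sup>+y. F x y \<partial>lebesgue"]
      by (simp only: ennreal_mult' powr_ge_zero mult.assoc)
  qed
  finally show ?thesis by (simp add: ngag_def F_def)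
qed

lemma Hs_scl:
  fixes u :: "'a::euclidean_space \<Rightarrow> real"
  assumes c: "c > 0" and u: "u \<in> Hs s"
  shows "scl c u \<in> Hs s" and "gag s (scl c u) = c powr (2 * s) * gag s u"
proof -
  note m = Hs_measurable[OF u]
  show 1: "scl c u \<in> Hs s"
    using u L2_scl(1)[OF c m] ngag_scl[OF c m, of s]
    by (auto simp: Hs_iff scl_measurable ennreal_mult_less_top)
  have "ennreal (gag s (scl c u)) = ennreal (c powr (2 * s) * gag s u)"
    using ngag_eq[OF 1] ngag_eq[OF u] ngag_scl[OF c m, of s] by (simp add: ennreal_mult')
  then show "gag s (scl c u) = c powr (2 * s) * gag s u"
    by simp
qed

lemma frac_energy_scl:
  "c > 0 \<Longrightarrow> u \<in> Hs s \<Longrightarrow> frac_energy s (scl c u) = c powr (2 * s) * frac_energy s u"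
  by (simp add: frac_energy_gag Hs_scl)

text \<open>The relation N \<beta>^2 = 2s - b is mass-criticality: the nonlinear term picks up the
  same power c^(2s) as the seminorm, so the energy without potential is homogeneous under
  \<open>scl\<close>.\<close>

lemma weighted_int_scl:
  fixes u :: "'a::euclidean_space \<Rightarrow> real"
  assumes c: "c > 0" and [measurable]: "u \<in> borel_measurable lebesgue"
    and \<beta>: "real DIM('a) * \<beta>\<^sup>2 = 2 * s - b"
  shows "weighted_int b \<beta> (scl c u) = c powr (2 * s) * weighted_int b \<beta> u"
proof -
  let ?N = "real DIM('a)" and ?p = "2 + 2 * \<beta>\<^sup>2"
  define f where "f = (\<lambda>x. norm x powr (- b) * \<bar>u x\<bar> powr ?p)"
  have [measurable]: "f \<in> borel_measurable lebesgue" unfolding f_def by measurable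
  have "norm x powr (- b) * \<bar>scl c u x\<bar> powr ?p = c powr (2 * s) * c ^ DIM('a) * f (c *\<^sub>R x)" for x
  proof -
    have e: "b + ?N * (1 + \<beta>\<^sup>2) = 2 * s + ?N"
      using \<beta> by (simp add: algebra_simps)
    have "c powr (b + ?N * (1 + \<beta>\<^sup>2)) * c powr (- b) = c powr (?N / 2 * ?p)"
      by (simp add: powr_add[symmetric] ring_distribs)
    then have "c powr (2 * s) * c ^ DIM('a) * c powr (- b) = c powr (?N / 2 * ?p)"
      using c by (simp add: e powr_add powr_realpow)
    then show ?thesis
      using c by (simp add: f_def scl_def abs_mult powr_mult powr_powr mult_ac)
  qed
  then have "weighted_int b \<beta> (scl c u) = (LINT x|lebesgue. c powr (2 * s) * c ^ DIM('a) * f (c *\<^sub>R x))"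
    by (simp add: weighted_int_def)
  also have "\<dots> = c powr (2 * s) * (c ^ DIM('a) * (LINT x|lebesgue. f (c *\<^sub>R x)))"
    by (simp add: mult.assoc)
  also have "\<dots> = c powr (2 * s) * weighted_int b \<beta> u"
    using integral_lebesgue_scale[OF _ c, of f] by (simp add: weighted_int_def f_def)
  finally show ?thesis .
qed

section \<open>Level sets\<close>

lemma integral_Cauchy_Schwarz:
  fixes f g :: "'b \<Rightarrow> real"
  assumes m: "f \<in> borel_measurable M" "g \<in> borel_measurable M"
    and f: "integrable M (\<lambda>x. (f x)\<^sup>2)" and g: "integrable M (\<lambda>x. (g x)\<^sup>2)"
  shows "(LINT x|M. f x * g x)\<^sup>2 \<le> (LINT x|M. (f x)\<^sup>2) * (LINT x|M. (g x)\<^sup>2)"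
proof -
  let ?F = "LINT x|M. (f x)\<^sup>2" and ?G = "LINT x|M. (g x)\<^sup>2" and ?P = "LINT x|M. f x * g x"
  have fg: "integrable M (\<lambda>x. f x * g x)" by (rule integrable_mult_L2[OF m f g])
  have quad: "0 \<le> ?F - 2 * t * ?P + t\<^sup>2 * ?G" for t
  proof -
    have "0 \<le> (LINT x|M. (f x - t * g x)\<^sup>2)"
      by (rule integral_nonneg_AE) simp
    also have "(\<lambda>x. (f x - t * g x)\<^sup>2) = (\<lambda>x. ((f x)\<^sup>2 - (2 * t) * (f x * g x)) + t\<^sup>2 * (g x)\<^sup>2)"
      by (auto simp: power2_diff power_mult_distrib algebra_simps)
    also have "(LINT x|M. \<dots> x) = ?F - 2 * t * ?P + t\<^sup>2 * ?G"
      using f g fg by simp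
    finally show ?thesis .
  qed
  have G0: "0 \<le> ?G" by (rule integral_nonneg_AE) simp
  show ?thesis
  proof (cases "?G = 0")
    case True
    have "?P = 0"
    proof (rule ccontr)
      assume "?P \<noteq> 0"
      \<comment> \<open>With \<open>?G = 0\<close> the quadratic polynomial in t is affine; at this
        t it would equal -1.\<close>
      then show False using quad[of "(?F + 1) / (2 * ?P)"] True by simp
    qed
    then show ?thesis using True by simp
  next
    case False
    then have "?G > 0" using G0 by linarith
    have "?F - 2 * (?P / ?G) * ?P + (?P / ?G)\<^sup>2 * ?G = ?F - ?P\<^sup>2 / ?G"
      using False by (simp add: power2_eq_square field_simps)
    then have "?P\<^sup>2 / ?G \<le> ?F" using quad[of "?P / ?G"] by simp
    then show ?thesis using \<open>?G > 0\<close> by (simp add: field_simps)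
  qed
qed

lemma measure_le_integral:
  fixes f :: "'b \<Rightarrow> real"
  assumes f: "integrable M f" and nn: "AE x in M. 0 \<le> f x"
    and S: "S \<in> sets M" and t: "0 < t" and le: "AE x in M. x \<in> S \<longrightarrow> t \<le> f x"
  shows "emeasure M S < \<infinity>" and "t * measure M S \<le> (LINT x|M. f x)"
proof -
  have "ennreal t * emeasure M S = (\<integral>\<^sup>+x. ennreal t * indicator S x \<partial>M)"
    using S by (simp add: nn_integral_cmult_indicator)
  also have "\<dots> \<le> (\<integral>\<^sup>+x. ennreal (f x) \<partial>M)"
  proof (rule nn_integral_mono_AE)
    show "AE x in M. ennreal t * indicator S x \<le> ennreal (f x)"
      using nn le by eventually_elim (auto simp: indicator_def intro!: ennreal_leI)
  qed
  also have "\<dots> = ennreal (LINT x|M. f x)"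
    by (rule nn_integral_eq_integral[OF f nn])
  finally have 1: "ennreal t * emeasure M S \<le> ennreal (LINT x|M. f x)" .
  then have "ennreal t * emeasure M S < \<infinity>"
    using le_less_trans ennreal_less_top by (metis infinity_ennreal_def)
  then show fin: "emeasure M S < \<infinity>"
    using t by (auto simp: ennreal_mult_less_top)
  then have "ennreal (t * measure M S) \<le> ennreal (LINT x|M. f x)"
    using 1 t by (simp add: emeasure_eq_ennreal_measure ennreal_mult')
  moreover have "0 \<le> (LINT x|M. f x)"
    by (rule integral_nonneg_AE[OF nn])
  ultimately show "t * measure M S \<le> (LINT x|M. f x)"
    by simp
qed

lemma integrable_finite_support:
  fixes f v :: "'b \<Rightarrow> real"
  assumes S: "S \<in> sets M" "emeasure M S < \<infinity>"
    and v: "v \<in> borel_measurable M" "integrable M (\<lambda>x. (v x)\<^sup>2)" "\<And>x. x \<notin> S \<Longrightarrow> v x = 0"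
  shows "integrable M v" and "(LINT x|M. v x)\<^sup>2 \<le> measure M S * (LINT x|M. (v x)\<^sup>2)"
proof -
  have ind: "(indicator S x :: real)\<^sup>2 = indicator S x" for x
    by (simp add: indicator_def)
  have i: "integrable M (\<lambda>x. (indicator S x :: real)\<^sup>2)"
    unfolding ind using S by (rule integrable_real_indicator)
  have e: "indicator S x * v x = v x" for x
    by (cases "x \<in> S") (simp_all add: v(3))
  show "integrable M v"
    using integrable_mult_L2[OF borel_measurable_indicator[OF S(1)] v(1) i v(2)] unfolding e .
  have "(LINT x|M. indicator S x * v x)\<^sup>2 \<le> (LINT x|M. (indicator S x :: real)\<^sup>2) * (LINT x|M. (v x)\<^sup>2)"
    by (rule integral_Cauchy_Schwarz[OF borel_measurable_indicator[OF S(1)] v(1) i v(2)])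
  moreover have "(LINT x|M. (indicator S x :: real)\<^sup>2) = measure M S"
    unfolding ind using sets.sets_into_space[OF S(1)] by (simp add: Int_absorb2)
  ultimately show "(LINT x|M. v x)\<^sup>2 \<le> measure M S * (LINT x|M. (v x)\<^sup>2)"
    unfolding e by simp
qed

text \<open>De Giorgi's iteration over the levels K + d (1 - 2^(-j)), along which f decays like
  2^(-j/\<delta>). The recursion is required only between K and K + d, so that M may depend on the
  range of levels. Here f will be the measure of a superlevel set.\<close>

lemma stampacchia:
  fixes f :: "real \<Rightarrow> real"
  assumes d: "0 < d" and M: "0 \<le> M" and \<delta>: "0 < \<delta>"
    and nonneg: "\<And>k. 0 \<le> f k"
    and mono: "\<And>k h. k \<le> h \<Longrightarrow> f h \<le> f k"
    and rec: "\<And>k h. K \<le> k \<Longrightarrow> k < h \<Longrightarrow> h \<le> K + d \<Longrightarrow> (h - k) * f h \<le> M * f k powr (1 + \<delta>)"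
    and start: "M * f K powr \<delta> * 2 powr (1 + 1 / \<delta>) \<le> d"
  shows "f (K + d) = 0"
proof -
  define k where "k = (\<lambda>j::nat. K + d * (1 - (1/2) ^ j))"
  have claim: "f (k j) \<le> f K * 2 powr (- (real j / \<delta>))" for j
  proof (induction j)
    case (Suc j)
    have k: "K \<le> k j" "k j < k (Suc j)" "k (Suc j) \<le> K + d" "k (Suc j) - k j = d / 2 powr (real j + 1)"
      using d by (auto simp: k_def powr_add powr_realpow power_one_over field_simps)
    have "f (k j) powr (1 + \<delta>) \<le> (f K * 2 powr (- (real j / \<delta>))) powr (1 + \<delta>)"
      using \<delta> nonneg by (intro powr_mono2 Suc) auto
    also have "\<dots> = f K powr (1 + \<delta>) * 2 powr (- (real j / \<delta>) * (1 + \<delta>))"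
      using nonneg by (simp add: powr_mult powr_powr)
    also have "f K powr (1 + \<delta>) = f K * f K powr \<delta>"
      using nonneg[of K] by (simp add: powr_add)
    finally have 1: "f (k j) powr (1 + \<delta>) \<le> f K * f K powr \<delta> * 2 powr (- (real j / \<delta>) * (1 + \<delta>))" .
    \<comment> \<open>The steps shrink like 2^(-j-1). Raising the induction hypothesis to the power
      1 + \<delta> yields an extra 2^(-j), which absorbs this; what is left over is the constant
      2^(1+1/\<delta>) of the assumption \<open>start\<close>.\<close>
    have e: "- (real j / \<delta>) * (1 + \<delta>) + (real j + 1) = (1 + 1 / \<delta>) + - (real (Suc j) / \<delta>)"
      using \<delta> by (simp add: field_simps)
    have "d * f (k (Suc j)) = (k (Suc j) - k j) * f (k (Suc j)) * 2 powr (real j + 1)"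
      unfolding k(4) by simp
    also have "\<dots> \<le> M * f (k j) powr (1 + \<delta>) * 2 powr (real j + 1)"
      by (intro mult_right_mono rec k) auto
    also have "\<dots> \<le> M * (f K * f K powr \<delta> * 2 powr (- (real j / \<delta>) * (1 + \<delta>))) * 2 powr (real j + 1)"
      by (intro mult_right_mono mult_left_mono 1 M) auto
    also have "\<dots> = f K * (M * f K powr \<delta>) * 2 powr (- (real j / \<delta>) * (1 + \<delta>) + (real j + 1))"
      by (simp only: powr_add mult_ac)
    also have "\<dots> = (M * f K powr \<delta> * 2 powr (1 + 1 / \<delta>)) * (f K * 2 powr (- (real (Suc j) / \<delta>)))"
      unfolding e powr_add by simp
    also have "\<dots> \<le> d * (f K * 2 powr (- (real (Suc j) / \<delta>)))"
      using nonneg by (intro mult_right_mono start mult_nonneg_nonneg) auto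
    finally show ?case using d by simp
  qed (simp add: k_def)
  have "(\<lambda>j. f K * (2 powr (- (1 / \<delta>))) ^ j) \<longlonglongrightarrow> f K * 0"
    using \<delta> powr_less_cancel_iff[of 2 "- (1 / \<delta>)" 0]
    by (intro tendsto_mult_left LIMSEQ_realpow_zero) auto
  moreover have "f (K + d) \<le> f K * (2 powr (- (1 / \<delta>))) ^ j" for j
  proof -
    have "f (K + d) \<le> f (k j)"
      using d by (intro mono) (simp add: k_def)
    also note claim[of j]
    also have "2 powr (- (real j / \<delta>)) = (2 powr (- (1 / \<delta>))) ^ j"
      by (simp add: powr_realpow[symmetric] powr_powr)
    finally show ?thesis .
  qed
  ultimately have "f (K + d) \<le> 0"
    by (intro LIMSEQ_le_const[where a = "f (K + d)"]) auto
  then show ?thesis using nonneg[of "K + d"] by simp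
qed

text \<open>
  A point \<open>x\<close> of the support interacts with the part of a ball around \<open>x\<close> outside the support,
  which has measure at least \<open>m\<close> if the ball has measure \<open>2 m\<close>.
\<close>

lemma faber_krahn:
  assumes s: "0 < s"
  obtains C where "C > 0"
    "\<And>(v :: 'a::euclidean_space \<Rightarrow> real) m. v \<in> Hs s \<Longrightarrow> 0 < m \<Longrightarrow> emeasure lebesgue {x. v x \<noteq> 0} \<le> ennreal m \<Longrightarrow>
      L2_norm_sq v \<le> C * m powr (2 * s / real DIM('a)) * gag s v"
proof -
  let ?N = "real DIM('a)"
  define w where "w = unit_ball_vol ?N"
  have w: "w > 0" by (simp add: w_def)
  define C where "C = (2 / w) powr ((?N + 2 * s) / ?N)"
  have C: "C > 0" using w by (simp add: C_def)
  show thesis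
  proof (rule that[OF C])
    fix v :: "'a \<Rightarrow> real" and m :: real
    assume v: "v \<in> Hs s" and m: "0 < m" and le: "emeasure lebesgue {x. v x \<noteq> 0} \<le> ennreal m"
    note [measurable] = Hs_measurable[OF v]
    define S where "S = {x. v x \<noteq> 0}"
    have S: "S \<in> sets lebesgue"
    proof -
      have "{x \<in> space lebesgue. v x \<noteq> 0} \<in> sets lebesgue" by measurable
      then show ?thesis by (simp only: S_def space_completion space_lborel space_borel UNIV_I simp_thms)
    qed
    define r where "r = (2 * m / w) powr (1 / ?N)"
    have r: "r > 0" using m w by (simp add: r_def)
    have rN: "w * r ^ DIM('a) = 2 * m"
      using w m r by (simp add: powr_realpow[symmetric]) (simp add: r_def powr_powr)
    have rs: "r powr (?N + 2 * s) = C * (m powr (2 * s / ?N) * m)"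
    proof -
      have "r powr (?N + 2 * s) = (2 / w * m) powr ((?N + 2 * s) / ?N)"
        by (simp add: r_def powr_powr)
      also have "\<dots> = C * m powr ((?N + 2 * s) / ?N)"
        using w m by (simp only: powr_mult C_def)
      also have "(?N + 2 * s) / ?N = 2 * s / ?N + 1" by (simp add: field_simps)
      finally show ?thesis using m by (simp add: powr_add)
    qed
    define \<kappa> where "\<kappa> = r powr (- (?N + 2 * s))"
    have out: "ennreal m \<le> emeasure lebesgue (cball x r - S)" for x
    proof -
      have "ennreal (2 * m) = emeasure lebesgue (cball x r)"
        using r rN by (simp add: emeasure_cball w_def)
      also have "\<dots> \<le> emeasure lebesgue ((cball x r - S) \<union> S)"
        by (rule emeasure_mono) (use S in \<open>auto simp del: emeasure_completion\<close>)
      also have "\<dots> \<le> emeasure lebesgue (cball x r - S) + emeasure lebesgue S"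
        by (rule emeasure_subadditive) (use S in \<open>auto simp del: emeasure_completion\<close>)
      also have "\<dots> \<le> emeasure lebesgue (cball x r - S) + ennreal m"
        by (rule add_left_mono) (use le in \<open>simp only: S_def\<close>)
      finally have "ennreal m + ennreal m \<le> emeasure lebesgue (cball x r - S) + ennreal m"
        using ennreal_plus[of m m] m by (simp only: mult_2)
      moreover have "ennreal m + ennreal m \<le> e + ennreal m \<Longrightarrow> ennreal m \<le> e" for e
        by (simp add: add.commute[of e] ennreal_add_left_cancel_le)
      ultimately show ?thesis by blast
    qed
    have inner: "ennreal ((v x)\<^sup>2) * ennreal (\<kappa> * m) \<le> (\<integral>\<^sup>+y. ennreal ((v x - v y)\<^sup>2 * kern s (x - y)) \<partial>lebesgue)" for x
    proof -
      have "ennreal ((v x)\<^sup>2) * ennreal (\<kappa> * m) = ennreal ((v x)\<^sup>2 * \<kappa>) * ennreal m"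
        using m by (simp add: ennreal_mult'[symmetric] mult_ac \<kappa>_def)
      also have "\<dots> \<le> ennreal ((v x)\<^sup>2 * \<kappa>) * emeasure lebesgue (cball x r - S)"
        by (intro mult_left_mono out) auto
      also have "\<dots> = (\<integral>\<^sup>+y. ennreal ((v x)\<^sup>2 * \<kappa>) * indicator (cball x r - S) y \<partial>lebesgue)"
        by (rule nn_integral_cmult_indicator[symmetric]) (use S in auto)
      also have "\<dots> \<le> (\<integral>\<^sup>+y. ennreal ((v x - v y)\<^sup>2 * kern s (x - y)) \<partial>lebesgue)"
      proof (rule nn_integral_mono)
        fix y
        show "ennreal ((v x)\<^sup>2 * \<kappa>) * indicator (cball x r - S) y \<le> ennreal ((v x - v y)\<^sup>2 * kern s (x - y))"
        proof (cases "y \<in> cball x r - S \<and> v x \<noteq> 0")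
          case True
          then have y: "v y = 0" "norm (x - y) \<le> r" "x \<noteq> y"
            by (auto simp: S_def dist_norm)
          \<comment> \<open>The two points differ because v vanishes at only one of them; at
            coinciding points the kernel would be 0 and the bound would fail.\<close>
          have "\<kappa> \<le> kern s (x - y)"
            unfolding \<kappa>_def kern_powr using y s by (intro powr_mono2') auto
          then have "(v x)\<^sup>2 * \<kappa> \<le> (v x - v y)\<^sup>2 * kern s (x - y)"
            using y by (simp add: mult_left_mono)
          then show ?thesis using True by (simp add: ennreal_leI)
        qed (auto simp: indicator_def)
      qed
      finally show ?thesis .
    qed
    have "ennreal (L2_norm_sq v * (\<kappa> * m)) = (\<integral>\<^sup>+x. ennreal ((v x)\<^sup>2) \<partial>lebesgue) * ennreal (\<kappa> * m)"
      by (simp add: nn_L2_norm_sq[OF v] ennreal_mult')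
    also have "\<dots> = (\<integral>\<^sup>+x. ennreal ((v x)\<^sup>2) * ennreal (\<kappa> * m) \<partial>lebesgue)"
      by (rule nn_integral_multc[symmetric]) measurable
    also have "\<dots> \<le> ngag s v"
      unfolding ngag_def by (intro nn_integral_mono inner)
    also have "\<dots> = ennreal (gag s v)" by (rule ngag_eq[OF v])
    finally have main: "L2_norm_sq v * (\<kappa> * m) \<le> gag s v" by simp
    have "\<kappa> * r powr (?N + 2 * s) = 1"
      unfolding \<kappa>_def powr_minus using r by simp
    then have e1: "\<kappa> * m * (C * m powr (2 * s / ?N)) = 1"
      unfolding rs by (simp add: mult_ac)
    have "L2_norm_sq v = L2_norm_sq v * (\<kappa> * m) * (C * m powr (2 * s / ?N))"
      using e1 by (simp add: mult.assoc)
    also have "\<dots> \<le> gag s v * (C * m powr (2 * s / ?N))"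
      using C by (intro mult_right_mono main) auto
    finally show "L2_norm_sq v \<le> C * m powr (2 * s / ?N) * gag s v"
      by (simp add: mult_ac)
  qed
qed

lemma gag_truncation:
  assumes w: "w \<in> Hs s" and k: "0 \<le> k"
  shows "(\<lambda>x. min (w x) k) \<in> Hs s" "(\<lambda>x. max (w x - k) 0) \<in> Hs s"
    and "gag s (\<lambda>x. min (w x) k) + gag s (\<lambda>x. max (w x - k) 0) \<le> gag s w"
    and "gag s (\<lambda>x. max (w x - k) 0) \<le> gag s w"
proof -
  note [measurable] = Hs_measurable[OF w]
  let ?z = "\<lambda>x. min (w x) k" and ?v = "\<lambda>x. max (w x - k) 0"
  show z: "?z \<in> Hs s"
    by (rule Hs_contraction(1)[OF w]) (measurable, use k in auto)
  show v: "?v \<in> Hs s"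
    by (rule Hs_contraction(1)[OF w]) (measurable, use k in auto)
  show "gag s ?v \<le> gag s w"
    by (rule Hs_contraction(2)[OF w]) (measurable, use k in auto)
  have "gagliardo_form s ?z ?v p \<ge> 0" for p
  proof -
    obtain x y where p: "p = (x, y)" by force
    have "0 \<le> (min (w x) k - min (w y) k) * (max (w x - k) 0 - max (w y - k) 0)"
      by (cases "w x \<le> w y") (auto intro!: mult_nonneg_nonneg mult_nonpos_nonpos)
    then show ?thesis by (simp add: p gagliardo_form_kern)
  qed
  then have "gagB s ?z ?v \<ge> 0"
    unfolding gagB_def by (intro integral_nonneg_AE) simp
  moreover have "(\<lambda>x. ?z x + ?v x) = w" by auto
  ultimately show "gag s ?z + gag s ?v \<le> gag s w"
    using gag_add[OF z v] by simp
qed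

section \<open>Elementary inequalities for powers\<close>

lemma powr_diff_le:
  fixes x y p :: real
  assumes "0 < y" "y \<le> x" "1 \<le> p"
  shows "x powr p - y powr p \<le> p * x powr (p - 1) * (x - y)"
proof (cases "y = x")
  case False
  then have "y < x" using assms by simp
  have "\<exists>z. y < z \<and> z < x \<and> x powr p - y powr p = (x - y) * (p * z powr (p - 1))"
    using assms \<open>y < x\<close> by (intro MVT2 has_real_derivative_powr) auto
  then obtain z where z: "y < z" "z < x" "x powr p - y powr p = (x - y) * (p * z powr (p - 1))"
    by blast
  have "z powr (p - 1) \<le> x powr (p - 1)"
    using z assms by (intro powr_mono2) auto
  then have "(x - y) * (p * z powr (p - 1)) \<le> (x - y) * (p * x powr (p - 1))"
    using assms by (intro mult_left_mono) auto
  then show ?thesis unfolding z(3) by (simp add: mult_ac)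
qed simp

lemma powr_add_le:
  fixes x y q :: real
  assumes "0 \<le> x" "0 \<le> y" "0 \<le> q"
  shows "(x + y) powr q \<le> 2 powr q * (x powr q + y powr q)"
proof -
  have "(x + y) powr q \<le> (2 * max x y) powr q"
    using assms by (intro powr_mono2) auto
  also have "\<dots> = 2 powr q * max x y powr q"
    using assms by (simp add: powr_mult)
  also have "\<dots> \<le> 2 powr q * (x powr q + y powr q)"
    by (intro mult_left_mono) (auto simp: max_def)
  finally show ?thesis .
qed

text \<open>Bernoulli's inequality for exponents in [0, 1]: the exponential lies below its chord
  between 0 and ln z.\<close>

lemma powr_tangent:
  fixes z q :: real
  assumes "0 < z" "0 \<le> q" "q \<le> 1"
  shows "z powr q \<le> 1 + q * (z - 1)"
proof (cases "q = 0")
  case False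
  have "exp (q * ln z) \<le> 1 + q * (z - 1)"
  proof -
    from convex_onD[OF exp_convex, of q 0 "ln z"] assms
    show ?thesis by (simp add: algebra_simps)
  qed
  then show ?thesis using assms by (simp add: powr_def)
qed (use assms in simp)

section \<open>Quasi-minimizers are bounded\<close>

text \<open>
  The part of the minimality of \<open>u\<^sub>a\<close> that survives the rescaling \<open>w\<^sub>a\<close>: the potential only enters
  through the sign of its contribution, and \<open>\<Lambda>\<close> is a bound for the rescaled minimal energy.
\<close>

definition quasi_min ::
  "real \<Rightarrow> real \<Rightarrow> real \<Rightarrow> real \<Rightarrow> real \<Rightarrow> ('a::euclidean_space \<Rightarrow> real) \<Rightarrow> bool" where
  "quasi_min s b \<beta> a \<Lambda> w \<longleftrightarrow> w \<in> Hs s \<and> (AE x in lebesgue. 0 \<le> w x) \<and>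
     (\<forall>z \<in> Hs s. (AE x in lebesgue. 0 \<le> z x \<and> z x \<le> w x) \<longrightarrow>
       frac_energy s w - a / (1 + \<beta>\<^sup>2) * weighted_int b \<beta> w \<le>
       frac_energy s z - a / (1 + \<beta>\<^sup>2) * weighted_int b \<beta> z + \<Lambda> * (L2_norm_sq w - L2_norm_sq z))"

text \<open>Here \<open>A\<close> is any positive constant for which the inequality holds. The bound
  b < N/2 makes the weight locally square integrable. Positivity of C(N,s) is later read off from
  the integral identities of Q, not from the integral that defines the constant.\<close>

locale gn_setting =
  fixes s b \<beta> A :: real and T :: "'a::euclidean_space itself"
  assumes s: "1 / 2 < s" "s < 1"
    and N: "2 * s < real DIM('a)"
    and b: "0 < b" "b < real DIM('a) / 2" "b < 1"
    and \<beta>: "real DIM('a) * \<beta>\<^sup>2 = 2 * s - b"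
    and const_pos: "0 < frac_const TYPE('a) s"
    and A: "0 < A"
    and GN: "GN_inequality TYPE('a) s b \<beta> A"
begin

definition c :: real where "c = frac_const TYPE('a) s / 2"

lemma c_pos: "0 < c"
  using const_pos by (simp add: c_def)

lemma frac_energy_c: "frac_energy s (u :: 'a \<Rightarrow> real) = c * gag s u"
  by (simp add: frac_energy_gag c_def)

lemma frac_energy_nonneg: "0 \<le> frac_energy s (u :: 'a \<Rightarrow> real)"
  using c_pos by (simp add: frac_energy_c)

lemma s_pos: "0 < s" and dim_pos: "0 < real DIM('a)"
  using s by auto

lemma beta_sq: "\<beta>\<^sup>2 = (2 * s - b) / real DIM('a)"
  using \<beta> dim_pos by (simp add: field_simps)

lemma beta_pos: "0 < \<beta>\<^sup>2"
  unfolding beta_sq using s b by (intro divide_pos_pos) auto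

lemma beta_less_1: "\<beta>\<^sup>2 < 1"
  unfolding beta_sq using N b by (simp add: field_simps)

lemma weighted_integrable:
  "u \<in> Hs s \<Longrightarrow> integrable lebesgue (\<lambda>x::'a. norm x powr (- b) * \<bar>u x\<bar> powr (2 + 2 * \<beta>\<^sup>2))"
  using GN by (simp add: GN_inequality_def)

lemma weighted_int_nonneg: "0 \<le> weighted_int b \<beta> (u :: 'a \<Rightarrow> real)"
  unfolding weighted_int_def by (rule integral_nonneg_AE) simp

lemma GN_ineq:
  assumes "(u :: 'a \<Rightarrow> real) \<in> Hs s"
  shows "A / (1 + \<beta>\<^sup>2) * weighted_int b \<beta> u \<le> frac_energy s u * L2_norm_sq u powr \<beta>\<^sup>2"
proof -
  have "L2_norm u powr (2 * \<beta>\<^sup>2) = L2_norm_sq u powr \<beta>\<^sup>2"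
    by (simp add: L2_norm_def powr_half_sqrt[symmetric] powr_powr)
  moreover have "A / (1 + \<beta>\<^sup>2) * weighted_int b \<beta> u \<le> frac_energy s u * L2_norm u powr (2 * \<beta>\<^sup>2)"
    using GN assms unfolding GN_inequality_def by blast
  ultimately show ?thesis by simp
qed

text \<open>The majorants \<open>g\<close> and \<open>h\<close> reduce the comparison of w with a
  truncation z to pointwise estimates, so that the constant truncation and the barrier of the decay
  argument can share it.\<close>

lemma quasi_min_diff:
  assumes q: "quasi_min s b \<beta> a \<Lambda> w" and z: "z \<in> Hs s"
    and le: "AE x in lebesgue. 0 \<le> z x \<and> z x \<le> (w x :: real)"
    and \<Lambda>: "0 \<le> \<Lambda>" and a: "0 \<le> a"
    and g: "integrable lebesgue g" "AE x in lebesgue. norm (x::'a) powr (- b) * (\<bar>w x\<bar> powr (2 + 2 * \<beta>\<^sup>2) - \<bar>z x\<bar> powr (2 + 2 * \<beta>\<^sup>2)) \<le> g x"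
    and h: "integrable lebesgue h" "AE x in lebesgue. (w x)\<^sup>2 - (z x)\<^sup>2 \<le> h x"
  shows "frac_energy s w - frac_energy s z \<le> a / (1 + \<beta>\<^sup>2) * (LINT x|lebesgue. g x) + \<Lambda> * (LINT x|lebesgue. h x)"
proof -
  have w: "w \<in> Hs s" using q by (simp add: quasi_min_def)
  have "weighted_int b \<beta> w - weighted_int b \<beta> z =
      (LINT x|lebesgue. norm x powr (- b) * \<bar>w x\<bar> powr (2 + 2 * \<beta>\<^sup>2) - norm x powr (- b) * \<bar>z x\<bar> powr (2 + 2 * \<beta>\<^sup>2))"
    unfolding weighted_int_def using w z by (simp add: weighted_integrable)
  also have "\<dots> \<le> (LINT x|lebesgue. g x)"
    using g w z by (intro integral_mono_AE Bochner_Integration.integrable_diff weighted_integrable)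
      (auto simp: right_diff_distrib)
  finally have 1: "weighted_int b \<beta> w - weighted_int b \<beta> z \<le> (LINT x|lebesgue. g x)" .
  have "L2_norm_sq w - L2_norm_sq z = (LINT x|lebesgue. (w x)\<^sup>2 - (z x)\<^sup>2)"
    unfolding L2_norm_sq_power using w z by (simp add: Hs_L2)
  also have "\<dots> \<le> (LINT x|lebesgue. h x)"
    using h w z by (intro integral_mono_AE Bochner_Integration.integrable_diff Hs_L2)
  finally have 2: "L2_norm_sq w - L2_norm_sq z \<le> (LINT x|lebesgue. h x)" .
  have "frac_energy s w - frac_energy s z \<le>
      a / (1 + \<beta>\<^sup>2) * (weighted_int b \<beta> w - weighted_int b \<beta> z) + \<Lambda> * (L2_norm_sq w - L2_norm_sq z)"
  proof -
    have "frac_energy s w - a / (1 + \<beta>\<^sup>2) * weighted_int b \<beta> w \<le>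
       frac_energy s z - a / (1 + \<beta>\<^sup>2) * weighted_int b \<beta> z + \<Lambda> * (L2_norm_sq w - L2_norm_sq z)"
      using q z le unfolding quasi_min_def by blast
    then show ?thesis by (simp only: right_diff_distrib)
  qed
  also have "\<dots> \<le> a / (1 + \<beta>\<^sup>2) * (LINT x|lebesgue. g x) + \<Lambda> * (LINT x|lebesgue. h x)"
    using a \<Lambda> by (intro add_mono mult_left_mono 1 2) auto
  finally show ?thesis .
qed

lemma superlevel_finite:
  assumes w: "(w :: 'a \<Rightarrow> real) \<in> Hs s" and k: "0 < k"
  shows "{x. k < w x} \<in> sets lebesgue" and "emeasure lebesgue {x. k < w x} < \<infinity>"
    and "k\<^sup>2 * measure lebesgue {x. k < w x} \<le> L2_norm_sq w"
proof -
  note [measurable] = Hs_measurable[OF w]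
  have "{x \<in> space lebesgue. k < w x} \<in> sets lebesgue" by measurable
  then show S: "{x. k < w x} \<in> sets lebesgue"
    by (simp only: space_completion space_lborel space_borel UNIV_I simp_thms)
  have le: "AE x in lebesgue. x \<in> {x. k < w x} \<longrightarrow> k\<^sup>2 \<le> (w x)\<^sup>2"
    using k by (intro AE_I2) (auto intro!: power_mono)
  have nn: "AE x in lebesgue. 0 \<le> (w x)\<^sup>2" and k2: "0 < k\<^sup>2"
    using k by simp_all
  show "emeasure lebesgue {x. k < w x} < \<infinity>"
    by (rule measure_le_integral(1)[OF Hs_L2[OF w] nn S k2 le])
  show "k\<^sup>2 * measure lebesgue {x. k < w x} \<le> L2_norm_sq w"
    unfolding L2_norm_sq_power by (rule measure_le_integral(2)[OF Hs_L2[OF w] nn S k2 le])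
qed

text \<open>Supplies the left-hand side of the recursion in \<open>stampacchia\<close>: on the set
  in question the positive part is at least t.\<close>

lemma superlevel_step:
  assumes i: "integrable lebesgue (\<lambda>x. max (w x - \<theta> x) 0)"
    and S: "{x. \<theta> x + t < w x} \<in> sets lebesgue" and t: "0 < t"
  shows "t * measure lebesgue {x::'a. \<theta> x + t < w x} \<le> (LINT x|lebesgue. max (w x - \<theta> x) 0)"
  by (rule measure_le_integral(2)[OF i _ S t]) (auto intro!: AE_I2)

text \<open>Let v = (w - k)_+, S its support and p = 2 + 2\<beta>^2. Comparing w with min(w, k)
  bounds the seminorm F of v by the integral of |x|^(-b) (v^p + k^(p-1) v) and lower order terms. By
  Gagliardo-Nirenberg the v^p part is F times a power of the mass of v, small for large k, and is
  absorbed. Cauchy-Schwarz with the weight |x|^(-2b) on S bounds the linear part by k^(p-1)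
  |S|^(1/2-b/N) times the norm of v, and \<open>faber_krahn\<close> turns this into a bound for that
  norm.

  The first conclusion is the smallness that starts the iteration over the levels, the last one its
  recursion.\<close>

lemma level_estimate:
  assumes \<Lambda>: "0 \<le> \<Lambda>"
  obtains C k0 where "0 < C" "1 \<le> k0"
    "\<And>a (w :: 'a \<Rightarrow> real) k. 0 \<le> a \<Longrightarrow> a \<le> A \<Longrightarrow> quasi_min s b \<beta> a \<Lambda> w \<Longrightarrow> L2_norm_sq w \<le> 1 \<Longrightarrow> frac_energy s w \<le> 1 \<Longrightarrow> k0 \<le> k \<Longrightarrow>
      L2_norm_sq (\<lambda>x. max (w x - k) 0) \<le> C * k powr (- 4 * s / real DIM('a)) \<and>
      integrable lebesgue (\<lambda>x. max (w x - k) 0) \<and>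
      (LINT x|lebesgue. max (w x - k) 0) \<le> C * k powr (1 + 2 * \<beta>\<^sup>2) * measure lebesgue {x. k < w x} powr (1 + \<beta>\<^sup>2)"
proof -
  let ?N = "real DIM('a)"
  define p where "p = 2 + 2 * \<beta>\<^sup>2"
  have p: "2 < p" using beta_pos by (simp add: p_def)
  obtain C1' where C1': "C1' > 0" "\<And>(v :: 'a \<Rightarrow> real) m. v \<in> Hs s \<Longrightarrow> 0 < m \<Longrightarrow> emeasure lebesgue {x. v x \<noteq> 0} \<le> ennreal m \<Longrightarrow>
      L2_norm_sq v \<le> C1' * m powr (2 * s / ?N) * gag s v"
    using faber_krahn[OF s_pos, where 'a='a] by blast
  have b2: "0 < 2 * b" "2 * b < ?N" using b by auto
  obtain C2 where C2: "C2 > 0" "\<And>S. S \<in> sets lebesgue \<Longrightarrow> emeasure lebesgue S < \<infinity> \<Longrightarrow>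
      (\<integral>\<^sup>+x. ennreal (norm x powr (- (2 * b))) * indicator S (x::'a) \<partial>lebesgue)
        \<le> ennreal (C2 * measure lebesgue S powr (1 - 2 * b / ?N))"
    using weight_set_bound[OF b2] by blast
  define C1 where "C1 = C1' / c"
  have C1: "C1 > 0" using C1'(1) c_pos by (simp add: C1_def)
  define C3 where "C3 = 2 * (2 powr p * A * sqrt C2 + 2 * \<Lambda>)"
  have C3: "C3 > 0" using A C2(1) \<Lambda> by (simp add: C3_def add_pos_nonneg)
  \<comment> \<open>By Chebyshev the support of v has measure at most k^(-2); the power 2s/N of this
    measure in \<open>faber_krahn\<close> gives k^(-e).\<close>
  define e where "e = 4 * s / ?N"
  have e: "e > 0" using s_pos dim_pos by (simp add: e_def)
  have lim: "((\<lambda>k. C1 * k powr (- e)) \<longlongrightarrow> C1 * 0) at_top"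
    using e by (intro tendsto_intros tendsto_neg_powr filterlim_ident) auto
  have "((\<lambda>k. 2 powr p * (1 + \<beta>\<^sup>2) * (C1 * k powr (- e)) powr \<beta>\<^sup>2) \<longlongrightarrow> 2 powr p * (1 + \<beta>\<^sup>2) * 0) at_top"
    using beta_pos C1 lim by (intro tendsto_mult_left tendsto_zero_powrI[OF _ tendsto_const]) (auto intro!: always_eventually)
  then have ev1: "\<forall>\<^sub>F k in at_top. 2 powr p * (1 + \<beta>\<^sup>2) * (C1 * k powr (- e)) powr \<beta>\<^sup>2 < 1 / 4"
    by (rule order_tendstoD) simp
  have "((\<lambda>k. \<Lambda> * (C1 * k powr (- e))) \<longlongrightarrow> \<Lambda> * (C1 * 0)) at_top"
    using lim by (rule tendsto_mult_left)
  then have ev2: "\<forall>\<^sub>F k in at_top. \<Lambda> * (C1 * k powr (- e)) < 1 / 4"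
    by (rule order_tendstoD) simp
  \<comment> \<open>From k0 on, the v^p term is at most F/4 and the mass term 2 \<Lambda> Y at most
    F/2, so that a quarter of F survives the absorption.\<close>
  obtain k0 where k0: "1 \<le> k0" "\<And>k. k0 \<le> k \<Longrightarrow> 2 powr p * (1 + \<beta>\<^sup>2) * (C1 * k powr (- e)) powr \<beta>\<^sup>2 < 1 / 4"
      "\<And>k. k0 \<le> k \<Longrightarrow> \<Lambda> * (C1 * k powr (- e)) < 1 / 4"
    using eventually_conj[OF eventually_ge_at_top[of 1] eventually_conj[OF ev1 ev2]]
    unfolding eventually_at_top_linorder by blast
  define C where "C = C1 + 2 * C1 * C3"
  have C: "C > 0" using C1 C3 by (simp add: C_def add_pos_pos)
  show thesis
  proof (rule that[OF C k0(1)])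
    fix a k :: real and w :: "'a \<Rightarrow> real"
    assume a: "0 \<le> a" "a \<le> A" and q: "quasi_min s b \<beta> a \<Lambda> w" and w1: "L2_norm_sq w \<le> 1" "frac_energy s w \<le> 1"
      and k: "k0 \<le> k"
    have k1: "1 \<le> k" using k k0 by simp
    have w: "w \<in> Hs s" and w0: "AE x in lebesgue. 0 \<le> w x" using q by (auto simp: quasi_min_def)
    note [measurable] = Hs_measurable[OF w]
    define v where "v = (\<lambda>x. max (w x - k) 0)"
    define z where "z = (\<lambda>x. min (w x) k)"
    have z: "z \<in> Hs s" and v: "v \<in> Hs s" and gle: "gag s z + gag s v \<le> gag s w" "gag s v \<le> gag s w"
      using gag_truncation[OF w, of k] k1 by (auto simp: z_def v_def)
    note [measurable] = Hs_measurable[OF v]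
    define S where "S = {x. k < w x}"
    have S: "S \<in> sets lebesgue" "emeasure lebesgue S < \<infinity>" and mS: "k\<^sup>2 * measure lebesgue S \<le> 1"
      using superlevel_finite[OF w, of k] k1 w1 unfolding S_def by linarith+
    define m where "m = measure lebesgue S"
    have m0: "0 \<le> m" by (simp add: m_def)
    have eS: "emeasure lebesgue S = ennreal m"
      unfolding m_def by (rule emeasure_eq_ennreal_measure) (use S in auto)
    have "m \<le> 1 / k\<^sup>2" using mS k1 by (simp add: m_def field_simps)
    then have mk: "m \<le> k powr (- 2)" using k1 by (simp add: powr_minus_divide)
    have m1: "m \<le> 1" using mk k1 powr_mono2'[of "- 2" 1 k] by simp
    have v_nonneg: "0 \<le> v x" and v_out: "x \<notin> S \<Longrightarrow> v x = 0" for x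
      by (auto simp: v_def S_def)
    have vi: "integrable lebesgue v" and vI: "(LINT x|lebesgue. v x)\<^sup>2 \<le> m * L2_norm_sq v"
      using integrable_finite_support[OF S Hs_measurable[OF v] Hs_L2[OF v] v_out] by (auto simp: m_def L2_norm_sq_power)
    have I0: "0 \<le> (LINT x|lebesgue. v x)" by (rule integral_nonneg_AE) (simp add: v_nonneg)
    have main: "L2_norm_sq v \<le> C * k powr (- 4 * s / ?N) \<and> integrable lebesgue v \<and>
      (LINT x|lebesgue. v x) \<le> C * k powr (1 + 2 * \<beta>\<^sup>2) * m powr (1 + \<beta>\<^sup>2)"
    proof (cases "m = 0")
      case True
      then have "AE x in lebesgue. x \<notin> S" using S eS by (intro AE_not_in) auto
      then have "AE x in lebesgue. v x = 0" by eventually_elim (rule v_out)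
      then have "(LINT x|lebesgue. v x) = 0" "L2_norm_sq v = 0"
        unfolding L2_norm_sq_power by (auto intro!: integral_eq_zero_AE)
      then show ?thesis using vi C True by simp
    next
      case False
      then have m: "0 < m" using m0 by simp
      define Y where "Y = L2_norm_sq v"
      define n where "n = sqrt Y"
      have Y0: "0 \<le> Y" by (simp add: Y_def)
      have n: "0 \<le> n" "n * n = Y" using Y0 by (auto simp: n_def)
      define F where "F = frac_energy s v"
      have F: "0 \<le> F" "F \<le> 1"
      proof -
        have "c * gag s v \<le> c * gag s w" using gle(2) c_pos by (intro mult_left_mono) auto
        then show "F \<le> 1" using w1(2) unfolding F_def frac_energy_c by linarith
      qed (simp add: F_def frac_energy_nonneg)
      have "emeasure lebesgue {x. v x \<noteq> 0} \<le> ennreal m"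
        unfolding eS[symmetric] by (rule emeasure_mono) (use S v_out in auto)
      from C1'(2)[OF v m this] have FK: "Y \<le> C1 * m powr (2 * s / ?N) * F"
        using c_pos by (simp add: Y_def F_def frac_energy_c C1_def)
      have mke: "m powr (2 * s / ?N) \<le> k powr (- e)"
      proof -
        have "m powr (2 * s / ?N) \<le> (k powr (- 2)) powr (2 * s / ?N)"
          using m0 mk s_pos by (intro powr_mono2) auto
        also have "\<dots> = k powr (- e)" by (simp add: powr_powr e_def)
        finally show ?thesis .
      qed
      have YF: "Y \<le> C1 * k powr (- e) * F"
      proof (rule order_trans[OF FK])
        show "C1 * m powr (2 * s / ?N) * F \<le> C1 * k powr (- e) * F"
          using C1 F mke by (intro mult_right_mono mult_left_mono) auto
      qed
      have Yk: "Y \<le> C1 * k powr (- e)"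
      proof (rule order_trans[OF YF])
        show "C1 * k powr (- e) * F \<le> C1 * k powr (- e)"
          using C1 F by (intro mult_left_le) auto
      qed
      define g where "g = (\<lambda>x. p * 2 powr (p - 1) * (norm x powr (- b) * \<bar>v x\<bar> powr p) + p * 2 powr (p - 1) * k powr (p - 1) * (norm x powr (- b) * v x))"
      define h where "h = (\<lambda>x. 2 * (v x)\<^sup>2 + 2 * k * v x)"
      \<comment> \<open>The weight restricted to the support is square integrable since 2b < N; its
        norm produces the exponent 1/2 - b/N.\<close>
      define f where "f = (\<lambda>x::'a. norm x powr (- b) * indicator S x)"
      have fm[measurable]: "f \<in> borel_measurable lebesgue"
        unfolding f_def using S by measurable
      have f2: "(\<integral>\<^sup>+x. ennreal ((f x)\<^sup>2) \<partial>lebesgue) \<le> ennreal (C2 * m powr (1 - 2 * b / ?N))"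
      proof -
        have "ennreal ((f x)\<^sup>2) = ennreal (norm x powr (- (2 * b))) * indicator S x" for x
          by (cases "x \<in> S") (simp_all add: f_def power2_eq_square powr_add[symmetric])
        then show ?thesis using C2(2)[OF S] by (simp add: m_def)
      qed
      have fi: "integrable lebesgue (\<lambda>x. (f x)\<^sup>2)"
        by (rule integrableI_bounded) (measurable, use f2 in \<open>auto intro: le_less_trans\<close>)
      have fL: "(LINT x|lebesgue. (f x)\<^sup>2) \<le> C2 * m powr (1 - 2 * b / ?N)"
        using f2 C2(1) nn_integral_eq_integral[OF fi] by simp
      have fv: "f x * v x = norm x powr (- b) * v x" for x
        using v_out[of x] by (cases "x \<in> S") (auto simp: f_def)
      define W where "W = (LINT x|lebesgue. norm x powr (- b) * v x)"
      have Wi: "integrable lebesgue (\<lambda>x. norm x powr (- b) * v x)"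
        using integrable_mult_L2[OF fm Hs_measurable[OF v] fi Hs_L2[OF v]] unfolding fv .
      have W0: "0 \<le> W" unfolding W_def by (rule integral_nonneg_AE) (simp add: v_nonneg)
      have "W\<^sup>2 \<le> (C2 * m powr (1 - 2 * b / ?N)) * Y"
      proof -
        have "W\<^sup>2 \<le> (LINT x|lebesgue. (f x)\<^sup>2) * Y"
          using integral_Cauchy_Schwarz[OF fm Hs_measurable[OF v] fi Hs_L2[OF v]]
          unfolding fv W_def Y_def L2_norm_sq_power .
        also have "\<dots> \<le> (C2 * m powr (1 - 2 * b / ?N)) * Y"
          by (intro mult_right_mono fL Y0)
        finally show ?thesis .
      qed
      also have "\<dots> = (sqrt C2 * m powr (1/2 - b / ?N) * n)\<^sup>2"
      proof -
        have "(m powr (1/2 - b / ?N))\<^sup>2 = m powr (1 - 2 * b / ?N)"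
          by (simp add: power2_eq_square powr_add[symmetric])
        then show ?thesis
          using n C2(1) by (simp add: power_mult_distrib power2_eq_square[of n])
      qed
      finally have W: "W \<le> sqrt C2 * m powr (1/2 - b / ?N) * n"
        using n C2(1) by (intro power2_le_imp_le[of W]) auto
      define I where "I = (LINT x|lebesgue. v x)"
      have "I\<^sup>2 \<le> (m powr (1/2) * n)\<^sup>2"
        using vI m n by (simp add: I_def Y_def[symmetric] power_mult_distrib power2_eq_square[of n] powr_half_sqrt)
      then have I: "I \<le> m powr (1/2) * n"
        using n by (intro power2_le_imp_le[of I]) auto
      \<comment> \<open>Since m is at most 1, the term without weight is dominated by the power of m
        that the weighted term carries, so both fit into X.\<close>
      have mhalf: "m powr (1/2) \<le> m powr (1/2 - b / ?N)"
        using m m1 b dim_pos by (intro powr_mono') auto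
      have "frac_energy s w - frac_energy s z \<le> a / (1 + \<beta>\<^sup>2) * (LINT x|lebesgue. g x) + \<Lambda> * (LINT x|lebesgue. h x)"
      proof (rule quasi_min_diff[OF q z _ \<Lambda> a(1)])
        show "AE x in lebesgue. 0 \<le> z x \<and> z x \<le> w x"
          using w0 by eventually_elim (use k1 in \<open>auto simp: z_def\<close>)
        show "integrable lebesgue g"
          unfolding g_def p_def using v Wi by (intro Bochner_Integration.integrable_add integrable_mult_right weighted_integrable)
        show "AE x in lebesgue. norm x powr (- b) * (\<bar>w x\<bar> powr (2 + 2 * \<beta>\<^sup>2) - \<bar>z x\<bar> powr (2 + 2 * \<beta>\<^sup>2)) \<le> g x"
        proof (rule AE_I2)
          fix x :: 'a
          have "\<bar>w x\<bar> powr p - \<bar>z x\<bar> powr p \<le> p * 2 powr (p - 1) * (\<bar>v x\<bar> powr p + k powr (p - 1) * v x)"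
          proof (cases "w x \<le> k")
            case True
            then show ?thesis using v_nonneg[of x] p by (simp add: z_def)
          next
            case False
            have vx: "v x = w x - k" "0 < v x" and wx: "w x = v x + k" and zx: "z x = k"
              using False by (auto simp: v_def z_def)
            have "w x powr p - k powr p \<le> p * w x powr (p - 1) * v x"
              unfolding vx(1) using False k1 p by (intro powr_diff_le) auto
            also have "\<dots> \<le> p * (2 powr (p - 1) * (v x powr (p - 1) + k powr (p - 1))) * v x"
              unfolding wx using vx k1 p by (intro mult_right_mono mult_left_mono powr_add_le) auto
            also have "\<dots> = p * 2 powr (p - 1) * (v x powr (p - 1) * v x + k powr (p - 1) * v x)"
              by (simp add: algebra_simps)
            also have "v x powr (p - 1) * v x = \<bar>v x\<bar> powr p"
              using vx(2) powr_add[of "v x" "p - 1" 1] by simp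
            finally show ?thesis using False k1 by (simp add: zx)
          qed
          from mult_left_mono[OF this, of "norm x powr (- b)"]
          show "norm x powr (- b) * (\<bar>w x\<bar> powr (2 + 2 * \<beta>\<^sup>2) - \<bar>z x\<bar> powr (2 + 2 * \<beta>\<^sup>2)) \<le> g x"
            unfolding g_def p_def[symmetric] by (simp add: algebra_simps)
        qed
        show "integrable lebesgue h"
          unfolding h_def using vi Hs_L2[OF v] by simp
        show "AE x in lebesgue. (w x)\<^sup>2 - (z x)\<^sup>2 \<le> h x"
        proof (rule AE_I2)
          fix x
          show "(w x)\<^sup>2 - (z x)\<^sup>2 \<le> h x"
          proof (cases "w x \<le> k")
            case False
            then have "z x = k" "w x = v x + k" by (auto simp: z_def v_def)
            then show ?thesis by (simp add: h_def power2_sum)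
          qed (simp add: h_def z_def v_def)
        qed
      qed
      also have "(LINT x|lebesgue. g x) = p * 2 powr (p - 1) * (weighted_int b \<beta> v + k powr (p - 1) * W)"
      proof -
        have "(LINT x|lebesgue. g x) = p * 2 powr (p - 1) * (LINT x|lebesgue. norm x powr (- b) * \<bar>v x\<bar> powr p) + p * 2 powr (p - 1) * k powr (p - 1) * W"
          unfolding g_def W_def using v Wi weighted_integrable[OF v] by (simp add: p_def)
        then show ?thesis
          by (simp add: weighted_int_def p_def[symmetric] algebra_simps)
      qed
      also have "(LINT x|lebesgue. h x) = 2 * Y + 2 * k * I"
        unfolding h_def I_def Y_def L2_norm_sq_power using vi Hs_L2[OF v] by simp
      finally have E1: "frac_energy s w - frac_energy s z \<le> a / (1 + \<beta>\<^sup>2) * (p * 2 powr (p - 1) * (weighted_int b \<beta> v + k powr (p - 1) * W)) + \<Lambda> * (2 * Y + 2 * k * I)" .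
      have pc: "a / (1 + \<beta>\<^sup>2) * (p * 2 powr (p - 1) * X) \<le> 2 powr p * (A * X)" if "0 \<le> X" for X
      proof -
        have "1 + \<beta>\<^sup>2 \<noteq> 0" "p = 2 * (1 + \<beta>\<^sup>2)" using beta_pos by (linarith, simp add: p_def)
        then have "p / (1 + \<beta>\<^sup>2) = 2" by (metis nonzero_mult_div_cancel_right)
        moreover have "2 powr p = 2 * 2 powr (p - 1)" using powr_add[of 2 "p - 1" 1] by simp
        ultimately have "a / (1 + \<beta>\<^sup>2) * (p * 2 powr (p - 1) * X) = 2 powr p * (a * X)"
          by (metis (no_types, opaque_lifting) mult.assoc mult.commute times_divide_eq_left times_divide_eq_right)
        also have "\<dots> \<le> 2 powr p * (A * X)"
          using a that by (intro mult_left_mono mult_right_mono) auto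
        finally show ?thesis .
      qed
      have "F \<le> frac_energy s w - frac_energy s z"
        using mult_left_mono[OF gle(1), of c] c_pos by (simp add: F_def frac_energy_c algebra_simps)
      also note E1
      also have "a / (1 + \<beta>\<^sup>2) * (p * 2 powr (p - 1) * (weighted_int b \<beta> v + k powr (p - 1) * W)) \<le>
          2 powr p * (A * (weighted_int b \<beta> v + k powr (p - 1) * W))"
        using weighted_int_nonneg[of v] W0 by (intro pc) auto
      finally have E2: "F \<le> 2 powr p * (A * weighted_int b \<beta> v) + 2 powr p * A * k powr (p - 1) * W + 2 * (\<Lambda> * Y) + 2 * \<Lambda> * k * I"
        by (simp add: algebra_simps)
      have G: "A * weighted_int b \<beta> v \<le> (1 + \<beta>\<^sup>2) * F * Y powr \<beta>\<^sup>2"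
        using GN_ineq[OF v] beta_pos by (simp add: F_def Y_def field_simps)
      have "2 powr p * (A * weighted_int b \<beta> v) \<le> F * (2 powr p * (1 + \<beta>\<^sup>2) * Y powr \<beta>\<^sup>2)"
        using mult_left_mono[OF G, of "2 powr p"] by (simp add: mult_ac)
      also have "\<dots> \<le> F * (2 powr p * (1 + \<beta>\<^sup>2) * (C1 * k powr (- e)) powr \<beta>\<^sup>2)"
        using F Y0 Yk beta_pos by (intro mult_left_mono powr_mono2) auto
      also have "\<dots> \<le> F * (1 / 4)"
        using F k0(2)[OF k] by (intro mult_left_mono) auto
      finally have E3: "2 powr p * (A * weighted_int b \<beta> v) \<le> F * (1 / 4)" .
      have "\<Lambda> * Y \<le> \<Lambda> * (C1 * k powr (- e) * F)"
        using \<Lambda> YF by (intro mult_left_mono)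
      also have "\<dots> = F * (\<Lambda> * (C1 * k powr (- e)))" by (simp add: mult_ac)
      also have "\<dots> \<le> F * (1 / 4)"
        using F k0(3)[OF k] by (intro mult_left_mono) auto
      finally have E4: "\<Lambda> * Y \<le> F * (1 / 4)" .
      define X where "X = k powr (p - 1) * (m powr (1/2 - b / ?N) * n)"
      have "k powr 1 \<le> k powr (p - 1)" using k1 p by (intro powr_mono) auto
      then have kp: "k \<le> k powr (p - 1)" using k1 by simp
      have W': "k powr (p - 1) * W \<le> sqrt C2 * X"
        using mult_left_mono[OF W, of "k powr (p - 1)"] by (simp add: X_def mult_ac)
      have "k * I \<le> k powr (p - 1) * (m powr (1/2 - b / ?N) * n)"
        using kp I mhalf n I0 k1 by (intro mult_mono) (auto simp: I_def intro: order_trans mult_right_mono)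
      then have I': "k * I \<le> X" by (simp add: X_def)
      have "F * (1 / 4) \<le> 2 powr p * A * (k powr (p - 1) * W) + 2 * \<Lambda> * (k * I)"
        using E2 E3 E4 by (simp add: mult.assoc)
      also have "\<dots> \<le> 2 powr p * A * (sqrt C2 * X) + 2 * \<Lambda> * X"
        using A \<Lambda> by (intro add_mono mult_left_mono W' I') auto
      finally have FX: "F \<le> 2 * C3 * X" by (simp add: C3_def algebra_simps)
      \<comment> \<open>The exponent 2s/N gained from the small support exceeds the b/N lost to the
        weight by exactly \<beta>^2; this surplus over 1/2 is what makes the recursion
        superlinear.\<close>
      have ex: "2 * s / ?N + (1/2 - b / ?N) = 1/2 + \<beta>\<^sup>2"
        unfolding beta_sq using dim_pos by (simp add: field_simps)
      have "n * n \<le> C1 * m powr (2 * s / ?N) * (2 * C3 * X)"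
        unfolding n(2) using C1 by (intro order_trans[OF FK] mult_left_mono FX) auto
      also have "\<dots> = 2 * C1 * C3 * k powr (p - 1) * (m powr (2 * s / ?N) * m powr (1/2 - b / ?N)) * n"
        by (simp add: X_def mult_ac)
      also have "m powr (2 * s / ?N) * m powr (1/2 - b / ?N) = m powr (1/2 + \<beta>\<^sup>2)"
        by (simp only: powr_add[symmetric] ex)
      finally have nn: "n * n \<le> 2 * C1 * C3 * k powr (p - 1) * m powr (1/2 + \<beta>\<^sup>2) * n" .
      have nle: "n \<le> 2 * C1 * C3 * k powr (p - 1) * m powr (1/2 + \<beta>\<^sup>2)"
      proof (cases "n = 0")
        case True
        then show ?thesis using C1 C3 by simp
      next
        case False
        then show ?thesis using nn n(1) by simp
      qed
      have "I \<le> m powr (1/2) * n" by (rule I)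
      also have "\<dots> \<le> m powr (1/2) * (2 * C1 * C3 * k powr (p - 1) * m powr (1/2 + \<beta>\<^sup>2))"
        by (intro mult_left_mono nle) auto
      also have "\<dots> = 2 * C1 * C3 * k powr (p - 1) * (m powr (1/2) * m powr (1/2 + \<beta>\<^sup>2))"
        by (simp add: mult_ac)
      also have "m powr (1/2) * m powr (1/2 + \<beta>\<^sup>2) = m powr (1 + \<beta>\<^sup>2)"
        by (simp add: powr_add[symmetric])
      also have "2 * C1 * C3 * k powr (p - 1) * m powr (1 + \<beta>\<^sup>2) \<le> C * k powr (p - 1) * m powr (1 + \<beta>\<^sup>2)"
        using C1 by (intro mult_right_mono) (auto simp: C_def)
      finally have "I \<le> C * k powr (1 + 2 * \<beta>\<^sup>2) * m powr (1 + \<beta>\<^sup>2)"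
        by (simp add: p_def)
      moreover have "Y \<le> C * k powr (- e)"
        using Yk mult_right_mono[of C1 C "k powr (- e)"] C1 C3 by (simp add: C_def)
      moreover have "- 4 * s / ?N = - e" by (simp add: e_def)
      ultimately show ?thesis
        using vi unfolding I_def Y_def by simp
    qed
    show "L2_norm_sq (\<lambda>x. max (w x - k) 0) \<le> C * k powr (- 4 * s / ?N) \<and>
      integrable lebesgue (\<lambda>x. max (w x - k) 0) \<and>
      (LINT x|lebesgue. max (w x - k) 0) \<le> C * k powr (1 + 2 * \<beta>\<^sup>2) * measure lebesgue {x. k < w x} powr (1 + \<beta>\<^sup>2)"
      by (rule main[unfolded v_def m_def S_def])
  qed
qed

end

lemma AE_notin_measure_0:
  assumes "S \<in> sets M" "emeasure M S < \<infinity>" "measure M S = 0"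
  shows "AE x in M. x \<notin> S"
proof -
  have "emeasure M S = 0"
    using emeasure_eq_ennreal_measure[of M S] assms by simp
  then have "S \<in> null_sets M" using assms(1) by (intro null_setsI)
  then show ?thesis by (rule AE_not_in)
qed

declare emeasure_completion [simp del] measure_completion [simp del]

context gn_setting
begin

text \<open>The iteration runs from K to 2K with recursion constant of order K^(1+2\<beta>^2).
  Chebyshev alone gives |{w > K}| of order K^(-2), and the starting condition would then read K
  against K, with no room. Applying the first part of \<open>level_estimate\<close> at level K/2
  improves this to K^(-2-e), and the gained factor K^(-e \<beta>^2) beats every constant once K is
  large.\<close>

lemma Linf_bound:
  assumes \<Lambda>: "0 \<le> \<Lambda>"
  obtains M where "0 < M"
    "\<And>a (w :: 'a \<Rightarrow> real). 0 \<le> a \<Longrightarrow> a \<le> A \<Longrightarrow> quasi_min s b \<beta> a \<Lambda> w \<Longrightarrow> L2_norm_sq w \<le> 1 \<Longrightarrow> frac_energy s w \<le> 1 \<Longrightarrow>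
      AE x in lebesgue. w x \<le> M"
proof -
  let ?N = "real DIM('a)"
  obtain C k0 where C: "0 < C" and k0: "1 \<le> k0" and lev:
    "\<And>a (w :: 'a \<Rightarrow> real) k. 0 \<le> a \<Longrightarrow> a \<le> A \<Longrightarrow> quasi_min s b \<beta> a \<Lambda> w \<Longrightarrow> L2_norm_sq w \<le> 1 \<Longrightarrow> frac_energy s w \<le> 1 \<Longrightarrow> k0 \<le> k \<Longrightarrow>
      L2_norm_sq (\<lambda>x. max (w x - k) 0) \<le> C * k powr (- 4 * s / ?N) \<and>
      integrable lebesgue (\<lambda>x. max (w x - k) 0) \<and>
      (LINT x|lebesgue. max (w x - k) 0) \<le> C * k powr (1 + 2 * \<beta>\<^sup>2) * measure lebesgue {x. k < w x} powr (1 + \<beta>\<^sup>2)"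
    using level_estimate[OF \<Lambda>] by blast
  define B where "B = \<beta>\<^sup>2"
  have B: "0 < B" using beta_pos by (simp add: B_def)
  define e where "e = 4 * s / ?N"
  have e: "e > 0" using s_pos dim_pos by (simp add: e_def)
  define E where "E = 4 * C * 2 powr e"
  have E: "0 < E" using C by (simp add: E_def)
  define D where "D = C * 2 powr (1 + 2 * B) * E powr B * 2 powr (1 + 1 / B)"
  have D: "0 < D" using C E by (simp add: D_def)
  define K where "K = max (2 * k0) (D powr (1 / (e * B)))"
  have K: "2 * k0 \<le> K" "D powr (1 / (e * B)) \<le> K" "1 \<le> K" "0 < K"
    using k0 by (auto simp: K_def)
  have "D = (D powr (1 / (e * B))) powr (e * B)"
    using D e B by (simp add: powr_powr)
  also have "\<dots> \<le> K powr (e * B)"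
    using K e B by (intro powr_mono2) auto
  finally have DK: "D \<le> K powr (e * B)" .
  show thesis
  proof (rule that[of "2 * K"])
    show "0 < 2 * K" using K by simp
    fix a and w :: "'a \<Rightarrow> real"
    assume a: "0 \<le> a" "a \<le> A" and q: "quasi_min s b \<beta> a \<Lambda> w" and w1: "L2_norm_sq w \<le> 1" "frac_energy s w \<le> 1"
    have w: "w \<in> Hs s" using q by (simp add: quasi_min_def)
    note [measurable] = Hs_measurable[OF w]
    \<comment> \<open>The maximum keeps the level positive. For levels k \<le> 0 the superlevel set
      may have infinite measure, to which \<open>measure\<close> assigns 0, and f would not be
      monotone on all of the reals.\<close>
    define f where "f = (\<lambda>k. measure lebesgue {x. max k (k0 / 2) < w x})"
    have fk: "f k = measure lebesgue {x. k < w x}" if "k0 \<le> k" for k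
      using that k0 by (simp add: f_def max_def)
    have kpos: "0 < max k (k0 / 2)" for k using k0 by simp
    have "f (K + K) = 0"
    proof (rule stampacchia[of K "C * (2 * K) powr (1 + 2 * B)" B])
      show "f h \<le> f k" if "k \<le> h" for k h
        unfolding f_def
      proof (rule measure_mono_fmeasurable)
        show "{x. max k (k0 / 2) < w x} \<in> fmeasurable lebesgue"
          by (rule fmeasurableI[OF superlevel_finite(1,2)[OF w kpos]])
        show "{x. max h (k0 / 2) < w x} \<in> sets lebesgue"
          by (rule superlevel_finite(1)[OF w kpos])
      qed (use that in auto)
      show "(h - k) * f h \<le> C * (2 * K) powr (1 + 2 * B) * f k powr (1 + B)" if h: "K \<le> k" "k < h" "h \<le> K + K" for k h
      proof -
        have k: "k0 \<le> k" "k0 \<le> h" "0 < k" "0 < h" using h K k0 by auto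
        note l = lev[OF a q w1 k(1)]
        have kh: "k + (h - k) = h" by simp
        have 1: "{x. k + (h - k) < w x} \<in> sets lebesgue"
          unfolding kh by (rule superlevel_finite(1)[OF w k(4)])
        have 2: "0 < h - k" using h by simp
        have "(h - k) * f h \<le> (LINT x|lebesgue. max (w x - k) 0)"
          using superlevel_step[OF conjunct1[OF conjunct2[OF l]] 1 2] unfolding fk[OF k(2)] kh .
        also have "\<dots> \<le> C * k powr (1 + 2 * B) * f k powr (1 + B)"
          using l unfolding fk[OF k(1)] B_def by blast
        also have "\<dots> \<le> C * (2 * K) powr (1 + 2 * B) * f k powr (1 + B)"
          using C B k h by (intro mult_right_mono mult_left_mono powr_mono2) auto
        finally show ?thesis .
      qed
      have K2: "k0 \<le> K / 2" using K by simp
      have fK: "f K \<le> E * K powr (- (2 + e))"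
      proof -
        define v where "v = (\<lambda>x. max (w x - K / 2) 0)"
        have v: "v \<in> Hs s" using gag_truncation(2)[OF w, of "K / 2"] K by (simp add: v_def)
        have S: "{x. K < w x} \<in> sets lebesgue" using superlevel_finite(1)[OF w K(4)] .
        have "(K / 2)\<^sup>2 * measure lebesgue {x. K < w x} \<le> L2_norm_sq v"
          unfolding L2_norm_sq_power
        proof (rule measure_le_integral(2)[OF Hs_L2[OF v] _ S])
          show "AE x in lebesgue. x \<in> {x. K < w x} \<longrightarrow> (K / 2)\<^sup>2 \<le> (v x)\<^sup>2"
            using K by (intro AE_I2) (auto intro!: power_mono simp: v_def)
        qed (use K in auto)
        also have "\<dots> \<le> C * (K / 2) powr (- e)"
          using lev[OF a q w1 K2] by (simp add: v_def e_def)
        also have "(K / 2) powr (- e) = 2 powr e * K powr (- e)"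
          using K by (simp add: powr_divide powr_minus field_simps)
        finally have "(K / 2)\<^sup>2 * f K \<le> C * (2 powr e * K powr (- e))"
          using fk[of K] K k0 by simp
        then have "f K \<le> 4 * C * (2 powr e * K powr (- e)) * (1 / K\<^sup>2)"
          using K by (simp add: field_simps)
        also have "1 / K\<^sup>2 = K powr (- 2)" using K by (simp add: powr_minus_divide)
        also have "4 * C * (2 powr e * K powr (- e)) * K powr (- 2) = E * (K powr (- e) * K powr (- 2))"
          by (simp add: E_def)
        also have "K powr (- e) * K powr (- 2) = K powr (- (2 + e))"
          by (simp only: powr_add[symmetric] minus_add_distrib add.commute)
        finally show ?thesis .
      qed
      have "f K powr B \<le> (E * K powr (- (2 + e))) powr B"
        using B fK by (intro powr_mono2) (auto simp: f_def)
      also have "\<dots> = E powr B * K powr (- (2 + e) * B)"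
        using E by (simp add: powr_mult powr_powr)
      finally have fKB: "f K powr B \<le> E powr B * K powr (- (2 + e) * B)" .
      have "C * (2 * K) powr (1 + 2 * B) * f K powr B * 2 powr (1 + 1 / B)
          \<le> C * (2 * K) powr (1 + 2 * B) * (E powr B * K powr (- (2 + e) * B)) * 2 powr (1 + 1 / B)"
        using C by (intro mult_right_mono mult_left_mono fKB) auto
      also have "\<dots> = D * (K powr (1 + 2 * B) * K powr (- (2 + e) * B))"
        using K by (simp add: D_def powr_mult mult_ac)
      also have "K powr (1 + 2 * B) * K powr (- (2 + e) * B) = K powr (1 - e * B)"
        by (simp add: powr_add[symmetric] algebra_simps)
      also have "D * K powr (1 - e * B) \<le> K powr (e * B) * K powr (1 - e * B)"
        by (intro mult_right_mono DK) auto
      also have "\<dots> = K" using K by (simp add: powr_add[symmetric])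
      finally show "C * (2 * K) powr (1 + 2 * B) * f K powr B * 2 powr (1 + 1 / B) \<le> K" .
    qed (use K C B in \<open>auto simp: f_def\<close>)
    then have 0: "measure lebesgue {x. 2 * K < w x} = 0"
      using fk[of "2 * K"] K k0 by simp
    have K20: "0 < 2 * K" using K by simp
    have "AE x in lebesgue. x \<notin> {x. 2 * K < w x}"
      by (rule AE_notin_measure_0[OF superlevel_finite(1,2)[OF w K20] 0])
    then show "AE x in lebesgue. w x \<le> 2 * K"
      by eventually_elim simp
  qed
qed

end

section \<open>Uniform decay\<close>

definition tent :: "real \<Rightarrow> 'a::euclidean_space \<Rightarrow> real" where
  "tent R x = max 0 (min 1 (2 - norm x / R))"

lemma tent_measurable [measurable]: "tent R \<in> borel_measurable borel"
  unfolding tent_def by measurable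

lemma tent_bounds: "0 \<le> tent R x" "tent R x \<le> 1"
  by (auto simp: tent_def)

lemma tent_inside: "0 < R \<Longrightarrow> norm x \<le> R \<Longrightarrow> tent R x = 1"
  by (simp add: tent_def field_simps)

lemma tent_outside: "0 < R \<Longrightarrow> 2 * R \<le> norm x \<Longrightarrow> tent R x = 0"
  by (simp add: tent_def field_simps)

lemma tent_lipschitz: assumes "0 < R" shows "\<bar>tent R x - tent R y\<bar> \<le> min 1 (norm (x - y) / R)"
proof -
  have "\<bar>norm x / R - norm y / R\<bar> \<le> norm (x - y) / R"
    using norm_triangle_ineq3[of x y] assms by (simp add: diff_divide_distrib[symmetric] divide_right_mono)
  then have "\<bar>tent R x - tent R y\<bar> \<le> norm (x - y) / R"
    unfolding tent_def by linarith
  then show ?thesis using tent_bounds[of R x] tent_bounds[of R y] by auto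
qed

text \<open>Symmetry of the kernel makes the contributions of both points of a pair equal, hence the
  factor 2. Stated for Bochner integrals, to be usable as a pointwise majorant of Gagliardo
  forms.\<close>

lemma cutoff_energy_bound_sym:
  assumes s: "0 < s" "s < 1"
  obtains C where "C > 0"
    "\<And>\<rho> \<phi> (f :: 'a::euclidean_space \<Rightarrow> real). \<rho> > 0 \<Longrightarrow> \<phi> \<in> borel_measurable borel \<Longrightarrow>
      (\<And>x y. \<bar>\<phi> x - \<phi> y\<bar> \<le> min 1 (norm (x - y) / \<rho>)) \<Longrightarrow>
      integrable lebesgue f \<Longrightarrow> (\<And>x. 0 \<le> f x) \<Longrightarrow>
      integrable (lebesgue \<Otimes>\<^sub>M lebesgue) (\<lambda>p. (f (fst p) + f (snd p)) * (\<phi> (fst p) - \<phi> (snd p))\<^sup>2 * kern s (fst p - snd p)) \<and>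
      (LINT p|(lebesgue \<Otimes>\<^sub>M lebesgue). (f (fst p) + f (snd p)) * (\<phi> (fst p) - \<phi> (snd p))\<^sup>2 * kern s (fst p - snd p))
        \<le> C * \<rho> powr (- 2 * s) * (LINT x|lebesgue. f x)"
proof -
  obtain C where C: "C > 0" and b:
    "\<And>\<rho> \<phi> (f :: 'a::euclidean_space \<Rightarrow> real). \<rho> > 0 \<Longrightarrow> \<phi> \<in> borel_measurable borel \<Longrightarrow>
      (\<And>x y. \<bar>\<phi> x - \<phi> y\<bar> \<le> min 1 (norm (x - y) / \<rho>)) \<Longrightarrow>
      f \<in> borel_measurable lebesgue \<Longrightarrow> (\<And>x. 0 \<le> f x) \<Longrightarrow>
      (\<integral>\<^sup>+x. \<integral>\<^sup>+y. ennreal (f x * (\<phi> x - \<phi> y)\<^sup>2 * kern s (x - y)) \<partial>lebesgue \<partial>lebesgue)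
        \<le> ennreal (C * \<rho> powr (- 2 * s)) * (\<integral>\<^sup>+x. ennreal (f x) \<partial>lebesgue)"
    using cutoff_energy_bound[OF s, where 'a='a] by blast
  show thesis
  proof (rule that[of "2 * C"])
    show "2 * C > 0" using C by simp
    fix \<rho> :: real and \<phi> f :: "'a \<Rightarrow> real"
    assume \<rho>: "\<rho> > 0" and \<phi>[measurable]: "\<phi> \<in> borel_measurable borel" 
      and lip: "\<And>x y. \<bar>\<phi> x - \<phi> y\<bar> \<le> min 1 (norm (x - y) / \<rho>)" and f: "integrable lebesgue f" and f0: "\<And>x. 0 \<le> f x"
    have fm[measurable]: "f \<in> borel_measurable lebesgue" using f by (rule borel_measurable_integrable)
    have I0: "0 \<le> (LINT x|lebesgue. f x)" by (rule integral_nonneg_AE) (simp add: f0)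
    have fI: "(\<integral>\<^sup>+x. ennreal (f x) \<partial>lebesgue) = ennreal (LINT x|lebesgue. f x)"
      by (rule nn_integral_eq_integral[OF f]) (simp add: f0)
    let ?G = "\<lambda>x y. ennreal (f x * (\<phi> x - \<phi> y)\<^sup>2 * kern s (x - y))"
    let ?H = "\<lambda>p. (f (fst p) + f (snd p)) * (\<phi> (fst p) - \<phi> (snd p))\<^sup>2 * kern s (fst p - snd p)"
    have Gm[measurable]: "(\<lambda>p. ?G (fst p) (snd p)) \<in> borel_measurable (lebesgue \<Otimes>\<^sub>M lebesgue)"
      by measurable
    have Gm'[measurable]: "(\<lambda>p. ?G (snd p) (fst p)) \<in> borel_measurable (lebesgue \<Otimes>\<^sub>M lebesgue)"
      by measurable
    have Hm: "?H \<in> borel_measurable (lebesgue \<Otimes>\<^sub>M lebesgue)"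
      by measurable
    have bG: "(\<integral>\<^sup>+x. \<integral>\<^sup>+y. ?G x y \<partial>lebesgue \<partial>lebesgue) \<le> ennreal (C * \<rho> powr (- 2 * s) * (LINT x|lebesgue. f x))"
      using b[OF \<rho> \<phi> lip fm f0] C I0 unfolding fI by (simp add: ennreal_mult')
    have "?H p = f (fst p) * (\<phi> (fst p) - \<phi> (snd p))\<^sup>2 * kern s (fst p - snd p) + f (snd p) * (\<phi> (snd p) - \<phi> (fst p))\<^sup>2 * kern s (snd p - fst p)" for p
      using kern_minus[of s "fst p" "snd p"] power2_commute[of "\<phi> (fst p)" "\<phi> (snd p)"] by (simp only: distrib_right)
    then have "(\<integral>\<^sup>+p. ennreal (?H p) \<partial>(lebesgue \<Otimes>\<^sub>M lebesgue)) =
        (\<integral>\<^sup>+p. ?G (fst p) (snd p) + ?G (snd p) (fst p) \<partial>(lebesgue \<Otimes>\<^sub>M lebesgue))"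
      by (simp only: ennreal_plus f0 kern_nonneg zero_le_power2 mult_nonneg_nonneg)
    also have "\<dots> = (\<integral>\<^sup>+p. ?G (fst p) (snd p) \<partial>(lebesgue \<Otimes>\<^sub>M lebesgue)) + (\<integral>\<^sup>+p. ?G (snd p) (fst p) \<partial>(lebesgue \<Otimes>\<^sub>M lebesgue))"
      by (rule nn_integral_add[OF Gm Gm'])
    also have "(\<integral>\<^sup>+p. ?G (fst p) (snd p) \<partial>(lebesgue \<Otimes>\<^sub>M lebesgue)) = (\<integral>\<^sup>+x. \<integral>\<^sup>+y. ?G x y \<partial>lebesgue \<partial>lebesgue)"
      using leb.nn_integral_fst[OF Gm] by simp
    also have "(\<integral>\<^sup>+p. ?G (snd p) (fst p) \<partial>(lebesgue \<Otimes>\<^sub>M lebesgue)) = (\<integral>\<^sup>+x. \<integral>\<^sup>+y. ?G x y \<partial>lebesgue \<partial>lebesgue)"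
      using lebp.nn_integral_snd[of "\<lambda>p. ?G (snd p) (fst p)"] Gm' by simp
    finally have "(\<integral>\<^sup>+p. ennreal (?H p) \<partial>(lebesgue \<Otimes>\<^sub>M lebesgue)) =
      (\<integral>\<^sup>+x. \<integral>\<^sup>+y. ?G x y \<partial>lebesgue \<partial>lebesgue) + (\<integral>\<^sup>+x. \<integral>\<^sup>+y. ?G x y \<partial>lebesgue \<partial>lebesgue)" .
    also have "\<dots> \<le> ennreal (C * \<rho> powr (- 2 * s) * (LINT x|lebesgue. f x)) + ennreal (C * \<rho> powr (- 2 * s) * (LINT x|lebesgue. f x))"
      by (intro add_mono bG)
    also have "\<dots> = ennreal (2 * C * \<rho> powr (- 2 * s) * (LINT x|lebesgue. f x))"
      using C I0 by (subst ennreal_plus[symmetric]) auto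
    finally have le: "(\<integral>\<^sup>+p. ennreal (?H p) \<partial>(lebesgue \<Otimes>\<^sub>M lebesgue)) \<le> ennreal (2 * C * \<rho> powr (- 2 * s) * (LINT x|lebesgue. f x))" .
    have H0: "0 \<le> ?H p" for p
      using f0 by (intro mult_nonneg_nonneg add_nonneg_nonneg) auto
    have Hi: "integrable (lebesgue \<Otimes>\<^sub>M lebesgue) ?H"
      by (rule integrableI_nonneg[OF Hm]) (use H0 le in \<open>auto intro: le_less_trans\<close>)
    have "ennreal (LINT p|(lebesgue \<Otimes>\<^sub>M lebesgue). ?H p) = (\<integral>\<^sup>+p. ennreal (?H p) \<partial>(lebesgue \<Otimes>\<^sub>M lebesgue))"
      by (rule nn_integral_eq_integral[symmetric, OF Hi]) (simp only: H0 eventually_True)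
    with le have "ennreal (LINT p|(lebesgue \<Otimes>\<^sub>M lebesgue). ?H p) \<le> ennreal (2 * C * \<rho> powr (- 2 * s) * (LINT x|lebesgue. f x))"
      by simp
    then have "(LINT p|(lebesgue \<Otimes>\<^sub>M lebesgue). ?H p) \<le> 2 * C * \<rho> powr (- 2 * s) * (LINT x|lebesgue. f x)"
      using C I0 by (subst (asm) ennreal_le_iff) auto
    with Hi show "integrable (lebesgue \<Otimes>\<^sub>M lebesgue) ?H \<and>
      (LINT p|(lebesgue \<Otimes>\<^sub>M lebesgue). ?H p) \<le> 2 * C * \<rho> powr (- 2 * s) * (LINT x|lebesgue. f x)" ..
  qed
qed

lemma emeasure_finite_measure: "emeasure M S < \<infinity> \<Longrightarrow> emeasure M S = ennreal (measure M S)"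
  by (simp add: emeasure_eq_ennreal_measure)

lemma power2_diff_le: "(a - b)\<^sup>2 \<le> 2 * a\<^sup>2 + 2 * (b::real)\<^sup>2"
  using zero_le_power2[of "a + b"] by (simp add: power2_sum power2_diff)

text \<open>In use, \<open>W\<close>, \<open>Z\<close> and \<open>t\<close> are the seminorms of w =
  z + v, of z and of v, and \<open>B\<close> is the cross term, which is bounded below only up to a
  quarter of \<open>t\<close>.\<close>

lemma absorb_quarter:
  fixes t X B W Z :: real
  assumes "- (1 / 4) * t - X \<le> B" "W = Z + 2 * B + t"
  shows "t \<le> 2 * (W - Z) + 4 * X"
proof -
  have "- t - 4 * X \<le> 4 * B" using assms(1) by simp
  then show ?thesis using assms(2) by simp
qed

context gn_setting
begin

lemma AE_tent_level:
  assumes "AE x in lebesgue. w x \<le> M" "0 < M" "0 < k" "0 < R"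
  shows "AE x in lebesgue. k + M * tent R x < w x \<longrightarrow> R < norm (x :: 'a)"
  using assms(1)
proof eventually_elim
  case (elim x)
  show ?case
  proof (rule impI, rule ccontr)
    assume "k + M * tent R x < w x" "\<not> R < norm x"
    then show False using elim assms tent_inside[of R x] by auto
  qed
qed

text \<open>
  The barrier \<open>k + M * tent R\<close> lies above \<open>w\<close> on the ball of radius \<open>R\<close>, so that the truncation only
  sees the exterior, where the weight is at most 1.
\<close>

lemma decay_level:
  assumes \<Lambda>: "0 \<le> \<Lambda>" and M: "0 < M"
  obtains C where "0 < C"
    "\<And>a (w :: 'a \<Rightarrow> real) R k. 0 \<le> a \<Longrightarrow> a \<le> A \<Longrightarrow> quasi_min s b \<beta> a \<Lambda> w \<Longrightarrow> (AE x in lebesgue. w x \<le> M) \<Longrightarrow>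
      1 \<le> R \<Longrightarrow> 0 < k \<Longrightarrow>
      integrable lebesgue (\<lambda>x. max (w x - (k + M * tent R x)) 0) \<and>
      (LINT x|lebesgue. max (w x - (k + M * tent R x)) 0) \<le>
        C * measure lebesgue {x. k + M * tent R x < w x} powr (1 + s / real DIM('a))"
proof -
  let ?N = "real DIM('a)"
  define p where "p = 2 + 2 * \<beta>\<^sup>2"
  have p: "2 < p" using beta_pos by (simp add: p_def)
  obtain C1 where C1: "C1 > 0" and FK: "\<And>(v :: 'a \<Rightarrow> real) m. v \<in> Hs s \<Longrightarrow> 0 < m \<Longrightarrow> emeasure lebesgue {x. v x \<noteq> 0} \<le> ennreal m \<Longrightarrow>
      L2_norm_sq v \<le> C1 * m powr (2 * s / ?N) * gag s v"
    using faber_krahn[OF s_pos, where 'a='a] by blast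
  obtain C2 where C2: "C2 > 0" and cut:
    "\<And>\<rho> \<phi> (f :: 'a::euclidean_space \<Rightarrow> real). \<rho> > 0 \<Longrightarrow> \<phi> \<in> borel_measurable borel \<Longrightarrow>
      (\<And>x y. \<bar>\<phi> x - \<phi> y\<bar> \<le> min 1 (norm (x - y) / \<rho>)) \<Longrightarrow>
      integrable lebesgue f \<Longrightarrow> (\<And>x. 0 \<le> f x) \<Longrightarrow>
      integrable (lebesgue \<Otimes>\<^sub>M lebesgue) (\<lambda>p. (f (fst p) + f (snd p)) * (\<phi> (fst p) - \<phi> (snd p))\<^sup>2 * kern s (fst p - snd p)) \<and>
      (LINT p|(lebesgue \<Otimes>\<^sub>M lebesgue). (f (fst p) + f (snd p)) * (\<phi> (fst p) - \<phi> (snd p))\<^sup>2 * kern s (fst p - snd p))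
        \<le> C2 * \<rho> powr (- 2 * s) * (LINT x|lebesgue. f x)"
    using cutoff_energy_bound_sym[OF s_pos s(2), where 'a='a] by blast
  \<comment> \<open>The quotient comes from the nonlinear and mass terms, where w is at most M and
    the weight at most 1 on the support; the last summand is the energy of the sloping barrier. The
    support enters both only through its measure.\<close>
  define C5 where "C5 = 2 * ((A * M powr p + \<Lambda> * M\<^sup>2) / c + 2 * (C2 * M\<^sup>2))"
  have C5: "C5 > 0"
    using A M \<Lambda> c_pos C2 by (auto simp: C5_def intro!: add_pos_pos mult_pos_pos divide_pos_pos add_pos_nonneg)
  define C where "C = sqrt (C1 * C5)"
  have C: "C > 0" using C1 C5 by (simp add: C_def)
  show thesis
  proof (rule that[OF C])
    fix a R k :: real and w :: "'a \<Rightarrow> real"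
    assume a: "0 \<le> a" "a \<le> A" and q: "quasi_min s b \<beta> a \<Lambda> w" and wM: "AE x in lebesgue. w x \<le> M"
      and R: "1 \<le> R" and k: "0 < k"
    have R0: "0 < R" using R by simp
    have w: "w \<in> Hs s" and w0: "AE x in lebesgue. 0 \<le> w x" using q by (auto simp: quasi_min_def)
    note wm[measurable] = Hs_measurable[OF w]
    define \<psi> where "\<psi> = (tent R :: 'a \<Rightarrow> real)"
    have \<psi>m[measurable]: "\<psi> \<in> borel_measurable borel" by (simp add: \<psi>_def)
    have \<psi>0: "0 \<le> \<psi> x" for x by (simp add: \<psi>_def tent_bounds)
    have lip: "\<bar>\<psi> x - \<psi> y\<bar> \<le> min 1 (norm (x - y) / R)" for x y
      unfolding \<psi>_def by (rule tent_lipschitz[OF R0])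
    define \<theta> where "\<theta> = (\<lambda>x. k + M * \<psi> x)"
    have \<theta>m[measurable]: "\<theta> \<in> borel_measurable borel" unfolding \<theta>_def by measurable
    have \<theta>k: "k \<le> \<theta> x" for x using \<psi>0 M by (simp add: \<theta>_def)
    define v where "v = (\<lambda>x. max (w x - \<theta> x) 0)"
    define z where "z = (\<lambda>x. min (w x) (\<theta> x))"
    have vm[measurable]: "v \<in> borel_measurable lebesgue" unfolding v_def by measurable
    define S where "S = {x. \<theta> x < w x}"
    have "{x \<in> space lebesgue. \<theta> x < w x} \<in> sets lebesgue" by measurable
    then have Sm[measurable]: "S \<in> sets lebesgue"
      by (simp only: S_def space_completion space_lborel space_borel UNIV_I simp_thms)
    have "S \<subseteq> {x. k < w x}"
      unfolding S_def by (rule Collect_mono) (blast intro: le_less_trans \<theta>k)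
    then have Sf: "emeasure lebesgue S < \<infinity>"
      by (rule le_less_trans[OF emeasure_mono superlevel_finite(2)[OF w k]]) (rule superlevel_finite(1)[OF w k])
    define m where "m = measure lebesgue S"
    have m0: "0 \<le> m" by (simp add: m_def)
    have eS: "emeasure lebesgue S = ennreal m"
      unfolding m_def by (rule emeasure_finite_measure[OF Sf])
    have v_nonneg: "0 \<le> v x" and v_out: "x \<notin> S \<Longrightarrow> v x = 0" and v_in: "x \<in> S \<Longrightarrow> v x = w x - \<theta> x"
      and z_in: "x \<in> S \<Longrightarrow> z x = \<theta> x" and z_out: "x \<notin> S \<Longrightarrow> z x = w x" and z_le: "z x \<le> \<theta> x" for x
      by (auto simp: v_def z_def S_def)
    \<comment> \<open>Every pair with a point in S has \<open>M\<^sup>2 \<le> ind x + ind y\<close>.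
      With this weight the cut-off bound charges the slope of the barrier only to pairs meeting S,
      which gives a multiple of the measure of S.\<close>
    define ind where "ind = (\<lambda>x::'a. M\<^sup>2 * indicator S x :: real)"
    have ind0: "0 \<le> ind x" for x by (simp add: ind_def)
    have indi: "integrable lebesgue ind" unfolding ind_def
      by (intro integrable_mult_right integrable_real_indicator Sm Sf)
    have indL: "(LINT x|lebesgue. ind x) = M\<^sup>2 * m"
      unfolding ind_def using Sm sets.sets_into_space[OF Sm] by (simp add: m_def Int_absorb2)
    define H where "H = (\<lambda>q. (ind (fst q) + ind (snd q)) * (\<psi> (fst q) - \<psi> (snd q))\<^sup>2 * kern s (fst q - snd q))"
    have Hi: "integrable (lebesgue \<Otimes>\<^sub>M lebesgue) H" and HL: "(LINT q|(lebesgue \<Otimes>\<^sub>M lebesgue). H q) \<le> C2 * (M\<^sup>2 * m)"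
    proof -
      note ct = cut[OF R0 \<psi>m lip indi ind0]
      show "integrable (lebesgue \<Otimes>\<^sub>M lebesgue) H" using conjunct1[OF ct] unfolding H_def .
      have "(LINT q|(lebesgue \<Otimes>\<^sub>M lebesgue). H q) \<le> C2 * R powr (- 2 * s) * (M\<^sup>2 * m)"
        using conjunct2[OF ct] unfolding H_def indL .
      also have "\<dots> \<le> C2 * 1 * (M\<^sup>2 * m)"
        using R s_pos C2 m0 powr_mono2'[of "- 2 * s" 1 R] by (intro mult_right_mono mult_left_mono) auto
      finally show "(LINT q|(lebesgue \<Otimes>\<^sub>M lebesgue). H q) \<le> C2 * (M\<^sup>2 * m)" by simp
    qed
    have ind_ge: "M\<^sup>2 \<le> ind x + ind y" if "x \<in> S \<or> y \<in> S" for x y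
      using that by (auto simp: ind_def)
    have Hs: "(M * (\<psi> x - \<psi> y))\<^sup>2 \<le> (ind x + ind y) * (\<psi> x - \<psi> y)\<^sup>2" if "x \<in> S \<or> y \<in> S" for x y
      unfolding power_mult_distrib using ind_ge[OF that] by (intro mult_right_mono) auto
    have v: "v \<in> Hs s"
    proof -
      \<comment> \<open>The barrier is not constant, so v is not a contraction of w and its seminorm
        has to be bounded directly. On pairs meeting S the increment of v is at most that of w - M
        \<psi>; on all others it vanishes.\<close>
      have pw: "(v x - v y)\<^sup>2 \<le> 2 * (w x - w y)\<^sup>2 + 2 * ((ind x + ind y) * (\<psi> x - \<psi> y)\<^sup>2)" for x y
      proof (cases "x \<in> S \<or> y \<in> S")
        case True
        have "\<bar>v x - v y\<bar> \<le> \<bar>(w x - w y) - M * (\<psi> x - \<psi> y)\<bar>"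
          by (auto simp: v_def \<theta>_def algebra_simps)
        then have "(v x - v y)\<^sup>2 \<le> ((w x - w y) - M * (\<psi> x - \<psi> y))\<^sup>2"
          by (simp add: abs_le_square_iff)
        also have "\<dots> \<le> 2 * (w x - w y)\<^sup>2 + 2 * (M * (\<psi> x - \<psi> y))\<^sup>2"
          by (rule power2_diff_le)
        also have "\<dots> \<le> 2 * (w x - w y)\<^sup>2 + 2 * ((ind x + ind y) * (\<psi> x - \<psi> y)\<^sup>2)"
          using Hs[OF True] by linarith
        finally show ?thesis .
      next
        case False
        then show ?thesis using v_out ind0 by simp
      qed
      have "integrable (lebesgue \<Otimes>\<^sub>M lebesgue) (gagliardo_form s v v)"
      proof (rule Bochner_Integration.integrable_bound)
        show "integrable (lebesgue \<Otimes>\<^sub>M lebesgue) (\<lambda>q. 2 * gagliardo_form s w w q + 2 * H q)"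
          using Hi gagB_integrable[OF w w] by simp
        show "AE q in lebesgue \<Otimes>\<^sub>M lebesgue. norm (gagliardo_form s v v q) \<le> norm (2 * gagliardo_form s w w q + 2 * H q)"
        proof (rule AE_I2)
          fix q :: "'a \<times> 'a"
          obtain x y where q: "q = (x, y)" by force
          have "gagliardo_form s v v q \<le> 2 * gagliardo_form s w w q + 2 * H q"
            using mult_right_mono[OF pw[of x y] kern_nonneg[of s "x - y"]]
            by (simp add: q gagliardo_form_kern H_def power2_eq_square distrib_right mult.assoc)
          moreover have "0 \<le> gagliardo_form s v v q" by (rule gagliardo_form_nonneg)
          ultimately show "norm (gagliardo_form s v v q) \<le> norm (2 * gagliardo_form s w w q + 2 * H q)"
            by simp
        qed
      qed measurable
      moreover have "\<bar>v x\<bar> \<le> \<bar>w x\<bar>" for x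
        using \<theta>k[of x] k by (auto simp: v_def)
      then have "integrable lebesgue (\<lambda>x. (v x)\<^sup>2)"
        by (intro L2_norm_sq_mono_AE(1)[OF w vm]) simp
      ultimately show ?thesis using vm by (simp add: Hs_def)
    qed
    have zwv: "z = (\<lambda>x. w x - v x)" by (auto simp: z_def v_def)
    have z: "z \<in> Hs s" unfolding zwv by (rule Hs_diff[OF w v])
    have cross: "- (1/4) * gag s v - C2 * (M\<^sup>2 * m) \<le> gagB s z v"
    proof -
      have "- (1/4) * gag s v - C2 * (M\<^sup>2 * m) \<le> - (1/4) * gag s v - (LINT q|(lebesgue \<Otimes>\<^sub>M lebesgue). H q)"
        using HL by simp
      also have "\<dots> = (LINT q|(lebesgue \<Otimes>\<^sub>M lebesgue). - (1/4) * gagliardo_form s v v q - H q)"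
        using Hi gagB_integrable[OF v v] by (simp add: gagB_def)
      also have "\<dots> \<le> gagB s z v"
        unfolding gagB_def
      proof (rule integral_mono)
        show "integrable (lebesgue \<Otimes>\<^sub>M lebesgue) (\<lambda>q. - (1/4) * gagliardo_form s v v q - H q)"
          using Hi gagB_integrable[OF v v] by simp
        show "integrable (lebesgue \<Otimes>\<^sub>M lebesgue) (gagliardo_form s z v)"
          by (rule gagB_integrable[OF z v])
        fix q :: "'a \<times> 'a"
        obtain x y where q: "q = (x, y)" by force
        have "- (1/4) * (v x - v y)\<^sup>2 - (ind x + ind y) * (\<psi> x - \<psi> y)\<^sup>2 \<le> (z x - z y) * (v x - v y)"
        proof (cases "x \<in> S \<or> y \<in> S")
          case True
          \<comment> \<open>If only one point lies in S, then v vanishes at the other one, where z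
            lies below \<theta>; replacing z by \<theta> can only decrease the product. What remains
            is a slope of the barrier times an increment of v, split by Young's inequality.\<close>
          have "(\<theta> x - \<theta> y) * (v x - v y) \<le> (z x - z y) * (v x - v y)"
          proof (cases "x \<in> S"; cases "y \<in> S")
            assume S: "x \<in> S" "y \<notin> S"
            then show ?thesis
              using v_nonneg[of x] z_le[of y] z_in[of x] v_out[of y] by (simp add: mult_right_mono)
          next
            assume S: "x \<notin> S" "y \<in> S"
            then show ?thesis
              using v_nonneg[of y] z_le[of x] z_in[of y] v_out[of x] by (simp add: mult_right_mono)
          qed (use True z_in in auto)
          moreover have "- (1/4) * (v x - v y)\<^sup>2 - (M * (\<psi> x - \<psi> y))\<^sup>2 \<le> (\<theta> x - \<theta> y) * (v x - v y)"
          proof -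
            have e: "\<theta> x - \<theta> y = M * (\<psi> x - \<psi> y)" by (simp add: \<theta>_def algebra_simps)
            have "- (1/4) * t\<^sup>2 - r\<^sup>2 \<le> r * t" for r t :: real
              using zero_le_power2[of "t / 2 + r"] by (simp add: power2_sum power_divide mult.commute)
            then show ?thesis unfolding e .
          qed
          moreover note Hs[OF True]
          ultimately show ?thesis by linarith
        next
          case False
          then show ?thesis using v_out ind0 by simp
        qed
        from mult_right_mono[OF this kern_nonneg[of s "x - y"]]
        show "- (1/4) * gagliardo_form s v v q - H q \<le> gagliardo_form s z v q"
          by (simp add: q gagliardo_form_kern H_def power2_eq_square left_diff_distrib mult.assoc)
      qed
      finally show ?thesis .
    qed
    have "(\<lambda>x. z x + v x) = w" by (auto simp: zwv)
    then have "gag s w = gag s z + 2 * gagB s z v + gag s v"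
      using gag_add[OF z v] by simp
    with cross have gle: "gag s v \<le> 2 * (gag s w - gag s z) + 4 * (C2 * (M\<^sup>2 * m))"
      by (intro absorb_quarter)
    have "frac_energy s w - frac_energy s z \<le> a / (1 + \<beta>\<^sup>2) * (LINT x|lebesgue. M powr p * indicator S x) + \<Lambda> * (LINT x|lebesgue. M\<^sup>2 * indicator S x)"
    proof (rule quasi_min_diff[OF q z _ \<Lambda> a(1)])
      show "AE x in lebesgue. 0 \<le> z x \<and> z x \<le> w x"
        using w0
      proof eventually_elim
        case (elim x)
        then show ?case using \<theta>k[of x] k by (auto simp: z_def)
      qed
      show "integrable lebesgue (\<lambda>x. M powr p * indicator S x)" "integrable lebesgue (\<lambda>x. M\<^sup>2 * indicator S x)"
        by (intro integrable_mult_right integrable_real_indicator Sm Sf)+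
      have "AE x in lebesgue. x \<in> S \<longrightarrow> R < norm x"
        using AE_tent_level[OF wM M k R0] by (simp add: S_def \<theta>_def \<psi>_def)
      then show "AE x in lebesgue. norm x powr (- b) * (\<bar>w x\<bar> powr (2 + 2 * \<beta>\<^sup>2) - \<bar>z x\<bar> powr (2 + 2 * \<beta>\<^sup>2)) \<le> M powr p * indicator S x"
        using w0 wM
      proof eventually_elim
        case (elim x)
        show ?case
        proof (cases "x \<in> S")
          case True
          then have "1 \<le> norm x" using elim R by auto
          then have "norm x powr (- b) \<le> 1 powr (- b)"
            using b by (intro powr_mono2') auto
          then have n1: "norm x powr (- b) \<le> 1" by simp
          have "norm x powr (- b) * (\<bar>w x\<bar> powr p - \<bar>z x\<bar> powr p) \<le> norm x powr (- b) * (\<bar>w x\<bar> powr p)"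
            by (intro mult_left_mono) auto
          also have "\<dots> \<le> 1 * M powr p"
            using n1 elim p by (intro mult_mono powr_mono2) auto
          finally show ?thesis using True by (simp add: p_def)
        qed (simp add: z_out)
      qed
      show "AE x in lebesgue. (w x)\<^sup>2 - (z x)\<^sup>2 \<le> M\<^sup>2 * indicator S x"
        using w0 wM
      proof eventually_elim
        case (elim x)
        show ?case
        proof (cases "x \<in> S")
          case True
          have "(w x)\<^sup>2 \<le> M\<^sup>2" using elim by (intro power_mono) auto
          moreover have "0 \<le> (z x)\<^sup>2" by (rule zero_le_power2)
          ultimately have "(w x)\<^sup>2 - (z x)\<^sup>2 \<le> M\<^sup>2" by linarith
          then show ?thesis using True by simp
        qed (simp add: z_out)
      qed
    qed
    also have "(LINT x|lebesgue. M powr p * indicator S x) = M powr p * m"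
      using sets.sets_into_space[OF Sm] by (simp add: m_def Int_absorb2)
    also have "(LINT x|lebesgue. M\<^sup>2 * indicator S x) = M\<^sup>2 * m"
      using sets.sets_into_space[OF Sm] by (simp add: m_def Int_absorb2)
    also have "a / (1 + \<beta>\<^sup>2) * (M powr p * m) \<le> A * (M powr p * m)"
    proof (rule mult_right_mono)
      have "a / (1 + \<beta>\<^sup>2) \<le> a / 1" using a beta_pos by (intro divide_left_mono mult_pos_pos) (linarith+)
      then show "a / (1 + \<beta>\<^sup>2) \<le> A" using a by simp
    qed (use m0 in simp)
    finally have "c * (gag s w - gag s z) \<le> (A * M powr p + \<Lambda> * M\<^sup>2) * m"
      by (simp add: frac_energy_c algebra_simps)
    then have gw: "gag s w - gag s z \<le> (A * M powr p + \<Lambda> * M\<^sup>2) / c * m"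
      using c_pos by (simp add: field_simps)
    have "gag s v \<le> 2 * ((A * M powr p + \<Lambda> * M\<^sup>2) / c * m) + 4 * (C2 * (M\<^sup>2 * m))"
      by (rule order_trans[OF gle add_right_mono[OF mult_left_mono[OF gw]]]) simp
    also have "\<dots> = C5 * m"
      by (simp only: C5_def distrib_right distrib_left mult.assoc)
    finally have gv: "gag s v \<le> C5 * m" .
    have vi: "integrable lebesgue v" and vI: "(LINT x|lebesgue. v x)\<^sup>2 \<le> m * L2_norm_sq v"
      using integrable_finite_support[OF Sm Sf vm Hs_L2[OF v] v_out] unfolding m_def L2_norm_sq_power by blast+
    have main: "(LINT x|lebesgue. v x) \<le> C * m powr (1 + s / ?N)"
    proof (cases "m = 0")
      case True
      then have "(LINT x|lebesgue. v x) = 0" using vI by simp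
      then show ?thesis using C by simp
    next
      case False
      then have m: "0 < m" using m0 by simp
      have "emeasure lebesgue {x. v x \<noteq> 0} \<le> ennreal m"
        unfolding eS[symmetric] by (rule emeasure_mono[OF _ Sm]) (use v_out in auto)
      from FK[OF v m this] have "L2_norm_sq v \<le> C1 * m powr (2 * s / ?N) * gag s v" .
      also have "\<dots> \<le> C1 * m powr (2 * s / ?N) * (C5 * m)"
        using C1 by (intro mult_left_mono gv) auto
      finally have Y: "L2_norm_sq v \<le> C1 * C5 * (m powr (2 * s / ?N) * m)" by (simp add: mult_ac)
      have "(LINT x|lebesgue. v x)\<^sup>2 \<le> m * (C1 * C5 * (m powr (2 * s / ?N) * m))"
        using order_trans[OF vI mult_left_mono[OF Y m0]] .
      also have "\<dots> = (C * m powr (1 + s / ?N))\<^sup>2"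
      proof -
        have "(m powr (1 + s / ?N))\<^sup>2 = m powr ((1 + s / ?N) + (1 + s / ?N))"
          by (simp only: power2_eq_square powr_add[symmetric])
        also have "(1 + s / ?N) + (1 + s / ?N) = 1 + (2 * s / ?N + 1)" by simp
        also have "m powr (1 + (2 * s / ?N + 1)) = m * (m powr (2 * s / ?N) * m)"
          using m by (simp only: powr_add powr_one)
        finally show ?thesis
          using C1 C5 by (simp add: C_def power_mult_distrib mult_ac)
      qed
      finally show ?thesis
        using C by (intro power2_le_imp_le[of "LINT x|lebesgue. v x"]) auto
    qed
    show "integrable lebesgue (\<lambda>x. max (w x - (k + M * tent R x)) 0) \<and>
      (LINT x|lebesgue. max (w x - (k + M * tent R x)) 0) \<le>
        C * measure lebesgue {x. k + M * tent R x < w x} powr (1 + s / ?N)"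
      using vi main unfolding v_def m_def S_def \<theta>_def \<psi>_def by blast
  qed
qed

text \<open>The levels run from \<eta>/2 to \<eta> above the barrier. At the first level the set
  lies outside the ball of radius R, so Chebyshev bounds its measure by the mass there; \<kappa> is
  the mass that still allows the iteration to start. Outside the ball of radius 2R the barrier is
  gone, and the last level is \<eta> itself.\<close>

lemma decay:
  assumes \<Lambda>: "0 \<le> \<Lambda>" and M: "0 < M" and \<eta>: "0 < \<eta>"
  obtains \<kappa> where "0 < \<kappa>"
    "\<And>a (w :: 'a \<Rightarrow> real) R. 0 \<le> a \<Longrightarrow> a \<le> A \<Longrightarrow> quasi_min s b \<beta> a \<Lambda> w \<Longrightarrow> (AE x in lebesgue. w x \<le> M) \<Longrightarrow>
      1 \<le> R \<Longrightarrow> (LINT x|lebesgue. (w x)\<^sup>2 * indicator (- cball 0 R) x) \<le> \<kappa> \<Longrightarrow>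
      AE x in lebesgue. 2 * R \<le> norm x \<longrightarrow> w x \<le> \<eta>"
proof -
  let ?N = "real DIM('a)"
  obtain C where C: "0 < C" and lev:
    "\<And>a (w :: 'a \<Rightarrow> real) R k. 0 \<le> a \<Longrightarrow> a \<le> A \<Longrightarrow> quasi_min s b \<beta> a \<Lambda> w \<Longrightarrow> (AE x in lebesgue. w x \<le> M) \<Longrightarrow>
      1 \<le> R \<Longrightarrow> 0 < k \<Longrightarrow>
      integrable lebesgue (\<lambda>x. max (w x - (k + M * tent R x)) 0) \<and>
      (LINT x|lebesgue. max (w x - (k + M * tent R x)) 0) \<le>
        C * measure lebesgue {x. k + M * tent R x < w x} powr (1 + s / ?N)"
    using decay_level[OF \<Lambda> M] by blast
  define \<delta> where "\<delta> = s / ?N"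
  have \<delta>: "0 < \<delta>" using s_pos dim_pos by (simp add: \<delta>_def)
  \<comment> \<open>The largest value of f(\<eta>/2)^\<delta> that the starting condition of
    \<open>stampacchia\<close> allows with d = \<eta>/2.\<close>
  define G where "G = \<eta> / 2 / (C * 2 powr (1 + 1 / \<delta>))"
  have G: "0 < G" using \<eta> C by (simp add: G_def)
  define \<kappa> where "\<kappa> = (\<eta> / 2)\<^sup>2 * G powr (1 / \<delta>)"
  have \<kappa>: "0 < \<kappa>" using \<eta> G by (simp add: \<kappa>_def)
  show thesis
  proof (rule that[OF \<kappa>])
    fix a R :: real and w :: "'a \<Rightarrow> real"
    assume a: "0 \<le> a" "a \<le> A" and q: "quasi_min s b \<beta> a \<Lambda> w" and wM: "AE x in lebesgue. w x \<le> M"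
      and R: "1 \<le> R" and tail: "(LINT x|lebesgue. (w x)\<^sup>2 * indicator (- cball 0 R) x) \<le> \<kappa>"
    have R0: "0 < R" using R by simp
    have w: "w \<in> Hs s" using q by (simp add: quasi_min_def)
    note wm[measurable] = Hs_measurable[OF w]
    let ?S = "\<lambda>k. {x. k + M * tent R x < w x}"
    have S: "?S k \<in> sets lebesgue" for k
    proof -
      have "{x \<in> space lebesgue. k + M * tent R x < w x} \<in> sets lebesgue" by measurable
      then show ?thesis
        by (simp only: space_completion space_lborel space_borel UNIV_I simp_thms)
    qed
    have Sfin: "emeasure lebesgue (?S k) < \<infinity>" if "0 < k" for k
    proof (rule le_less_trans[OF emeasure_mono superlevel_finite(2)[OF w that]])
      have "0 \<le> M * tent R x" for x :: 'a using M tent_bounds[of R x] by simp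
      then show "?S k \<subseteq> {x. k < w x}" by (smt (verit) Collect_mono)
      show "{x. k < w x} \<in> sets lebesgue" by (rule superlevel_finite(1)[OF w that])
    qed
    \<comment> \<open>The maximum keeps the level positive, so that all the sets have finite measure
      and f is monotone; on the levels of the iteration it changes nothing.\<close>
    define f where "f = (\<lambda>k. measure lebesgue (?S (max k (\<eta> / 4))))"
    have fk: "f k = measure lebesgue (?S k)" if "\<eta> / 2 \<le> k" for k
      using that \<eta> by (simp only: f_def max_def) simp
    have kpos: "0 < max k (\<eta> / 4)" for k using \<eta> by simp
    have "f (\<eta> / 2 + \<eta> / 2) = 0"
    proof (rule stampacchia[of "\<eta> / 2" C \<delta>])
      show "f h \<le> f k" if "k \<le> h" for k h
        unfolding f_def
      proof (rule measure_mono_fmeasurable[OF _ S])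
        show "?S (max k (\<eta> / 4)) \<in> fmeasurable lebesgue"
          by (rule fmeasurableI[OF S Sfin[OF kpos]])
      qed (use that in auto)
      show "(h - k) * f h \<le> C * f k powr (1 + \<delta>)" if h: "\<eta> / 2 \<le> k" "k < h" "h \<le> \<eta> / 2 + \<eta> / 2" for k h
      proof -
        have k: "\<eta> / 2 \<le> h" "0 < k" "0 < h - k" using h \<eta> by auto
        note l = lev[OF a q wM R k(2)]
        have e: "{x. k + M * tent R x + (h - k) < w x} = ?S h" by (auto simp: algebra_simps)
        have "(h - k) * f h \<le> (LINT x|lebesgue. max (w x - (k + M * tent R x)) 0)"
          using superlevel_step[OF conjunct1[OF l], of "h - k"] S[of h] k(3) unfolding fk[OF k(1)] e by blast
        also have "\<dots> \<le> C * f k powr (1 + \<delta>)"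
          using l unfolding fk[OF h(1)] \<delta>_def by blast
        finally show ?thesis .
      qed
      have "(\<eta> / 2)\<^sup>2 * f (\<eta> / 2) \<le> (LINT x|lebesgue. (w x)\<^sup>2 * indicator (- cball 0 R) x)"
        unfolding fk[OF order_refl]
      proof (rule measure_le_integral(2)[OF _ _ S])
        show "integrable lebesgue (\<lambda>x. (w x)\<^sup>2 * indicator (- cball 0 R) x)"
          using integrable_mult_indicator[of "- cball 0 R" lebesgue "\<lambda>x. (w x)\<^sup>2"] Hs_L2[OF w]
          by (simp add: mult.commute sets.compl_sets)
        have "AE x in lebesgue. \<eta> / 2 + M * tent R x < w x \<longrightarrow> R < norm (x :: 'a)"
          by (rule AE_tent_level[OF wM M _ R0]) (use \<eta> in simp)
        then show "AE x in lebesgue. x \<in> ?S (\<eta> / 2) \<longrightarrow> (\<eta> / 2)\<^sup>2 \<le> (w x)\<^sup>2 * indicator (- cball 0 R) x"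
        proof eventually_elim
          case (elim x)
          have "0 \<le> M * tent R x" using M tent_bounds[of R x] by simp
          then show ?case using elim \<eta> by (auto intro!: power_mono)
        qed
      qed (use \<eta> in auto)
      with tail have "(\<eta> / 2)\<^sup>2 * f (\<eta> / 2) \<le> (\<eta> / 2)\<^sup>2 * G powr (1 / \<delta>)"
        unfolding \<kappa>_def by (rule order_trans[rotated])
      then have "f (\<eta> / 2) \<le> G powr (1 / \<delta>)"
        using \<eta> by simp
      then have "f (\<eta> / 2) powr \<delta> \<le> (G powr (1 / \<delta>)) powr \<delta>"
        using \<delta> by (intro powr_mono2) (auto simp: f_def)
      also have "\<dots> = G" using \<delta> G by (simp add: powr_powr)
      finally have "C * f (\<eta> / 2) powr \<delta> * 2 powr (1 + 1 / \<delta>) \<le> C * G * 2 powr (1 + 1 / \<delta>)"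
        using C by (intro mult_right_mono mult_left_mono) auto
      also have "\<dots> = \<eta> / 2" using C by (simp add: G_def)
      finally show "C * f (\<eta> / 2) powr \<delta> * 2 powr (1 + 1 / \<delta>) \<le> \<eta> / 2" .
    qed (use \<eta> C \<delta> in \<open>auto simp: f_def\<close>)
    then have 0: "measure lebesgue (?S \<eta>) = 0"
      using fk[of \<eta>] \<eta> by (simp only: field_sum_of_halves)
    have "AE x in lebesgue. x \<notin> ?S \<eta>"
      by (rule AE_notin_measure_0[OF S Sfin[OF \<eta>] 0])
    then show "AE x in lebesgue. 2 * R \<le> norm x \<longrightarrow> w x \<le> \<eta>"
    proof eventually_elim
      case (elim x)
      then show ?case using tent_outside[OF R0, of x] by auto
    qed
  qed
qed

end

section \<open>Compactness\<close>

text \<open>The half-open lattice cube of side l that contains x. As an equality of floors it is an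
  equivalence relation, so that averages over cells are constant on each cell.\<close>

definition cell :: "real \<Rightarrow> 'a::euclidean_space \<Rightarrow> 'a set" where
  "cell l x = {y. \<forall>i\<in>Basis. \<lfloor>y \<bullet> i / l\<rfloor> = \<lfloor>x \<bullet> i / l\<rfloor>}"

lemma cell_eq: "y \<in> cell l x \<Longrightarrow> cell l y = cell l x"
  by (auto simp: cell_def)

lemma cell_pair_sets: "{p \<in> space (lebesgue \<Otimes>\<^sub>M lebesgue). snd p \<in> cell l (fst p)} \<in> sets (lebesgue \<Otimes>\<^sub>M (lebesgue :: 'a::euclidean_space measure))"
proof -
  have "Measurable.pred (lebesgue \<Otimes>\<^sub>M lebesgue) (\<lambda>p. \<forall>i\<in>Basis. \<lfloor>snd p \<bullet> i / l\<rfloor> = \<lfloor>fst p \<bullet> (i :: 'a) / l\<rfloor>)"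
    by (intro pred_intros_finite finite_Basis) measurable
  then show ?thesis
    by (simp only: cell_def mem_Collect_eq pred_def)
qed

lemma cell_sets: "cell l x \<in> sets (borel :: 'a::euclidean_space measure)"
proof -
  have "Measurable.pred borel (\<lambda>y. \<forall>i\<in>Basis. \<lfloor>y \<bullet> i / l\<rfloor> = \<lfloor>x \<bullet> (i :: 'a) / l\<rfloor>)"
    by (intro pred_intros_finite finite_Basis) measurable
  then show ?thesis
    by (simp only: cell_def pred_def space_borel UNIV_I simp_thms)
qed

lemma cell_between:
  fixes x :: "'a::euclidean_space"
  assumes l: "0 < l"
  obtains a b where "box a b \<subseteq> cell l x" "cell l x \<subseteq> cbox a b"
    "\<And>i. i \<in> Basis \<Longrightarrow> b \<bullet> i - a \<bullet> i = l" "\<And>i. i \<in> Basis \<Longrightarrow> a \<bullet> i < b \<bullet> i"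
proof (rule that)
  define a where "a = (\<Sum>i\<in>Basis. (l * of_int \<lfloor>x \<bullet> i / l\<rfloor>) *\<^sub>R i)"
  define b where "b = (\<Sum>i\<in>Basis. (l * (of_int \<lfloor>x \<bullet> i / l\<rfloor> + 1)) *\<^sub>R i)"
  have a: "a \<bullet> i = l * of_int \<lfloor>x \<bullet> i / l\<rfloor>" and b: "b \<bullet> i = l * (of_int \<lfloor>x \<bullet> i / l\<rfloor> + 1)" if "i \<in> Basis" for i
    using that by (simp_all add: a_def b_def inner_sum_left inner_Basis if_distrib sum.If_cases cong: if_cong)
  show "box a b \<subseteq> cell l x"
  proof
    fix y assume y: "y \<in> box a b"
    have "\<lfloor>y \<bullet> i / l\<rfloor> = \<lfloor>x \<bullet> i / l\<rfloor>" if i: "i \<in> Basis" for i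
    proof (rule floor_unique)
      have "l * of_int \<lfloor>x \<bullet> i / l\<rfloor> < y \<bullet> i" "y \<bullet> i < l * (of_int \<lfloor>x \<bullet> i / l\<rfloor> + 1)"
        using y i a b by (auto simp: mem_box)
      then show "of_int \<lfloor>x \<bullet> i / l\<rfloor> \<le> y \<bullet> i / l" "y \<bullet> i / l < of_int \<lfloor>x \<bullet> i / l\<rfloor> + 1"
        using l by (simp_all add: field_simps)
    qed
    then show "y \<in> cell l x" by (simp add: cell_def)
  qed
  show "cell l x \<subseteq> cbox a b"
  proof
    fix y assume y: "y \<in> cell l x"
    have "a \<bullet> i \<le> y \<bullet> i \<and> y \<bullet> i \<le> b \<bullet> i" if i: "i \<in> Basis" for i
    proof -
      have e: "\<lfloor>y \<bullet> i / l\<rfloor> = \<lfloor>x \<bullet> i / l\<rfloor>" using y i by (simp add: cell_def)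
      have "of_int \<lfloor>x \<bullet> i / l\<rfloor> \<le> y \<bullet> i / l" "y \<bullet> i / l \<le> of_int \<lfloor>x \<bullet> i / l\<rfloor> + 1"
        unfolding e[symmetric] by linarith+
      then show ?thesis using l a[OF i] b[OF i] by (simp add: field_simps)
    qed
    then show "y \<in> cbox a b" by (simp add: mem_box)
  qed
  show "b \<bullet> i - a \<bullet> i = l" "a \<bullet> i < b \<bullet> i" if "i \<in> Basis" for i
    using l a[OF that] b[OF that] by (simp_all add: algebra_simps)
qed

lemma emeasure_cell:
  fixes x :: "'a::euclidean_space"
  assumes l: "0 < l"
  shows "emeasure lebesgue (cell l x) = ennreal (l ^ DIM('a))"
proof -
  obtain a b where ab: "box a b \<subseteq> cell l x" "cell l x \<subseteq> cbox a b"
    "\<And>i. i \<in> Basis \<Longrightarrow> b \<bullet> i - a \<bullet> i = l" "\<And>i. i \<in> Basis \<Longrightarrow> a \<bullet> i < b \<bullet> i"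
    using cell_between[OF l] by metis
  have 0: "emeasure lebesgue (cell l x) = emeasure lborel (cell l x)"
    using cell_sets[of l x] by (subst emeasure_completion) (auto simp: main_part)
  have pr: "(\<Prod>i\<in>Basis. (b - a) \<bullet> i) = l ^ DIM('a)"
    using ab(3) by (simp add: inner_diff_left)
  have "emeasure lborel (box a b) = ennreal (l ^ DIM('a))" "emeasure lborel (cbox a b) = ennreal (l ^ DIM('a))"
    using ab(4) unfolding pr[symmetric] by (auto simp: less_imp_le)
  moreover have "emeasure lborel (box a b) \<le> emeasure lborel (cell l x)" "emeasure lborel (cell l x) \<le> emeasure lborel (cbox a b)"
    using ab cell_sets[of l x] by (auto intro!: emeasure_mono)
  ultimately show ?thesis unfolding 0 by simp
qed

lemma cell_norm:
  fixes x :: "'a::euclidean_space"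
  assumes l: "0 < l" and y: "y \<in> cell l x"
  shows "norm (x - y) \<le> real DIM('a) * l"
proof -
  obtain a b where ab: "cell l x \<subseteq> cbox a b" "\<And>i. i \<in> Basis \<Longrightarrow> b \<bullet> i - a \<bullet> i = l"
    using cell_between[OF l] by metis
  have "x \<in> cell l x" by (simp add: cell_def)
  then have xy: "x \<in> cbox a b" "y \<in> cbox a b" using ab(1) y by auto
  have "norm (x - y) \<le> (\<Sum>i\<in>Basis. \<bar>(x - y) \<bullet> i\<bar>)" by (rule norm_le_l1)
  also have "\<dots> \<le> (\<Sum>i\<in>(Basis :: 'a set). l)"
  proof (rule sum_mono)
    fix i :: 'a assume i: "i \<in> Basis"
    show "\<bar>(x - y) \<bullet> i\<bar> \<le> l"
      using xy i ab(2)[OF i] by (auto simp: mem_box inner_diff_left abs_le_iff dest!: bspec[OF _ i])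
  qed
  finally show ?thesis by simp
qed

definition avg :: "real \<Rightarrow> ('a::euclidean_space \<Rightarrow> real) \<Rightarrow> 'a \<Rightarrow> real" where
  "avg l u x = (LINT y|lebesgue. indicator (cell l x) y * u y) / l ^ DIM('a)"

lemma cell_sets_lebesgue: "cell l x \<in> sets lebesgue"
  using cell_sets[of l x] by simp

lemma avg_integrable:
  fixes u :: "'a::euclidean_space \<Rightarrow> real"
  assumes l: "0 < l" and u: "u \<in> borel_measurable lebesgue" "integrable lebesgue (\<lambda>x. (u x)\<^sup>2)"
  shows "integrable lebesgue (\<lambda>y. indicator (cell l x) y * u y)"
proof (rule integrable_mult_L2[OF _ u(1) _ u(2)])
  show "(indicator (cell l x) :: _ \<Rightarrow> real) \<in> borel_measurable lebesgue"
    by (rule borel_measurable_indicator[OF cell_sets_lebesgue])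
  have "(indicator (cell l x) y :: real)\<^sup>2 = indicator (cell l x) y" for y
    by (simp add: indicator_def)
  moreover have "integrable lebesgue (indicator (cell l x) :: _ \<Rightarrow> real)"
    by (rule integrable_real_indicator[OF cell_sets_lebesgue]) (simp add: emeasure_cell[OF l])
  ultimately show "integrable lebesgue (\<lambda>y. (indicator (cell l x) y :: real)\<^sup>2)" by simp
qed

lemma avg_measurable:
  fixes u :: "'a::euclidean_space \<Rightarrow> real"
  assumes [measurable]: "u \<in> borel_measurable lebesgue"
  shows "avg l u \<in> borel_measurable lebesgue"
proof -
  define E where "E = {p \<in> space (lebesgue \<Otimes>\<^sub>M lebesgue). snd p \<in> cell l (fst p :: 'a)}"
  have [measurable]: "E \<in> sets (lebesgue \<Otimes>\<^sub>M lebesgue)"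
    unfolding E_def by (rule cell_pair_sets)
  have e: "indicator (cell l x) y = (indicator E (x, y) :: real)" for x y
    by (simp add: E_def indicator_def space_pair_measure)
  have "(\<lambda>x. LINT y|lebesgue. indicator E (x, y) * u y) \<in> borel_measurable lebesgue"
    by measurable
  then show ?thesis
    unfolding avg_def e by measurable
qed

lemma avg_bound:
  fixes u :: "'a::euclidean_space \<Rightarrow> real"
  assumes l: "0 < l" and u: "u \<in> borel_measurable lebesgue" "integrable lebesgue (\<lambda>x. (u x)\<^sup>2)"
    and M: "AE x in lebesgue. \<bar>u x\<bar> \<le> M" "0 \<le> M"
  shows "\<bar>avg l u x\<bar> \<le> M"
proof -
  have i: "integrable lebesgue (\<lambda>y. M * indicator (cell l x) y)"
    by (intro integrable_mult_right integrable_real_indicator[OF cell_sets_lebesgue]) (simp add: emeasure_cell[OF l])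
  have "\<bar>LINT y|lebesgue. indicator (cell l x) y * u y\<bar> \<le> (LINT y|lebesgue. M * indicator (cell l x) y)"
    unfolding real_norm_def[symmetric]
  proof (rule order_trans[OF integral_norm_bound integral_mono_AE])
    show "integrable lebesgue (\<lambda>y. norm (indicator (cell l x) y * u y))"
      using avg_integrable[OF l u] by (rule integrable_norm)
    show "AE y in lebesgue. norm (indicator (cell l x) y * u y) \<le> M * indicator (cell l x) y"
      using M(1) by eventually_elim (use M(2) in \<open>auto simp: indicator_def\<close>)
  qed (rule i)
  also have "\<dots> = M * measure lebesgue (cell l x)"
    using sets.sets_into_space[OF cell_sets_lebesgue, of l x] by (simp add: Int_absorb2)
  also have "measure lebesgue (cell l x) = l ^ DIM('a)"
    unfolding measure_def emeasure_cell[OF l] using l by simp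
  finally show ?thesis
    using l by (simp add: avg_def field_simps)
qed

text \<open>A fractional Poincare inequality on one cell. There the kernel is at least (N
  l)^(-(N+2s)), and division by the volume l^N leaves l^(2s). Young's inequality |t| \<le>
  \<delta>/2 + t^2/(2\<delta>) makes the bound linear in the inner integral of the seminorm, so that
  it can be integrated against any bounded weight of finite integral.\<close>

lemma avg_diff_pointwise:
  fixes u :: "'a::euclidean_space \<Rightarrow> real"
  assumes s: "0 < s" and l: "0 < l" and \<delta>: "0 < \<delta>"
    and u: "u \<in> borel_measurable lebesgue" "integrable lebesgue (\<lambda>x. (u x)\<^sup>2)"
  shows "ennreal \<bar>u x - avg l u x\<bar> \<le> ennreal (\<delta> / 2) +
    ennreal (real DIM('a) powr (real DIM('a) + 2 * s) * l powr (2 * s) / (2 * \<delta>)) *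
      (\<integral>\<^sup>+y. ennreal ((u x - u y)\<^sup>2 * kern s (x - y)) \<partial>lebesgue)"
proof -
  note [measurable] = u(1) cell_sets_lebesgue
  let ?N = "real DIM('a)" and ?n = "DIM('a)"
  let ?I = "indicator (cell l x) :: 'a \<Rightarrow> real"
  define \<kappa> where "\<kappa> = (?N * l) powr (?N + 2 * s)"
  have ln: "0 < l ^ ?n" using l by simp
  have mc: "measure lebesgue (cell l x) = l ^ ?n"
    unfolding measure_def emeasure_cell[OF l] using l by simp
  have Ii: "integrable lebesgue ?I"
    by (rule integrable_real_indicator[OF cell_sets_lebesgue]) (simp add: emeasure_cell[OF l])
  have IL: "(LINT y|lebesgue. ?I y) = l ^ ?n"
    using sets.sets_into_space[OF cell_sets_lebesgue, of l x] by (simp add: Int_absorb2 mc)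
  have Iu: "integrable lebesgue (\<lambda>y. ?I y * u y)" by (rule avg_integrable[OF l u])
  have "(LINT y|lebesgue. ?I y * (u x - u y)) = (LINT y|lebesgue. u x * ?I y - ?I y * u y)"
    by (simp add: algebra_simps)
  also have "\<dots> = u x * l ^ ?n - (LINT y|lebesgue. ?I y * u y)"
    using Ii Iu by (simp add: mc)
  also have "\<dots> = l ^ ?n * (u x - avg l u x)"
    using ln l by (simp add: avg_def field_simps)
  finally have eq: "l ^ ?n * (u x - avg l u x) = (LINT y|lebesgue. ?I y * (u x - u y))" by simp
  have ae: "ennreal (l ^ ?n) * ennreal \<bar>u x - avg l u x\<bar> = ennreal (norm (LINT y|lebesgue. ?I y * (u x - u y)))"
    unfolding eq[symmetric] using ln by (simp add: abs_mult ennreal_mult')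
  also have "\<dots> \<le> (\<integral>\<^sup>+y. ennreal (norm (?I y * (u x - u y))) \<partial>lebesgue)"
  proof (rule integral_norm_bound_ennreal)
    have "integrable lebesgue (\<lambda>y. u x * ?I y - ?I y * u y)" using Ii Iu by simp
    then show "integrable lebesgue (\<lambda>y. ?I y * (u x - u y))" by (simp add: algebra_simps)
  qed
  also have "\<dots> \<le> (\<integral>\<^sup>+y. ennreal (\<delta> / 2) * indicator (cell l x) y + ennreal (\<kappa> / (2 * \<delta>)) * ennreal ((u x - u y)\<^sup>2 * kern s (x - y)) \<partial>lebesgue)"
  proof (rule nn_integral_mono)
    fix y :: 'a
    show "ennreal (norm (?I y * (u x - u y))) \<le> ennreal (\<delta> / 2) * indicator (cell l x) y + ennreal (\<kappa> / (2 * \<delta>)) * ennreal ((u x - u y)\<^sup>2 * kern s (x - y))"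
    proof (cases "y \<in> cell l x")
      case True
      have \<kappa>: "(u x - u y)\<^sup>2 \<le> \<kappa> * ((u x - u y)\<^sup>2 * kern s (x - y))"
      proof (cases "x = y")
        case False
        have "norm (x - y) \<le> ?N * l" by (rule cell_norm[OF l True])
        then have "norm (x - y) powr (?N + 2 * s) \<le> \<kappa>"
          unfolding \<kappa>_def using s by (intro powr_mono2) auto
        then have "1 \<le> \<kappa> * kern s (x - y)"
          using False by (simp add: kern_def field_simps)
        then have "(u x - u y)\<^sup>2 * 1 \<le> (u x - u y)\<^sup>2 * (\<kappa> * kern s (x - y))"
          by (intro mult_left_mono) auto
        then show ?thesis by (simp add: mult_ac)
      qed simp
      have "\<bar>t\<bar> \<le> \<delta> / 2 + t\<^sup>2 / (2 * \<delta>)" for t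
      proof -
        have "0 \<le> (\<bar>t\<bar> - \<delta>)\<^sup>2 / (2 * \<delta>)" using \<delta> by simp
        also have "\<dots> = \<delta> / 2 + t\<^sup>2 / (2 * \<delta>) - \<bar>t\<bar>"
          using \<delta> by (simp add: power2_diff power2_eq_square field_simps)
        finally show ?thesis by simp
      qed
      then have "\<bar>u x - u y\<bar> \<le> \<delta> / 2 + (u x - u y)\<^sup>2 / (2 * \<delta>)" .
      also have "\<dots> \<le> \<delta> / 2 + \<kappa> * ((u x - u y)\<^sup>2 * kern s (x - y)) / (2 * \<delta>)"
        using \<kappa> \<delta> by (intro add_left_mono divide_right_mono) auto
      also have "\<dots> = \<delta> / 2 + \<kappa> / (2 * \<delta>) * ((u x - u y)\<^sup>2 * kern s (x - y))" by simp
      finally have "ennreal \<bar>u x - u y\<bar> \<le> ennreal (\<delta> / 2 + \<kappa> / (2 * \<delta>) * ((u x - u y)\<^sup>2 * kern s (x - y)))"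
        by (rule ennreal_leI)
      also have "\<dots> = ennreal (\<delta> / 2) + ennreal (\<kappa> / (2 * \<delta>)) * ennreal ((u x - u y)\<^sup>2 * kern s (x - y))"
        using \<delta> by (subst ennreal_plus) (auto simp: ennreal_mult'[symmetric] \<kappa>_def)
      finally show ?thesis using True by simp
    qed simp
  qed
  also have "\<dots> = ennreal (\<delta> / 2) * ennreal (l ^ ?n) + ennreal (\<kappa> / (2 * \<delta>)) * (\<integral>\<^sup>+y. ennreal ((u x - u y)\<^sup>2 * kern s (x - y)) \<partial>lebesgue)"
    by (subst nn_integral_add, measurable)
      (simp add: nn_integral_cmult nn_integral_cmult_indicator[OF cell_sets_lebesgue] emeasure_cell[OF l])
  finally have main: "ennreal (l ^ ?n) * ennreal \<bar>u x - avg l u x\<bar> \<le> ennreal (\<delta> / 2) * ennreal (l ^ ?n) + ennreal (\<kappa> / (2 * \<delta>)) * (\<integral>\<^sup>+y. ennreal ((u x - u y)\<^sup>2 * kern s (x - y)) \<partial>lebesgue)" .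
  let ?J = "\<integral>\<^sup>+y. ennreal ((u x - u y)\<^sup>2 * kern s (x - y)) \<partial>lebesgue"
  have "\<kappa> = ?N powr (?N + 2 * s) * (l powr ?N * l powr (2 * s))"
    using l by (simp add: \<kappa>_def powr_mult powr_add)
  then have k: "inverse (l ^ ?n) * (\<kappa> / (2 * \<delta>)) = ?N powr (?N + 2 * s) * l powr (2 * s) / (2 * \<delta>)"
    using l by (simp add: powr_realpow field_simps)
  have i1: "ennreal (inverse (l ^ ?n)) * ennreal (l ^ ?n) = 1"
    using ln l by (simp add: ennreal_mult'[symmetric])
  have "ennreal \<bar>u x - avg l u x\<bar> = ennreal (inverse (l ^ ?n)) * (ennreal (l ^ ?n) * ennreal \<bar>u x - avg l u x\<bar>)"
    by (simp add: mult.assoc[symmetric] i1)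
  also have "\<dots> \<le> ennreal (inverse (l ^ ?n)) * (ennreal (\<delta> / 2) * ennreal (l ^ ?n) + ennreal (\<kappa> / (2 * \<delta>)) * ?J)"
    by (intro mult_left_mono main) auto
  also have "\<dots> = (ennreal (inverse (l ^ ?n)) * ennreal (l ^ ?n)) * ennreal (\<delta> / 2) + (ennreal (inverse (l ^ ?n)) * ennreal (\<kappa> / (2 * \<delta>))) * ?J"
    by (simp only: distrib_left mult_ac)
  also have "ennreal (inverse (l ^ ?n)) * ennreal (\<kappa> / (2 * \<delta>)) = ennreal (?N powr (?N + 2 * s) * l powr (2 * s) / (2 * \<delta>))"
    unfolding k[symmetric] using ln by (intro ennreal_mult'[symmetric]) simp
  finally show ?thesis unfolding i1 by simp
qed

text \<open>At a fixed scale the cell averages converge along a subsequence, and by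
  \<open>avg_diff_pointwise\<close> they are close in weighted L^1 to the functions themselves,
  uniformly in k. The subsequence is therefore Cauchy in weighted L^1, and a further one converges
  almost everywhere. Uniform boundedness gives convergence of the averages and the dominating
  constants.\<close>

lemma local_compactness:
  fixes u :: "nat \<Rightarrow> 'a::euclidean_space \<Rightarrow> real"
  assumes s: "0 < s" and u: "\<And>k. u k \<in> Hs s" and D: "\<And>k. gag s (u k) \<le> D"
    and M: "\<And>k. AE x in lebesgue. \<bar>u k x\<bar> \<le> M" "0 \<le> M"
  obtains r u0 where "strict_mono r" "u0 \<in> borel_measurable lebesgue"
    "AE x in lebesgue. (\<lambda>k. u (r k) x) \<longlonglongrightarrow> u0 x"
proof -
  note um[measurable] = Hs_measurable[OF u]
  have D0: "0 \<le> D" using order_trans[OF gag_nonneg D[of 0]] .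
  define l where "l = (\<lambda>m::nat. 1 / (real m + 1))"
  have l: "0 < l m" for m by (simp add: l_def)
  \<comment> \<open>Every cell contains an open box and hence a point of C, so convergence of the
    averages at countably many pairs of a scale and a point is enough, and a diagonal extraction
    provides it.\<close>
  obtain C :: "'a set" where C: "countable C" "\<And>X. open X \<Longrightarrow> X \<noteq> {} \<Longrightarrow> \<exists>d\<in>C. d \<in> X"
    using countable_dense_exists by metis
  have bd: "norm (avg (l (fst p)) (u k) (snd p)) \<le> M" for p :: "nat \<times> 'a" and k
    unfolding real_norm_def by (rule avg_bound[OF l um Hs_L2[OF u] M])
  have cS: "countable ((UNIV :: nat set) \<times> C)"
    using C(1) by (intro countable_SIGMA) auto
  have "\<exists>r0 :: nat \<Rightarrow> nat. strict_mono r0 \<and>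
      (\<forall>p \<in> UNIV \<times> C. \<exists>L. (\<lambda>k. avg (l (fst p)) (u (r0 k)) (snd p)) \<longlonglongrightarrow> L)"
    by (rule function_convergent_subsequence[OF cS, of "\<lambda>k p. avg (l (fst p)) (u k) (snd p)" M])
      (rule bd, blast)
  then obtain r0 :: "nat \<Rightarrow> nat" where r0: "strict_mono r0"
    and conv: "\<And>p. p \<in> UNIV \<times> C \<Longrightarrow> \<exists>L. (\<lambda>k. avg (l (fst p)) (u (r0 k)) (snd p)) \<longlonglongrightarrow> L"
    by blast
  define v where "v = (\<lambda>k. u (r0 k))"
  have v: "v k \<in> Hs s" and gv: "gag s (v k) \<le> D" and vM: "AE x in lebesgue. \<bar>v k x\<bar> \<le> M"
    and vm[measurable]: "v k \<in> borel_measurable lebesgue" for k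
    using u D M um by (simp_all add: v_def)
  have avg_conv: "\<exists>L. (\<lambda>k. avg (l m) (v k) x) \<longlonglongrightarrow> L" for m x
  proof -
    obtain a b where ab: "box a b \<subseteq> cell (l m) x" "\<And>i. i \<in> Basis \<Longrightarrow> a \<bullet> i < b \<bullet> i"
      using cell_between[OF l] by metis
    have "box a b \<noteq> {}" using ab(2) by (simp add: box_ne_empty)
    then obtain c where c: "c \<in> C" "c \<in> box a b" using C(2)[OF open_box] by blast
    then have "cell (l m) c = cell (l m) x" using ab(1) by (intro cell_eq) auto
    then have "avg (l m) (v k) x = avg (l m) (v k) c" for k by (simp add: avg_def)
    then show ?thesis using conv[of "(m, c)"] c by (simp add: v_def)
  qed
  define a where "a = (\<lambda>m x. lim (\<lambda>k. avg (l m) (v k) x))"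
  have a: "(\<lambda>k. avg (l m) (v k) x) \<longlonglongrightarrow> a m x" for m x
    unfolding a_def using avg_conv by (simp add: convergent_def convergent_LIMSEQ_iff[symmetric])
  have am[measurable]: "a m \<in> borel_measurable lebesgue" for m
    by (rule borel_measurable_LIMSEQ_real[OF a avg_measurable[OF vm]])
  have aM: "\<bar>a m x\<bar> \<le> M" for m x
  proof (rule LIMSEQ_le_const2[OF tendsto_rabs[OF a]])
    show "\<exists>N. \<forall>n\<ge>N. \<bar>avg (l m) (v n) x\<bar> \<le> M"
      using avg_bound[OF l vm Hs_L2[OF v] vM M(2)] by blast
  qed
  \<comment> \<open>A positive integrable density makes Lebesgue measure finite without changing its
    null sets; this replaces an exhaustion by balls. Capping it at 1 ensures that the weighted
    seminorm integral does not exceed the unweighted one.\<close>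
  obtain h :: "'a \<Rightarrow> ennreal" where hm[measurable]: "h \<in> borel_measurable lebesgue" and h: "integral\<^sup>N lebesgue h \<noteq> \<infinity>" "\<And>x. 0 < h x"
    using leb.Ex_finite_integrable_function[where 'a='a] by auto
  define \<rho> where "\<rho> = (\<lambda>x. min 1 (h x))"
  have \<rho>m[measurable]: "\<rho> \<in> borel_measurable lebesgue" unfolding \<rho>_def by measurable
  have \<rho>: "0 < \<rho> x" "\<rho> x \<le> 1" for x using h(2) by (auto simp: \<rho>_def)
  have "integral\<^sup>N lebesgue \<rho> \<le> integral\<^sup>N lebesgue h"
    by (intro nn_integral_mono) (simp add: \<rho>_def)
  then have \<rho>fin: "integral\<^sup>N lebesgue \<rho> < \<infinity>" using h(1) by (simp add: le_less_trans less_top)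
  define \<nu> where "\<nu> = density lebesgue \<rho>"
  have AE_\<nu>: "(AE x in \<nu>. P x) \<longleftrightarrow> (AE x in lebesgue. P x)" for P
    unfolding \<nu>_def using \<rho>(1) by (simp add: AE_density)
  have m\<nu>: "f \<in> borel_measurable \<nu> \<longleftrightarrow> f \<in> borel_measurable lebesgue" for f :: "'a \<Rightarrow> real"
    by (simp add: \<nu>_def)
  have nn\<nu>: "f \<in> borel_measurable lebesgue \<Longrightarrow> (\<integral>\<^sup>+x. f x \<partial>\<nu>) = (\<integral>\<^sup>+x. \<rho> x * f x \<partial>lebesgue)" for f
    unfolding \<nu>_def by (rule nn_integral_density[OF \<rho>m])
  interpret \<nu>: finite_measure \<nu>
  proof
    have "emeasure \<nu> (space \<nu>) = (\<integral>\<^sup>+x. \<rho> x * indicator (space lebesgue) x \<partial>lebesgue)"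
      unfolding \<nu>_def by (subst emeasure_density[OF \<rho>m]) auto
    also have "\<dots> = integral\<^sup>N lebesgue \<rho>" by (intro nn_integral_cong) simp
    finally show "emeasure \<nu> (space \<nu>) \<noteq> \<infinity>" using \<rho>fin by simp
  qed
  have vi: "integrable \<nu> (v k)" for k
    by (rule \<nu>.integrable_const_bound[where B=M]) (simp_all add: AE_\<nu> vM m\<nu>)
  have avi: "integrable \<nu> (avg (l m) (v k))" for m k
    by (rule \<nu>.integrable_const_bound[where B=M]) (simp_all add: m\<nu> avg_measurable avg_bound[OF l vm Hs_L2[OF v] vM M(2)])
  have ai: "integrable \<nu> (a m)" for m
    by (rule \<nu>.integrable_const_bound[where B=M]) (simp_all add: m\<nu> aM)
  define V where "V = enn2real (integral\<^sup>N lebesgue \<rho>)"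
  have V: "0 \<le> V" "integral\<^sup>N lebesgue \<rho> = ennreal V" using \<rho>fin by (simp_all add: V_def less_top)
  define c where "c = (\<lambda>m \<delta>. real DIM('a) powr (real DIM('a) + 2 * s) * l m powr (2 * s) / (2 * \<delta>))"
  have first: "(LINT x|\<nu>. \<bar>v k x - avg (l m) (v k) x\<bar>) \<le> \<delta> / 2 * V + c m \<delta> * D" if \<delta>: "0 < \<delta>" for k m \<delta>
  proof -
    let ?J = "\<lambda>x. \<integral>\<^sup>+y. ennreal ((v k x - v k y)\<^sup>2 * kern s (x - y)) \<partial>lebesgue"
    have Jm: "?J \<in> borel_measurable lebesgue" by measurable
    note [measurable] = avg_measurable[OF vm]
    have c0: "0 \<le> c m \<delta>" using \<delta> by (simp add: c_def)
    have "(\<integral>\<^sup>+x. ennreal \<bar>v k x - avg (l m) (v k) x\<bar> \<partial>\<nu>) = (\<integral>\<^sup>+x. \<rho> x * ennreal \<bar>v k x - avg (l m) (v k) x\<bar> \<partial>lebesgue)"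
      by (rule nn\<nu>) measurable
    also have "\<dots> \<le> (\<integral>\<^sup>+x. ennreal (\<delta> / 2) * \<rho> x + ennreal (c m \<delta>) * ?J x \<partial>lebesgue)"
    proof (rule nn_integral_mono)
      fix x
      have "\<rho> x * ennreal \<bar>v k x - avg (l m) (v k) x\<bar> \<le> \<rho> x * (ennreal (\<delta> / 2) + ennreal (c m \<delta>) * ?J x)"
        unfolding c_def by (intro mult_left_mono avg_diff_pointwise[OF s l \<delta> vm Hs_L2[OF v]]) auto
      also have "\<dots> = ennreal (\<delta> / 2) * \<rho> x + \<rho> x * (ennreal (c m \<delta>) * ?J x)"
        by (simp add: distrib_left mult.commute)
      also have "\<dots> \<le> ennreal (\<delta> / 2) * \<rho> x + 1 * (ennreal (c m \<delta>) * ?J x)"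
        by (intro add_left_mono mult_right_mono \<rho>) auto
      finally show "\<rho> x * ennreal \<bar>v k x - avg (l m) (v k) x\<bar> \<le> ennreal (\<delta> / 2) * \<rho> x + ennreal (c m \<delta>) * ?J x"
        by simp
    qed
    also have "\<dots> = ennreal (\<delta> / 2) * integral\<^sup>N lebesgue \<rho> + ennreal (c m \<delta>) * integral\<^sup>N lebesgue ?J"
      using Jm by (subst nn_integral_add) (simp_all add: nn_integral_cmult)
    also have "integral\<^sup>N lebesgue ?J = ennreal (gag s (v k))"
      using ngag_eq[OF v] by (simp add: ngag_def)
    also have "ennreal (\<delta> / 2) * integral\<^sup>N lebesgue \<rho> + ennreal (c m \<delta>) * ennreal (gag s (v k)) =
        ennreal (\<delta> / 2 * V + c m \<delta> * gag s (v k))"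
      using V \<delta> c0 by (simp add: ennreal_mult'[symmetric] ennreal_plus[symmetric] del: ennreal_plus)
    also have "\<dots> \<le> ennreal (\<delta> / 2 * V + c m \<delta> * D)"
      using c0 by (intro ennreal_leI add_left_mono mult_left_mono gv) auto
    finally have le: "(\<integral>\<^sup>+x. ennreal \<bar>v k x - avg (l m) (v k) x\<bar> \<partial>\<nu>) \<le> ennreal (\<delta> / 2 * V + c m \<delta> * D)" .
    have "ennreal (LINT x|\<nu>. \<bar>v k x - avg (l m) (v k) x\<bar>) = (\<integral>\<^sup>+x. ennreal \<bar>v k x - avg (l m) (v k) x\<bar> \<partial>\<nu>)"
      using vi avi by (intro nn_integral_eq_integral[symmetric]) auto
    with le have "ennreal (LINT x|\<nu>. \<bar>v k x - avg (l m) (v k) x\<bar>) \<le> ennreal (\<delta> / 2 * V + c m \<delta> * D)" by simp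
    then show ?thesis using V c0 D0 \<delta> by (subst (asm) ennreal_le_iff) auto
  qed
  have second: "(\<lambda>k. LINT x|\<nu>. \<bar>avg (l m) (v k) x - a m x\<bar>) \<longlonglongrightarrow> 0" for m
  proof -
    have "(\<lambda>k. LINT x|\<nu>. \<bar>avg (l m) (v k) x - a m x\<bar>) \<longlonglongrightarrow> (LINT x|\<nu>. 0)"
    proof (rule integral_dominated_convergence[where w = "\<lambda>_. 2 * M"])
      show "AE x in \<nu>. (\<lambda>k. \<bar>avg (l m) (v k) x - a m x\<bar>) \<longlonglongrightarrow> 0"
        by (rule AE_I2) (intro tendsto_rabs_zero LIM_zero a)
      fix k
      show "AE x in \<nu>. norm \<bar>avg (l m) (v k) x - a m x\<bar> \<le> 2 * M"
      proof (rule AE_I2)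
        fix x
        show "norm \<bar>avg (l m) (v k) x - a m x\<bar> \<le> 2 * M"
          using avg_bound[OF l vm Hs_L2[OF v] vM M(2), of m k x] aM[of m x] by simp
      qed
      show "(\<lambda>x. \<bar>avg (l m) (v k) x - a m x\<bar>) \<in> borel_measurable \<nu>"
        using avi ai by (intro borel_measurable_integrable) auto
    qed auto
    then show ?thesis by simp
  qed
  have cauchy: "\<exists>n. \<forall>i\<ge>n. \<forall>j\<ge>n. (LINT x|\<nu>. norm (v i x - v j x)) < e" if e: "0 < e" for e
  proof -
    define W where "W = V + 1"
    have W: "0 < W" "V \<le> W" using V(1) by (simp_all add: W_def)
    \<comment> \<open>The error of averaging is \<delta>/2 times the total mass plus a multiple of
      the seminorm: \<delta> is fixed first to make the former at most e/10, then the scale m makes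
      the latter smaller than e/10.\<close>
    define \<delta> where "\<delta> = e / (5 * W)"
    have \<delta>: "0 < \<delta>" using e W by (simp add: \<delta>_def)
    have "\<delta> * V \<le> \<delta> * W" using \<delta> W by (intro mult_left_mono) auto
    also have "\<delta> * W = e / 5" using W by (simp add: \<delta>_def)
    finally have "\<delta> * V \<le> e / 5" .
    moreover have "\<delta> / 2 * V = \<delta> * V / 2" by simp
    ultimately have d1: "\<delta> / 2 * V \<le> e / 10" by linarith
    have "(\<lambda>m. l m) \<longlonglongrightarrow> 0"
      unfolding l_def using LIMSEQ_inverse_real_of_nat by (simp add: inverse_eq_divide add.commute)
    then have "(\<lambda>m. l m powr (2 * s)) \<longlonglongrightarrow> 0"
      by (rule tendsto_zero_powrI[OF _ tendsto_const]) (use s l in \<open>auto simp: less_imp_le\<close>)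
    then have "(\<lambda>m. real DIM('a) powr (real DIM('a) + 2 * s) * l m powr (2 * s) / (2 * \<delta>) * D) \<longlonglongrightarrow>
        real DIM('a) powr (real DIM('a) + 2 * s) * 0 / (2 * \<delta>) * D"
      by (intro tendsto_intros) (use \<delta> in auto)
    then have "(\<lambda>m. c m \<delta> * D) \<longlonglongrightarrow> 0" by (simp add: c_def)
    then have "\<forall>\<^sub>F m in sequentially. c m \<delta> * D < e / 10"
      by (rule order_tendstoD) (use e in simp)
    then obtain m where m: "c m \<delta> * D < e / 10" by (auto simp: eventually_sequentially)
    have 1: "(LINT x|\<nu>. \<bar>v k x - avg (l m) (v k) x\<bar>) < e / 4" for k
      using first[OF \<delta>, of k m] d1 m e by linarith
    have "\<forall>\<^sub>F k in sequentially. (LINT x|\<nu>. \<bar>avg (l m) (v k) x - a m x\<bar>) < e / 4"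
      by (rule order_tendstoD[OF second]) (use e in simp)
    then obtain n where n: "\<And>k. n \<le> k \<Longrightarrow> (LINT x|\<nu>. \<bar>avg (l m) (v k) x - a m x\<bar>) < e / 4"
      by (auto simp: eventually_sequentially)
    have "(LINT x|\<nu>. norm (v i x - v j x)) < e" if ij: "n \<le> i" "n \<le> j" for i j
    proof -
      have "(LINT x|\<nu>. norm (v i x - v j x)) \<le> (LINT x|\<nu>. (\<bar>v i x - avg (l m) (v i) x\<bar> + \<bar>avg (l m) (v i) x - a m x\<bar>) +
          (\<bar>v j x - avg (l m) (v j) x\<bar> + \<bar>avg (l m) (v j) x - a m x\<bar>))"
        using vi avi ai by (intro integral_mono) auto
      also have "\<dots> = ((LINT x|\<nu>. \<bar>v i x - avg (l m) (v i) x\<bar>) + (LINT x|\<nu>. \<bar>avg (l m) (v i) x - a m x\<bar>)) +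
          ((LINT x|\<nu>. \<bar>v j x - avg (l m) (v j) x\<bar>) + (LINT x|\<nu>. \<bar>avg (l m) (v j) x - a m x\<bar>))"
        using vi avi ai by simp
      finally show ?thesis using 1[of i] 1[of j] n[OF ij(1)] n[OF ij(2)] by linarith
    qed
    then show ?thesis by blast
  qed
  obtain r1 :: "nat \<Rightarrow> nat" where r1: "strict_mono r1" "AE x in \<nu>. Cauchy (\<lambda>i. v (r1 i) x)"
    using cauchy_L1_AE_cauchy_subseq[OF vi cauchy] by blast
  define u0 where "u0 = (\<lambda>x. lim (\<lambda>i. v (r1 i) x))"
  show thesis
  proof (rule that[of "r0 \<circ> r1" u0])
    show "strict_mono (r0 \<circ> r1)" by (rule strict_mono_o[OF r0 r1(1)])
    show "u0 \<in> borel_measurable lebesgue"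
      unfolding u0_def by (rule borel_measurable_lim_metric) (rule vm)
    have "AE x in lebesgue. Cauchy (\<lambda>i. v (r1 i) x)" using r1(2) by (simp add: AE_\<nu>)
    then show "AE x in lebesgue. (\<lambda>k. u ((r0 \<circ> r1) k) x) \<longlonglongrightarrow> u0 x"
      by eventually_elim (simp add: u0_def v_def Cauchy_convergent_iff convergent_LIMSEQ_iff)
  qed
qed

text \<open>
  Fatou's lemma for \<open>2 f\<^sub>n\<^sup>2 + 2 f\<^sup>2 - (f\<^sub>n - f)\<^sup>2 \<ge> 0\<close> replaces weak convergence.
\<close>

lemma tendsto_L2_of_norm:
  fixes f :: "nat \<Rightarrow> 'b \<Rightarrow> real"
  assumes fm: "\<And>n. f n \<in> borel_measurable M" and gm: "g \<in> borel_measurable M"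
    and fi: "\<And>n. integrable M (\<lambda>x. (f n x)\<^sup>2)" and gi: "integrable M (\<lambda>x. (g x)\<^sup>2)"
    and ae: "AE x in M. (\<lambda>n. f n x) \<longlonglongrightarrow> g x"
    and lim: "(\<lambda>n. LINT x|M. (f n x)\<^sup>2) \<longlonglongrightarrow> (LINT x|M. (g x)\<^sup>2)"
  shows "(\<lambda>n. LINT x|M. (f n x - g x)\<^sup>2) \<longlonglongrightarrow> 0"
proof -
  note [measurable] = fm gm
  let ?a = "LINT x|M. (g x)\<^sup>2"
  define A where "A = (\<lambda>n. LINT x|M. (f n x)\<^sup>2)"
  define d where "d = (\<lambda>n. LINT x|M. (f n x - g x)\<^sup>2)"
  have di: "integrable M (\<lambda>x. (f n x - g x)\<^sup>2)" for n
    using integrable_square_add[of "f n" M "\<lambda>x. - g x"] fm gm fi gi by simp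
  have d0: "0 \<le> d n" for n unfolding d_def by (rule integral_nonneg_AE) simp
  have a0: "0 \<le> ?a" by (rule integral_nonneg_AE) simp
  let ?h = "\<lambda>n x. 2 * (f n x)\<^sup>2 + 2 * (g x)\<^sup>2 - (f n x - g x)\<^sup>2"
  have h0: "0 \<le> ?h n x" for n x using power2_diff_le[of "f n x" "g x"] by simp
  have hi: "integrable M (?h n)" for n using fi gi di by simp
  have hI: "(\<integral>\<^sup>+x. ennreal (?h n x) \<partial>M) = ennreal (2 * A n + 2 * ?a - d n)" for n
    using nn_integral_eq_integral[OF hi[of n] AE_I2[OF h0]] fi gi di by (simp add: A_def d_def)
  have "ennreal (4 * ?a) = (\<integral>\<^sup>+x. ennreal (4 * (g x)\<^sup>2) \<partial>M)"
    using nn_integral_eq_integral[of M "\<lambda>x. 4 * (g x)\<^sup>2"] gi by simp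
  also have "\<dots> = (\<integral>\<^sup>+x. liminf (\<lambda>n. ennreal (?h n x)) \<partial>M)"
  proof (rule nn_integral_cong_AE)
    show "AE x in M. ennreal (4 * (g x)\<^sup>2) = liminf (\<lambda>n. ennreal (?h n x))"
      using ae
    proof eventually_elim
      case (elim x)
      have "(\<lambda>n. ?h n x) \<longlonglongrightarrow> 2 * (g x)\<^sup>2 + 2 * (g x)\<^sup>2 - (g x - g x)\<^sup>2"
        by (intro tendsto_intros elim)
      then have "(\<lambda>n. ennreal (?h n x)) \<longlonglongrightarrow> ennreal (4 * (g x)\<^sup>2)"
        by (intro tendsto_ennrealI) simp
      then show ?case by (rule lim_imp_Liminf[symmetric, rotated]) simp
    qed
  qed
  also have "\<dots> \<le> liminf (\<lambda>n. (\<integral>\<^sup>+x. ennreal (?h n x) \<partial>M))"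
    by (rule nn_integral_liminf) measurable
  finally have fatou: "ennreal (4 * ?a) \<le> liminf (\<lambda>n. ennreal (2 * A n + 2 * ?a - d n))"
    unfolding hI .
  have "(\<lambda>n. d n) \<longlonglongrightarrow> 0"
  proof (rule order_tendstoI)
    fix e :: real assume "e < 0"
    then have "e < d n" for n using d0[of n] by linarith
    then show "\<forall>\<^sub>F n in sequentially. e < d n" by simp
  next
    fix e :: real assume e: "0 < e"
    have A_lt: "\<forall>\<^sub>F n in sequentially. A n < ?a + e / 4"
      using lim e unfolding A_def by (intro order_tendstoD(2)[OF lim]) simp
    have "\<forall>\<^sub>F n in sequentially. 4 * ?a - e / 2 < 2 * A n + 2 * ?a - d n"
    \<comment> \<open>A negative lower bound would be truncated to 0 by \<open>ennreal\<close>; it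
      is served by nonnegativity of the integrand instead of the Fatou estimate.\<close>
    proof (cases "4 * ?a - e / 2 < 0")
      case True
      have "0 \<le> 2 * A n + 2 * ?a - d n" for n
      proof -
        have "0 \<le> (LINT x|M. ?h n x)" by (rule integral_nonneg_AE[OF AE_I2[OF h0]])
        also have "\<dots> = 2 * A n + 2 * ?a - d n" using fi gi di by (simp add: A_def d_def)
        finally show ?thesis .
      qed
      with True have "4 * ?a - e / 2 < 2 * A n + 2 * ?a - d n" for n
        by (rule order.strict_trans2)
      then show ?thesis by simp
    next
      case False
      then have "ennreal (4 * ?a - e / 2) < ennreal (4 * ?a)" using e by (intro ennreal_lessI) auto
      then have "ennreal (4 * ?a - e / 2) < liminf (\<lambda>n. ennreal (2 * A n + 2 * ?a - d n))"
        using fatou by (rule order.strict_trans2)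
      then have "\<forall>\<^sub>F n in sequentially. ennreal (4 * ?a - e / 2) < ennreal (2 * A n + 2 * ?a - d n)"
        by (rule less_LiminfD)
      then show ?thesis
        by eventually_elim (use False in \<open>simp add: ennreal_less_iff\<close>)
    qed
    then show "\<forall>\<^sub>F n in sequentially. d n < e"
      using A_lt by eventually_elim linarith
  qed
  then show ?thesis by (simp add: d_def)
qed

section \<open>Almost everywhere limits, on points and on pairs of points\<close>

lemma Fatou_integrable:
  fixes f :: "nat \<Rightarrow> 'b \<Rightarrow> real"
  assumes fm: "\<And>n. f n \<in> borel_measurable M" and gm: "g \<in> borel_measurable M"
    and fi: "\<And>n. integrable M (f n)" and f0: "\<And>n. AE x in M. 0 \<le> f n x"
    and ae: "AE x in M. (\<lambda>n. f n x) \<longlonglongrightarrow> g x" and B: "\<And>n. (LINT x|M. f n x) \<le> B"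
  shows "integrable M g" "(LINT x|M. g x) \<le> B"
proof -
  note [measurable] = fm gm
  have B0: "0 \<le> B" using order_trans[OF integral_nonneg_AE[OF f0[of 0]] B[of 0]] .
  have g0: "AE x in M. 0 \<le> g x"
  proof -
    have "AE x in M. \<forall>n. 0 \<le> f n x" using f0 by (simp add: AE_all_countable)
    then show ?thesis using ae
      by eventually_elim (rule LIMSEQ_le_const, auto)
  qed
  have "(\<integral>\<^sup>+x. ennreal (g x) \<partial>M) = (\<integral>\<^sup>+x. liminf (\<lambda>n. ennreal (f n x)) \<partial>M)"
  proof (rule nn_integral_cong_AE)
    show "AE x in M. ennreal (g x) = liminf (\<lambda>n. ennreal (f n x))"
      using ae
    proof eventually_elim
      case (elim x)
      then have "(\<lambda>n. ennreal (f n x)) \<longlonglongrightarrow> ennreal (g x)" by (rule tendsto_ennrealI)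
      then show ?case by (rule lim_imp_Liminf[symmetric, rotated]) simp
    qed
  qed
  also have "\<dots> \<le> liminf (\<lambda>n. (\<integral>\<^sup>+x. ennreal (f n x) \<partial>M))"
    by (rule nn_integral_liminf) measurable
  also have "\<dots> \<le> ennreal B"
  proof -
    have "(\<integral>\<^sup>+x. ennreal (f n x) \<partial>M) \<le> ennreal B" for n
      using nn_integral_eq_integral[OF fi f0, of n] B[of n] by (simp add: ennreal_leI)
    then have "liminf (\<lambda>n. (\<integral>\<^sup>+x. ennreal (f n x) \<partial>M)) \<le> liminf (\<lambda>n::nat. ennreal B)"
      by (intro Liminf_mono) simp
    then show ?thesis by (simp add: Liminf_const)
  qed
  finally have le: "(\<integral>\<^sup>+x. ennreal (g x) \<partial>M) \<le> ennreal B" .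
  show gi: "integrable M g"
    by (rule integrableI_nonneg[OF gm g0]) (use le in \<open>auto intro: le_less_trans\<close>)
  have "ennreal (LINT x|M. g x) \<le> ennreal B"
    using nn_integral_eq_integral[OF gi g0] le by simp
  then show "(LINT x|M. g x) \<le> B" using B0 by simp
qed

text \<open>The exceptional set is enclosed in a measurable null set, so that Fubini applies to it.
  This carries convergence of functions over to their Gagliardo forms.\<close>

lemma AE_lebesgue_pair:
  assumes "AE x in (lebesgue :: 'a::euclidean_space measure). P x"
  shows "AE p in (lebesgue :: 'a measure) \<Otimes>\<^sub>M (lebesgue :: 'a measure). P (fst p) \<and> P (snd p)"
proof -
  obtain N where N: "N \<in> null_sets lebesgue" "\<And>x. \<not> P x \<Longrightarrow> x \<in> N"
    using assms by (auto simp: eventually_ae_filter)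
  have Ns: "N \<in> sets lebesgue" using N(1) by (rule null_setsD2)
  have nN: "AE x in lebesgue. x \<notin> N" by (rule AE_not_in[OF N(1)])
  have "AE p in (lebesgue :: 'a measure) \<Otimes>\<^sub>M (lebesgue :: 'a measure). fst p \<notin> N \<and> snd p \<notin> N"
  proof (rule lebp.AE_pair_measure)
    show "{p \<in> space (lebesgue \<Otimes>\<^sub>M lebesgue). fst p \<notin> N \<and> snd p \<notin> N} \<in> sets (lebesgue \<Otimes>\<^sub>M (lebesgue :: 'a measure))"
      using Ns by measurable
    show "AE x in lebesgue. AE y in lebesgue. fst (x, y) \<notin> N \<and> snd (x, y) \<notin> N"
      using nN
    proof eventually_elim
      case (elim x)
      show ?case using nN by eventually_elim (simp add: elim)
    qed
  qed
  then show ?thesis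
    by eventually_elim (use N(2) in blast)
qed

text \<open>Presents the seminorm as a squared L^2 norm on pairs, the form in which
  \<open>tendsto_L2_of_norm\<close> applies to it.\<close>

lemma gagliardo_form_sq:
  "gagliardo_form s u u p = ((u (fst p) - u (snd p)) * sqrt (kern s (fst p - snd p)))\<^sup>2"
  by (cases p) (simp add: gagliardo_form_kern power_mult_distrib power2_eq_square)

lemma gagliardo_form_sq':
  "gagliardo_form s u u = (\<lambda>p. ((u (fst p) - u (snd p)) * sqrt (kern s (fst p - snd p)))\<^sup>2)"
  by (rule ext) (rule gagliardo_form_sq)

lemma gagliardo_form_tendsto:
  assumes "(\<lambda>k. u k (fst p)) \<longlonglongrightarrow> v (fst p)" "(\<lambda>k. u k (snd p)) \<longlonglongrightarrow> v (snd p)"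
  shows "(\<lambda>k. gagliardo_form s (u k) (u k) p) \<longlonglongrightarrow> gagliardo_form s v v p"
  unfolding gagliardo_form_sq by (intro tendsto_intros assms)

section \<open>Limits of blow-up sequences\<close>

context gn_setting
begin

lemma weight_ball_integrable:
  assumes "0 \<le> M"
  shows "integrable lebesgue (\<lambda>x::'a. M * (norm x powr (- b) * indicator (cball 0 R) x))"
proof -
  have b2: "0 < b" "b < real DIM('a)" using b by auto
  obtain C where C: "C > 0" "\<And>S. S \<in> sets lebesgue \<Longrightarrow> emeasure lebesgue S < \<infinity> \<Longrightarrow>
      (\<integral>\<^sup>+x. ennreal (norm x powr (- b)) * indicator S (x::'a) \<partial>lebesgue)
        \<le> ennreal (C * measure lebesgue S powr (1 - b / real DIM('a)))"
    using weight_set_bound[OF b2] by blast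
  have fin: "emeasure lebesgue (cball (0::'a) R) < \<infinity>"
    using emeasure_lborel_cball_finite[of "0::'a" R] by (simp add: emeasure_completion)
  have "(\<integral>\<^sup>+x. ennreal (norm x powr (- b)) * indicator (cball 0 R) (x::'a) \<partial>lebesgue) < \<infinity>"
    by (rule le_less_trans[OF C(2)[OF cball_sets_lebesgue fin]]) simp
  moreover have "ennreal (norm x powr (- b)) * indicator (cball 0 R) x = ennreal (norm x powr (- b) * indicator (cball 0 R) x)" for x :: 'a
    by (cases "x \<in> cball 0 R") simp_all
  ultimately have "(\<integral>\<^sup>+x. ennreal (norm x powr (- b) * indicator (cball 0 R) (x::'a)) \<partial>lebesgue) < \<infinity>"
    by simp
  moreover have "(\<lambda>x::'a. norm x powr (- b) * indicator (cball 0 R) x) \<in> borel_measurable lebesgue"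
    by measurable
  ultimately have "integrable lebesgue (\<lambda>x::'a. norm x powr (- b) * indicator (cball 0 R) x)"
    by (intro integrableI_nonneg) auto
  then show ?thesis by (rule integrable_mult_right)
qed

text \<open>Outside the ball the weight is at most R^(-b) and |w|^(2\<beta>^2) at most
  M^(2\<beta>^2), which leaves the mass. Because b > 0, no part of the nonlinear term can escape to
  infinity, and no translations are needed for compactness.\<close>

lemma weighted_int_tail:
  fixes w :: "'a \<Rightarrow> real"
  assumes w: "w \<in> Hs s" "L2_norm_sq w \<le> 1" and M: "AE x in lebesgue. \<bar>w x\<bar> \<le> M" "0 < M" and R: "0 < R"
  shows "weighted_int b \<beta> w \<le> (LINT x|lebesgue. norm x powr (- b) * \<bar>w x\<bar> powr (2 + 2 * \<beta>\<^sup>2) * indicator (cball 0 R) x)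
      + R powr (- b) * M powr (2 * \<beta>\<^sup>2)"
    and "integrable lebesgue (\<lambda>x. norm x powr (- b) * \<bar>w x\<bar> powr (2 + 2 * \<beta>\<^sup>2) * indicator (cball 0 R) x)"
    and "(LINT x|lebesgue. norm x powr (- b) * \<bar>w x\<bar> powr (2 + 2 * \<beta>\<^sup>2) * indicator (cball 0 R) x) \<le> weighted_int b \<beta> w"
proof -
  note [measurable] = Hs_measurable[OF w(1)]
  let ?g = "\<lambda>x. norm x powr (- b) * \<bar>w x\<bar> powr (2 + 2 * \<beta>\<^sup>2)"
  have g: "integrable lebesgue ?g" by (rule weighted_integrable[OF w(1)])
  show gi: "integrable lebesgue (\<lambda>x. ?g x * indicator (cball 0 R) x)"
    using integrable_mult_indicator[OF cball_sets_lebesgue g, of 0 R] by (simp add: mult.commute)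
  show "(LINT x|lebesgue. ?g x * indicator (cball 0 R) x) \<le> weighted_int b \<beta> w"
    unfolding weighted_int_def using g gi by (intro integral_mono) (auto simp: indicator_def)
  have L2: "integrable lebesgue (\<lambda>x. (w x)\<^sup>2)" by (rule Hs_L2[OF w(1)])
  define \<kappa> where "\<kappa> = R powr (- b) * M powr (2 * \<beta>\<^sup>2)"
  have \<kappa>: "0 \<le> \<kappa>" by (simp add: \<kappa>_def)
  have "weighted_int b \<beta> w \<le> (LINT x|lebesgue. ?g x * indicator (cball 0 R) x + \<kappa> * (w x)\<^sup>2)"
    unfolding weighted_int_def
  proof (rule integral_mono_AE[OF g])
    show "integrable lebesgue (\<lambda>x. ?g x * indicator (cball 0 R) x + \<kappa> * (w x)\<^sup>2)" using gi L2 by simp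
    show "AE x in lebesgue. ?g x \<le> ?g x * indicator (cball 0 R) x + \<kappa> * (w x)\<^sup>2"
      using M(1)
    proof eventually_elim
      case (elim x)
      show ?case
      proof (cases "norm x \<le> R")
        case True
        then show ?thesis using \<kappa> by simp
      next
        case False
        have n: "norm x powr (- b) \<le> R powr (- b)" using False R b by (intro powr_mono2') auto
        have "\<bar>w x\<bar> powr (2 + 2 * \<beta>\<^sup>2) = \<bar>w x\<bar> powr (2 * \<beta>\<^sup>2) * (w x)\<^sup>2"
        proof (cases "w x = 0")
          case False
          have "2 + 2 * \<beta>\<^sup>2 = 2 * \<beta>\<^sup>2 + 2" by simp
          then show ?thesis using False by (simp only: powr_add) simp
        qed simp
        also have "\<dots> \<le> M powr (2 * \<beta>\<^sup>2) * (w x)\<^sup>2"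
          using elim by (intro mult_right_mono powr_mono2) auto
        finally have "?g x \<le> R powr (- b) * (M powr (2 * \<beta>\<^sup>2) * (w x)\<^sup>2)"
          using n by (intro mult_mono) auto
        then show ?thesis using False by (simp add: \<kappa>_def mult.assoc)
      qed
    qed
  qed
  also have "\<dots> = (LINT x|lebesgue. ?g x * indicator (cball 0 R) x) + \<kappa> * L2_norm_sq w"
    unfolding L2_norm_sq_power using gi L2 by simp
  also have "\<dots> \<le> (LINT x|lebesgue. ?g x * indicator (cball 0 R) x) + \<kappa> * 1"
    using \<kappa> w(2) by (intro add_left_mono mult_left_mono)
  finally show "weighted_int b \<beta> w \<le> (LINT x|lebesgue. ?g x * indicator (cball 0 R) x) + R powr (- b) * M powr (2 * \<beta>\<^sup>2)"
    by (simp add: \<kappa>_def)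
qed

text \<open>Dominated convergence on each ball, with an error R^(-b) uniform in k that disappears as
  R grows. Only this inequality is needed; for a limit of unit norms the reverse one comes from
  Gagliardo-Nirenberg.\<close>

lemma weighted_int_upper_semicontinuous:
  fixes v :: "nat \<Rightarrow> 'a \<Rightarrow> real"
  assumes v: "\<And>k. v k \<in> Hs s" "\<And>k. L2_norm_sq (v k) \<le> 1" and M: "\<And>k. AE x in lebesgue. \<bar>v k x\<bar> \<le> M" "0 < M"
    and w0: "w0 \<in> Hs s" "L2_norm_sq w0 \<le> 1"
    and ae: "AE x in lebesgue. (\<lambda>k. v k x) \<longlonglongrightarrow> w0 x"
    and lim: "(\<lambda>k. weighted_int b \<beta> (v k)) \<longlonglongrightarrow> L"
  shows "L \<le> weighted_int b \<beta> w0"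
proof -
  note vm[measurable] = Hs_measurable[OF v(1)] and wm[measurable] = Hs_measurable[OF w0(1)]
  have wM: "AE x in lebesgue. \<bar>w0 x\<bar> \<le> M"
  proof -
    have "AE x in lebesgue. \<forall>k. \<bar>v k x\<bar> \<le> M" using M(1) by (simp add: AE_all_countable)
    then show ?thesis using ae
    proof eventually_elim
      case (elim x)
      show ?case by (rule LIMSEQ_le_const2[OF tendsto_rabs[OF elim(2)]]) (use elim(1) in blast)
    qed
  qed
  let ?g = "\<lambda>u x. norm x powr (- b) * \<bar>u x\<bar> powr (2 + 2 * \<beta>\<^sup>2)"
  have pp: "0 < 2 + 2 * \<beta>\<^sup>2" using beta_pos by linarith
  have le: "L \<le> weighted_int b \<beta> w0 + R powr (- b) * M powr (2 * \<beta>\<^sup>2)" if R: "0 < R" for R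
  proof -
    have conv: "(\<lambda>k. LINT x|lebesgue. ?g (v k) x * indicator (cball 0 R) x) \<longlonglongrightarrow> (LINT x|lebesgue. ?g w0 x * indicator (cball 0 R) x)"
    proof (rule integral_dominated_convergence)
      show "integrable lebesgue (\<lambda>x::'a. M powr (2 + 2 * \<beta>\<^sup>2) * (norm x powr (- b) * indicator (cball 0 R) x))"
        by (rule weight_ball_integrable) simp
      show "AE x in lebesgue. (\<lambda>k. ?g (v k) x * indicator (cball 0 R) x) \<longlonglongrightarrow> ?g w0 x * indicator (cball 0 R) x"
        using ae
      proof eventually_elim
        case (elim x)
        have "(\<lambda>k. \<bar>v k x\<bar> powr (2 + 2 * \<beta>\<^sup>2)) \<longlonglongrightarrow> \<bar>w0 x\<bar> powr (2 + 2 * \<beta>\<^sup>2)"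
          using pp by (intro tendsto_powr' tendsto_rabs elim tendsto_const) auto
        then show ?case by (intro tendsto_mult_left tendsto_mult_right)
      qed
      fix k
      show "AE x in lebesgue. norm (?g (v k) x * indicator (cball 0 R) x) \<le> M powr (2 + 2 * \<beta>\<^sup>2) * (norm x powr (- b) * indicator (cball 0 R) x)"
        using M(1)[of k]
      proof eventually_elim
        case (elim x)
        have "\<bar>v k x\<bar> powr (2 + 2 * \<beta>\<^sup>2) \<le> M powr (2 + 2 * \<beta>\<^sup>2)"
          using elim by (intro powr_mono2) auto
        then have "norm x powr (- b) * \<bar>v k x\<bar> powr (2 + 2 * \<beta>\<^sup>2) \<le> norm x powr (- b) * M powr (2 + 2 * \<beta>\<^sup>2)"
          by (intro mult_left_mono) auto
        then show ?case by (auto simp: indicator_def mult.commute)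
      qed
    qed measurable
    have ge: "weighted_int b \<beta> (v k) - R powr (- b) * M powr (2 * \<beta>\<^sup>2) \<le> (LINT x|lebesgue. ?g (v k) x * indicator (cball 0 R) x)" for k
      using weighted_int_tail(1)[OF v M R, of k] by simp
    have "L - R powr (- b) * M powr (2 * \<beta>\<^sup>2) \<le> (LINT x|lebesgue. ?g w0 x * indicator (cball 0 R) x)"
      by (rule LIMSEQ_le[OF tendsto_diff[OF lim tendsto_const] conv]) (use ge in blast)
    then show ?thesis using weighted_int_tail(3)[OF w0 wM M(2) R] by simp
  qed
  have "((\<lambda>R. weighted_int b \<beta> w0 + R powr (- b) * M powr (2 * \<beta>\<^sup>2)) \<longlongrightarrow> weighted_int b \<beta> w0 + 0 * M powr (2 * \<beta>\<^sup>2)) at_top"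
    using b by (intro tendsto_intros tendsto_neg_powr filterlim_ident) auto
  then show ?thesis
    by (intro tendsto_lowerbound[where f = "\<lambda>R. weighted_int b \<beta> w0 + R powr (- b) * M powr (2 * \<beta>\<^sup>2)"])
      (use le in \<open>auto intro!: eventually_mono[OF eventually_gt_at_top[of 0]]\<close>)
qed

text \<open>Let G, F and m be the nonlinear term, seminorm and mass of the limit. Semicontinuity,
  the Gagliardo-Nirenberg inequality and Fatou give the chain 1 \<le> A/(1+\<beta>^2) G \<le> F
  m^(\<beta>^2) \<le> 1. Equality throughout makes the limit an optimizer and forces F = m = 1;
  convergence of these norms upgrades almost everywhere convergence to strong convergence of
  functions and of increments.\<close>

lemma blowup_compact:
  fixes w :: "nat \<Rightarrow> 'a \<Rightarrow> real"
  assumes w: "\<And>k. w k \<in> Hs s" "\<And>k. L2_norm_sq (w k) = 1" "\<And>k. frac_energy s (w k) = 1"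
    and M: "\<And>k. AE x in lebesgue. \<bar>w k x\<bar> \<le> M" "0 < M"
    and lim: "(\<lambda>k. weighted_int b \<beta> (w k)) \<longlonglongrightarrow> (1 + \<beta>\<^sup>2) / A"
  obtains r w0 where "strict_mono r" "Hs_tendsto s (\<lambda>k. w (r k)) w0" "GN_optimizer s b \<beta> A w0"
proof -
  have gw: "gag s (w k) = 1 / c" for k
    using w(3)[of k] c_pos by (simp add: frac_energy_c field_simps)
  have "\<exists>r w0. strict_mono r \<and> w0 \<in> borel_measurable lebesgue \<and>
      (AE x in lebesgue. (\<lambda>k. w (r k) x) \<longlonglongrightarrow> w0 x)"
    by (rule local_compactness[where u = w, OF s_pos w(1) eq_refl[OF gw] M(1) less_imp_le[OF M(2)]]) blast
  then obtain r w0 where r: "strict_mono r" and wm[measurable]: "w0 \<in> borel_measurable lebesgue"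
    and ae: "AE x in lebesgue. (\<lambda>k. w (r k) x) \<longlonglongrightarrow> w0 x"
    by blast
  define v where "v = (\<lambda>k. w (r k))"
  have v: "v k \<in> Hs s" "L2_norm_sq (v k) = 1" "gag s (v k) = 1 / c" "AE x in lebesgue. \<bar>v k x\<bar> \<le> M" for k
    using w gw M by (simp_all add: v_def)
  have ae: "AE x in lebesgue. (\<lambda>k. v k x) \<longlonglongrightarrow> w0 x" using ae by (simp add: v_def)
  note vm[measurable] = Hs_measurable[OF v(1)]
  have aep: "AE p in lebesgue \<Otimes>\<^sub>M lebesgue. (\<lambda>k. gagliardo_form s (v k) (v k) p) \<longlonglongrightarrow> gagliardo_form s w0 w0 p"
    using AE_lebesgue_pair[OF ae] by eventually_elim (rule gagliardo_form_tendsto, auto)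
  have L2: "integrable lebesgue (\<lambda>x. (w0 x)\<^sup>2)" "(LINT x|lebesgue. (w0 x)\<^sup>2) \<le> 1"
  proof -
    have ae2: "AE x in lebesgue. (\<lambda>k. (v k x)\<^sup>2) \<longlonglongrightarrow> (w0 x)\<^sup>2"
      using ae by eventually_elim (rule tendsto_power)
    have le: "(LINT x|lebesgue. (v n x)\<^sup>2) \<le> 1" for n
      using v(2)[of n] by (simp add: L2_norm_sq_power)
    show "integrable lebesgue (\<lambda>x. (w0 x)\<^sup>2)" "(LINT x|lebesgue. (w0 x)\<^sup>2) \<le> 1"
      by (rule Fatou_integrable[OF _ _ Hs_L2[OF v(1)] _ ae2 le]; simp)+
  qed
  have G: "integrable (lebesgue \<Otimes>\<^sub>M lebesgue) (gagliardo_form s w0 w0)" "gag s w0 \<le> 1 / c"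
  proof -
    have le: "(LINT p|(lebesgue \<Otimes>\<^sub>M lebesgue). gagliardo_form s (v n) (v n) p) \<le> 1 / c" for n
      using v(3)[of n] by (simp add: gagB_def)
    show "integrable (lebesgue \<Otimes>\<^sub>M lebesgue) (gagliardo_form s w0 w0)" "gag s w0 \<le> 1 / c"
      unfolding gagB_def
      by (rule Fatou_integrable[OF gagliardo_form_measurable[OF vm vm] gagliardo_form_measurable[OF wm wm]
            gagB_integrable[OF v(1) v(1)] AE_I2[OF gagliardo_form_nonneg] aep le])+
  qed
  have w0: "w0 \<in> Hs s" using wm L2(1) G(1) by (simp add: Hs_def)
  have L2le: "L2_norm_sq w0 \<le> 1" using L2(2) by (simp add: L2_norm_sq_power)
  have Fle: "frac_energy s w0 \<le> 1"
    using mult_left_mono[OF G(2), of c] c_pos by (simp add: frac_energy_c)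
  have "(\<lambda>k. weighted_int b \<beta> (v k)) \<longlonglongrightarrow> (1 + \<beta>\<^sup>2) / A"
    using LIMSEQ_subseq_LIMSEQ[OF lim r] by (simp add: v_def o_def)
  then have "(1 + \<beta>\<^sup>2) / A \<le> weighted_int b \<beta> w0"
    by (intro weighted_int_upper_semicontinuous[OF v(1) _ v(4) M(2) w0 L2le ae]) (simp_all add: v(2))
  then have "A / (1 + \<beta>\<^sup>2) * ((1 + \<beta>\<^sup>2) / A) \<le> A / (1 + \<beta>\<^sup>2) * weighted_int b \<beta> w0"
    using A by (intro mult_left_mono divide_nonneg_nonneg) auto
  moreover have "A / (1 + \<beta>\<^sup>2) * ((1 + \<beta>\<^sup>2) / A) = 1"
  proof -
    have "1 + \<beta>\<^sup>2 > 0" using beta_pos by linarith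
    then show ?thesis using A by simp
  qed
  ultimately have one: "1 \<le> A / (1 + \<beta>\<^sup>2) * weighted_int b \<beta> w0" by simp
  define y where "y = L2_norm_sq w0 powr \<beta>\<^sup>2"
  have y: "0 \<le> y" "y \<le> 1"
    using L2le powr_mono2[of "\<beta>\<^sup>2" "L2_norm_sq w0" 1] by (auto simp: y_def)
  have Fy: "A / (1 + \<beta>\<^sup>2) * weighted_int b \<beta> w0 \<le> frac_energy s w0 * y"
    using GN_ineq[OF w0] by (simp add: y_def)
  have "frac_energy s w0 * y \<le> frac_energy s w0" using y frac_energy_nonneg[of w0] by (intro mult_left_le) auto
  then have F1: "frac_energy s w0 = 1" using one Fy Fle by linarith
  then have y1: "y = 1" using one Fy y by simp
  have L1: "L2_norm_sq w0 = 1"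
  proof (rule ccontr)
    assume "L2_norm_sq w0 \<noteq> 1"
    then have "L2_norm_sq w0 powr \<beta>\<^sup>2 < 1 powr \<beta>\<^sup>2"
      using L2le beta_pos by (intro powr_less_mono2) auto
    then show False using y1 by (simp add: y_def)
  qed
  have opt: "GN_optimizer s b \<beta> A w0"
    unfolding GN_optimizer_def
  proof (intro conjI w0)
    show "\<not> (AE x in lebesgue. w0 x = 0)"
    proof
      assume "AE x in lebesgue. w0 x = 0"
      then have "AE x in lebesgue. (w0 x)\<^sup>2 = 0" by eventually_elim simp
      then have "L2_norm_sq w0 = 0" unfolding L2_norm_sq_power by (rule integral_eq_zero_AE)
      then show False using L1 by simp
    qed
    show "A / (1 + \<beta>\<^sup>2) * weighted_int b \<beta> w0 = frac_energy s w0 * L2_norm w0 powr (2 * \<beta>\<^sup>2)"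
    proof -
      have "A / (1 + \<beta>\<^sup>2) * weighted_int b \<beta> w0 = 1"
        using one Fy unfolding F1 y1 by linarith
      then show ?thesis by (simp only: F1 L2_norm_def L1 real_sqrt_one powr_one_eq_one mult_1)
    qed
  qed
  have t1: "(\<lambda>k. L2_norm_sq (\<lambda>x. v k x - w0 x)) \<longlonglongrightarrow> 0"
    unfolding L2_norm_sq_power
    by (rule tendsto_L2_of_norm[OF vm wm Hs_L2[OF v(1)] L2(1) ae])
      (use v(2) L1 in \<open>simp add: L2_norm_sq_power\<close>)
  have t2: "(\<lambda>k. gag s (\<lambda>x. v k x - w0 x)) \<longlonglongrightarrow> 0"
  proof -
    let ?f = "\<lambda>u p. (u (fst p) - u (snd p)) * sqrt (kern s (fst p - snd p))"
    have m: "?f u \<in> borel_measurable (lebesgue \<Otimes>\<^sub>M lebesgue)" if [measurable]: "u \<in> borel_measurable lebesgue" for u :: "'a \<Rightarrow> real"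
      by measurable
    have aef: "AE p in lebesgue \<Otimes>\<^sub>M lebesgue. (\<lambda>k. ?f (v k) p) \<longlonglongrightarrow> ?f w0 p"
      using AE_lebesgue_pair[OF ae] by eventually_elim (intro tendsto_intros; blast)
    have eq: "gagliardo_form s (\<lambda>x. v k x - w0 x) (\<lambda>x. v k x - w0 x) p = (?f (v k) p - ?f w0 p)\<^sup>2" for k p
      unfolding gagliardo_form_sq by (simp add: algebra_simps)
    have i: "integrable (lebesgue \<Otimes>\<^sub>M lebesgue) (\<lambda>p. (?f (v k) p)\<^sup>2)" for k
      using gagB_integrable[OF v(1) v(1), of k k] unfolding gagliardo_form_sq' .
    have i0: "integrable (lebesgue \<Otimes>\<^sub>M lebesgue) (\<lambda>p. (?f w0 p)\<^sup>2)"
      using G(1) unfolding gagliardo_form_sq' .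
    have "gag s w0 = 1 / c" using F1 c_pos by (simp add: frac_energy_c field_simps)
    then have l: "(\<lambda>k. LINT p|(lebesgue \<Otimes>\<^sub>M lebesgue). (?f (v k) p)\<^sup>2) \<longlonglongrightarrow> (LINT p|(lebesgue \<Otimes>\<^sub>M lebesgue). (?f w0 p)\<^sup>2)"
      using v(3) unfolding gagB_def gagliardo_form_sq' by simp
    show ?thesis
      unfolding gagB_def eq
      by (rule tendsto_L2_of_norm[OF m[OF vm] m[OF wm] i i0 aef l])
  qed
  have "(\<lambda>k. sqrt (L2_norm_sq (\<lambda>x. v k x - w0 x) + c * gag s (\<lambda>x. v k x - w0 x))) \<longlonglongrightarrow> sqrt (0 + c * 0)"
    by (intro tendsto_intros t1 t2)
  then have "(\<lambda>k. Hs_norm s (\<lambda>x. v k x - w0 x)) \<longlonglongrightarrow> 0"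
    by (simp add: Hs_norm_def frac_energy_c)
  then have "Hs_tendsto s (\<lambda>k. w (r k)) w0"
    unfolding Hs_tendsto_def using w0 w(1) by (simp add: v_def)
  then show thesis by (rule that[OF r _ opt])
qed

end

section \<open>Minimizers\<close>

lemma min_one_powr_neg: "0 < m \<Longrightarrow> m \<le> 1 \<Longrightarrow> 0 \<le> q \<Longrightarrow> 1 \<le> (m::real) powr (- q)"
  using powr_mono2'[of "- q" m 1] by simp

lemma frac_energy_cmult: "frac_energy s (\<lambda>x. t * u x) = t\<^sup>2 * frac_energy s u"
  by (simp add: frac_energy_gag gag_cmult)

lemma weighted_int_cmult:
  "weighted_int b \<beta> (\<lambda>x. t * u x) = \<bar>t\<bar> powr (2 + 2 * \<beta>\<^sup>2) * weighted_int b \<beta> u"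
proof -
  have "(\<lambda>x. norm x powr (- b) * \<bar>t * u x\<bar> powr (2 + 2 * \<beta>\<^sup>2)) =
      (\<lambda>x. \<bar>t\<bar> powr (2 + 2 * \<beta>\<^sup>2) * (norm x powr (- b) * \<bar>u x\<bar> powr (2 + 2 * \<beta>\<^sup>2)))"
    by (auto simp: abs_mult powr_mult mult_ac)
  then show ?thesis by (simp add: weighted_int_def)
qed

lemma energy_eq:
  "energy s b \<beta> V a u = frac_energy s u + (LINT x|lebesgue. V x * (u x)\<^sup>2) - a / (1 + \<beta>\<^sup>2) * weighted_int b \<beta> u"
proof -
  have "(\<lambda>x. \<bar>u x\<bar> powr (2 + 2 * \<beta>\<^sup>2) / norm x powr b) = (\<lambda>x. norm x powr (- b) * \<bar>u x\<bar> powr (2 + 2 * \<beta>\<^sup>2))"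
    by (simp add: powr_minus divide_inverse mult.commute)
  then show ?thesis by (simp add: energy_def weighted_int_def)
qed

lemma energy_spaceD:
  assumes "u \<in> energy_space s V" shows "u \<in> Hs s" "integrable lebesgue (\<lambda>x. V x * (u x)\<^sup>2)"
  using assms by (simp_all add: energy_space_def)

lemma normalize:
  assumes "z \<in> Hs s" "0 < L2_norm_sq z"
  defines "t \<equiv> 1 / sqrt (L2_norm_sq z)"
  shows "L2_norm_sq (\<lambda>x. t * z x) = 1"
    and "frac_energy s (\<lambda>x. t * z x) = frac_energy s z / L2_norm_sq z"
    and "weighted_int b \<beta> (\<lambda>x. t * z x) = weighted_int b \<beta> z * L2_norm_sq z powr (- \<beta>\<^sup>2) / L2_norm_sq z"
    and "(\<lambda>x. t * z x) \<in> Hs s"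
    and "t\<^sup>2 = 1 / L2_norm_sq z"
proof -
  let ?m = "L2_norm_sq z"
  have m: "0 < ?m" by fact
  show t2: "t\<^sup>2 = 1 / ?m" using m by (simp add: t_def power_divide)
  show "L2_norm_sq (\<lambda>x. t * z x) = 1" using m by (simp add: L2_norm_sq_cmult t2)
  show "frac_energy s (\<lambda>x. t * z x) = frac_energy s z / ?m" by (simp add: frac_energy_cmult t2)
  show "(\<lambda>x. t * z x) \<in> Hs s" by (rule Hs_cmult) fact
  have "\<bar>t\<bar> = ?m powr (- (1/2))"
    using m by (simp add: t_def powr_half_sqrt[symmetric] powr_minus_divide)
  then have "\<bar>t\<bar> powr (2 + 2 * \<beta>\<^sup>2) = ?m powr (- (1/2) * (2 + 2 * \<beta>\<^sup>2))"
    by (simp only: powr_powr)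
  also have "- (1/2) * (2 + 2 * \<beta>\<^sup>2) = - \<beta>\<^sup>2 + - 1" by (simp add: add_divide_distrib)
  also have "?m powr (- \<beta>\<^sup>2 + - 1) = ?m powr (- \<beta>\<^sup>2) / ?m"
    using m by (simp only: powr_add powr_minus_divide[of _ 1]) simp
  finally show "weighted_int b \<beta> (\<lambda>x. t * z x) = weighted_int b \<beta> z * ?m powr (- \<beta>\<^sup>2) / ?m"
    by (simp add: weighted_int_cmult)
qed

context gn_setting
begin

lemma subcritical:
  assumes u: "(u :: 'a \<Rightarrow> real) \<in> Hs s" "L2_norm_sq u = 1" and a: "0 \<le> a" "a \<le> A"
  shows "a / (1 + \<beta>\<^sup>2) * weighted_int b \<beta> u \<le> frac_energy s u"
proof -
  have "a / (1 + \<beta>\<^sup>2) * weighted_int b \<beta> u \<le> A / (1 + \<beta>\<^sup>2) * weighted_int b \<beta> u"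
    using a weighted_int_nonneg[of u] by (intro mult_right_mono divide_right_mono) auto
  also have "\<dots> \<le> frac_energy s u" using GN_ineq[OF u(1)] u(2) by simp
  finally show ?thesis .
qed

lemma energy_nonneg:
  assumes V: "\<And>x. 0 \<le> V x" and u: "(u :: 'a \<Rightarrow> real) \<in> energy_space s V" "L2_norm_sq u = 1" and a: "0 \<le> a" "a \<le> A"
  shows "(LINT x|lebesgue. V x * (u x)\<^sup>2) \<le> energy s b \<beta> V a u" "0 \<le> (LINT x|lebesgue. V x * (u x)\<^sup>2)"
  using subcritical[OF energy_spaceD(1)[OF u(1)] u(2) a] V by (simp_all add: energy_eq)

text \<open>An infimum of reals is a lower bound only if the set is bounded below; for a \<le> A the
  Gagliardo-Nirenberg inequality provides the bound 0.\<close>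

lemma min_energy_le:
  assumes V: "\<And>x. 0 \<le> V x" and u: "(u :: 'a \<Rightarrow> real) \<in> energy_space s V" "L2_norm_sq u = 1" and a: "0 \<le> a" "a \<le> A"
  shows "min_energy s b \<beta> V a \<le> energy s b \<beta> V a u"
  unfolding min_energy_def
proof (rule cInf_lower)
  show "bdd_below {energy s b \<beta> V a u |u. u \<in> energy_space s V \<and> L2_norm_sq u = 1}"
  proof (rule bdd_belowI[of _ 0])
    fix e assume "e \<in> {energy s b \<beta> V a u |u. u \<in> energy_space s V \<and> L2_norm_sq u = 1}"
    then obtain u where "u \<in> energy_space s V" "L2_norm_sq u = 1" "e = energy s b \<beta> V a u" by blast
    then show "0 \<le> e" using energy_nonneg[where V = V and u = u, OF V _ _ a] by simp
  qed
qed (use u in blast)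

text \<open>Let m be the mass of z. Testing with z divided by the square root of m and multiplying
  by m gives e(a) m \<le> E(z): seminorm and potential are homogeneous of degree 2, and the surplus
  factor m^(-\<beta>^2) \<ge> 1 of the nonlinear term lowers the energy further. Subtracting this
  from E(u) = e(a) leaves e(a) times the lost mass, and z \<le> u gives the difference of the
  potential terms the right sign.\<close>

lemma minimizer_quasi_min:
  assumes V: "\<And>x. 0 \<le> V x" "V \<in> borel_measurable lebesgue" and a: "0 \<le> a" "a \<le> A"
    and u: "minimizer s b \<beta> V a u" "AE x in lebesgue. 0 \<le> (u :: 'a \<Rightarrow> real) x"
  shows "quasi_min s b \<beta> a (min_energy s b \<beta> V a) u" "0 \<le> min_energy s b \<beta> V a"
proof -
  let ?e = "min_energy s b \<beta> V a" and ?k = "a / (1 + \<beta>\<^sup>2)"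
  have us: "u \<in> energy_space s V" "L2_norm_sq u = 1" and ue: "energy s b \<beta> V a u = ?e"
    using u by (auto simp: minimizer_def)
  note uH = energy_spaceD[OF us(1)]
  show e0: "0 \<le> ?e" using energy_nonneg[OF V(1) us a] ue by simp
  have k0: "0 \<le> ?k" using a by simp
  show "quasi_min s b \<beta> a ?e u"
    unfolding quasi_min_def
  proof (intro conjI ballI impI uH(1) u(2))
    fix z assume z: "z \<in> Hs s" and le: "AE x in lebesgue. 0 \<le> z x \<and> z x \<le> u x"
    note [measurable] = V(2) Hs_measurable[OF z]
    have zu: "AE x in lebesgue. \<bar>z x\<bar> \<le> \<bar>u x\<bar>" using le by eventually_elim simp
    have zV: "AE x in lebesgue. V x * (z x)\<^sup>2 \<le> V x * (u x)\<^sup>2"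
      using le by eventually_elim (intro mult_left_mono power_mono V, auto)
    have zi: "integrable lebesgue (\<lambda>x. V x * (z x)\<^sup>2)"
    proof (rule Bochner_Integration.integrable_bound[OF uH(2)])
      show "AE x in lebesgue. norm (V x * (z x)\<^sup>2) \<le> norm (V x * (u x)\<^sup>2)"
        using zV by eventually_elim (simp add: V)
    qed measurable
    have P: "(LINT x|lebesgue. V x * (z x)\<^sup>2) \<le> (LINT x|lebesgue. V x * (u x)\<^sup>2)"
      by (rule integral_mono_AE[OF zi uH(2) zV])
    have P0: "0 \<le> (LINT x|lebesgue. V x * (z x)\<^sup>2)" by (rule integral_nonneg_AE) (simp add: V)
    define m where "m = L2_norm_sq z"
    have m1: "m \<le> 1" using L2_norm_sq_mono_AE(2)[OF uH(1) Hs_measurable[OF z] zu] us by (simp add: m_def)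
    have m0: "0 \<le> m" by (simp add: m_def)
    have main: "?e * m \<le> frac_energy s z + (LINT x|lebesgue. V x * (z x)\<^sup>2) - ?k * weighted_int b \<beta> z"
    proof (cases "m = 0")
      case True
      \<comment> \<open>A competitor of mass 0 cannot be normalized; here the Gagliardo-Nirenberg
        inequality makes its nonlinear term vanish.\<close>
      have "A / (1 + \<beta>\<^sup>2) * weighted_int b \<beta> z \<le> 0"
        using GN_ineq[OF z] True beta_pos by (simp add: m_def)
      moreover have "?k * weighted_int b \<beta> z \<le> A / (1 + \<beta>\<^sup>2) * weighted_int b \<beta> z"
        using a weighted_int_nonneg[of z] by (intro mult_right_mono divide_right_mono) auto
      ultimately show ?thesis using True frac_energy_nonneg[of z] P0 by simp
    next
      case False
      then have m: "0 < m" using m0 by simp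
      define t where "t = 1 / sqrt (L2_norm_sq z)"
      note n = normalize[OF z m[unfolded m_def], folded t_def m_def]
      have tV: "V x * (t * z x)\<^sup>2 = V x * (z x)\<^sup>2 / m" for x
        unfolding power_mult_distrib n(5) by simp
      have "(\<lambda>x. t * z x) \<in> energy_space s V"
        using n(4) zi by (simp add: energy_space_def tV)
      then have "?e \<le> energy s b \<beta> V a (\<lambda>x. t * z x)"
        by (rule min_energy_le[OF V(1) _ n(1) a])
      also have "\<dots> = frac_energy s z / m + (LINT x|lebesgue. V x * (z x)\<^sup>2) / m - ?k * (weighted_int b \<beta> z * m powr (- \<beta>\<^sup>2) / m)"
        unfolding energy_eq tV n(2,3) by simp
      finally have "?e * m \<le> (frac_energy s z / m + (LINT x|lebesgue. V x * (z x)\<^sup>2) / m - ?k * (weighted_int b \<beta> z * m powr (- \<beta>\<^sup>2) / m)) * m"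
        using m by (intro mult_right_mono) auto
      also have "\<dots> = frac_energy s z + (LINT x|lebesgue. V x * (z x)\<^sup>2) - ?k * (weighted_int b \<beta> z * m powr (- \<beta>\<^sup>2))"
      proof -
        have "(X / m + Y / m - k * (Z / m)) * m = X + Y - k * Z" for X Y Z k
          using m by (simp add: field_simps)
        then show ?thesis .
      qed
      also have "\<dots> \<le> frac_energy s z + (LINT x|lebesgue. V x * (z x)\<^sup>2) - ?k * (weighted_int b \<beta> z * 1)"
        using min_one_powr_neg[OF m m1, of "\<beta>\<^sup>2"] weighted_int_nonneg[of z] k0
        by (intro diff_left_mono mult_left_mono) auto
      finally show ?thesis by simp
    qed
    have "frac_energy s u + (LINT x|lebesgue. V x * (u x)\<^sup>2) - ?k * weighted_int b \<beta> u = ?e"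
      using ue by (simp add: energy_eq)
    then show "frac_energy s u - ?k * weighted_int b \<beta> u \<le> frac_energy s z - ?k * weighted_int b \<beta> z + ?e * (L2_norm_sq u - L2_norm_sq z)"
      using main P unfolding us(2) m_def[symmetric] right_diff_distrib by simp
  qed
qed

text \<open>By mass-criticality seminorm and nonlinear term scale alike while the mass is invariant,
  so the whole effect falls on the price of the mass. The inverse dilation carries competitors
  back.\<close>

lemma quasi_min_scl:
  assumes q: "quasi_min s b \<beta> a \<Lambda> (u :: 'a \<Rightarrow> real)" and e: "0 < e"
  shows "quasi_min s b \<beta> a (e powr (2 * s) * \<Lambda>) (scl e u)"
proof -
  have u: "u \<in> Hs s" and u0: "AE x in lebesgue. 0 \<le> u x" using q by (auto simp: quasi_min_def)
  have e': "0 < 1 / e" using e by simp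
  show ?thesis
    unfolding quasi_min_def
  proof (intro conjI ballI impI Hs_scl(1)[OF e u])
    show "AE x in lebesgue. 0 \<le> scl e u x"
      using AE_lebesgue_scale[OF e u0] by eventually_elim (simp add: scl_def)
    fix y assume y: "y \<in> Hs s" and le: "AE x in lebesgue. 0 \<le> y x \<and> y x \<le> scl e u x"
    define z where "z = scl (1 / e) y"
    have z: "z \<in> Hs s" unfolding z_def by (rule Hs_scl(1)[OF e' y])
    have yz: "y = scl e z" unfolding z_def by (rule scl_inverse[OF e, symmetric])
    have uz: "u = scl (1 / e) (scl e u)" using scl_inverse[OF e', of u] by simp
    have "AE x in lebesgue. 0 \<le> z x \<and> z x \<le> u x"
      using AE_lebesgue_scale[OF e' le]
    proof eventually_elim
      case (elim x)
      show ?case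
        by (subst uz, unfold z_def, unfold scl_def[of "1 / e"])
          (use elim in \<open>auto intro!: mult_left_mono mult_nonneg_nonneg\<close>)
    qed
    then have le': "frac_energy s u - a / (1 + \<beta>\<^sup>2) * weighted_int b \<beta> u \<le>
       frac_energy s z - a / (1 + \<beta>\<^sup>2) * weighted_int b \<beta> z + \<Lambda> * (L2_norm_sq u - L2_norm_sq z)"
      using q z unfolding quasi_min_def by blast
    have sc: "frac_energy s (scl e f) = e powr (2 * s) * frac_energy s f"
      "weighted_int b \<beta> (scl e f) = e powr (2 * s) * weighted_int b \<beta> f" "L2_norm_sq (scl e f) = L2_norm_sq f"
      if "f \<in> Hs s" for f :: "'a \<Rightarrow> real"
      using frac_energy_scl[OF e that] weighted_int_scl[OF e Hs_measurable[OF that] \<beta>] L2_scl(2)[OF e Hs_measurable[OF that]] by simp_all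
    show "frac_energy s (scl e u) - a / (1 + \<beta>\<^sup>2) * weighted_int b \<beta> (scl e u) \<le>
       frac_energy s y - a / (1 + \<beta>\<^sup>2) * weighted_int b \<beta> y + e powr (2 * s) * \<Lambda> * (L2_norm_sq (scl e u) - L2_norm_sq y)"
      using mult_left_mono[OF le', of "e powr (2 * s)"] unfolding yz sc[OF u] sc[OF z]
      by (simp add: algebra_simps)
  qed
qed

text \<open>
  A bound for the potential energy confines half of the mass to a fixed ball; a function of small
  seminorm would spread it evenly over a much larger ball.
\<close>

lemma confinement:
  assumes V: "\<And>x. 0 \<le> V x" "filterlim V at_top at_infinity" and P: "0 \<le> P"
  obtains \<kappa> where "0 < \<kappa>"
    "\<And>u :: 'a \<Rightarrow> real. u \<in> energy_space s V \<Longrightarrow> L2_norm_sq u = 1 \<Longrightarrow> (LINT x|lebesgue. V x * (u x)\<^sup>2) \<le> P \<Longrightarrow> \<kappa> \<le> frac_energy s u"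
proof -
  let ?N = "real DIM('a)" and ?n = "DIM('a)"
  have "\<forall>\<^sub>F x in at_infinity. 2 * P + 1 \<le> V x" using V(2) by (simp add: filterlim_at_top)
  then obtain R0 where R0: "\<And>x. R0 \<le> norm x \<Longrightarrow> 2 * P + 1 \<le> V x" by (auto simp: eventually_at_infinity)
  define R where "R = max 1 R0"
  have R: "0 < R" "\<And>x. R \<le> norm x \<Longrightarrow> 2 * P + 1 \<le> V x" using R0 by (auto simp: R_def)
  define w where "w = unit_ball_vol ?N"
  have w: "0 < w" by (simp add: w_def)
  define m0 where "m0 = w * R ^ ?n"
  define m1 where "m1 = w * (8 * R) ^ ?n"
  have m0: "0 < m0" using w R by (simp add: m0_def)
  \<comment> \<open>The ratio 8 is what the final balance needs: in m1/2 \<le> 2 K [u]^2 + 2 m0 the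
    last term is then at most m1/4.\<close>
  have m1: "8 * m0 \<le> m1"
  proof -
    have "(8::real) ^ 1 \<le> 8 ^ ?n" by (rule power_increasing) (simp_all add: Suc_le_eq)
    then have "8 * m0 \<le> 8 ^ ?n * m0" using m0 by (intro mult_right_mono) auto
    also have "\<dots> = m1" by (simp add: m0_def m1_def power_mult_distrib)
    finally show ?thesis .
  qed
  define B0 where "B0 = cball (0::'a) R"
  define B1 where "B1 = cball (0::'a) (8 * R)"
  have B: "B0 \<in> sets lebesgue" "B1 \<in> sets lebesgue" by (simp_all add: B0_def B1_def)
  have eB: "emeasure lebesgue B0 = ennreal m0" "emeasure lebesgue B1 = ennreal m1"
    using R unfolding B0_def B1_def m0_def m1_def w_def
    by (simp_all add: emeasure_completion emeasure_cball)
  \<comment> \<open>Inverse of a lower bound for the kernel between points of the two balls, whose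
    distance is at most 9 R and generously bounded by 16 R.\<close>
  define K where "K = (16 * R) powr (?N + 2 * s)"
  have K: "0 < K" using R by (simp add: K_def)
  show thesis
  proof (rule that[of "c * (m1 / (8 * K))"])
    show "0 < c * (m1 / (8 * K))" using c_pos K m0 m1 by simp
    fix u :: "'a \<Rightarrow> real"
    assume us: "u \<in> energy_space s V" "L2_norm_sq u = 1" and uP: "(LINT x|lebesgue. V x * (u x)\<^sup>2) \<le> P"
    note u = energy_spaceD[OF us(1)]
    note [measurable] = Hs_measurable[OF u(1)] B
    have L: "integrable lebesgue (\<lambda>x. (u x)\<^sup>2)" "(LINT x|lebesgue. (u x)\<^sup>2) = 1"
      using Hs_L2[OF u(1)] us(2) by (simp_all add: L2_norm_sq_power)
    have i0: "integrable lebesgue (\<lambda>x. (u x)\<^sup>2 * indicator B0 x)"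
      using integrable_mult_indicator[OF B(1) L(1)] by (simp add: mult.commute)
    have half: "1 / 2 \<le> (LINT x|lebesgue. (u x)\<^sup>2 * indicator B0 x)"
    proof -
      have "(2 * P + 1) * (1 - (LINT x|lebesgue. (u x)\<^sup>2 * indicator B0 x)) =
          (LINT x|lebesgue. (2 * P + 1) * ((u x)\<^sup>2 - (u x)\<^sup>2 * indicator B0 x))"
        using L i0 by simp
      also have "\<dots> \<le> (LINT x|lebesgue. V x * (u x)\<^sup>2)"
      proof (rule integral_mono)
        show "integrable lebesgue (\<lambda>x. (2 * P + 1) * ((u x)\<^sup>2 - (u x)\<^sup>2 * indicator B0 x))" using L i0 by simp
        fix x :: 'a
        show "(2 * P + 1) * ((u x)\<^sup>2 - (u x)\<^sup>2 * indicator B0 x) \<le> V x * (u x)\<^sup>2"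
        proof (cases "x \<in> B0")
          case False
          then have "2 * P + 1 \<le> V x" by (intro R) (simp add: B0_def)
          then show ?thesis using False by (simp add: mult_right_mono)
        qed (simp add: V)
      qed (rule u(2))
      finally have "(2 * P + 1) * (1 - (LINT x|lebesgue. (u x)\<^sup>2 * indicator B0 x)) \<le> P" using uP by simp
      also have "P \<le> (2 * P + 1) * (1 / 2)" by simp
      finally have "1 - (LINT x|lebesgue. (u x)\<^sup>2 * indicator B0 x) \<le> 1 / 2"
        using P by (subst (asm) mult_le_cancel_left_pos) auto
      then show ?thesis by simp
    qed
    have nnL: "(\<integral>\<^sup>+y. ennreal ((u y)\<^sup>2) \<partial>lebesgue) = ennreal 1"
      using nn_integral_eq_integral[OF L(1)] L(2) by simp
    have pt: "ennreal ((u x)\<^sup>2 * indicator B0 x * m1) \<le>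
        ennreal (2 * K) * (\<integral>\<^sup>+y. ennreal ((u x - u y)\<^sup>2 * kern s (x - y)) \<partial>lebesgue) + ennreal 2 * indicator B0 x" for x
    proof (cases "x \<in> B0")
      case True
      have "ennreal ((u x)\<^sup>2 * m1) = (\<integral>\<^sup>+y. ennreal ((u x)\<^sup>2) * indicator B1 y \<partial>lebesgue)"
        using B by (subst nn_integral_cmult_indicator) (simp_all add: eB ennreal_mult')
      also have "\<dots> \<le> (\<integral>\<^sup>+y. ennreal (2 * K) * ennreal ((u x - u y)\<^sup>2 * kern s (x - y)) + ennreal 2 * ennreal ((u y)\<^sup>2) \<partial>lebesgue)"
      proof (rule nn_integral_mono)
        fix y
        show "ennreal ((u x)\<^sup>2) * indicator B1 y \<le> ennreal (2 * K) * ennreal ((u x - u y)\<^sup>2 * kern s (x - y)) + ennreal 2 * ennreal ((u y)\<^sup>2)"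
        proof (cases "y \<in> B1")
          case y: True
          have "(u x - u y)\<^sup>2 \<le> K * ((u x - u y)\<^sup>2 * kern s (x - y))"
          proof (cases "x = y")
            case False
            have "norm (x - y) \<le> 16 * R"
              using norm_triangle_ineq4[of x y] True y R by (simp add: B0_def B1_def)
            then have "norm (x - y) powr (?N + 2 * s) \<le> K"
              unfolding K_def using s_pos by (intro powr_mono2) auto
            then have "1 \<le> K * kern s (x - y)" using False by (simp add: kern_def field_simps)
            then have "(u x - u y)\<^sup>2 * 1 \<le> (u x - u y)\<^sup>2 * (K * kern s (x - y))"
              by (intro mult_left_mono) auto
            then show ?thesis by (simp add: mult_ac)
          qed simp
          moreover have "(u x)\<^sup>2 \<le> 2 * (u x - u y)\<^sup>2 + 2 * (u y)\<^sup>2"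
            using power2_diff_le[of "u x - u y" "- u y"] by simp
          ultimately have "(u x)\<^sup>2 \<le> 2 * K * ((u x - u y)\<^sup>2 * kern s (x - y)) + 2 * (u y)\<^sup>2" by linarith
          then have "ennreal ((u x)\<^sup>2) \<le> ennreal (2 * K * ((u x - u y)\<^sup>2 * kern s (x - y)) + 2 * (u y)\<^sup>2)"
            by (rule ennreal_leI)
          also have "\<dots> = ennreal (2 * K) * ennreal ((u x - u y)\<^sup>2 * kern s (x - y)) + ennreal 2 * ennreal ((u y)\<^sup>2)"
            using K by (subst ennreal_plus) (simp_all only: ennreal_mult'[symmetric], simp_all)
          finally show ?thesis using y by simp
        qed simp
      qed
      also have "\<dots> = ennreal (2 * K) * (\<integral>\<^sup>+y. ennreal ((u x - u y)\<^sup>2 * kern s (x - y)) \<partial>lebesgue) + ennreal 2 * ennreal 1"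
        unfolding nnL[symmetric] by (subst nn_integral_add, measurable) (simp add: nn_integral_cmult del: ennreal_numeral)
      finally show ?thesis using True by simp
    qed simp
    have "ennreal (m1 * (1 / 2)) \<le> ennreal (m1 * (LINT x|lebesgue. (u x)\<^sup>2 * indicator B0 x))"
      using m0 m1 half by (intro ennreal_leI mult_left_mono) auto
    also have "\<dots> = ennreal (LINT x|lebesgue. (u x)\<^sup>2 * indicator B0 x * m1)" by (simp add: mult.commute)
    also have "\<dots> = (\<integral>\<^sup>+x. ennreal ((u x)\<^sup>2 * indicator B0 x * m1) \<partial>lebesgue)"
    proof (rule nn_integral_eq_integral[symmetric])
      show "integrable lebesgue (\<lambda>x. (u x)\<^sup>2 * indicator B0 x * m1)" using i0 by (rule integrable_mult_left)
      show "AE x in lebesgue. 0 \<le> (u x)\<^sup>2 * indicator B0 x * m1" using m0 m1 by simp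
    qed
    also have "\<dots> \<le> (\<integral>\<^sup>+x. ennreal (2 * K) * (\<integral>\<^sup>+y. ennreal ((u x - u y)\<^sup>2 * kern s (x - y)) \<partial>lebesgue) + ennreal 2 * indicator B0 x \<partial>lebesgue)"
      by (intro nn_integral_mono pt)
    also have "\<dots> = ennreal (2 * K) * ngag s u + ennreal 2 * ennreal m0"
      unfolding ngag_def eB(1)[symmetric]
      by (subst nn_integral_add, measurable) (simp add: nn_integral_cmult nn_integral_cmult_indicator[OF B(1)] del: ennreal_numeral)
    also have "\<dots> = ennreal (2 * K * gag s u + 2 * m0)"
      unfolding ngag_eq[OF u(1)] using K m0 by (subst ennreal_plus) (simp_all only: ennreal_mult'[symmetric] zero_le_numeral, simp_all)
    finally have "m1 * (1 / 2) \<le> 2 * K * gag s u + 2 * m0"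
      using K m0 by (subst (asm) ennreal_le_iff) auto
    then have "m1 / 4 \<le> 2 * K * gag s u" using m1 by linarith
    then have "m1 / (8 * K) \<le> gag s u" using K by (simp add: field_simps)
    then show "c * (m1 / (8 * K)) \<le> frac_energy s u"
      unfolding frac_energy_c using c_pos by (intro mult_left_mono) auto
  qed
qed

end

section \<open>The minimal energy tends to zero\<close>

lemma tail_to_zero:
  fixes f :: "'a::euclidean_space \<Rightarrow> real"
  assumes f: "integrable lebesgue f"
  shows "((\<lambda>r. LINT x|lebesgue. f x * indicator (- cball 0 r) x) \<longlongrightarrow> 0) at_top"
proof -
  have fm[measurable]: "f \<in> borel_measurable lebesgue" using f by (rule borel_measurable_integrable)
  have "((\<lambda>r. LINT x|lebesgue. f x * indicator (- cball 0 r) x) \<longlongrightarrow> (LINT (x::'a)|lebesgue. 0)) at_top"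
  proof (rule integral_dominated_convergence_at_top[where w = "\<lambda>x. \<bar>f x\<bar>"])
    show "AE x in lebesgue. ((\<lambda>r. f x * indicator (- cball 0 r) x) \<longlongrightarrow> 0) at_top"
    proof (rule AE_I2)
      fix x :: 'a
      have "\<forall>\<^sub>F r in at_top. f x * indicator (- cball 0 r) x = 0"
        using eventually_ge_at_top[of "norm x"] by eventually_elim simp
      then show "((\<lambda>r. f x * indicator (- cball 0 r) x) \<longlongrightarrow> 0) at_top"
        by (rule tendsto_eventually)
    qed
    show "integrable lebesgue (\<lambda>x. \<bar>f x\<bar>)" using f by simp
    show "\<forall>\<^sub>F r in at_top. AE x in lebesgue. norm (f x * indicator (- cball 0 r) x) \<le> \<bar>f x\<bar>"
      by (intro always_eventually allI AE_I2) (simp add: indicator_def)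
    show "(\<lambda>x. f x * indicator (- cball 0 r) x) \<in> borel_measurable lebesgue" for r
      by (intro borel_measurable_times fm borel_measurable_indicator) (simp add: Compl_in_sets_lebesgue)
  qed simp
  then show ?thesis by simp
qed

text \<open>Convexity of t^p through its tangent at y, obtained from \<open>powr_tangent\<close>
  with the exponent 1/p and the number (t/y)^p.\<close>

lemma powr_convex_tangent:
  fixes y t p :: real
  assumes y: "0 < y" and t: "0 \<le> t" and p: "1 \<le> p"
  shows "y powr p + p * y powr (p - 1) * (t - y) \<le> t powr p"
proof -
  have yp: "y powr p = y * y powr (p - 1)" using y powr_add[of y 1 "p - 1"] by simp
  have "1 + p * (t / y - 1) \<le> (t / y) powr p"
  proof (cases "t = 0")
    case False
    have "(((t / y) powr p) powr (1 / p)) \<le> 1 + 1 / p * ((t / y) powr p - 1)"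
      using False y t p by (intro powr_tangent) auto
    moreover have "((t / y) powr p) powr (1 / p) = t / y"
      using y t p by (simp add: powr_powr)
    ultimately have "p * (t / y) \<le> p * (1 + 1 / p * ((t / y) powr p - 1))"
      using p by (intro mult_left_mono) auto
    also have "\<dots> = p + ((t / y) powr p - 1)" using p by (simp add: field_simps)
    finally show ?thesis by (simp add: algebra_simps)
  qed (use p in simp)
  then have "y powr p * (1 + p * (t / y - 1)) \<le> y powr p * (t / y) powr p"
    by (intro mult_left_mono) auto
  moreover have "y powr p * (t / y) powr p = t powr p"
    using y t by (simp add: powr_mult[symmetric])
  moreover have "y powr p * (1 + p * (t / y - 1)) = y powr p + p * y powr (p - 1) * (t - y)"
    unfolding yp using y by (simp add: field_simps)
  ultimately show ?thesis by simp
qed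

text \<open>
  For fixed \<open>T\<close> the left-hand side is largest at \<open>m = B T / (1 + B)\<close>, by the tangent of \<open>m\<^sup>B\<close> there.
\<close>

lemma mass_optimization:
  fixes B M0 T m G :: real
  assumes B: "0 < B" "B \<le> 1" and M0: "0 < M0" and T: "0 < T" and m: "0 < m"
    and G: "T * (T / ((1 + B) / B * M0)) powr B \<le> G"
  shows "(T - m) * m powr B \<le> M0 powr B / (1 + B) * G"
proof -
  define y where "y = T / ((1 + B) / B * M0)"
  have y: "0 < y" using B M0 T by (simp add: y_def)
  \<comment> \<open>This is the maximizer B T / (1 + B); m is then written as m0 (1 + t), with t the
    relative deviation.\<close>
  define m0 where "m0 = y * M0"
  have m0: "0 < m0" using y M0 by (simp add: m0_def)
  have Tm: "T = m0 * (1 + 1 / B)"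
  proof -
    have "1 + 1 / B = (1 + B) / B" "(1 + B) / B \<noteq> 0" using B by (simp_all add: field_simps)
    moreover have "T = T / (k * M0) * M0 * k" if "k \<noteq> 0" for k
      using that M0 by simp
    ultimately show ?thesis by (simp only: m0_def y_def)
  qed
  define t where "t = m / m0 - 1"
  have mt: "m = m0 * (1 + t)" using m0 by (simp add: t_def)
  have t1: "0 < 1 + t" using m m0 by (simp add: t_def)
  have "(T - m) * m powr B \<le> m0 * m0 powr B / B"
  proof (cases "T \<le> m")
    case True
    then have "(T - m) * m powr B \<le> 0" by (intro mult_nonpos_nonneg) auto
    also have "0 \<le> m0 * m0 powr B / B" using m0 B by simp
    finally show ?thesis .
  next
    case False
    have "m powr B = m0 powr B * (1 + t) powr B" using m0 t1 by (simp add: mt powr_mult)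
    also have "\<dots> \<le> m0 powr B * (1 + B * t)"
      using powr_tangent[OF t1, of B] B by (intro mult_left_mono) auto
    finally have mB: "m powr B \<le> m0 powr B * (1 + B * t)" .
    have "(T - m) * m powr B \<le> (T - m) * (m0 powr B * (1 + B * t))"
      using False by (intro mult_left_mono mB) auto
    \<comment> \<open>With the tangent in place of the power the product is a quadratic in t without
      linear term, so its maximum is at t = 0.\<close>
    also have "(T - m) * (m0 powr B * (1 + B * t)) = m0 * m0 powr B * (1 / B - B * t\<^sup>2)"
    proof -
      have "T - m = m0 * (1 / B - t)" by (simp add: Tm mt algebra_simps)
      moreover have "(1 / B - t) * (1 + B * t) = 1 / B - B * t\<^sup>2"
        using B by (simp add: field_simps power2_eq_square)
      ultimately show ?thesis by (metis mult.assoc mult.left_commute)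
    qed
    also have "\<dots> \<le> m0 * m0 powr B * (1 / B)"
      using m0 B by (intro mult_left_mono) auto
    finally show ?thesis by simp
  qed
  also have "m0 * m0 powr B / B = M0 powr B / (1 + B) * (T * y powr B)"
  proof -
    have e: "1 + 1 / B = (1 + B) * (1 / B)" and B1: "1 + B \<noteq> 0" using B by (simp_all add: field_simps)
    have "m0 powr B = y powr B * M0 powr B" using y M0 by (simp add: m0_def powr_mult)
    then show ?thesis unfolding Tm e using B1 by simp
  qed
  also have "\<dots> \<le> M0 powr B / (1 + B) * G"
    using G B by (intro mult_left_mono) (auto simp: y_def)
  finally show ?thesis .
qed

section \<open>The potential near the origin\<close>

lemma Linf_loc_cball:
  assumes "V \<in> Linf_loc"
  obtains M where "0 \<le> M" "AE x in lebesgue. x \<in> cball 0 R \<longrightarrow> \<bar>V x :: real\<bar> \<le> M"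
proof -
  obtain M where M: "AE x in lebesgue. x \<in> cball 0 R \<longrightarrow> \<bar>V x\<bar> \<le> M"
    using assms compact_cball unfolding Linf_loc_def by blast
  show thesis
    by (rule that[of "max M 0"]) (use M in \<open>auto elim!: eventually_mono\<close>)
qed

lemma Linf_loc_integrable_ball:
  assumes V: "V \<in> Linf_loc"
  shows "integrable lebesgue (\<lambda>x::'a::euclidean_space. V x * indicator (ball 0 r) x)"
proof -
  have [measurable]: "V \<in> borel_measurable lebesgue" using V by (simp add: Linf_loc_def)
  obtain M where M: "0 \<le> M" "AE x in lebesgue. x \<in> cball (0::'a) r \<longrightarrow> \<bar>V x\<bar> \<le> M"
    using Linf_loc_cball[OF V, of r] by blast
  have fin: "emeasure lebesgue (ball (0::'a) r) < \<infinity>"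
    using emeasure_lborel_ball_finite[of "0::'a" r] by (simp add: emeasure_completion)
  show ?thesis
  proof (rule Bochner_Integration.integrable_bound)
    show "integrable lebesgue (\<lambda>x. M * indicator (ball (0::'a) r) x)"
      by (intro integrable_mult_right integrable_real_indicator ball_sets_lebesgue fin)
    show "AE x in lebesgue. norm (V x * indicator (ball 0 r) x) \<le> norm (M * indicator (ball (0::'a) r) x)"
      using M(2) by eventually_elim (use M(1) in \<open>auto simp: indicator_def\<close>)
  qed measurable
qed

text \<open>Since V is nonnegative and V(0) = 0, the absolute value in the definition of a Lebesgue
  point disappears; normalizing by r^N instead of the volume suits the later change of
  scale.\<close>

lemma lebesgue_point_average:
  fixes V :: "'a::euclidean_space \<Rightarrow> real"
  assumes V: "\<And>x. 0 \<le> V x" and V0: "has_value_at V 0 0"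
  shows "((\<lambda>r. (LINT x|lebesgue. V x * indicator (ball 0 r) x) / r ^ DIM('a)) \<longlongrightarrow> 0) (at_right 0)"
proof -
  let ?w = "unit_ball_vol (real DIM('a))"
  let ?I = "\<lambda>r. LINT x|lebesgue. V x * indicator (ball 0 r) x"
  have "((\<lambda>r. (LINT x:ball 0 r|lebesgue. \<bar>V x - V 0\<bar>) / measure lebesgue (ball (0::'a) r)) \<longlongrightarrow> 0) (at_right 0)"
    using V0 unfolding has_value_at_def lebesgue_point_def by blast
  then have "((\<lambda>r. ?w * ((LINT x:ball 0 r|lebesgue. \<bar>V x - V 0\<bar>) / measure lebesgue (ball (0::'a) r))) \<longlongrightarrow> ?w * 0) (at_right 0)"
    by (rule tendsto_mult_left)
  moreover have "\<forall>\<^sub>F r in at_right 0. ?w * ((LINT x:ball 0 r|lebesgue. \<bar>V x - V 0\<bar>) / measure lebesgue (ball (0::'a) r)) = ?I r / r ^ DIM('a)"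
    using eventually_at_right_less[of "0::real"]
  proof eventually_elim
    case (elim r)
    have "V 0 = 0" using V0 by (simp add: has_value_at_def)
    then have "(LINT x:ball 0 r|lebesgue. \<bar>V x - V 0\<bar>) = ?I r"
      using V by (simp add: set_lebesgue_integral_def mult.commute)
    moreover have "measure lebesgue (ball (0::'a) r) = ?w * r ^ DIM('a)"
      using elim by (simp add: measure_completion content_ball)
    moreover have "?w \<noteq> 0" using unit_ball_vol_pos[of "real DIM('a)"] by linarith
    ultimately show ?case by simp
  qed
  ultimately show ?thesis by (simp add: filterlim_cong)
qed

text \<open>Q is only square integrable, so the Lebesgue point cannot be used on all of it. On
  \<open>G n\<close>, where Q^2 and |x| are at most n, the integral is controlled by the average of
  V over a ball of radius (n+1)/\<rho>. The remainder \<open>q n\<close> has small integral and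
  meets only the local bound M of V. Choosing n before \<rho> makes both small. The ball of radius 2
  is where the rescaled cut-off lives.\<close>

lemma potential_concentration:
  fixes V Q :: "'a::euclidean_space \<Rightarrow> real"
  assumes V: "\<And>x. 0 \<le> V x" "V \<in> Linf_loc" "has_value_at V 0 0"
    and Qm: "Q \<in> borel_measurable lebesgue" and Q: "integrable lebesgue (\<lambda>x. (Q x)\<^sup>2)"
  shows "((\<lambda>\<rho>. LINT x|lebesgue. V x * (\<rho> ^ DIM('a) * (Q (\<rho> *\<^sub>R x))\<^sup>2) * indicator (cball 0 2) x) \<longlongrightarrow> 0) at_top"
    and "0 < \<rho> \<Longrightarrow> integrable lebesgue (\<lambda>x. V x * (\<rho> ^ DIM('a) * (Q (\<rho> *\<^sub>R x))\<^sup>2) * indicator (cball 0 2) x)"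
proof -
  let ?n = "DIM('a)"
  have Vm[measurable]: "V \<in> borel_measurable lebesgue" using V(2) by (simp add: Linf_loc_def)
  note [measurable] = Qm
  obtain M where M: "0 \<le> M" "AE x in lebesgue. x \<in> cball (0::'a) 2 \<longrightarrow> \<bar>V x\<bar> \<le> M"
    using Linf_loc_cball[OF V(2), of 2] by blast
  let ?f = "\<lambda>\<rho> x. V x * (\<rho> ^ ?n * (Q (\<rho> *\<^sub>R x))\<^sup>2) * indicator (cball 0 2) x"
  have fi: "integrable lebesgue (?f \<rho>)" if \<rho>: "0 < \<rho>" for \<rho>
  proof (rule Bochner_Integration.integrable_bound)
    show "integrable lebesgue (\<lambda>x. M * (\<rho> ^ ?n * (Q (\<rho> *\<^sub>R x))\<^sup>2))"
      using integrable_lebesgue_scale[OF _ \<rho>, of "\<lambda>x. (Q x)\<^sup>2"] Q by (intro integrable_mult_right) simp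
    show "AE x in lebesgue. norm (?f \<rho> x) \<le> norm (M * (\<rho> ^ ?n * (Q (\<rho> *\<^sub>R x))\<^sup>2))"
      using M(2)
    proof eventually_elim
      case (elim x)
      have "0 \<le> \<rho> ^ ?n * (Q (\<rho> *\<^sub>R x))\<^sup>2" using \<rho> by simp
      then show ?case using elim V(1)[of x] M(1)
        by (cases "x \<in> cball 0 2") (auto simp: abs_mult intro!: mult_right_mono)
    qed
    show "?f \<rho> \<in> borel_measurable lebesgue" by measurable
  qed
  then show "0 < \<rho> \<Longrightarrow> integrable lebesgue (?f \<rho>)" .
  define G where "G = (\<lambda>n::nat. {x. (Q x)\<^sup>2 \<le> real n \<and> norm x \<le> real n})"
  have Gs[measurable]: "G n \<in> sets lebesgue" for n
  proof -
    have "{x \<in> space lebesgue. (Q x)\<^sup>2 \<le> real n \<and> norm x \<le> real n} \<in> sets lebesgue" by measurable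
    then show ?thesis by (simp only: G_def space_completion space_lborel space_borel UNIV_I simp_thms)
  qed
  define q where "q = (\<lambda>n x. (Q x)\<^sup>2 * indicator (- G n) x)"
  have qm[measurable]: "q n \<in> borel_measurable lebesgue" for n
    unfolding q_def by (intro borel_measurable_times borel_measurable_indicator borel_measurable_power Qm) (simp add: Compl_in_sets_lebesgue Gs)
  have q_le: "0 \<le> q n x" "q n x \<le> (Q x)\<^sup>2" for n x by (auto simp: q_def indicator_def)
  have qi: "integrable lebesgue (q n)" for n
    by (rule Bochner_Integration.integrable_bound[OF Q]) (use q_le in auto)
  have "(\<lambda>n. LINT x|lebesgue. q n x) \<longlonglongrightarrow> (LINT (x::'a)|lebesgue. 0)"
  proof (rule integral_dominated_convergence[OF _ _ Q])
    show "AE x in lebesgue. (\<lambda>n. q n x) \<longlonglongrightarrow> 0"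
    proof (rule AE_I2)
      fix x
      obtain n0 :: nat where n0: "max ((Q x)\<^sup>2) (norm x) \<le> real n0" using real_arch_simple by blast
      have "\<forall>\<^sub>F n in sequentially. q n x = 0"
        using eventually_ge_at_top[of n0]
        by eventually_elim (use n0 in \<open>auto simp: q_def G_def\<close>)
      then show "(\<lambda>n. q n x) \<longlonglongrightarrow> 0" by (rule tendsto_eventually)
    qed
    show "AE x in lebesgue. norm (q n x) \<le> (Q x)\<^sup>2" for n
      by (rule AE_I2) (use q_le in auto)
  qed (use qm in auto)
  then have q0: "(\<lambda>n. LINT x|lebesgue. q n x) \<longlonglongrightarrow> 0" by simp
  let ?J = "\<lambda>r. LINT x|lebesgue. V x * indicator (ball 0 r) x"
  have bound: "(LINT x|lebesgue. ?f \<rho> x) \<le> real n * (real n + 1) ^ ?n * (?J ((real n + 1) / \<rho>) / ((real n + 1) / \<rho>) ^ ?n) + M * (LINT x|lebesgue. q n x)"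
    if \<rho>: "0 < \<rho>" for n \<rho>
  proof -
    define r where "r = (real n + 1) / \<rho>"
    have Vi: "integrable lebesgue (\<lambda>x. V x * indicator (ball 0 r) x)" by (rule Linf_loc_integrable_ball[OF V(2)])
    have qsi: "integrable lebesgue (\<lambda>x. q n (\<rho> *\<^sub>R x))"
      using integrable_lebesgue_scale[OF qm \<rho>] qi by simp
    have "(LINT x|lebesgue. ?f \<rho> x) \<le> (LINT x|lebesgue. real n * \<rho> ^ ?n * (V x * indicator (ball 0 r) x) + M * \<rho> ^ ?n * q n (\<rho> *\<^sub>R x))"
    proof (rule integral_mono_AE[OF fi[OF \<rho>]])
      show "integrable lebesgue (\<lambda>x. real n * \<rho> ^ ?n * (V x * indicator (ball 0 r) x) + M * \<rho> ^ ?n * q n (\<rho> *\<^sub>R x))"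
        by (intro Bochner_Integration.integrable_add integrable_mult_right Vi qsi)
      show "AE x in lebesgue. ?f \<rho> x \<le> real n * \<rho> ^ ?n * (V x * indicator (ball 0 r) x) + M * \<rho> ^ ?n * q n (\<rho> *\<^sub>R x)"
        using M(2)
      proof eventually_elim
        case (elim x)
        have rn: "0 \<le> \<rho> ^ ?n" using \<rho> by simp
        have nn: "0 \<le> M * \<rho> ^ ?n * q n (\<rho> *\<^sub>R x)" "0 \<le> real n * \<rho> ^ ?n * (V x * indicator (ball 0 r) x)"
          using M(1) rn q_le V(1) by (auto intro!: mult_nonneg_nonneg)
        show ?case
        proof (cases "x \<in> cball 0 2")
          case False
          then show ?thesis using nn by simp
        next
          case True
          show ?thesis
          proof (cases "\<rho> *\<^sub>R x \<in> G n")
            case g: True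
            then have "\<rho> * norm x \<le> real n" "(Q (\<rho> *\<^sub>R x))\<^sup>2 \<le> real n" using \<rho> by (auto simp: G_def)
            then have xr: "x \<in> ball 0 r" using \<rho> by (simp add: r_def field_simps)
            have "?f \<rho> x \<le> V x * (\<rho> ^ ?n * real n)"
              using True \<open>(Q (\<rho> *\<^sub>R x))\<^sup>2 \<le> real n\<close> V(1) rn by (simp add: mult_left_mono)
            then show ?thesis using nn(1) xr by (simp add: mult_ac)
          next
            case g: False
            then have "q n (\<rho> *\<^sub>R x) = (Q (\<rho> *\<^sub>R x))\<^sup>2" by (simp add: q_def)
            moreover have "V x \<le> M" using elim True by auto
            then have "V x * (\<rho> ^ ?n * (Q (\<rho> *\<^sub>R x))\<^sup>2) \<le> M * (\<rho> ^ ?n * (Q (\<rho> *\<^sub>R x))\<^sup>2)"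
              using rn by (intro mult_right_mono) auto
            ultimately show ?thesis using nn(2) True by (simp add: mult_ac)
          qed
        qed
      qed
    qed
    also have "\<dots> = real n * \<rho> ^ ?n * ?J r + M * (\<rho> ^ ?n * (LINT x|lebesgue. q n (\<rho> *\<^sub>R x)))"
      using Vi qsi by (simp add: mult.assoc)
    also have "\<rho> ^ ?n * (LINT x|lebesgue. q n (\<rho> *\<^sub>R x)) = (LINT x|lebesgue. q n x)"
      using integral_lebesgue_scale[OF qm \<rho>] by simp
    also have "real n * \<rho> ^ ?n * ?J r = real n * (real n + 1) ^ ?n * (?J r / r ^ ?n)"
      using \<rho> by (simp add: r_def power_divide)
    finally show ?thesis by (simp add: r_def)
  qed
  show "((\<lambda>\<rho>. LINT x|lebesgue. ?f \<rho> x) \<longlongrightarrow> 0) at_top"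
  proof (rule order_tendstoI)
    fix e :: real assume e: "e < 0"
    have "0 \<le> (LINT x|lebesgue. ?f \<rho> x)" if "0 < \<rho>" for \<rho>
      using that V(1) by (intro integral_nonneg_AE AE_I2 mult_nonneg_nonneg) auto
    then show "\<forall>\<^sub>F \<rho> in at_top. e < (LINT x|lebesgue. ?f \<rho> x)"
      using e by (intro eventually_mono[OF eventually_gt_at_top[of 0]]) (rule less_le_trans)
  next
    fix e :: real assume e: "0 < e"
    have "(\<lambda>n. M * (LINT x|lebesgue. q n x)) \<longlonglongrightarrow> M * 0" by (rule tendsto_mult_left[OF q0])
    then have "\<forall>\<^sub>F n in sequentially. M * (LINT x|lebesgue. q n x) < e / 2"
      by (rule order_tendstoD) (use e in simp)
    then obtain n where n: "M * (LINT x|lebesgue. q n x) < e / 2" by (auto simp: eventually_sequentially)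
    have "filterlim (\<lambda>\<rho>::real. (real n + 1) / \<rho>) (at_right 0) at_top"
    proof (rule tendsto_imp_filterlim_at_right)
      show "((\<lambda>\<rho>::real. (real n + 1) / \<rho>) \<longlongrightarrow> 0) at_top"
        by (intro tendsto_divide_0[OF tendsto_const] filterlim_at_top_imp_at_infinity filterlim_ident)
      show "\<forall>\<^sub>F \<rho>::real in at_top. 0 < (real n + 1) / \<rho>"
        using eventually_gt_at_top[of "0::real"] by eventually_elim simp
    qed
    from filterlim_compose[OF lebesgue_point_average[OF V(1,3)] this]
    have "((\<lambda>\<rho>. real n * (real n + 1) ^ ?n * (?J ((real n + 1) / \<rho>) / ((real n + 1) / \<rho>) ^ ?n)) \<longlongrightarrow> real n * (real n + 1) ^ ?n * 0) at_top"
      by (rule tendsto_mult_left)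
    then have "\<forall>\<^sub>F \<rho> in at_top. real n * (real n + 1) ^ ?n * (?J ((real n + 1) / \<rho>) / ((real n + 1) / \<rho>) ^ ?n) < e / 2"
      by (rule order_tendstoD) (use e in simp)
    then show "\<forall>\<^sub>F \<rho> in at_top. (LINT x|lebesgue. ?f \<rho> x) < e"
      using eventually_gt_at_top[of 0]
    proof eventually_elim
      case (elim \<rho>)
      then show ?case using bound[OF elim(2), of n] n by linarith
    qed
  qed
qed

text \<open>The discrete form of the IMS localization formula: with a, b the values of a cut-off
  \<phi> and x, y those of Q, it compares the energy of \<phi> Q with the pairing of Q and \<phi>^2
  Q, up to a term carrying the squared increment of \<phi>.\<close>

lemma ims_identity:
  fixes a b x y :: real
  shows "(a * x - b * y)\<^sup>2 = (x - y) * (a\<^sup>2 * x - b\<^sup>2 * y) + x * y * (a - b)\<^sup>2"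
  by (simp add: power2_eq_square algebra_simps)

section \<open>Cut-offs of Q as test functions\<close>

context gn_setting
begin

text \<open>
  The localization error is \<open>o(\<rho>\<^sup>-\<^sup>2\<^sup>s)\<close>, not only \<open>O(\<rho>\<^sup>-\<^sup>2\<^sup>s)\<close>, because
  one of the two points of every interacting pair lies outside the ball of radius \<open>\<rho>\<close>.
\<close>

lemma localization_error:
  fixes Q :: "'a \<Rightarrow> real"
  assumes Q: "Q \<in> Hs s" and \<eta>: "0 < \<eta>"
  shows "\<forall>\<^sub>F \<rho> in at_top. gag s (\<lambda>x. tent \<rho> x * Q x) - gagB s Q (\<lambda>x. (tent \<rho> x)\<^sup>2 * Q x) \<le> \<eta> * \<rho> powr (- 2 * s)"
proof -
  note Qm[measurable] = Hs_measurable[OF Q] and Qi = Hs_L2[OF Q]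
  obtain C where C: "C > 0" and cut:
    "\<And>\<rho> \<phi> (f :: 'a::euclidean_space \<Rightarrow> real). \<rho> > 0 \<Longrightarrow> \<phi> \<in> borel_measurable borel \<Longrightarrow>
      (\<And>x y. \<bar>\<phi> x - \<phi> y\<bar> \<le> min 1 (norm (x - y) / \<rho>)) \<Longrightarrow>
      integrable lebesgue f \<Longrightarrow> (\<And>x. 0 \<le> f x) \<Longrightarrow>
      integrable (lebesgue \<Otimes>\<^sub>M lebesgue) (\<lambda>p. (f (fst p) + f (snd p)) * (\<phi> (fst p) - \<phi> (snd p))\<^sup>2 * kern s (fst p - snd p)) \<and>
      (LINT p|(lebesgue \<Otimes>\<^sub>M lebesgue). (f (fst p) + f (snd p)) * (\<phi> (fst p) - \<phi> (snd p))\<^sup>2 * kern s (fst p - snd p))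
        \<le> C * \<rho> powr (- 2 * s) * (LINT x|lebesgue. f x)"
    using cutoff_energy_bound_sym[OF s_pos s(2), where 'a='a] by blast
  define m where "m = L2_norm_sq Q"
  have m0: "0 \<le> m" by (simp add: m_def)
  \<comment> \<open>The weight in Young's inequality: it multiplies the full mass of Q and is chosen
    so that this part costs at most \<eta>/2. The mass outside the ball appears divided by l and
    becomes small only afterwards, for large \<rho>.\<close>
  define l where "l = \<eta> / (2 * (C * (m + 1)))"
  have m1: "0 < m + 1" using m0 by linarith
  have l: "0 < l" using \<eta> C m1 by (simp add: l_def)
  have Cl: "C * (l * m) \<le> \<eta> / 2"
  proof -
    have "C * (l * m) \<le> C * (l * (m + 1))" using C l by (intro mult_left_mono) auto
    also have "\<dots> = \<eta> / 2"
    proof -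
      have "C * (\<eta> / (2 * (C * k)) * k) = \<eta> / 2" if "0 < k" for k using that C by simp
      then show ?thesis using m1 unfolding l_def by blast
    qed
    finally show ?thesis .
  qed
  have "((\<lambda>r. C * ((LINT x|lebesgue. (Q x)\<^sup>2 * indicator (- cball 0 r) x) / l)) \<longlongrightarrow> C * (0 / l)) at_top"
    using l by (intro tendsto_intros tail_to_zero Qi) auto
  then have "\<forall>\<^sub>F r in at_top. C * ((LINT x|lebesgue. (Q x)\<^sup>2 * indicator (- cball 0 r) x) / l) < \<eta> / 2"
    by (rule order_tendstoD) (use \<eta> in simp)
  then show ?thesis
    using eventually_gt_at_top[of "0::real"]
  proof eventually_elim
    case (elim \<rho>)
    then have \<rho>: "0 < \<rho>" by simp
    let ?\<phi> = "tent \<rho> :: 'a \<Rightarrow> real"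
    define X where "X = (\<lambda>x. ?\<phi> x * Q x)"
    define Y where "Y = (\<lambda>x. (?\<phi> x)\<^sup>2 * Q x)"
    have \<phi>1: "\<bar>?\<phi> x\<bar> \<le> 1" for x using tent_bounds[of \<rho> x] by simp
    have X: "X \<in> Hs s" unfolding X_def
      by (rule Hs_cutoff[OF s_pos s(2) Q \<rho> tent_measurable tent_lipschitz[OF \<rho>] \<phi>1])
    have "(\<lambda>x. ?\<phi> x * X x) \<in> Hs s"
      by (rule Hs_cutoff[OF s_pos s(2) X \<rho> tent_measurable tent_lipschitz[OF \<rho>] \<phi>1])
    then have Y: "Y \<in> Hs s" by (simp add: X_def Y_def power2_eq_square mult.assoc)
    define q where "q = (\<lambda>x. (Q x)\<^sup>2 * indicator (- cball 0 \<rho>) x)"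
    have qi: "integrable lebesgue q"
      unfolding q_def using integrable_mult_indicator[of "- cball 0 \<rho>" lebesgue "\<lambda>x. (Q x)\<^sup>2"] Qi
      by (simp add: mult.commute Compl_in_sets_lebesgue)
    have q0: "0 \<le> q x" for x by (simp add: q_def)
    \<comment> \<open>Of an interacting pair, the point outside the ball is paid by the q / l term
      and its partner, wherever it lies, by the term with the factor l.\<close>
    define f where "f = (\<lambda>x. q x / l + l * (Q x)\<^sup>2)"
    have fi: "integrable lebesgue f" using qi Qi by (simp add: f_def)
    have f0: "0 \<le> f x" for x using q0 l by (simp add: f_def)
    let ?H = "\<lambda>p. (f (fst p) + f (snd p)) * (?\<phi> (fst p) - ?\<phi> (snd p))\<^sup>2 * kern s (fst p - snd p)"
    note H = cut[OF \<rho> tent_measurable tent_lipschitz[OF \<rho>] fi f0]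
    have "gag s X - gagB s Q Y = (LINT p|(lebesgue \<Otimes>\<^sub>M lebesgue). gagliardo_form s X X p - gagliardo_form s Q Y p)"
      unfolding gagB_def using gagB_integrable[OF X X] gagB_integrable[OF Q Y] by simp
    also have "\<dots> \<le> (LINT p|(lebesgue \<Otimes>\<^sub>M lebesgue). ?H p)"
    proof (rule integral_mono)
      show "integrable (lebesgue \<Otimes>\<^sub>M lebesgue) (\<lambda>p. gagliardo_form s X X p - gagliardo_form s Q Y p)"
        using gagB_integrable[OF X X] gagB_integrable[OF Q Y] by simp
      show "integrable (lebesgue \<Otimes>\<^sub>M lebesgue) ?H" using H by blast
      fix p :: "'a \<times> 'a"
      obtain x y where p: "p = (x, y)" by force
      have "(?\<phi> x * Q x - ?\<phi> y * Q y)\<^sup>2 - (Q x - Q y) * ((?\<phi> x)\<^sup>2 * Q x - (?\<phi> y)\<^sup>2 * Q y) = Q x * Q y * (?\<phi> x - ?\<phi> y)\<^sup>2"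
        by (simp add: ims_identity)
      also have "\<dots> \<le> (f x + f y) * (?\<phi> x - ?\<phi> y)\<^sup>2"
      proof (cases "?\<phi> x = ?\<phi> y")
        case False
        have young: "u * v \<le> u\<^sup>2 / l + l * v\<^sup>2" for u v :: real
        proof -
          have "0 \<le> (u / sqrt l - sqrt l * v / 2)\<^sup>2" by simp
          also have "\<dots> = u\<^sup>2 / l - u * v + l * v\<^sup>2 / 4"
            using l by (simp add: power2_diff power_divide power_mult_distrib)
          finally show ?thesis using l zero_le_power2[of v] mult_nonneg_nonneg[of l "v\<^sup>2"] by linarith
        qed
        have "\<rho> < norm x \<or> \<rho> < norm y"
          using False tent_inside[OF \<rho>, of x] tent_inside[OF \<rho>, of y] by force
        then have "Q x * Q y \<le> f x + f y"
        proof
          assume "\<rho> < norm x"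
          then have "f x + f y = (Q x)\<^sup>2 / l + l * (Q x)\<^sup>2 + (q y / l + l * (Q y)\<^sup>2)" by (simp add: f_def q_def)
          moreover have "0 \<le> l * (Q x)\<^sup>2" "0 \<le> q y / l" using l q0 by auto
          ultimately show ?thesis using young[of "Q x" "Q y"] by linarith
        next
          assume "\<rho> < norm y"
          then have "f x + f y = (q x / l + l * (Q x)\<^sup>2) + ((Q y)\<^sup>2 / l + l * (Q y)\<^sup>2)" by (simp add: f_def q_def)
          moreover have "0 \<le> l * (Q y)\<^sup>2" "0 \<le> q x / l" using l q0 by auto
          ultimately show ?thesis using young[of "Q y" "Q x"] by (simp only: mult.commute[of "Q y" "Q x"])
        qed
        then show ?thesis by (intro mult_right_mono) auto
      qed simp
      finally have "((?\<phi> x * Q x - ?\<phi> y * Q y)\<^sup>2 - (Q x - Q y) * ((?\<phi> x)\<^sup>2 * Q x - (?\<phi> y)\<^sup>2 * Q y)) * kern s (x - y) \<le>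
          (f x + f y) * (?\<phi> x - ?\<phi> y)\<^sup>2 * kern s (x - y)"
        by (intro mult_right_mono) auto
      then show "gagliardo_form s X X p - gagliardo_form s Q Y p \<le> ?H p"
        by (simp add: p gagliardo_form_kern X_def Y_def power2_eq_square left_diff_distrib)
    qed
    also have "\<dots> \<le> C * \<rho> powr (- 2 * s) * (LINT x|lebesgue. f x)" using H by blast
    also have "(LINT x|lebesgue. f x) = (LINT x|lebesgue. q x) / l + l * m"
      unfolding f_def m_def L2_norm_sq_power using qi Qi by simp
    also have "C * \<rho> powr (- 2 * s) * ((LINT x|lebesgue. q x) / l + l * m) = (C * ((LINT x|lebesgue. q x) / l) + C * (l * m)) * \<rho> powr (- 2 * s)"
      by (simp add: algebra_simps)
    also have "\<dots> \<le> \<eta> * \<rho> powr (- 2 * s)"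
    proof (rule mult_right_mono)
      show "C * ((LINT x|lebesgue. q x) / l) + C * (l * m) \<le> \<eta>"
        using elim(1) Cl unfolding q_def by linarith
    qed simp
    finally show ?case by (simp add: X_def Y_def)
  qed
qed

text \<open>Jensen's inequality for t^(1+\<beta>^2), applied to \<phi>^2 and the probability measure
  with density proportional to |x|^(-b) |Q|^(2+2\<beta>^2); it is proved by integrating the tangent
  at the mean y = \<tau>/T0.\<close>

lemma truncated_weight:
  fixes Q \<phi> :: "'a \<Rightarrow> real"
  assumes Q: "Q \<in> Hs s" and \<phi>m: "\<phi> \<in> borel_measurable lebesgue" and \<phi>: "\<And>x. 0 \<le> \<phi> x" "\<And>x. \<phi> x \<le> 1" and X: "(\<lambda>x. \<phi> x * Q x) \<in> Hs s"
    and T0: "0 < weighted_int b \<beta> Q"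
  defines "\<tau> \<equiv> LINT x|lebesgue. norm x powr (- b) * \<bar>Q x\<bar> powr (2 + 2 * \<beta>\<^sup>2) * (\<phi> x)\<^sup>2"
  assumes \<tau>: "0 < \<tau>"
  shows "\<tau> * (\<tau> / weighted_int b \<beta> Q) powr \<beta>\<^sup>2 \<le> weighted_int b \<beta> (\<lambda>x. \<phi> x * Q x)"
proof -
  note [measurable] = Hs_measurable[OF Q] \<phi>m
  define B where "B = \<beta>\<^sup>2"
  have B: "0 < B" using beta_pos by (simp add: B_def)
  let ?\<mu> = "\<lambda>x. norm x powr (- b) * \<bar>Q x\<bar> powr (2 + 2 * \<beta>\<^sup>2)"
  define T0 where "T0 = weighted_int b \<beta> Q"
  have \<mu>: "integrable lebesgue ?\<mu>" by (rule weighted_integrable[OF Q])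
  have T0\<mu>: "(LINT x|lebesgue. ?\<mu> x) = T0" by (simp add: T0_def weighted_int_def)
  have \<phi>2: "(\<phi> x)\<^sup>2 \<le> 1" for x using \<phi>[of x] by (simp add: abs_square_le_1)
  have Ti: "integrable lebesgue (\<lambda>x. ?\<mu> x * (\<phi> x)\<^sup>2)"
  proof (rule Bochner_Integration.integrable_bound[OF \<mu>])
    have "?\<mu> x * (\<phi> x)\<^sup>2 \<le> ?\<mu> x * 1" for x using \<phi>2[of x] by (intro mult_left_mono) auto
    then show "AE x in lebesgue. norm (?\<mu> x * (\<phi> x)\<^sup>2) \<le> norm (?\<mu> x)" by (intro AE_I2) simp
  qed measurable
  define y where "y = \<tau> / T0"
  have y: "0 < y" using \<tau> T0 by (simp add: y_def T0_def)
  have "\<tau> * y powr B = (LINT x|lebesgue. (y powr (1 + B) - (1 + B) * y powr B * y) * ?\<mu> x + (1 + B) * y powr B * (?\<mu> x * (\<phi> x)\<^sup>2))"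
  proof -
    have "(LINT x|lebesgue. (y powr (1 + B) - (1 + B) * y powr B * y) * ?\<mu> x + (1 + B) * y powr B * (?\<mu> x * (\<phi> x)\<^sup>2))
        = (y powr (1 + B) - (1 + B) * y powr B * y) * T0 + (1 + B) * y powr B * \<tau>"
      using \<mu> Ti by (simp add: T0\<mu> \<tau>_def)
    moreover have "\<tau> = y * T0" using assms(6) by (simp add: y_def T0_def)
    moreover have "y powr (1 + B) = y * y powr B" using y by (simp add: powr_add)
    ultimately show ?thesis by (simp add: algebra_simps)
  qed
  also have "\<dots> \<le> (LINT x|lebesgue. norm x powr (- b) * \<bar>\<phi> x * Q x\<bar> powr (2 + 2 * \<beta>\<^sup>2))"
  proof (rule integral_mono)
    show "integrable lebesgue (\<lambda>x. (y powr (1 + B) - (1 + B) * y powr B * y) * ?\<mu> x + (1 + B) * y powr B * (?\<mu> x * (\<phi> x)\<^sup>2))"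
      using \<mu> Ti by (intro Bochner_Integration.integrable_add integrable_mult_right)
    show "integrable lebesgue (\<lambda>x. norm x powr (- b) * \<bar>\<phi> x * Q x\<bar> powr (2 + 2 * \<beta>\<^sup>2))"
      by (rule weighted_integrable[OF X])
    fix x :: 'a
    have "y powr (1 + B) + (1 + B) * y powr (1 + B - 1) * ((\<phi> x)\<^sup>2 - y) \<le> ((\<phi> x)\<^sup>2) powr (1 + B)"
      using B y by (intro powr_convex_tangent) auto
    then have "?\<mu> x * (y powr (1 + B) + (1 + B) * y powr B * ((\<phi> x)\<^sup>2 - y)) \<le> ?\<mu> x * ((\<phi> x)\<^sup>2) powr (1 + B)"
      by (intro mult_left_mono) auto
    also have "((\<phi> x)\<^sup>2) powr (1 + B) = \<bar>\<phi> x\<bar> powr (2 + 2 * \<beta>\<^sup>2)"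
    proof (cases "\<phi> x = 0")
      case False
      then have "(\<phi> x)\<^sup>2 = \<bar>\<phi> x\<bar> powr 2" by simp
      then have "((\<phi> x)\<^sup>2) powr (1 + B) = \<bar>\<phi> x\<bar> powr (2 * (1 + B))" by (simp only: powr_powr)
      then show ?thesis by (simp add: B_def)
    qed simp
    finally show "(y powr (1 + B) - (1 + B) * y powr B * y) * ?\<mu> x + (1 + B) * y powr B * (?\<mu> x * (\<phi> x)\<^sup>2) \<le> norm x powr (- b) * \<bar>\<phi> x * Q x\<bar> powr (2 + 2 * \<beta>\<^sup>2)"
      by (simp add: abs_mult powr_mult algebra_simps)
  qed
  finally show ?thesis by (simp add: weighted_int_def y_def T0_def B_def)
qed

text \<open>Let \<phi> be the cut-off, m the mass of \<phi> Q and T the integral of |x|^(-b)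
  |Q|^(2+2\<beta>^2) \<phi>^2. The equation of Q tested with \<phi>^2 Q gives the pairing T - m, so
  the seminorm of \<phi> Q is at most T - m plus the localization error. By
  \<open>mass_optimization\<close> and \<open>truncated_weight\<close>, (T - m) m^(\<beta>^2) never
  exceeds the nonlinear term with its constant, whatever T and m are. Hence the deficit consists of
  the localization error alone, and no rate at which T and m approach their limits is
  needed.\<close>

lemma near_optimal_cutoff:
  fixes Q :: "'a \<Rightarrow> real"
  assumes Q: "GN_ground_state s b \<beta> Q" and AQ: "A = L2_norm Q powr (2 * \<beta>\<^sup>2)" and \<delta>: "0 < \<delta>"
  shows "\<forall>\<^sub>F \<rho> in at_top. L2_norm_sq Q / 2 \<le> L2_norm_sq (\<lambda>x. tent \<rho> x * Q x) \<and>
    frac_energy s (\<lambda>x. tent \<rho> x * Q x) * L2_norm_sq (\<lambda>x. tent \<rho> x * Q x) powr \<beta>\<^sup>2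
      - A / (1 + \<beta>\<^sup>2) * weighted_int b \<beta> (\<lambda>x. tent \<rho> x * Q x) \<le>
        \<delta> * L2_norm_sq (\<lambda>x. tent \<rho> x * Q x) powr \<beta>\<^sup>2 * \<rho> powr (- 2 * s)"
proof -
  have QH: "Q \<in> Hs s" and eq: "GN_equation s b \<beta> Q"
    and W: "1 / \<beta>\<^sup>2 * L2_norm_sq Q = 1 / (1 + \<beta>\<^sup>2) * weighted_int b \<beta> Q"
    and nz: "\<not> (AE x in lebesgue. Q x = 0)"
    using Q by (auto simp: GN_ground_state_def GN_optimizer_def)
  note Qm[measurable] = Hs_measurable[OF QH] and Qi = Hs_L2[OF QH]
  define B where "B = \<beta>\<^sup>2"
  have B: "0 < B" "B \<le> 1" using beta_pos beta_less_1 by (simp_all add: B_def)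
  define M0 where "M0 = L2_norm_sq Q"
  have "M0 \<noteq> 0"
  proof
    assume "M0 = 0"
    then have "AE x in lebesgue. (Q x)\<^sup>2 = 0"
      using integral_nonneg_eq_0_iff_AE[OF Qi] by (simp add: M0_def L2_norm_sq_power)
    then show False using nz by simp
  qed
  then have M0: "0 < M0" by (simp add: M0_def less_le)
  have AM: "A = M0 powr B"
    unfolding AQ M0_def B_def by (simp add: L2_norm_def powr_half_sqrt[symmetric] powr_powr)
  define T0 where "T0 = weighted_int b \<beta> Q"
  \<comment> \<open>The integral identity of Q puts its mass at the maximizer of
    \<open>mass_optimization\<close> for T = T0, so that lemma is sharp without the cut-off.\<close>
  have T0: "T0 = (1 + B) / B * M0"
  proof -
    have "1 + B \<noteq> 0" using B by simp
    moreover have "1 / B * M0 = 1 / (1 + B) * T0" using W by (simp add: B_def M0_def T0_def)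
    then have "(1 + B) * (1 / B * M0) = (1 + B) * (1 / (1 + B) * T0)" by simp
    ultimately show ?thesis by simp
  qed
  then have T0p: "0 < T0" using B M0 by simp
  let ?\<mu> = "\<lambda>x. norm x powr (- b) * \<bar>Q x\<bar> powr (2 + 2 * \<beta>\<^sup>2)"
  have \<mu>: "integrable lebesgue ?\<mu>" by (rule weighted_integrable[OF QH])
  have lower: "(LINT x|lebesgue. f x) - (LINT x|lebesgue. f x * indicator (- cball 0 \<rho>) x) \<le> (LINT x|lebesgue. f x * (tent \<rho> x)\<^sup>2)"
    "integrable lebesgue (\<lambda>x. f x * (tent \<rho> x)\<^sup>2)"
    if f: "integrable lebesgue f" "\<And>x. 0 \<le> f x" and \<rho>: "0 < \<rho>" for f :: "'a \<Rightarrow> real" and \<rho>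
  proof -
    have [measurable]: "f \<in> borel_measurable lebesgue" using f(1) by (rule borel_measurable_integrable)
    have fc: "integrable lebesgue (\<lambda>x. f x * indicator (- cball 0 \<rho>) x)"
      using integrable_mult_indicator[of "- cball 0 \<rho>" lebesgue f] f(1) by (simp add: mult.commute Compl_in_sets_lebesgue)
    have t2: "(tent \<rho> x)\<^sup>2 \<le> 1" for x :: 'a using tent_bounds[of \<rho> x] by (simp add: abs_square_le_1)
    show ti: "integrable lebesgue (\<lambda>x. f x * (tent \<rho> x)\<^sup>2)"
    proof (rule Bochner_Integration.integrable_bound[OF f(1)])
      have "f x * (tent \<rho> x)\<^sup>2 \<le> f x * 1" for x using t2[of x] f(2) by (intro mult_left_mono) auto
      then show "AE x in lebesgue. norm (f x * (tent \<rho> x)\<^sup>2) \<le> norm (f x)" using f(2) by (intro AE_I2) (simp add: abs_mult)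
    qed measurable
    have "(LINT x|lebesgue. f x) - (LINT x|lebesgue. f x * indicator (- cball 0 \<rho>) x) = (LINT x|lebesgue. f x - f x * indicator (- cball 0 \<rho>) x)"
      using f(1) fc by simp
    also have "\<dots> \<le> (LINT x|lebesgue. f x * (tent \<rho> x)\<^sup>2)"
    proof (rule integral_mono)
      show "f x - f x * indicator (- cball 0 \<rho>) x \<le> f x * (tent \<rho> x)\<^sup>2" for x
        using f(2)[of x] tent_inside[OF \<rho>, of x] by (cases "x \<in> cball 0 \<rho>") auto
    qed (use f(1) fc ti in auto)
    finally show "(LINT x|lebesgue. f x) - (LINT x|lebesgue. f x * indicator (- cball 0 \<rho>) x) \<le> (LINT x|lebesgue. f x * (tent \<rho> x)\<^sup>2)" .
  qed
  have ev1: "\<forall>\<^sub>F \<rho> in at_top. (LINT x|lebesgue. (Q x)\<^sup>2 * indicator (- cball 0 \<rho>) x) < M0 / 2"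
    by (rule order_tendstoD(2)[OF tail_to_zero[OF Qi]]) (use M0 in simp)
  have ev2: "\<forall>\<^sub>F \<rho> in at_top. (LINT x|lebesgue. ?\<mu> x * indicator (- cball 0 \<rho>) x) < T0"
    by (rule order_tendstoD(2)[OF tail_to_zero[OF \<mu>]]) (use T0p in simp)
  have "0 < \<delta> / c" using \<delta> c_pos by simp
  from localization_error[OF QH this] ev1 ev2 eventually_gt_at_top[of "0::real"]
  show ?thesis
  proof eventually_elim
    case (elim \<rho>)
    then have \<rho>: "0 < \<rho>" by simp
    let ?\<phi> = "tent \<rho> :: 'a \<Rightarrow> real"
    define X where "X = (\<lambda>x. ?\<phi> x * Q x)"
    define Y where "Y = (\<lambda>x. (?\<phi> x)\<^sup>2 * Q x)"
    have \<phi>1: "\<bar>?\<phi> x\<bar> \<le> 1" for x using tent_bounds[of \<rho> x] by simp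
    have X: "X \<in> Hs s" unfolding X_def
      by (rule Hs_cutoff[OF s_pos s(2) QH \<rho> tent_measurable tent_lipschitz[OF \<rho>] \<phi>1])
    have "(\<lambda>x. ?\<phi> x * X x) \<in> Hs s"
      by (rule Hs_cutoff[OF s_pos s(2) X \<rho> tent_measurable tent_lipschitz[OF \<rho>] \<phi>1])
    then have Y: "Y \<in> Hs s" by (simp add: X_def Y_def power2_eq_square mult.assoc)
    define m where "m = L2_norm_sq X"
    have m_eq: "m = (LINT x|lebesgue. (Q x)\<^sup>2 * (?\<phi> x)\<^sup>2)"
      by (simp add: m_def L2_norm_sq_power X_def power_mult_distrib mult.commute)
    have m2: "M0 / 2 \<le> m"
      using lower(1)[OF Qi _ \<rho>] elim(2) unfolding m_eq by (simp add: M0_def L2_norm_sq_power)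
    then have m: "0 < m" using M0 by simp
    define T where "T = (LINT x|lebesgue. ?\<mu> x * (?\<phi> x)\<^sup>2)"
    have T: "0 < T"
      using lower(1)[OF \<mu> _ \<rho>] elim(3) unfolding T_def T0_def weighted_int_def by simp
    have \<phi>ml: "?\<phi> \<in> borel_measurable lebesgue" by measurable
    have G: "T * (T / T0) powr B \<le> weighted_int b \<beta> X"
      unfolding T_def T0_def B_def X_def
      by (rule truncated_weight[OF QH \<phi>ml tent_bounds X[unfolded X_def] T0p[unfolded T0_def] T[unfolded T_def]])
    have e: "frac_pairing s Q Y = T - m"
    proof -
      have "frac_pairing s Q Y + (LINT x|lebesgue. Q x * Y x)
         - (LINT x|lebesgue. norm x powr (- b) * \<bar>Q x\<bar> powr (2 * \<beta>\<^sup>2) * Q x * Y x) = 0"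
        using eq Y by (simp add: GN_equation_def)
      moreover have "(\<lambda>x. Q x * Y x) = (\<lambda>x. (Q x)\<^sup>2 * (?\<phi> x)\<^sup>2)"
        by (auto simp: Y_def power2_eq_square)
      moreover have "norm x powr (- b) * \<bar>Q x\<bar> powr (2 * \<beta>\<^sup>2) * Q x * Y x = ?\<mu> x * (?\<phi> x)\<^sup>2" for x
      proof (cases "Q x = 0")
        case False
        then have "\<bar>Q x\<bar> powr (2 + 2 * \<beta>\<^sup>2) = (Q x)\<^sup>2 * \<bar>Q x\<bar> powr (2 * \<beta>\<^sup>2)" by (simp add: powr_add)
        then show ?thesis by (simp add: Y_def power2_eq_square)
      qed simp
      ultimately show ?thesis by (simp add: m_eq T_def)
    qed
    have F: "frac_energy s X \<le> (T - m) + \<delta> * \<rho> powr (- 2 * s)"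
    proof -
      have "c * (gag s X - gagB s Q Y) \<le> c * (\<delta> / c * \<rho> powr (- 2 * s))"
        using elim(1) c_pos unfolding X_def Y_def by (intro mult_left_mono) auto
      then show ?thesis
        using e c_pos unfolding frac_pairing_gag c_def[symmetric] frac_energy_c by (simp add: right_diff_distrib)
    qed
    have "frac_energy s X * m powr B \<le> ((T - m) + \<delta> * \<rho> powr (- 2 * s)) * m powr B"
      by (intro mult_right_mono F) auto
    moreover have "(T - m) * m powr B \<le> M0 powr B / (1 + B) * weighted_int b \<beta> X"
      by (rule mass_optimization[OF B M0 T m]) (use G T0 in simp)
    moreover have "u \<le> (d + e) * k \<Longrightarrow> d * k \<le> g \<Longrightarrow> u - g \<le> e * k" for u d e k g :: real
      unfolding distrib_right by linarith
    ultimately have "frac_energy s X * m powr B - A / (1 + B) * weighted_int b \<beta> X \<le> \<delta> * \<rho> powr (- 2 * s) * m powr B"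
      unfolding AM by blast
    then have "frac_energy s X * m powr B - A / (1 + B) * weighted_int b \<beta> X \<le> \<delta> * m powr B * \<rho> powr (- 2 * s)"
      by (simp only: mult_ac)
    with m2 show ?case by (simp add: X_def m_def M0_def B_def)
  qed
qed

text \<open>The cut-off of Q is normalized and concentrated by the factor \<rho>. This multiplies
  the deficit by \<rho>^(2s), which the factor \<rho>^(-2s) of \<open>near_optimal_cutoff\<close>
  compensates exactly. At a = A the energy is this deficit plus the potential term. The cut-off
  confines v to the ball of radius 2, where V is bounded.\<close>

lemma critical_test_function:
  fixes Q V :: "'a \<Rightarrow> real"
  assumes Q: "GN_ground_state s b \<beta> Q" and AQ: "A = L2_norm Q powr (2 * \<beta>\<^sup>2)"
    and V: "\<And>x. 0 \<le> V x" "V \<in> Linf_loc" "has_value_at V 0 0" and \<delta>: "0 < \<delta>"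
  obtains v where "v \<in> energy_space s V" "L2_norm_sq v = 1" "energy s b \<beta> V A v \<le> \<delta>"
proof -
  have QH: "Q \<in> Hs s" and nz: "\<not> (AE x in lebesgue. Q x = 0)"
    using Q by (auto simp: GN_ground_state_def GN_optimizer_def)
  note Qm[measurable] = Hs_measurable[OF QH] and Qi = Hs_L2[OF QH]
  have [measurable]: "V \<in> borel_measurable lebesgue" using V(2) by (simp add: Linf_loc_def)
  define M0 where "M0 = L2_norm_sq Q"
  have "M0 \<noteq> 0"
  proof
    assume "M0 = 0"
    then have "AE x in lebesgue. (Q x)\<^sup>2 = 0"
      using integral_nonneg_eq_0_iff_AE[OF Qi] by (simp add: M0_def L2_norm_sq_power)
    then show False using nz by simp
  qed
  then have M0: "0 < M0" by (simp add: M0_def less_le)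
  let ?J = "\<lambda>\<rho> x. V x * (\<rho> ^ DIM('a) * (Q (\<rho> *\<^sub>R x))\<^sup>2) * indicator (cball 0 2) x"
  \<comment> \<open>Normalization divides by a mass of at least M0/2, so this tolerance becomes
    \<delta>/2 for each of the deficit and the potential term.\<close>
  have d1: "0 < \<delta> * M0 / 4" using \<delta> M0 by simp
  have "\<forall>\<^sub>F \<rho> in at_top. (LINT x|lebesgue. ?J \<rho> x) < \<delta> * M0 / 4"
    by (rule order_tendstoD(2)[OF potential_concentration(1)[OF V Qm Qi] d1])
  from eventually_conj[OF this eventually_conj[OF near_optimal_cutoff[OF Q AQ d1] eventually_gt_at_top[of "0::real"]]]
  obtain \<rho> where J: "(LINT x|lebesgue. ?J \<rho> x) < \<delta> * M0 / 4" and \<rho>: "0 < \<rho>"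
    and cut: "M0 / 2 \<le> L2_norm_sq (\<lambda>x. tent \<rho> x * Q x)"
     "frac_energy s (\<lambda>x. tent \<rho> x * Q x) * L2_norm_sq (\<lambda>x. tent \<rho> x * Q x) powr \<beta>\<^sup>2
      - A / (1 + \<beta>\<^sup>2) * weighted_int b \<beta> (\<lambda>x. tent \<rho> x * Q x) \<le>
        \<delta> * M0 / 4 * L2_norm_sq (\<lambda>x. tent \<rho> x * Q x) powr \<beta>\<^sup>2 * \<rho> powr (- 2 * s)"
    unfolding M0_def using eventually_happens[of _ at_top] by force
  have \<phi>1: "\<bar>tent \<rho> x\<bar> \<le> 1" for x :: 'a using tent_bounds[of \<rho> x] by simp
  define X where "X = (\<lambda>x. tent \<rho> x * Q x)"
  have X: "X \<in> Hs s" unfolding X_def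
    by (rule Hs_cutoff[OF s_pos s(2) QH \<rho> tent_measurable tent_lipschitz[OF \<rho>] \<phi>1])
  define m where "m = L2_norm_sq X"
  have m2: "M0 / 2 \<le> m" using cut(1) by (simp add: m_def X_def)
  then have m: "0 < m" using M0 by simp
  define t where "t = 1 / sqrt (L2_norm_sq X)"
  note n = normalize[OF X m[unfolded m_def], folded t_def m_def]
  define Z where "Z = (\<lambda>x. t * X x)"
  have Z: "Z \<in> Hs s" using n(4) by (simp add: Z_def)
  define v where "v = scl \<rho> Z"
  have v: "v \<in> Hs s" unfolding v_def by (rule Hs_scl(1)[OF \<rho> Z])
  note vm[measurable] = Hs_measurable[OF v]
  have L2v: "L2_norm_sq v = 1"
    unfolding v_def L2_scl(2)[OF \<rho> Hs_measurable[OF Z]] using n(1) by (simp add: Z_def)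
  have mM: "1 / m \<le> 2 / M0" using m2 M0 m by (simp add: field_simps)
  have pot: "V x * (v x)\<^sup>2 \<le> 2 / M0 * ?J \<rho> x" for x
  proof -
    have "(v x)\<^sup>2 = \<rho> ^ DIM('a) * (1 / m * ((tent \<rho> (\<rho> *\<^sub>R x))\<^sup>2 * (Q (\<rho> *\<^sub>R x))\<^sup>2))"
      unfolding v_def scl_power2[OF \<rho>] Z_def X_def power_mult_distrib n(5) by simp
    also have "\<dots> \<le> \<rho> ^ DIM('a) * (2 / M0 * (indicator (cball 0 2) x * (Q (\<rho> *\<^sub>R x))\<^sup>2))"
    proof (cases "x \<in> cball 0 2")
      case True
      have "(tent \<rho> (\<rho> *\<^sub>R x))\<^sup>2 \<le> 1" using \<phi>1[of "\<rho> *\<^sub>R x"] by (simp add: abs_square_le_1)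
      then have "1 / m * ((tent \<rho> (\<rho> *\<^sub>R x))\<^sup>2 * (Q (\<rho> *\<^sub>R x))\<^sup>2) \<le> 2 / M0 * (1 * (Q (\<rho> *\<^sub>R x))\<^sup>2)"
        using mM M0 m by (intro mult_mono mult_right_mono) auto
      then show ?thesis using True \<rho> by (intro mult_left_mono) auto
    next
      case False
      then have "2 * \<rho> \<le> norm (\<rho> *\<^sub>R x)" using \<rho> by simp
      then have "tent \<rho> (\<rho> *\<^sub>R x) = 0" by (rule tent_outside[OF \<rho>])
      then show ?thesis using False by simp
    qed
    finally have "V x * (v x)\<^sup>2 \<le> V x * (\<rho> ^ DIM('a) * (2 / M0 * (indicator (cball 0 2) x * (Q (\<rho> *\<^sub>R x))\<^sup>2)))"
      by (rule mult_left_mono[OF _ V(1)])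
    then show ?thesis by (simp add: mult_ac)
  qed
  have Ji: "integrable lebesgue (\<lambda>x. 2 / M0 * ?J \<rho> x)"
    by (rule integrable_mult_right[OF potential_concentration(2)[OF V Qm Qi \<rho>]])
  have Vi: "integrable lebesgue (\<lambda>x. V x * (v x)\<^sup>2)"
  proof (rule Bochner_Integration.integrable_bound[OF Ji])
    show "AE x in lebesgue. norm (V x * (v x)\<^sup>2) \<le> norm (2 / M0 * ?J \<rho> x)"
    proof (rule AE_I2)
      fix x
      have "0 \<le> V x * (v x)\<^sup>2" using V(1) by simp
      then show "norm (V x * (v x)\<^sup>2) \<le> norm (2 / M0 * ?J \<rho> x)"
        unfolding real_norm_def using pot[of x] by linarith
    qed
  qed measurable
  have "(LINT x|lebesgue. V x * (v x)\<^sup>2) \<le> (LINT x|lebesgue. 2 / M0 * ?J \<rho> x)"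
    by (rule integral_mono[OF Vi Ji pot])
  also have "\<dots> = 2 / M0 * (LINT x|lebesgue. ?J \<rho> x)" by simp
  also have "\<dots> \<le> 2 / M0 * (\<delta> * M0 / 4)" using J M0 by (intro mult_left_mono) auto
  also have "\<dots> = \<delta> / 2" using M0 by simp
  finally have P: "(LINT x|lebesgue. V x * (v x)\<^sup>2) \<le> \<delta> / 2" .
  have mm: "m powr (- \<beta>\<^sup>2) * m powr \<beta>\<^sup>2 = 1" using m by (simp add: powr_add[symmetric])
  have "frac_energy s v - A / (1 + \<beta>\<^sup>2) * weighted_int b \<beta> v =
      \<rho> powr (2 * s) * (frac_energy s Z - A / (1 + \<beta>\<^sup>2) * weighted_int b \<beta> Z)"
    unfolding v_def frac_energy_scl[OF \<rho> Z] weighted_int_scl[OF \<rho> Hs_measurable[OF Z] \<beta>]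
    by (simp add: algebra_simps)
  also have "frac_energy s Z - A / (1 + \<beta>\<^sup>2) * weighted_int b \<beta> Z =
      m powr (- \<beta>\<^sup>2) / m * (frac_energy s X * m powr \<beta>\<^sup>2 - A / (1 + \<beta>\<^sup>2) * weighted_int b \<beta> X)"
  proof -
    have e1: "frac_energy s Z = frac_energy s X * (m powr (- \<beta>\<^sup>2) * m powr \<beta>\<^sup>2) / m"
      unfolding mm using n(2) by (simp add: Z_def)
    have e2: "weighted_int b \<beta> Z = weighted_int b \<beta> X * m powr (- \<beta>\<^sup>2) / m" using n(3) by (simp add: Z_def)
    have "f * (p * q) / m - k * (g * p / m) = p / m * (f * q - k * g)" for f g k p q
      by (simp add: diff_divide_distrib right_diff_distrib mult_ac)
    then show ?thesis unfolding e1 e2 .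
  qed
  also have "\<rho> powr (2 * s) * (m powr (- \<beta>\<^sup>2) / m * (frac_energy s X * m powr \<beta>\<^sup>2 - A / (1 + \<beta>\<^sup>2) * weighted_int b \<beta> X))
      \<le> \<rho> powr (2 * s) * (m powr (- \<beta>\<^sup>2) / m * (\<delta> * M0 / 4 * m powr \<beta>\<^sup>2 * \<rho> powr (- 2 * s)))"
    using cut(2) m unfolding X_def[symmetric] m_def[symmetric] by (intro mult_left_mono) auto
  also have "\<dots> = \<delta> / 4 * M0 * (1 / m)"
  proof -
    have rr: "\<rho> powr (2 * s) * \<rho> powr (- 2 * s) = 1" using \<rho> by (simp add: powr_add[symmetric])
    have "r * (p / m * (d * q * r')) = (r * r') * (p * q) * d * (1 / m)" for r p d q r' by simp
    then have "\<rho> powr (2 * s) * (m powr (- \<beta>\<^sup>2) / m * (\<delta> * M0 / 4 * m powr \<beta>\<^sup>2 * \<rho> powr (- 2 * s))) =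
      (\<rho> powr (2 * s) * \<rho> powr (- 2 * s)) * (m powr (- \<beta>\<^sup>2) * m powr \<beta>\<^sup>2) * (\<delta> * M0 / 4) * (1 / m)" .
    then show ?thesis unfolding rr mm by simp
  qed
  also have "\<dots> \<le> \<delta> / 4 * M0 * (2 / M0)" using \<delta> M0 mM by (intro mult_left_mono) auto
  also have "\<dots> = \<delta> / 2" using M0 by simp
  finally have E: "frac_energy s v - A / (1 + \<beta>\<^sup>2) * weighted_int b \<beta> v \<le> \<delta> / 2" .
  show thesis
  proof (rule that[of v])
    show "v \<in> energy_space s V" using v Vi by (simp add: energy_space_def)
    show "L2_norm_sq v = 1" by (rule L2v)
    show "energy s b \<beta> V A v \<le> \<delta>" using E P unfolding energy_eq by linarith
  qed
qed

text \<open>A single test function chosen at the critical value suffices, because its energy is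
  affine in a.\<close>

lemma min_energy_to_zero:
  fixes Q V :: "'a \<Rightarrow> real"
  assumes Q: "GN_ground_state s b \<beta> Q" and AQ: "A = L2_norm Q powr (2 * \<beta>\<^sup>2)"
    and V: "\<And>x. 0 \<le> V x" "V \<in> Linf_loc" "has_value_at V 0 0" and \<delta>: "0 < \<delta>"
  shows "\<forall>\<^sub>F a in at_left A. min_energy s b \<beta> V a \<le> \<delta>"
proof -
  have "0 < \<delta> / 2" using \<delta> by simp
  then obtain v where v: "v \<in> energy_space s V" "L2_norm_sq v = 1" "energy s b \<beta> V A v \<le> \<delta> / 2"
    using critical_test_function[OF Q AQ V] by blast
  define g where "g = weighted_int b \<beta> v / (1 + \<beta>\<^sup>2)"
  have "((\<lambda>a. (A - a) * g) \<longlongrightarrow> (A - A) * g) (at_left A)"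
    by (intro tendsto_intros)
  then have "\<forall>\<^sub>F a in at_left A. (A - a) * g < \<delta> / 2"
    by (rule order_tendstoD) (use \<delta> in simp)
  then show ?thesis
    using eventually_at_left_real[OF A]
  proof eventually_elim
    case (elim a)
    have "min_energy s b \<beta> V a \<le> energy s b \<beta> V a v"
      by (rule min_energy_le[OF V(1) v(1,2)]) (use elim(2) in auto)
    also have "\<dots> = energy s b \<beta> V A v + (A - a) * g"
      by (simp add: energy_eq g_def diff_divide_distrib left_diff_distrib)
    finally show ?case using v(3) elim(1) by simp
  qed
qed

end

section \<open>Blow-up profiles\<close>

lemma Hs_tendsto_L2:
  assumes t: "Hs_tendsto s f g" and C: "\<And>u :: 'a::euclidean_space \<Rightarrow> real. 0 \<le> frac_energy s u"
  shows "(\<lambda>k. L2_norm_sq (\<lambda>x::'a. f k x - g x)) \<longlonglongrightarrow> 0"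
proof -
  have "(\<lambda>k. (Hs_norm s (\<lambda>x. f k x - g x))\<^sup>2) \<longlonglongrightarrow> 0\<^sup>2"
    using t unfolding Hs_tendsto_def by (intro tendsto_power) blast
  then have lim0: "(\<lambda>k. L2_norm_sq (\<lambda>x. f k x - g x) + frac_energy s (\<lambda>x. f k x - g x)) \<longlonglongrightarrow> 0"
    using C by (simp add: Hs_norm_def)
  have le: "norm (L2_norm_sq (\<lambda>x. f k x - g x)) \<le> L2_norm_sq (\<lambda>x. f k x - g x) + frac_energy s (\<lambda>x. f k x - g x)" for k
    using C[of "\<lambda>x. f k x - g x"] by simp
  show ?thesis
    by (rule Lim_null_comparison[OF always_eventually lim0]) (rule allI, rule le)
qed

text \<open>The radius may vary with k: the tail of f_k is at most twice the squared distance to g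
  plus twice the tail of g alone.\<close>

lemma tail_of_limit:
  fixes f :: "nat \<Rightarrow> 'a::euclidean_space \<Rightarrow> real"
  assumes f: "\<And>k. f k \<in> Hs s" and g: "g \<in> Hs s"
    and lim: "(\<lambda>k. L2_norm_sq (\<lambda>x. f k x - g x)) \<longlonglongrightarrow> 0" and R: "filterlim R at_top sequentially"
  shows "(\<lambda>k. LINT x|lebesgue. (f k x)\<^sup>2 * indicator (- cball 0 (R k)) x) \<longlonglongrightarrow> 0"
proof -
  have ci: "integrable lebesgue (\<lambda>x. (u x)\<^sup>2 * indicator (- cball 0 r) x)" if "u \<in> Hs s" for u :: "'a \<Rightarrow> real" and r
    using integrable_mult_indicator[of "- cball 0 r" lebesgue "\<lambda>x. (u x)\<^sup>2"] Hs_L2[OF that]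
    by (simp add: mult.commute Compl_in_sets_lebesgue)
  have d: "(\<lambda>x. f k x - g x) \<in> Hs s" for k by (rule Hs_diff[OF f g])
  have "(\<lambda>k. LINT x|lebesgue. (g x)\<^sup>2 * indicator (- cball 0 (R k)) x) \<longlonglongrightarrow> 0"
    by (rule filterlim_compose[OF tail_to_zero[OF Hs_L2[OF g]] R])
  then have "(\<lambda>k. 2 * L2_norm_sq (\<lambda>x. f k x - g x) + 2 * (LINT x|lebesgue. (g x)\<^sup>2 * indicator (- cball 0 (R k)) x)) \<longlonglongrightarrow> 2 * 0 + 2 * 0"
    by (intro tendsto_intros lim)
  then have lim0: "(\<lambda>k. 2 * L2_norm_sq (\<lambda>x. f k x - g x) + 2 * (LINT x|lebesgue. (g x)\<^sup>2 * indicator (- cball 0 (R k)) x)) \<longlonglongrightarrow> 0"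
    by simp
  have le: "norm (LINT x|lebesgue. (f k x)\<^sup>2 * indicator (- cball 0 (R k)) x) \<le>
      2 * L2_norm_sq (\<lambda>x. f k x - g x) + 2 * (LINT x|lebesgue. (g x)\<^sup>2 * indicator (- cball 0 (R k)) x)" for k
  proof -
    have "0 \<le> (LINT x|lebesgue. (f k x)\<^sup>2 * indicator (- cball 0 (R k)) x)"
      by (rule integral_nonneg_AE) simp
    moreover have "(LINT x|lebesgue. (f k x)\<^sup>2 * indicator (- cball 0 (R k)) x) \<le>
        (LINT x|lebesgue. 2 * (f k x - g x)\<^sup>2 + 2 * ((g x)\<^sup>2 * indicator (- cball 0 (R k)) x))"
    proof (rule integral_mono[OF ci[OF f]])
      show "integrable lebesgue (\<lambda>x. 2 * (f k x - g x)\<^sup>2 + 2 * ((g x)\<^sup>2 * indicator (- cball 0 (R k)) x))"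
        using Hs_L2[OF d] ci[OF g] by simp
      show "(f k x)\<^sup>2 * indicator (- cball 0 (R k)) x \<le> 2 * (f k x - g x)\<^sup>2 + 2 * ((g x)\<^sup>2 * indicator (- cball 0 (R k)) x)" for x
        using power2_diff_le[of "f k x - g x" "- g x"] by (simp add: indicator_def)
    qed
    moreover have "(LINT x|lebesgue. 2 * (f k x - g x)\<^sup>2 + 2 * ((g x)\<^sup>2 * indicator (- cball 0 (R k)) x)) =
        2 * L2_norm_sq (\<lambda>x. f k x - g x) + 2 * (LINT x|lebesgue. (g x)\<^sup>2 * indicator (- cball 0 (R k)) x)"
      unfolding L2_norm_sq_power using Hs_L2[OF d] ci[OF g] by simp
    ultimately show ?thesis by simp
  qed
  show ?thesis
    by (rule Lim_null_comparison[OF always_eventually lim0]) (rule allI, rule le)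
qed

lemma quasi_min_mono:
  assumes q: "quasi_min s b \<beta> a \<Lambda> (w :: 'a::euclidean_space \<Rightarrow> real)" and le: "\<Lambda> \<le> \<Lambda>'"
  shows "quasi_min s b \<beta> a \<Lambda>' w"
  unfolding quasi_min_def
proof (intro conjI ballI impI)
  show w: "w \<in> Hs s" and "AE x in lebesgue. 0 \<le> w x" using q by (simp_all add: quasi_min_def)
  fix z assume z: "z \<in> Hs s" "AE x in lebesgue. 0 \<le> z x \<and> z x \<le> w x"
  have "L2_norm_sq z \<le> L2_norm_sq w"
  proof (rule L2_norm_sq_mono_AE(2)[OF w Hs_measurable[OF z(1)]])
    show "AE x in lebesgue. \<bar>z x\<bar> \<le> \<bar>w x\<bar>" using z(2) by eventually_elim simp
  qed
  then have "\<Lambda> * (L2_norm_sq w - L2_norm_sq z) \<le> \<Lambda>' * (L2_norm_sq w - L2_norm_sq z)"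
    using le by (intro mult_right_mono) auto
  moreover have "frac_energy s w - a / (1 + \<beta>\<^sup>2) * weighted_int b \<beta> w \<le>
       frac_energy s z - a / (1 + \<beta>\<^sup>2) * weighted_int b \<beta> z + \<Lambda> * (L2_norm_sq w - L2_norm_sq z)"
    using q z unfolding quasi_min_def by blast
  ultimately show "frac_energy s w - a / (1 + \<beta>\<^sup>2) * weighted_int b \<beta> w \<le>
       frac_energy s z - a / (1 + \<beta>\<^sup>2) * weighted_int b \<beta> z + \<Lambda>' * (L2_norm_sq w - L2_norm_sq z)"
    by linarith
qed

text \<open>Positivity of C(N,s): the seminorm of Q equals its positive mass divided by \<beta>^2,
  and it is also C(N,s)/2 times a nonnegative double integral.\<close>

lemma ground_state_gn_setting:
  fixes Q :: "'a::euclidean_space \<Rightarrow> real"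
  assumes s: "1 / 2 < s" "s < 1" and N: "2 * s < real DIM('a)"
    and b: "0 < b" "b < min (real DIM('a) / 2) 1"
    and \<beta>: "\<beta> = sqrt ((2 * s - b) / real DIM('a))"
    and Q: "GN_ground_state s b \<beta> Q" and A: "A = L2_norm Q powr (2 * \<beta>\<^sup>2)"
  shows "gn_setting TYPE('a) s b \<beta> A"
proof
  have d: "0 < real DIM('a)" "0 < 2 * s - b" using s b by auto
  then have B: "\<beta>\<^sup>2 = (2 * s - b) / real DIM('a)" unfolding \<beta> by (simp add: less_imp_le)
  then have Bp: "0 < \<beta>\<^sup>2" using d by simp
  show "real DIM('a) * \<beta>\<^sup>2 = 2 * s - b" using B d by simp
  have QH: "Q \<in> Hs s" and nz: "\<not> (AE x in lebesgue. Q x = 0)" and E: "frac_energy s Q = 1 / \<beta>\<^sup>2 * L2_norm_sq Q"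
    and GN: "GN_inequality TYPE('a) s b \<beta> A"
    using Q by (auto simp: GN_ground_state_def GN_optimizer_def A)
  have "L2_norm_sq Q \<noteq> 0"
  proof
    assume "L2_norm_sq Q = 0"
    then have "AE x in lebesgue. (Q x)\<^sup>2 = 0"
      using integral_nonneg_eq_0_iff_AE[OF Hs_L2[OF QH]] by (simp add: L2_norm_sq_power)
    then show False using nz by simp
  qed
  then have L: "0 < L2_norm_sq Q" by (simp add: less_le)
  then have "0 < frac_energy s Q" unfolding E using Bp by simp
  then show "0 < frac_const TYPE('a) s"
    unfolding frac_energy_gag using gag_nonneg[of s Q] by (auto simp: zero_less_mult_iff)
  show "0 < A" using L by (simp add: A L2_norm_def)
  show "GN_inequality TYPE('a) s b \<beta> A" by (rule GN)
  show "b < real DIM('a) / 2" "b < 1"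
    using b(2) by (simp_all only: min_less_iff_conj)
qed (use s N b in auto)

theorem theorem1p3:
  fixes s b \<beta> astar :: real
    and Q V :: "'a::euclidean_space \<Rightarrow> real"
    and u w :: "real \<Rightarrow> 'a \<Rightarrow> real"
    and \<epsilon> :: "real \<Rightarrow> real"
  assumes s: "1 / 2 < s" "s < 1"
    and N: "2 * s < real DIM('a)"
    and b: "0 < b" "b < min (real DIM('a) / 2) 1"
    and \<beta>: "\<beta> = sqrt ((2 * s - b) / real DIM('a))"
    and Q: "GN_ground_state s b \<beta> Q"
    and astar: "astar = L2_norm Q powr (2 * \<beta>\<^sup>2)"
    and V_nonneg: "\<And>x. 0 \<le> V x"
    and V_loc: "V \<in> Linf_loc"
    and V_infinity: "filterlim V at_top at_infinity"
    and V_0: "has_value_at V 0 0"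
    and u_min: "\<And>a. 0 < a \<Longrightarrow> a < astar \<Longrightarrow> minimizer s b \<beta> V a (u a)"
    and u_nonneg: "\<And>a. 0 < a \<Longrightarrow> a < astar \<Longrightarrow> AE x in lebesgue. 0 \<le> u a x"
    and \<epsilon>: "\<And>a. 0 < a \<Longrightarrow> a < astar \<Longrightarrow> \<epsilon> a = frac_energy s (u a) powr (- 1 / (2 * s))"
    and w: "\<And>a x. 0 < a \<Longrightarrow> a < astar \<Longrightarrow>
              w a x = \<epsilon> a powr (real DIM('a) / 2) * u a (\<epsilon> a *\<^sub>R x)"
  shows "(\<exists>(a :: nat \<Rightarrow> real) w\<^sub>0.
            strict_mono a \<and> (\<forall>k. 0 < a k \<and> a k < astar) \<and> a \<longlonglongrightarrow> astar \<and>
            Hs_tendsto s (\<lambda>k. w (a k)) w\<^sub>0 \<and> GN_optimizer s b \<beta> astar w\<^sub>0) \<and>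
         (\<exists>C > 0. \<forall>a. 0 < a \<and> a < astar \<longrightarrow> Linf_norm (w a) \<le> ereal C) \<and>
         (\<forall>\<eta> > 0. \<exists>R. \<forall>\<^sub>F a in at_left astar.
            AE x in lebesgue. R \<le> norm x \<longrightarrow> \<bar>w a x\<bar> \<le> \<eta>)"
proof -
  interpret gn_setting s b \<beta> astar "TYPE('a)"
    by (rule ground_state_gn_setting[OF s N b \<beta> Q astar])
  have Vm: "V \<in> borel_measurable lebesgue" using V_loc by (simp add: Linf_loc_def)
  define e where "e = (\<lambda>a. min_energy s b \<beta> V a)"
  have us: "u a \<in> energy_space s V" "L2_norm_sq (u a) = 1" "energy s b \<beta> V a (u a) = e a"
    and uq: "quasi_min s b \<beta> a (e a) (u a)" and e0: "0 \<le> e a" if "0 < a" "a < astar" for a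
    using u_min[OF that] minimizer_quasi_min[OF V_nonneg Vm _ _ u_min[OF that] u_nonneg[OF that]] that
    by (auto simp: minimizer_def e_def)
  \<comment> \<open>The minimizer at half the critical value serves as one admissible function for
    every a; dropping its nonlinear term gives a bound that does not depend on a.\<close>
  define P where "P = frac_energy s (u (astar / 2)) + (LINT x|lebesgue. V x * (u (astar / 2) x)\<^sup>2)"
  have half: "0 < astar / 2" "astar / 2 < astar" using A by auto
  have eP: "e a \<le> P" if a: "0 < a" "a < astar" for a
  proof -
    have "e a \<le> energy s b \<beta> V a (u (astar / 2))"
      unfolding e_def by (rule min_energy_le[OF V_nonneg us(1,2)[OF half]]) (use a in auto)
    also have "\<dots> \<le> P"
      using a weighted_int_nonneg[of "u (astar / 2)"] by (simp add: energy_eq P_def)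
    finally show ?thesis .
  qed
  have P0: "0 \<le> P" using e0[OF half] eP[OF half] by linarith
  obtain \<kappa> where \<kappa>: "0 < \<kappa>" and conf:
    "\<And>v :: 'a \<Rightarrow> real. v \<in> energy_space s V \<Longrightarrow> L2_norm_sq v = 1 \<Longrightarrow> (LINT x|lebesgue. V x * (v x)\<^sup>2) \<le> P \<Longrightarrow> \<kappa> \<le> frac_energy s v"
    using confinement[OF V_nonneg V_infinity P0] by blast
  have F\<kappa>: "\<kappa> \<le> frac_energy s (u a)" if a: "0 < a" "a < astar" for a
  proof (rule conf[OF us(1,2)[OF a]])
    have "(LINT x|lebesgue. V x * (u a x)\<^sup>2) \<le> e a"
      using energy_nonneg(1)[OF V_nonneg us(1,2)[OF a] less_imp_le[OF a(1)] less_imp_le[OF a(2)]]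
      unfolding us(3)[OF a] .
    then show "(LINT x|lebesgue. V x * (u a x)\<^sup>2) \<le> P" using eP[OF a] by linarith
  qed
  have \<epsilon>_pos: "0 < \<epsilon> a" and \<epsilon>_pow: "\<epsilon> a powr (2 * s) = 1 / frac_energy s (u a)" if a: "0 < a" "a < astar" for a
  proof -
    have F: "0 < frac_energy s (u a)" using F\<kappa>[OF a] \<kappa> by linarith
    then show "0 < \<epsilon> a" by (simp add: \<epsilon>[OF a])
    have "\<epsilon> a powr (2 * s) = frac_energy s (u a) powr (- 1 / (2 * s) * (2 * s))"
      by (simp only: \<epsilon>[OF a] powr_powr)
    also have "- 1 / (2 * s) * (2 * s) = - 1" using s by simp
    finally show "\<epsilon> a powr (2 * s) = 1 / frac_energy s (u a)" using F by (simp add: powr_minus_divide)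
  qed
  have w_scl: "w a = scl (\<epsilon> a) (u a)" if "0 < a" "a < astar" for a
    using w[OF that] by (auto simp: scl_def)
  have w_Hs: "w a \<in> Hs s" and w_L2: "L2_norm_sq (w a) = 1" and w_F: "frac_energy s (w a) = 1"
    and w_G: "weighted_int b \<beta> (w a) = weighted_int b \<beta> (u a) / frac_energy s (u a)"
    if a: "0 < a" "a < astar" for a
  proof -
    note uH = energy_spaceD(1)[OF us(1)[OF a]]
    have F: "0 < frac_energy s (u a)" using F\<kappa>[OF a] \<kappa> by linarith
    show "w a \<in> Hs s" unfolding w_scl[OF a] by (rule Hs_scl(1)[OF \<epsilon>_pos[OF a] uH])
    show "L2_norm_sq (w a) = 1"
      unfolding w_scl[OF a] L2_scl(2)[OF \<epsilon>_pos[OF a] Hs_measurable[OF uH]] by (rule us(2)[OF a])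
    show "frac_energy s (w a) = 1"
      unfolding w_scl[OF a] frac_energy_scl[OF \<epsilon>_pos[OF a] uH] \<epsilon>_pow[OF a] using F by simp
    show "weighted_int b \<beta> (w a) = weighted_int b \<beta> (u a) / frac_energy s (u a)"
      unfolding w_scl[OF a] weighted_int_scl[OF \<epsilon>_pos[OF a] Hs_measurable[OF uH] \<beta>] \<epsilon>_pow[OF a] by simp
  qed
  \<comment> \<open>The rescaled price of mass is e(a) divided by the seminorm of
    \<open>u a\<close>, hence at most P / \<kappa> for every a below \<open>astar\<close>. This is
    why the supremum bound is uniform on the whole interval.\<close>
  define \<Lambda> where "\<Lambda> = P / \<kappa>"
  have \<Lambda>: "0 \<le> \<Lambda>" using P0 \<kappa> by (simp add: \<Lambda>_def)
  have w_q: "quasi_min s b \<beta> a \<Lambda> (w a)" if a: "0 < a" "a < astar" for a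
  proof (rule quasi_min_mono)
    show "quasi_min s b \<beta> a (\<epsilon> a powr (2 * s) * e a) (w a)"
      unfolding w_scl[OF a] by (rule quasi_min_scl[OF uq[OF a] \<epsilon>_pos[OF a]])
    have "e a / frac_energy s (u a) \<le> P / \<kappa>"
      using eP[OF a] e0[OF a] F\<kappa>[OF a] \<kappa> by (intro frac_le) auto
    then show "\<epsilon> a powr (2 * s) * e a \<le> \<Lambda>" by (simp add: \<epsilon>_pow[OF a] \<Lambda>_def)
  qed
  have w_nonneg: "AE x in lebesgue. 0 \<le> w a x" if "0 < a" "a < astar" for a
    using w_q[OF that] by (simp add: quasi_min_def)
  obtain M where M: "0 < M" and Mb:
    "\<And>a (v :: 'a \<Rightarrow> real). 0 \<le> a \<Longrightarrow> a \<le> astar \<Longrightarrow> quasi_min s b \<beta> a \<Lambda> v \<Longrightarrow> L2_norm_sq v \<le> 1 \<Longrightarrow> frac_energy s v \<le> 1 \<Longrightarrow>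
      AE x in lebesgue. v x \<le> M"
    using Linf_bound[OF \<Lambda>] by blast
  have w_M: "AE x in lebesgue. w a x \<le> M" if a: "0 < a" "a < astar" for a
    by (rule Mb[OF _ _ w_q[OF a]]) (use a w_L2 w_F in auto)
  have w_abs: "AE x in lebesgue. \<bar>w a x\<bar> \<le> M" if a: "0 < a" "a < astar" for a
    using w_M[OF a] w_nonneg[OF a] by eventually_elim simp
  have Linf: "Linf_norm (w a) \<le> ereal M" if a: "0 < a" "a < astar" for a
    unfolding Linf_norm_def
  proof (rule esssup_I)
    have [measurable]: "w a \<in> borel_measurable lebesgue" by (rule Hs_measurable[OF w_Hs[OF a]])
    show "(\<lambda>x. ereal \<bar>w a x\<bar>) \<in> borel_measurable lebesgue" by measurable
    show "AE x in lebesgue. ereal \<bar>w a x\<bar> \<le> ereal M" using w_abs[OF a] by eventually_elim simp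
  qed
  have near: "\<forall>\<^sub>F a in at_left astar. a \<in> {0<..<astar}" by (rule eventually_at_left_real[OF A])
  have e_lim: "(e \<longlongrightarrow> 0) (at_left astar)"
  proof (rule order_tendstoI)
    fix l :: real assume "l < 0"
    with near show "\<forall>\<^sub>F a in at_left astar. l < e a"
      by (auto elim!: eventually_mono intro: less_le_trans e0)
  next
    fix l :: real assume "0 < l"
    then have "0 < l / 2" by simp
    from min_energy_to_zero[OF Q astar V_nonneg V_loc V_0 this]
    show "\<forall>\<^sub>F a in at_left astar. e a < l"
      by eventually_elim (use \<open>0 < l\<close> in \<open>simp add: e_def\<close>)
  qed
  \<comment> \<open>The upper bound is Gagliardo-Nirenberg for unit norms. For the lower one, the
    energy of \<open>u a\<close> without its nonnegative potential part is divided by the seminorm,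
    which is at least \<kappa>; the error e(a)/\<kappa> tends to 0.\<close>
  have G_lim: "((\<lambda>a. weighted_int b \<beta> (w a)) \<longlongrightarrow> (1 + \<beta>\<^sup>2) / astar) (at_left astar)"
  proof (rule tendsto_sandwich)
    have B1: "0 < 1 + \<beta>\<^sup>2" using beta_pos by linarith
    show "\<forall>\<^sub>F a in at_left astar. (1 + \<beta>\<^sup>2) / a * (1 - e a / \<kappa>) \<le> weighted_int b \<beta> (w a)"
      using near
    proof eventually_elim
      case (elim a)
      then have a: "0 < a" "a < astar" by auto
      have F: "0 < frac_energy s (u a)" using F\<kappa>[OF a] \<kappa> by linarith
      have "frac_energy s (u a) - a / (1 + \<beta>\<^sup>2) * weighted_int b \<beta> (u a) \<le> e a"
        using us(3)[OF a] energy_nonneg(2)[OF V_nonneg us(1,2)[OF a] less_imp_le[OF a(1)] less_imp_le[OF a(2)]]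
        unfolding energy_eq by linarith
      then have "(frac_energy s (u a) - a / (1 + \<beta>\<^sup>2) * weighted_int b \<beta> (u a)) / frac_energy s (u a) \<le> e a / frac_energy s (u a)"
        using F by (intro divide_right_mono) auto
      also have "\<dots> \<le> e a / \<kappa>" using e0[OF a] F\<kappa>[OF a] \<kappa> by (intro divide_left_mono) auto
      finally have "1 - a / (1 + \<beta>\<^sup>2) * weighted_int b \<beta> (w a) \<le> e a / \<kappa>"
        using F by (simp add: w_G[OF a] diff_divide_distrib)
      then have "(1 + \<beta>\<^sup>2) / a * (1 - e a / \<kappa>) \<le> (1 + \<beta>\<^sup>2) / a * (a / (1 + \<beta>\<^sup>2) * weighted_int b \<beta> (w a))"
        using a B1 by (intro mult_left_mono) auto
      also have "\<dots> = weighted_int b \<beta> (w a)" using a B1 by simp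
      finally show ?case .
    qed
    show "\<forall>\<^sub>F a in at_left astar. weighted_int b \<beta> (w a) \<le> (1 + \<beta>\<^sup>2) / astar"
      using near
    proof eventually_elim
      case (elim a)
      then have a: "0 < a" "a < astar" by auto
      have "astar / (1 + \<beta>\<^sup>2) * weighted_int b \<beta> (w a) \<le> 1"
        using GN_ineq[OF w_Hs[OF a]] by (simp add: w_F[OF a] w_L2[OF a])
      then have "(1 + \<beta>\<^sup>2) / astar * (astar / (1 + \<beta>\<^sup>2) * weighted_int b \<beta> (w a)) \<le> (1 + \<beta>\<^sup>2) / astar * 1"
        using A B1 by (intro mult_left_mono) auto
      then show ?case using A B1 by simp
    qed
    have "((\<lambda>a. (1 + \<beta>\<^sup>2) / a * (1 - e a / \<kappa>)) \<longlongrightarrow> (1 + \<beta>\<^sup>2) / astar * (1 - 0 / \<kappa>)) (at_left astar)"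
      using A \<kappa> by (intro tendsto_intros e_lim) auto
    then show "((\<lambda>a. (1 + \<beta>\<^sup>2) / a * (1 - e a / \<kappa>)) \<longlongrightarrow> (1 + \<beta>\<^sup>2) / astar) (at_left astar)" by simp
  qed simp
  \<comment> \<open>Formulated for arbitrary sequences approaching \<open>astar\<close>, because it
    is needed both for the claimed subsequence and for the contradiction that proves
    tightness.\<close>
  have compact: "\<exists>r w0. strict_mono (r :: nat \<Rightarrow> nat) \<and> Hs_tendsto s (\<lambda>k. w (a (r k))) w0 \<and> GN_optimizer s b \<beta> astar w0"
    if a: "\<And>k. 0 < a k \<and> a k < astar" and lim: "a \<longlonglongrightarrow> astar" for a :: "nat \<Rightarrow> real"
  proof -
    have "filterlim a (at_left astar) sequentially"
      using a by (intro tendsto_imp_filterlim_at_left lim) simp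
    from filterlim_compose[OF G_lim this]
    have G: "(\<lambda>k. weighted_int b \<beta> (w (a k))) \<longlonglongrightarrow> (1 + \<beta>\<^sup>2) / astar" .
    show ?thesis
      by (rule blowup_compact[where w = "\<lambda>k. w (a k)" and M = M, OF _ _ _ _ M G])
        (use a w_Hs w_L2 w_F w_abs in blast)+
  qed
  \<comment> \<open>Uniformity over all a near \<open>astar\<close>, although convergence holds only
    along subsequences. Otherwise there are values a n within 1/(n+1) of \<open>astar\<close> with
    mass above k outside the ball of radius n+1; along a strongly convergent subsequence that mass
    tends to 0.\<close>
  have tight: "\<exists>R\<ge>1. \<forall>\<^sub>F a in at_left astar. (LINT x|lebesgue. (w a x)\<^sup>2 * indicator (- cball 0 R) x) \<le> k" if k: "0 < k" for k
  proof (rule ccontr)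
    assume no: "\<not> ?thesis"
    let ?t = "\<lambda>a R. LINT x|lebesgue. (w a x)\<^sup>2 * indicator (- cball 0 R) x"
    have "\<exists>a. max 0 (astar - 1 / (real n + 1)) < a \<and> a < astar \<and> k < ?t a (real n + 1)" for n :: nat
    proof (rule ccontr)
      assume none: "\<not> ?thesis"
      have "max 0 (astar - 1 / (real n + 1)) < astar" using A by simp
      from eventually_at_left_real[OF this]
      have "\<forall>\<^sub>F a in at_left astar. ?t a (real n + 1) \<le> k"
        by eventually_elim (use none in \<open>meson greaterThanLessThan_iff not_less\<close>)
      then show False using no by (auto intro!: exI[of _ "real n + 1"])
    qed
    then obtain a where a: "\<And>n::nat. max 0 (astar - 1 / (real n + 1)) < a n" "\<And>n. a n < astar" "\<And>n. k < ?t (a n) (real n + 1)"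
      by metis
    have a0: "0 < a n \<and> a n < astar" for n using a(1,2)[of n] by simp
    have "a \<longlonglongrightarrow> astar"
    proof (rule tendsto_sandwich)
      have "(\<lambda>n. astar - 1 / (real n + 1)) \<longlonglongrightarrow> astar - 0"
        using LIMSEQ_inverse_real_of_nat by (intro tendsto_diff tendsto_const) (simp add: inverse_eq_divide add.commute)
      then show "(\<lambda>n. astar - 1 / (real n + 1)) \<longlonglongrightarrow> astar" by simp
      show "\<forall>\<^sub>F n in sequentially. astar - 1 / (real n + 1) \<le> a n"
        using a(1) by (intro always_eventually allI) (simp add: less_imp_le)
      show "\<forall>\<^sub>F n in sequentially. a n \<le> astar"
        using a(2) by (intro always_eventually allI) (simp add: less_imp_le)
    qed simp
    from compact[OF a0 this] obtain r w0 where r: "strict_mono (r :: nat \<Rightarrow> nat)" and t: "Hs_tendsto s (\<lambda>k. w (a (r k))) w0"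
      by blast
    have rt: "filterlim (\<lambda>n. real (r n) + 1) at_top sequentially"
    proof (rule filterlim_at_top_mono[OF filterlim_real_sequentially])
      show "\<forall>\<^sub>F n in sequentially. real n \<le> real (r n) + 1"
      proof (intro always_eventually allI)
        show "real n \<le> real (r n) + 1" for n using seq_suble[OF r, of n] by linarith
      qed
    qed
    have "(\<lambda>n. ?t (a (r n)) (real (r n) + 1)) \<longlonglongrightarrow> 0"
      by (rule tail_of_limit[where f = "\<lambda>n. w (a (r n))", OF _ _ Hs_tendsto_L2[OF t frac_energy_nonneg] rt])
        (use t in \<open>auto simp: Hs_tendsto_def\<close>)
    then have "\<forall>\<^sub>F n in sequentially. ?t (a (r n)) (real (r n) + 1) < k"
      by (rule order_tendstoD(2)) (rule k)
    then obtain n where "?t (a (r n)) (real (r n) + 1) < k" by (auto simp: eventually_sequentially)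
    then show False using a(3)[of "r n"] by simp
  qed
  show ?thesis
  proof (intro conjI)
    \<comment> \<open>An explicit increasing sequence, from astar/2 up to the critical value, from
      which the subsequence is drawn.\<close>
    define a where "a = (\<lambda>n::nat. astar - astar / 2 * (1 / (real n + 1)))"
    have a: "0 < a n \<and> a n < astar" for n
    proof -
      have n: "0 < 1 / (real n + 1)" "1 / (real n + 1) \<le> 1" by auto
      have "astar / 2 * (1 / (real n + 1)) \<le> astar / 2 * 1"
        by (rule mult_left_mono[OF n(2)]) (use A in simp)
      moreover have "0 < astar / 2 * (1 / (real n + 1))"
        by (rule mult_pos_pos[OF half(1) n(1)])
      ultimately show "0 < a n \<and> a n < astar" using A unfolding a_def by linarith
    qed
    have "(\<lambda>n. 1 / (real n + 1)) \<longlonglongrightarrow> 0"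
      using LIMSEQ_inverse_real_of_nat by (simp add: inverse_eq_divide add.commute)
    then have "a \<longlonglongrightarrow> astar - astar / 2 * 0"
      unfolding a_def by (intro tendsto_intros)
    then have al: "a \<longlonglongrightarrow> astar" by simp
    have am: "strict_mono a"
    proof (rule strict_monoI)
      fix i j :: nat assume "i < j"
      then have "astar / 2 * (1 / (real j + 1)) < astar / 2 * (1 / (real i + 1))"
        using A by (intro mult_strict_left_mono divide_strict_left_mono) auto
      then show "a i < a j" by (simp add: a_def)
    qed
    from compact[OF a al] obtain r w0 where r: "strict_mono (r :: nat \<Rightarrow> nat)"
      and t: "Hs_tendsto s (\<lambda>k. w (a (r k))) w0" "GN_optimizer s b \<beta> astar w0" by blast
    show "\<exists>(a :: nat \<Rightarrow> real) w\<^sub>0.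
            strict_mono a \<and> (\<forall>k. 0 < a k \<and> a k < astar) \<and> a \<longlonglongrightarrow> astar \<and>
            Hs_tendsto s (\<lambda>k. w (a k)) w\<^sub>0 \<and> GN_optimizer s b \<beta> astar w\<^sub>0"
    proof (intro exI[of _ "a \<circ> r"] exI[of _ w0] conjI allI)
      show "strict_mono (a \<circ> r)" by (rule strict_mono_o[OF am r])
      show "(a \<circ> r) \<longlonglongrightarrow> astar" by (rule LIMSEQ_subseq_LIMSEQ[OF al r])
    qed (use a t in auto)
    show "\<exists>C>0. \<forall>a. 0 < a \<and> a < astar \<longrightarrow> Linf_norm (w a) \<le> ereal C"
      using M Linf by blast
    show "\<forall>\<eta>>0. \<exists>R. \<forall>\<^sub>F a in at_left astar. AE x in lebesgue. R \<le> norm x \<longrightarrow> \<bar>w a x\<bar> \<le> \<eta>"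
    proof (intro allI impI)
      fix \<eta> :: real assume \<eta>: "0 < \<eta>"
      obtain k where k: "0 < k" and dec:
        "\<And>a (v :: 'a \<Rightarrow> real) R. 0 \<le> a \<Longrightarrow> a \<le> astar \<Longrightarrow> quasi_min s b \<beta> a \<Lambda> v \<Longrightarrow> (AE x in lebesgue. v x \<le> M) \<Longrightarrow>
          1 \<le> R \<Longrightarrow> (LINT x|lebesgue. (v x)\<^sup>2 * indicator (- cball 0 R) x) \<le> k \<Longrightarrow>
          AE x in lebesgue. 2 * R \<le> norm x \<longrightarrow> v x \<le> \<eta>"
        using decay[OF \<Lambda> M \<eta>] by blast
      obtain R where R: "1 \<le> R" "\<forall>\<^sub>F a in at_left astar. (LINT x|lebesgue. (w a x)\<^sup>2 * indicator (- cball 0 R) x) \<le> k"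
        using tight[OF k] by blast
      have "\<forall>\<^sub>F a in at_left astar. AE x in lebesgue. 2 * R \<le> norm x \<longrightarrow> \<bar>w a x\<bar> \<le> \<eta>"
        using R(2) near
      proof eventually_elim
        case (elim a)
        then have a: "0 < a" "a < astar" by auto
        have "AE x in lebesgue. 2 * R \<le> norm x \<longrightarrow> w a x \<le> \<eta>"
          by (rule dec[OF _ _ w_q[OF a] w_M[OF a] R(1) elim(1)]) (use a in auto)
        then show ?case using w_nonneg[OF a] by eventually_elim simp
      qed
      then show "\<exists>R. \<forall>\<^sub>F a in at_left astar. AE x in lebesgue. R \<le> norm x \<longrightarrow> \<bar>w a x\<bar> \<le> \<eta>" by blast
    qed
  qed
qed

end
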